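(* Let $\mathcal{M}_1 = (M_1,E_1,\nabla_1,\omega_1)$ and $\mathcal{M}_2 = (M_2,E_2,\nabla_2,\omega_2)$ be two connected LCS manifolds with Lee classes $\mathfrak{l}_1 \in H^1(M_1;\mathbb{R})$ and $\mathfrak{l}_2 \in H^1(M_2;\mathbb{R})$. Let $r=(r_1,r_2) \colon \mathcal{M}_1 \boxplus \mathcal{M}_2 \to M_1 \times M_2$ be the covering associated with $(M_1,\mathfrak{l}_1)$, $(M_2,\mathfrak{l}_2)$ as described in the context. Then: (1) There is a natural family $\Xi$ of LCS structures on $\mathcal{M}_1 \boxplus \mathcal{M}_2$ (described in the context), and $\Xi$ is an $\mathbb{R}^+$-torsor. (2) The deck group action of $r$ intertwines the LCS structures freely: if $\Gamma$ is the deck group of $r$, then there is an injective group homomorphism $\rho \colon \Gamma \to \mathbb{R}$ such that for each $g \in \Gamma$ and each $\Omega \in \Xi$, the corresponding diffeomorphism $\phi_g$ of $\mathcal{M}_1\boxplus \mathcal{M}_2$ is an LCS symplectomorphism from $\Omega$ to $e^{\rho(g)}\cdot \Omega$. (3) The Lee class of any LCS structure in $\Xi$ is $r_1^*\mathfrak{l}_1 = r_2^*\mathfrak{l}_2$. (4) Fix a lift $\Gamma(\phi)\colon M_1\to \mathcal{M}_1\boxplus\mathcal{M}_2$ for a smooth map $\phi \colon M_1 \to M_2$, i.e. a smooth map with $r\circ\Gamma(\phi)=(\mathrm{Id},\phi)$. Then $\phi$ is (the base of) an LCS map $\mathcal{M}_1\to\mathcal{M}_2$ if and only if there exists an LCS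 structure $\Omega_{\Gamma(\phi)} \in \Xi$ with respect to which $\Gamma(\phi)$ is an isotropic embedding, in which case this LCS structure is uniquely determined. (5) Let $\mathcal{M}_1=\mathcal{M}_2=\mathcal{M}=(M,E,\nabla,\omega)$. If $\phi_t$ is a smooth family of LCS automorphisms of $\mathcal{M}$ with $\phi_0=\mathrm{Id}$, then each corresponding diffeomorphism $\psi_t$ of $\mathcal{M} \boxplus \mathcal{M}$ is an LCS symplectomorphism from $\Omega_{\Gamma(\mathrm{Id})}$ to $\Omega_{\Gamma(\phi_t)}$. Explicitly, if $\phi_t$ is generated by LCS vector fields $X_t$ with expansion constants $\mu_t$, then $$\Omega_{\Gamma(\phi_t)} = e^{\int_0^t \mu_{\tau}\,d\tau} \cdot \Omega_{\Gamma(\mathrm{Id})}.$$ (6) If $\phi_t$ is an LCS-Hamiltonian isotopy of $\mathcal{M}$, then $\Omega_{\Gamma(\phi_t)}=\Omega_{\Gamma(\mathrm{Id})}$ and the corresponding $\psi_t$ is an LCS-Hamiltonian isotopy of this LCS structure.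
   Context: Flat line bundles. For a flat oriented line bundle $(E,\nabla)$ over $M$, $d_\nabla$ denotes the induced differential on $E$-valued forms $\Omega^\bullet(M;E)$. A morphism of flat oriented line bundles $(E_1,\nabla_1)\to(E_2,\nabla_2)$ over $\phi\colon M_1\to M_2$ is an orientation-preserving bundle map $\Phi$ covering $\phi$ that is a fibrewise isomorphism with $\Phi^*\nabla_2=\nabla_1$; pullback of $E_2$-valued forms is $\Phi^*=\phi^*\otimes\Phi^{-1}$ fibrewise. Parallel transport gives the holonomy class $\mathrm{hol}(\nabla)\in H^1(M;\mathbb{R}^+)$. LCS geometry. An LCS manifold $(M,E,\nabla,\omega)$ is a smooth manifold $M$, a flat oriented line bundle $(E,\nabla)$ over $M$, and $\omega\in\Omega^2(M;E)$ with $d_\nabla\omega=0$ and $X\mapsto\iota_X\omega$ an isomorphism $TM\to T^*M\otimes E$; $(E,\nabla,\omega)$ is called an LCS structure on $M$. Its Lee class is $\ln(\mathrm{hol}(\nabla))\in H^1(M;\mathbb{R})$. An LCS map $(\phi,\Phi)$ is a morphism of flat oriented line bundles with $\Phi^*\omega_2=\omega_1$; $\phi$ determines $\Phi$, so one also calls $\phi$ an LCS map. An LCS symplectomorphism is an LCS map whose base is a diffeomorphism; an LCS automorphism is one from $\mathcal{M}$ to itself. A map $f$ is isotropic if $f^*\omega=0$. An LCS vector field $X$ is one with $d_\nabla(\iota_X\omega)=\mu_X\omega$ for a constant $\mu_X\in\mathbb{R}$, its expansion constant. For a section $H\in\Gamma(E)$, the LCS-Hamiltonian vector field $X_H$ is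 defined by $\iota_{X_H}\omega=-\nabla H$; an LCS-Hamiltonian isotopy is the flow (starting at the identity) of a smooth family $X_{H_t}$. The product. For connected $M_i$ with class $\mathfrak{l}_i$, regarded as a homomorphism $\rho_i\colon\pi_1(M_i)\to\mathbb{R}$, let $q_i\colon\widetilde M_i\to M_i$ be connected coverings corresponding to normal subgroups contained in $\ker\rho_i$, with deck groups $\Gamma_i$ and induced homomorphisms $\overline\rho_i\colon\Gamma_i\to\mathbb{R}$. Put $\Gamma_{12}=\{(g_1,g_2)\in\Gamma_1\times\Gamma_2:\overline\rho_1(g_1)=\overline\rho_2(g_2)\}$ and $M_1\boxplus M_2=(\widetilde M_1\times\widetilde M_2)/\Gamma_{12}$, with covering $r=(r_1,r_2)$ of $M_1\times M_2$ (independent of the choice of $q_i$ up to isomorphism). The underlying manifold of $\mathcal{M}_1\boxplus\mathcal{M}_2$ is $M_1\boxplus M_2$. The family $\Xi$. It consists of the LCS structures $\Omega_\Phi=(r_1^*E_1,\,r_1^*\nabla_1,\,r_1^*\omega_1-\Phi(r_2^*\omega_2))$, indexed by isomorphisms of flat oriented line bundles $\Phi\colon (r_2^*E_2,r_2^*\nabla_2)\to(r_1^*E_1,r_1^*\nabla_1)$ covering the identity of $M_1\boxplus M_2$. The set of such $\Phi$ is an $\mathbb{R}^+$-torsor under multiplication of $\Phi$ by positive constants, and this gives the $\mathbb{R}^+$-action on $\Xi$: $c\cdot\Omega_\Phi=\Omega_{c\Phi}$. The maps in (5), (6). When $\mathcal{M}_1=\mathcal{M}_2=\mathcal{M}$ one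 uses the same covering $\widetilde M\to M$ for both factors; $\Gamma(\mathrm{Id})\colon M\to M\boxplus M$ is the lift of the diagonal induced by the diagonal $\widetilde M\to\widetilde M\times\widetilde M$. For a smooth family $\phi_t$ with $\phi_0=\mathrm{Id}$, $\psi_t$ is the unique smooth family of diffeomorphisms of $M\boxplus M$ lifting $\mathrm{Id}\times\phi_t$ with $\psi_0=\mathrm{Id}$, and $\Gamma(\phi_t)=\psi_t\circ\Gamma(\mathrm{Id})$.
   Formalization: In (5) the factor is exp(−∫μ), not exp(+∫μ): with c·Ω_Φ=Ω_{cΦ}, the printed sign fails for ω=dx∧dy, φ_t(x,y)=(e^t x,y) on R². Manifolds have positive dimension, since for a point the torsor claim or the uniqueness in (4) fails. *)

theory Defs
  imports "HOL-Analysis.Analysis" "HOL-Algebra.Group_Action"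
begin

section \<open>Smooth manifolds\<close>

text \<open>\<open>C\<^sup>k\<close> on an open set: all iterated directional derivatives up to order \<open>k\<close> exist and are
  continuous.\<close>

fun ck_on :: "nat \<Rightarrow> 'e::real_normed_vector set \<Rightarrow> ('e \<Rightarrow> 'f::real_normed_vector) \<Rightarrow> bool" where
  "ck_on 0 S f \<longleftrightarrow> continuous_on S f"
| "ck_on (Suc k) S f \<longleftrightarrow> (\<forall>x\<in>S. f differentiable (at x)) \<and>
     (\<forall>v. ck_on k S (\<lambda>x. frechet_derivative f (at x) v))"

definition smooth_on :: "'e::real_normed_vector set \<Rightarrow> ('e \<Rightarrow> 'f::real_normed_vector) \<Rightarrow> bool" where
  "smooth_on S f \<longleftrightarrow> (\<forall>k. ck_on k S f)"

text \<open>A manifold is an abstract topology with an atlas, not required to be maximal, of charts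
  \<open>(U, \<kappa>)\<close>; the values of \<open>\<kappa>\<close> outside \<open>U\<close> are irrelevant.  The dimension is that of the model
  type, hence positive.\<close>

record ('a, 'e) manifold =
  mtop :: "'a topology"
  atlas :: "('a set \<times> ('a \<Rightarrow> 'e)) set"

abbreviation pts :: "('a, 'e, 'z) manifold_scheme \<Rightarrow> 'a set" where
  "pts M \<equiv> topspace (mtop M)"

definition smooth_manifold :: "('a, 'e::euclidean_space) manifold \<Rightarrow> bool" where
  "smooth_manifold M \<longleftrightarrow>
     Hausdorff_space (mtop M) \<and> second_countable (mtop M) \<and>
     pts M = (\<Union>(U, \<kappa>)\<in>atlas M. U) \<and>
     (\<forall>(U, \<kappa>)\<in>atlas M. openin (mtop M) U \<and> open (\<kappa> ` U) \<and>
        homeomorphic_map (subtopology (mtop M) U) (top_of_set (\<kappa> ` U)) \<kappa>) \<and>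
     (\<forall>(U, \<kappa>)\<in>atlas M. \<forall>(V, \<kappa>')\<in>atlas M. smooth_on (\<kappa> ` (U \<inter> V)) (\<kappa>' \<circ> inv_into U \<kappa>))"

definition euclid_mfd :: "('e::euclidean_space, 'e) manifold" where
  "euclid_mfd = \<lparr>mtop = euclidean, atlas = {(UNIV, id)}\<rparr>"

definition prod_mfd ::
  "('a, 'e::euclidean_space) manifold \<Rightarrow> ('b, 'f::euclidean_space) manifold \<Rightarrow> ('a \<times> 'b, 'e \<times> 'f) manifold" where
  "prod_mfd M N = \<lparr>mtop = prod_topology (mtop M) (mtop N),
     atlas = {(U \<times> V, map_prod \<kappa> \<kappa>') | U \<kappa> V \<kappa>'. (U, \<kappa>) \<in> atlas M \<and> (V, \<kappa>') \<in> atlas N}\<rparr>"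

definition nearby :: "('a, 'e) manifold \<Rightarrow> 'a \<Rightarrow> ('a \<Rightarrow> bool) \<Rightarrow> bool" where
  "nearby M p P \<longleftrightarrow> (\<exists>W. openin (mtop M) W \<and> p \<in> W \<and> (\<forall>q\<in>W. P q))"

text \<open>Smoothness of \<open>f\<close> on some open neighbourhood of \<open>p\<close>.\<close>

definition smooth_at ::
  "('a, 'e::euclidean_space) manifold \<Rightarrow> ('b, 'f::euclidean_space) manifold \<Rightarrow> 'a \<Rightarrow> ('a \<Rightarrow> 'b) \<Rightarrow> bool" where
  "smooth_at M N p f \<longleftrightarrow> (\<exists>(U, \<kappa>)\<in>atlas M. \<exists>(V, \<kappa>')\<in>atlas N. \<exists>W.
     openin (mtop M) W \<and> p \<in> W \<and> W \<subseteq> U \<and> f ` W \<subseteq> V \<and>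
     smooth_on (\<kappa> ` W) (\<kappa>' \<circ> f \<circ> inv_into U \<kappa>))"

definition smooth_map ::
  "('a, 'e::euclidean_space) manifold \<Rightarrow> ('b, 'f::euclidean_space) manifold \<Rightarrow> ('a \<Rightarrow> 'b) \<Rightarrow> bool" where
  "smooth_map M N f \<longleftrightarrow> (\<forall>p\<in>pts M. smooth_at M N p f)"

text \<open>On an arbitrary subset, smoothness means that smooth extensions exist locally.\<close>

definition smooth_map_on ::
  "('a, 'e::euclidean_space) manifold \<Rightarrow> 'a set \<Rightarrow> ('b, 'f::euclidean_space) manifold \<Rightarrow> ('a \<Rightarrow> 'b) \<Rightarrow> bool" where
  "smooth_map_on M A N f \<longleftrightarrow>
     (\<forall>p\<in>A. \<exists>F. smooth_at M N p F \<and> nearby M p (\<lambda>q. q \<in> A \<longrightarrow> F q = f q))"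

definition diffeo ::
  "('a, 'e::euclidean_space) manifold \<Rightarrow> ('b, 'f::euclidean_space) manifold \<Rightarrow> ('a \<Rightarrow> 'b) \<Rightarrow> bool" where
  "diffeo M N f \<longleftrightarrow> smooth_map M N f \<and> bij_betw f (pts M) (pts N) \<and>
     smooth_map N M (inv_into (pts M) f)"

subsection \<open>Tangent vectors\<close>

text \<open>Every tangent space \<open>T\<^sub>pM\<close> is identified with the model space \<open>'e\<close> by means of one preferred
  chart \<open>chart_at M p\<close> around \<open>p\<close>.  Since the preferred chart varies with \<open>p\<close> in an
  uncontrolled way, smoothness of a vector field is not smoothness of its values in \<open>'e\<close>; see
  \<open>smooth_vf_at\<close>.\<close>

definition chart_at :: "('a, 'e) manifold \<Rightarrow> 'a \<Rightarrow> 'a set \<times> ('a \<Rightarrow> 'e)" where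
  "chart_at M p = (SOME c. c \<in> atlas M \<and> p \<in> fst c)"

definition crd :: "('a, 'e) manifold \<Rightarrow> 'a \<Rightarrow> 'a \<Rightarrow> 'e" where
  "crd M p = snd (chart_at M p)"

definition crd_inv :: "('a, 'e) manifold \<Rightarrow> 'a \<Rightarrow> 'e \<Rightarrow> 'a" where
  "crd_inv M p = inv_into (fst (chart_at M p)) (crd M p)"

definition tmap ::
  "('a, 'e::euclidean_space) manifold \<Rightarrow> ('b, 'f::euclidean_space) manifold \<Rightarrow> ('a \<Rightarrow> 'b) \<Rightarrow> 'a \<Rightarrow> 'e \<Rightarrow> 'f" where
  "tmap M N f p = frechet_derivative (crd N (f p) \<circ> f \<circ> crd_inv M p) (at (crd M p p))"

definition smooth_vf_at :: "('a, 'e::euclidean_space) manifold \<Rightarrow> 'a \<Rightarrow> ('a \<Rightarrow> 'e) \<Rightarrow> bool" where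
  "smooth_vf_at M p X \<longleftrightarrow>
     smooth_at M euclid_mfd p (\<lambda>q. tmap M euclid_mfd (crd M p) q (X q))"

definition smooth_vf :: "('a, 'e::euclidean_space) manifold \<Rightarrow> ('a \<Rightarrow> 'e) \<Rightarrow> bool" where
  "smooth_vf M X \<longleftrightarrow> (\<forall>p\<in>pts M. smooth_vf_at M p X)"

text \<open>The vector field near \<open>p\<close> with constant coordinates \<open>v\<close> in the chart \<open>chart_at M p\<close>.  Its
  value at \<open>p\<close> is \<open>v\<close>, and any two such fields for the same \<open>p\<close> commute.\<close>

definition coord_vf :: "('a, 'e::euclidean_space) manifold \<Rightarrow> 'a \<Rightarrow> 'e \<Rightarrow> 'a \<Rightarrow> 'e" where
  "coord_vf M p v q = frechet_derivative (crd M q \<circ> crd_inv M p) (at (crd M p q)) v"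

definition smooth_embedding ::
  "('a, 'e::euclidean_space) manifold \<Rightarrow> ('b, 'f::euclidean_space) manifold \<Rightarrow> ('a \<Rightarrow> 'b) \<Rightarrow> bool" where
  "smooth_embedding M N f \<longleftrightarrow> smooth_map M N f \<and> (\<forall>p\<in>pts M. inj (tmap M N f p)) \<and>
     embedding_map (mtop M) (mtop N) f"

section \<open>Flat oriented line bundles\<close>

text \<open>The fibres are one-dimensional subspaces of an ambient real vector space \<open>'l\<close>, of which only
  the linear structure is used: neither the smooth structure nor the orientation of the bundle comes
  from \<open>'l\<close>.  Both are given by an atlas of local frames with smooth positive
  transition functions.  (Any family of lines embeds into such an \<open>'l\<close>.)\<close>

record ('a, 'l) lbundle =
  fibre :: "'a \<Rightarrow> 'l set"
  frames :: "('a set \<times> ('a \<Rightarrow> 'l)) set"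

definition oriented_line_bundle ::
  "('a, 'e::euclidean_space) manifold \<Rightarrow> ('a, 'l::real_vector) lbundle \<Rightarrow> bool" where
  "oriented_line_bundle M E \<longleftrightarrow>
     (\<forall>p\<in>pts M. \<exists>x. x \<noteq> 0 \<and> fibre E p = span {x}) \<and>
     pts M = (\<Union>(U, e)\<in>frames E. U) \<and>
     (\<forall>(U, e)\<in>frames E. openin (mtop M) U \<and> (\<forall>p\<in>U. e p \<in> fibre E p \<and> e p \<noteq> 0)) \<and>
     (\<forall>(U, e)\<in>frames E. \<forall>(V, e')\<in>frames E. \<exists>g::'a \<Rightarrow> real. \<forall>p\<in>U \<inter> V.
        smooth_at M euclid_mfd p g \<and> g p > 0 \<and> e' p = g p *\<^sub>R e p)"

definition smooth_sec_at ::
  "('a, 'e::euclidean_space) manifold \<Rightarrow> ('a, 'l::real_vector) lbundle \<Rightarrow> 'a \<Rightarrow> ('a \<Rightarrow> 'l) \<Rightarrow> bool" where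
  "smooth_sec_at M E p s \<longleftrightarrow> (\<exists>(U, e)\<in>frames E. p \<in> U \<and> (\<exists>g::'a \<Rightarrow> real.
     smooth_at M euclid_mfd p g \<and> nearby M p (\<lambda>q. q \<in> U \<and> s q = g q *\<^sub>R e q)))"

text \<open>A connection acts on germs of local sections: \<open>D s p v\<close> is \<open>\<nabla>\<^sub>v s\<close> at \<open>p\<close>, meaningful whenever
  \<open>s\<close> is a smooth section near \<open>p\<close>.\<close>

type_synonym ('a, 'e, 'l) connexion = "('a \<Rightarrow> 'l) \<Rightarrow> 'a \<Rightarrow> 'e \<Rightarrow> 'l"

definition bundle_connection ::
  "('a, 'e::euclidean_space) manifold \<Rightarrow> ('a, 'l::real_vector) lbundle \<Rightarrow> ('a, 'e, 'l) connexion \<Rightarrow> bool" where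
  "bundle_connection M E D \<longleftrightarrow> (\<forall>p\<in>pts M. \<forall>s. smooth_sec_at M E p s \<longrightarrow>
     linear (D s p) \<and> (\<forall>v. D s p v \<in> fibre E p) \<and>
     (\<forall>s'. smooth_sec_at M E p s' \<longrightarrow> (\<forall>v. D (\<lambda>q. s q + s' q) p v = D s p v + D s' p v)) \<and>
     (\<forall>f::'a \<Rightarrow> real. smooth_at M euclid_mfd p f \<longrightarrow>
        (\<forall>v. D (\<lambda>q. f q *\<^sub>R s q) p v = tmap M euclid_mfd f p v *\<^sub>R s p + f p *\<^sub>R D s p v)) \<and>
     (\<forall>s'. nearby M p (\<lambda>q. s' q = s q) \<longrightarrow> D s' p = D s p) \<and>
     (\<forall>X. smooth_vf_at M p X \<longrightarrow> smooth_sec_at M E p (\<lambda>q. D s q (X q))))"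

text \<open>An \<open>E\<close>-valued \<open>k\<close>-form assigns to \<open>p\<close> and a list of \<open>k\<close> tangent vectors at \<open>p\<close> an element of
  the fibre.  Forms are normalised to vanish on arguments outside their domain, so that equality of
  forms is equality of functions.\<close>

type_synonym ('a, 'e, 'l) eform = "'a \<Rightarrow> 'e list \<Rightarrow> 'l"

definition bundle_form ::
  "('a, 'e::euclidean_space) manifold \<Rightarrow> ('a, 'l::real_vector) lbundle \<Rightarrow> nat \<Rightarrow> ('a, 'e, 'l) eform \<Rightarrow> bool" where
  "bundle_form M E k \<alpha> \<longleftrightarrow>
     (\<forall>p vs. p \<notin> pts M \<or> length vs \<noteq> k \<longrightarrow> \<alpha> p vs = 0) \<and>
     (\<forall>p\<in>pts M. \<forall>vs. length vs = k \<longrightarrow> \<alpha> p vs \<in> fibre E p \<and>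
        (\<forall>i<k. linear (\<lambda>v. \<alpha> p (vs[i := v]))) \<and>
        (\<forall>i<k. \<forall>j<k. i \<noteq> j \<and> vs ! i = vs ! j \<longrightarrow> \<alpha> p vs = 0)) \<and>
     (\<forall>p\<in>pts M. \<forall>Xs. length Xs = k \<and> (\<forall>X\<in>set Xs. smooth_vf_at M p X) \<longrightarrow>
        smooth_sec_at M E p (\<lambda>q. \<alpha> q (map (\<lambda>X. X q) Xs)))"

text \<open>The differential \<open>d\<^sub>\<nabla>\<close>, by Koszul's formula evaluated on vector fields with constant coordinates,
  for which the terms with Lie brackets vanish.\<close>

definition ext_d ::
  "('a, 'e::euclidean_space) manifold \<Rightarrow> ('a, 'e, 'l::real_vector) connexion \<Rightarrow> ('a, 'e, 'l) eform \<Rightarrow> ('a, 'e, 'l) eform" where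
  "ext_d M D \<alpha> p vs = (\<Sum>i<length vs. (-1) ^ i *\<^sub>R
     D (\<lambda>q. \<alpha> q (map (\<lambda>v. coord_vf M p v q) (take i vs @ drop (Suc i) vs))) p (vs ! i))"

definition flat_connection ::
  "('a, 'e::euclidean_space) manifold \<Rightarrow> ('a, 'l::real_vector) lbundle \<Rightarrow> ('a, 'e, 'l) connexion \<Rightarrow> bool" where
  "flat_connection M E D \<longleftrightarrow> bundle_connection M E D \<and>
     (\<forall>p\<in>pts M. \<forall>s. smooth_sec_at M E p s \<longrightarrow>
        (\<forall>v w. ext_d M D (\<lambda>q vs. D s q (hd vs)) p [v, w] = 0))"

subsection \<open>Pullbacks and morphisms\<close>

definition pull_bundle ::
  "('a, 'e) manifold \<Rightarrow> ('a \<Rightarrow> 'b) \<Rightarrow> ('b, 'l) lbundle \<Rightarrow> ('a, 'l) lbundle" where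
  "pull_bundle M f E = \<lparr>fibre = fibre E \<circ> f,
     frames = {(pts M \<inter> f -` U, e \<circ> f) | U e. (U, e) \<in> frames E}\<rparr>"

definition frame_coef :: "'l::real_vector \<Rightarrow> 'l \<Rightarrow> real" where
  "frame_coef x e = (THE c. x = c *\<^sub>R e)"

text \<open>A section of \<open>f\<^sup>*E\<close> has the form \<open>g \<cdot> (e \<circ> f)\<close> for a local frame \<open>e\<close> of \<open>E\<close>; the pullback
  connection sends it to \<open>dg \<otimes> (e \<circ> f) + g \<cdot> f\<^sup>*(\<nabla>e)\<close>.\<close>

definition pull_conn ::
  "('a, 'e::euclidean_space) manifold \<Rightarrow> ('b, 'f::euclidean_space) manifold \<Rightarrow> ('a \<Rightarrow> 'b) \<Rightarrow>
   ('b, 'l::real_vector) lbundle \<Rightarrow> ('b, 'f, 'l) connexion \<Rightarrow> ('a, 'e, 'l) connexion" where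
  "pull_conn M N f E D s p v =
     (let e = snd (SOME c. c \<in> frames E \<and> f p \<in> fst c);
          g = (\<lambda>q. frame_coef (s q) (e (f q)))
      in tmap M euclid_mfd g p v *\<^sub>R e (f p) + g p *\<^sub>R D e (f p) (tmap M N f p v))"

definition pull_form ::
  "('a, 'e::euclidean_space) manifold \<Rightarrow> ('b, 'f::euclidean_space) manifold \<Rightarrow> ('a \<Rightarrow> 'b) \<Rightarrow>
   ('b, 'f, 'l::real_vector) eform \<Rightarrow> ('a, 'e, 'l) eform" where
  "pull_form M N f \<alpha> p vs = (if p \<in> pts M then \<alpha> (f p) (map (tmap M N f p) vs) else 0)"

text \<open>\<open>\<Phi> p\<close> maps the fibre over \<open>p\<close> to the fibre over \<open>\<phi> p\<close>.  The condition on frames expresses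
  both smoothness and preservation of the orientation; the last condition is \<open>\<Phi>\<^sup>*\<nabla>\<^sub>2 = \<nabla>\<^sub>1\<close>.\<close>

definition flat_morphism ::
  "('a, 'e::euclidean_space) manifold \<Rightarrow> ('a, 'l::real_vector) lbundle \<Rightarrow> ('a, 'e, 'l) connexion \<Rightarrow>
   ('b, 'f::euclidean_space) manifold \<Rightarrow> ('b, 'm::real_vector) lbundle \<Rightarrow> ('b, 'f, 'm) connexion \<Rightarrow>
   ('a \<Rightarrow> 'b) \<Rightarrow> ('a \<Rightarrow> 'l \<Rightarrow> 'm) \<Rightarrow> bool" where
  "flat_morphism M E D N E' D' \<phi> \<Phi> \<longleftrightarrow> smooth_map M N \<phi> \<and>
     (\<forall>p\<in>pts M. bij_betw (\<Phi> p) (fibre E p) (fibre E' (\<phi> p)) \<and>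
        (\<forall>x\<in>fibre E p. \<forall>y\<in>fibre E p. \<forall>a b. \<Phi> p (a *\<^sub>R x + b *\<^sub>R y) = a *\<^sub>R \<Phi> p x + b *\<^sub>R \<Phi> p y)) \<and>
     (\<forall>(U, e)\<in>frames E. \<forall>(V, e')\<in>frames E'. \<exists>g::'a \<Rightarrow> real. \<forall>p\<in>pts M. p \<in> U \<and> \<phi> p \<in> V \<longrightarrow>
        smooth_at M euclid_mfd p g \<and> g p > 0 \<and> \<Phi> p (e p) = g p *\<^sub>R e' (\<phi> p)) \<and>
     (\<forall>p\<in>pts M. \<forall>s. smooth_sec_at M E p s \<longrightarrow>
        (\<forall>v. D s p v =
           inv_into (fibre E p) (\<Phi> p) (pull_conn M N \<phi> E' D' (\<lambda>q. \<Phi> q (s q)) p v)))"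

definition bundle_pull_form ::
  "('a, 'e::euclidean_space) manifold \<Rightarrow> ('a, 'l::real_vector) lbundle \<Rightarrow> ('b, 'f::euclidean_space) manifold \<Rightarrow>
   ('a \<Rightarrow> 'b) \<Rightarrow> ('a \<Rightarrow> 'l \<Rightarrow> 'm::real_vector) \<Rightarrow> ('b, 'f, 'm) eform \<Rightarrow> ('a, 'e, 'l) eform" where
  "bundle_pull_form M E N \<phi> \<Phi> \<alpha> p vs =
     (if p \<in> pts M then inv_into (fibre E p) (\<Phi> p) (pull_form M N \<phi> \<alpha> p vs) else 0)"

section \<open>LCS geometry\<close>

record ('a, 'e, 'l) lcs_structure =
  lbun :: "('a, 'l) lbundle"
  lcon :: "('a, 'e, 'l) connexion"
  lfrm :: "('a, 'e, 'l) eform"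

definition lcs :: "('a, 'e::euclidean_space) manifold \<Rightarrow> ('a, 'e, 'l::real_vector) lcs_structure \<Rightarrow> bool" where
  "lcs M \<Omega> \<longleftrightarrow> smooth_manifold M \<and> oriented_line_bundle M (lbun \<Omega>) \<and>
     flat_connection M (lbun \<Omega>) (lcon \<Omega>) \<and> bundle_form M (lbun \<Omega>) 2 (lfrm \<Omega>) \<and>
     (\<forall>p\<in>pts M. \<forall>vs. length vs = 3 \<longrightarrow> ext_d M (lcon \<Omega>) (lfrm \<Omega>) p vs = 0) \<and>
     (\<forall>p\<in>pts M. bij_betw (\<lambda>v w. lfrm \<Omega> p [v, w]) UNIV
        {A. linear A \<and> range A \<subseteq> fibre (lbun \<Omega>) p})"

definition lcs_map ::
  "('a, 'e::euclidean_space) manifold \<Rightarrow> ('a, 'e, 'l::real_vector) lcs_structure \<Rightarrow>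
   ('b, 'f::euclidean_space) manifold \<Rightarrow> ('b, 'f, 'm::real_vector) lcs_structure \<Rightarrow> ('a \<Rightarrow> 'b) \<Rightarrow> bool" where
  "lcs_map M \<Omega> N \<Omega>' \<phi> \<longleftrightarrow> (\<exists>\<Phi>.
     flat_morphism M (lbun \<Omega>) (lcon \<Omega>) N (lbun \<Omega>') (lcon \<Omega>') \<phi> \<Phi> \<and>
     (\<forall>p\<in>pts M. \<forall>vs. length vs = 2 \<longrightarrow>
        bundle_pull_form M (lbun \<Omega>) N \<phi> \<Phi> (lfrm \<Omega>') p vs = lfrm \<Omega> p vs))"

definition lcs_symplecto ::
  "('a, 'e::euclidean_space) manifold \<Rightarrow> ('a, 'e, 'l::real_vector) lcs_structure \<Rightarrow>
   ('b, 'f::euclidean_space) manifold \<Rightarrow> ('b, 'f, 'm::real_vector) lcs_structure \<Rightarrow> ('a \<Rightarrow> 'b) \<Rightarrow> bool" where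
  "lcs_symplecto M \<Omega> N \<Omega>' \<phi> \<longleftrightarrow> lcs_map M \<Omega> N \<Omega>' \<phi> \<and> diffeo M N \<phi>"

abbreviation lcs_automorphism ::
  "('a, 'e::euclidean_space) manifold \<Rightarrow> ('a, 'e, 'l::real_vector) lcs_structure \<Rightarrow> ('a \<Rightarrow> 'a) \<Rightarrow> bool" where
  "lcs_automorphism M \<Omega> \<equiv> lcs_symplecto M \<Omega> M \<Omega>"

definition isotropic_embedding ::
  "('a, 'e::euclidean_space) manifold \<Rightarrow> ('b, 'f::euclidean_space) manifold \<Rightarrow>
   ('b, 'f, 'l::real_vector) lcs_structure \<Rightarrow> ('a \<Rightarrow> 'b) \<Rightarrow> bool" where
  "isotropic_embedding L M \<Omega> f \<longleftrightarrow> smooth_embedding L M f \<and>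
     (\<forall>p\<in>pts L. \<forall>vs. length vs = 2 \<longrightarrow> pull_form L M f (lfrm \<Omega>) p vs = 0)"

text \<open>\<open>\<mu>\<close> is the expansion constant of \<open>X\<close>.\<close>

definition lcs_vf ::
  "('a, 'e::euclidean_space) manifold \<Rightarrow> ('a, 'e, 'l::real_vector) lcs_structure \<Rightarrow> ('a \<Rightarrow> 'e) \<Rightarrow> real \<Rightarrow> bool" where
  "lcs_vf M \<Omega> X \<mu> \<longleftrightarrow> smooth_vf M X \<and>
     (\<forall>p\<in>pts M. \<forall>vs. length vs = 2 \<longrightarrow>
        ext_d M (lcon \<Omega>) (\<lambda>q ws. lfrm \<Omega> q (X q # ws)) p vs = \<mu> *\<^sub>R lfrm \<Omega> p vs)"

definition hamiltonian_vf ::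
  "('a, 'e::euclidean_space) manifold \<Rightarrow> ('a, 'e, 'l::real_vector) lcs_structure \<Rightarrow> ('a \<Rightarrow> 'l) \<Rightarrow> ('a \<Rightarrow> 'e) \<Rightarrow> bool" where
  "hamiltonian_vf M \<Omega> H X \<longleftrightarrow>
     (\<forall>p\<in>pts M. \<forall>v. lfrm \<Omega> p [X p, v] = - lcon \<Omega> H p v)"

text \<open>Families are parametrised by an interval \<open>J\<close>, which may contain its end points.\<close>

definition smooth_isotopy ::
  "real set \<Rightarrow> ('a, 'e::euclidean_space) manifold \<Rightarrow> (real \<Rightarrow> 'a \<Rightarrow> 'a) \<Rightarrow> bool" where
  "smooth_isotopy J M \<phi> \<longleftrightarrow>
     smooth_map_on (prod_mfd euclid_mfd M) (J \<times> pts M) M (\<lambda>(t, p). \<phi> t p) \<and>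
     (\<forall>t\<in>J. diffeo M M (\<phi> t)) \<and> (\<forall>p\<in>pts M. \<phi> 0 p = p)"

text \<open>\<open>d\<phi>\<^sub>t/dt = X\<^sub>t \<circ> \<phi>\<^sub>t\<close>; the velocity at \<open>\<phi>\<^sub>t(p)\<close> is computed in the preferred chart there.\<close>

definition generated_by ::
  "real set \<Rightarrow> ('a, 'e::euclidean_space) manifold \<Rightarrow> (real \<Rightarrow> 'a \<Rightarrow> 'a) \<Rightarrow> (real \<Rightarrow> 'a \<Rightarrow> 'e) \<Rightarrow> bool" where
  "generated_by J M \<phi> X \<longleftrightarrow> (\<forall>t\<in>J. \<forall>p\<in>pts M.
     ((\<lambda>\<tau>. crd M (\<phi> t p) (\<phi> \<tau> p)) has_vector_derivative X t (\<phi> t p)) (at t within J))"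

definition smooth_sec_family ::
  "real set \<Rightarrow> ('a, 'e::euclidean_space) manifold \<Rightarrow> ('a, 'l::real_vector) lbundle \<Rightarrow> (real \<Rightarrow> 'a \<Rightarrow> 'l) \<Rightarrow> bool" where
  "smooth_sec_family J M E H \<longleftrightarrow> (\<forall>(U, e)\<in>frames E. \<exists>g::real \<times> 'a \<Rightarrow> real.
     smooth_map_on (prod_mfd euclid_mfd M) (J \<times> U) euclid_mfd g \<and>
     (\<forall>t\<in>J. \<forall>p\<in>U. H t p = g (t, p) *\<^sub>R e p))"

definition hamiltonian_isotopy ::
  "real set \<Rightarrow> ('a, 'e::euclidean_space) manifold \<Rightarrow> ('a, 'e, 'l::real_vector) lcs_structure \<Rightarrow> (real \<Rightarrow> 'a \<Rightarrow> 'a) \<Rightarrow> bool" where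
  "hamiltonian_isotopy J M \<Omega> \<phi> \<longleftrightarrow> smooth_isotopy J M \<phi> \<and>
     (\<exists>H X. smooth_sec_family J M (lbun \<Omega>) H \<and> (\<forall>t\<in>J. hamiltonian_vf M \<Omega> (H t) (X t)) \<and>
            generated_by J M \<phi> X)"

subsection \<open>The Lee class\<close>

text \<open>Classes in \<open>H\<^sup>1(M;\<real>) = Hom(\<pi>\<^sub>1(M), \<real>)\<close> are represented by their values on loops, and by \<open>0\<close> on
  functions that are not loops.\<close>

definition loopin :: "'a topology \<Rightarrow> (real \<Rightarrow> 'a) \<Rightarrow> bool" where
  "loopin X \<gamma> \<longleftrightarrow> pathin X \<gamma> \<and> \<gamma> 1 = \<gamma> 0"

definition parallel_along ::
  "('a, 'e::euclidean_space) manifold \<Rightarrow> ('a, 'l::real_vector) lbundle \<Rightarrow> ('a, 'e, 'l) connexion \<Rightarrow>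
   (real \<Rightarrow> 'a) \<Rightarrow> (real \<Rightarrow> 'l) \<Rightarrow> bool" where
  "parallel_along M E D \<gamma> u \<longleftrightarrow> (\<forall>t\<in>{0..1}. u t \<in> fibre E (\<gamma> t) \<and>
     (\<exists>s. nearby M (\<gamma> t) (\<lambda>q. smooth_sec_at M E q s \<and> (\<forall>v. D s q v = 0)) \<and>
          (\<exists>\<epsilon>>0. \<forall>t'\<in>{0..1}. \<bar>t' - t\<bar> < \<epsilon> \<longrightarrow> u t' = s (\<gamma> t'))))"

definition holonomy ::
  "('a, 'e::euclidean_space) manifold \<Rightarrow> ('a, 'l::real_vector) lbundle \<Rightarrow> ('a, 'e, 'l) connexion \<Rightarrow>
   (real \<Rightarrow> 'a) \<Rightarrow> real" where
  "holonomy M E D \<gamma> = (THE c. \<exists>u. parallel_along M E D \<gamma> u \<and> u 0 \<noteq> 0 \<and> u 1 = c *\<^sub>R u 0)"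

definition lee_class ::
  "('a, 'e::euclidean_space) manifold \<Rightarrow> ('a, 'e, 'l::real_vector) lcs_structure \<Rightarrow> (real \<Rightarrow> 'a) \<Rightarrow> real" where
  "lee_class M \<Omega> \<gamma> =
     (if loopin (mtop M) \<gamma> then ln (holonomy M (lbun \<Omega>) (lcon \<Omega>) \<gamma>) else 0)"

definition pull_class ::
  "('a, 'e) manifold \<Rightarrow> ('a \<Rightarrow> 'b) \<Rightarrow> ((real \<Rightarrow> 'b) \<Rightarrow> real) \<Rightarrow> (real \<Rightarrow> 'a) \<Rightarrow> real" where
  "pull_class M f l \<gamma> = (if loopin (mtop M) \<gamma> then l (f \<circ> \<gamma>) else 0)"

section \<open>The product\<close>

definition smooth_covering ::
  "('c, 'e::euclidean_space) manifold \<Rightarrow> ('a, 'e) manifold \<Rightarrow> ('c \<Rightarrow> 'a) \<Rightarrow> bool" where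
  "smooth_covering C M q \<longleftrightarrow> smooth_map C M q \<and> q ` pts C = pts M \<and>
     (\<forall>p\<in>pts M. \<exists>V \<U>. openin (mtop M) V \<and> p \<in> V \<and>
        \<Union>\<U> = pts C \<inter> q -` V \<and> pairwise disjnt \<U> \<and>
        (\<forall>U\<in>\<U>. openin (mtop C) U \<and> bij_betw q U V \<and>
           (\<forall>y\<in>V. smooth_at M C y (inv_into U q))))"

definition deck_group :: "'c topology \<Rightarrow> ('c \<Rightarrow> 'a) \<Rightarrow> ('c \<Rightarrow> 'c) monoid" where
  "deck_group X q = (BijGroup (topspace X))
     \<lparr>carrier := {g \<in> Bij (topspace X). homeomorphic_map X X g \<and> (\<forall>x\<in>topspace X. q (g x) = q x)}\<rparr>"

text \<open>An LCS manifold together with a covering \<open>cprj\<close> of it.\<close>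

record ('a, 'e, 'l, 'c) covered_lcs =
  cmfd :: "('a, 'e) manifold"
  cstr :: "('a, 'e, 'l) lcs_structure"
  ccov :: "('c, 'e) manifold"
  cprj :: "'c \<Rightarrow> 'a"

text \<open>The last two conditions say that the covering corresponds to a normal subgroup of \<open>\<pi>\<^sub>1\<close> (the
  covering is normal: its deck group is transitive on fibres) contained in the kernel of the Lee class.\<close>

definition connected_covered_lcs ::
  "('a, 'e::euclidean_space, 'l::real_vector, 'c) covered_lcs \<Rightarrow> bool" where
  "connected_covered_lcs A \<longleftrightarrow>
     lcs (cmfd A) (cstr A) \<and> connected_space (mtop (cmfd A)) \<and> pts (cmfd A) \<noteq> {} \<and>
     smooth_manifold (ccov A) \<and> connected_space (mtop (ccov A)) \<and>
     smooth_covering (ccov A) (cmfd A) (cprj A) \<and>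
     (\<forall>x\<in>pts (ccov A). \<forall>y\<in>pts (ccov A). cprj A x = cprj A y \<longrightarrow>
        (\<exists>g\<in>carrier (deck_group (mtop (ccov A)) (cprj A)). g x = y)) \<and>
     (\<forall>\<gamma>. loopin (mtop (ccov A)) \<gamma> \<longrightarrow> lee_class (cmfd A) (cstr A) (cprj A \<circ> \<gamma>) = 0)"

text \<open>The homomorphism induced on the deck group: \<open>g\<close> corresponds to the loop that is the
  projection of a path from a point \<open>x\<close> to \<open>g x\<close>.\<close>

definition deck_hom :: "('a, 'e::euclidean_space, 'l::real_vector, 'c) covered_lcs \<Rightarrow> ('c \<Rightarrow> 'c) \<Rightarrow> real" where
  "deck_hom A g = (THE c. \<forall>\<gamma>. pathin (mtop (ccov A)) \<gamma> \<and> \<gamma> 1 = g (\<gamma> 0) \<longrightarrow>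
     lee_class (cmfd A) (cstr A) (cprj A \<circ> \<gamma>) = c)"

definition deck12 ::
  "('a, 'e::euclidean_space, 'l::real_vector, 'c) covered_lcs \<Rightarrow>
   ('b, 'f::euclidean_space, 'm::real_vector, 'd) covered_lcs \<Rightarrow> (('c \<Rightarrow> 'c) \<times> ('d \<Rightarrow> 'd)) monoid" where
  "deck12 A B =
     (deck_group (mtop (ccov A)) (cprj A) \<times>\<times> deck_group (mtop (ccov B)) (cprj B))
     \<lparr>carrier := {(g, h). g \<in> carrier (deck_group (mtop (ccov A)) (cprj A)) \<and>
        h \<in> carrier (deck_group (mtop (ccov B)) (cprj B)) \<and> deck_hom A g = deck_hom B h}\<rparr>"

definition box_proj ::
  "('a, 'e::euclidean_space, 'l::real_vector, 'c) covered_lcs \<Rightarrow>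
   ('b, 'f::euclidean_space, 'm::real_vector, 'd) covered_lcs \<Rightarrow> 'c \<times> 'd \<Rightarrow> ('c \<times> 'd) set" where
  "box_proj A B = orbit (deck12 A B) (\<lambda>(g, h). map_prod g h)"

text \<open>The points of \<open>M\<^sub>1 \<boxplus> M\<^sub>2\<close> are the \<open>\<Gamma>\<^sub>1\<^sub>2\<close>-orbits; the topology is the quotient topology.  The charts
  are those of the product of the coverings, restricted to open sets on which the quotient map is
  injective.\<close>

definition boxplus ::
  "('a, 'e::euclidean_space, 'l::real_vector, 'c) covered_lcs \<Rightarrow>
   ('b, 'f::euclidean_space, 'm::real_vector, 'd) covered_lcs \<Rightarrow> (('c \<times> 'd) set, 'e \<times> 'f) manifold" where
  "boxplus A B = (let C = prod_mfd (ccov A) (ccov B); \<pi> = box_proj A B in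
     \<lparr>mtop = topology (\<lambda>S. S \<subseteq> \<pi> ` pts C \<and> openin (mtop C) {w \<in> pts C. \<pi> w \<in> S}),
      atlas = {(\<pi> ` V, \<kappa> \<circ> inv_into V \<pi>) | V \<kappa>.
        openin (mtop C) V \<and> inj_on \<pi> V \<and> (\<exists>U. (U, \<kappa>) \<in> atlas C \<and> V \<subseteq> U)}\<rparr>)"

definition box_r ::
  "('a, 'e::euclidean_space, 'l::real_vector, 'c) covered_lcs \<Rightarrow>
   ('b, 'f::euclidean_space, 'm::real_vector, 'd) covered_lcs \<Rightarrow> ('c \<times> 'd) set \<Rightarrow> 'a \<times> 'b" where
  "box_r A B z = map_prod (cprj A) (cprj B) (SOME w. w \<in> z)"

abbreviation "box_r1 A B \<equiv> fst \<circ> box_r A B"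
abbreviation "box_r2 A B \<equiv> snd \<circ> box_r A B"

subsection \<open>The family \<open>\<Xi>\<close>\<close>

text \<open>The isomorphisms of flat oriented line bundles from \<open>r\<^sub>2\<^sup>*E\<^sub>2\<close> to \<open>r\<^sub>1\<^sup>*E\<^sub>1\<close> covering the identity.\<close>

definition box_iso ::
  "('a, 'e::euclidean_space, 'l::real_vector, 'c) covered_lcs \<Rightarrow>
   ('b, 'f::euclidean_space, 'm::real_vector, 'd) covered_lcs \<Rightarrow> (('c \<times> 'd) set \<Rightarrow> 'm \<Rightarrow> 'l) \<Rightarrow> bool" where
  "box_iso A B \<Phi> \<longleftrightarrow> flat_morphism
     (boxplus A B) (pull_bundle (boxplus A B) (box_r2 A B) (lbun (cstr B)))
       (pull_conn (boxplus A B) (cmfd B) (box_r2 A B) (lbun (cstr B)) (lcon (cstr B)))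
     (boxplus A B) (pull_bundle (boxplus A B) (box_r1 A B) (lbun (cstr A)))
       (pull_conn (boxplus A B) (cmfd A) (box_r1 A B) (lbun (cstr A)) (lcon (cstr A)))
     id \<Phi>"

definition box_struct ::
  "('a, 'e::euclidean_space, 'l::real_vector, 'c) covered_lcs \<Rightarrow>
   ('b, 'f::euclidean_space, 'm::real_vector, 'd) covered_lcs \<Rightarrow> (('c \<times> 'd) set \<Rightarrow> 'm \<Rightarrow> 'l) \<Rightarrow>
   (('c \<times> 'd) set, 'e \<times> 'f, 'l) lcs_structure" where
  "box_struct A B \<Phi> =
     \<lparr>lbun = pull_bundle (boxplus A B) (box_r1 A B) (lbun (cstr A)),
      lcon = pull_conn (boxplus A B) (cmfd A) (box_r1 A B) (lbun (cstr A)) (lcon (cstr A)),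
      lfrm = (\<lambda>z vs. if z \<in> pts (boxplus A B) \<and> length vs = 2
        then pull_form (boxplus A B) (cmfd A) (box_r1 A B) (lfrm (cstr A)) z vs
             - \<Phi> z (pull_form (boxplus A B) (cmfd B) (box_r2 A B) (lfrm (cstr B)) z vs)
        else 0)\<rparr>"

definition Xi ::
  "('a, 'e::euclidean_space, 'l::real_vector, 'c) covered_lcs \<Rightarrow>
   ('b, 'f::euclidean_space, 'm::real_vector, 'd) covered_lcs \<Rightarrow>
   (('c \<times> 'd) set, 'e \<times> 'f, 'l) lcs_structure set" where
  "Xi A B = {box_struct A B \<Phi> | \<Phi>. box_iso A B \<Phi>}"

text \<open>The action \<open>c \<cdot> \<Omega>\<^sub>\<Phi> = \<Omega>\<^sub>c\<^sub>\<Phi>\<close>: the summand \<open>\<Phi>(r\<^sub>2\<^sup>*\<omega>\<^sub>2)\<close> is multiplied by \<open>c\<close>, and \<open>r\<^sub>1\<^sup>*\<omega>\<^sub>1\<close> is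
  kept.\<close>

definition Xi_act ::
  "('a, 'e::euclidean_space, 'l::real_vector, 'c) covered_lcs \<Rightarrow>
   ('b, 'f::euclidean_space, 'm::real_vector, 'd) covered_lcs \<Rightarrow> real \<Rightarrow>
   (('c \<times> 'd) set, 'e \<times> 'f, 'l) lcs_structure \<Rightarrow> (('c \<times> 'd) set, 'e \<times> 'f, 'l) lcs_structure" where
  "Xi_act A B c \<Omega> =
     (let \<Phi> = (SOME \<Phi>. box_iso A B \<Phi> \<and> box_struct A B \<Phi> = \<Omega>)
      in box_struct A B (\<lambda>z x. c *\<^sub>R \<Phi> z x))"

definition pos_real_group :: "real monoid" where
  "pos_real_group = \<lparr>carrier = {0<..}, mult = (*), one = 1\<rparr>"

definition add_real_group :: "real monoid" where
  "add_real_group = \<lparr>carrier = UNIV, mult = (+), one = 0\<rparr>"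

definition torsor :: "('g, 'z) monoid_scheme \<Rightarrow> 'x set \<Rightarrow> ('g \<Rightarrow> 'x \<Rightarrow> 'x) \<Rightarrow> bool" where
  "torsor G S act \<longleftrightarrow> group_action G S (\<lambda>g. restrict (act g) S) \<and> S \<noteq> {} \<and>
     (\<forall>x\<in>S. \<forall>y\<in>S. \<exists>!g. g \<in> carrier G \<and> act g x = y)"

text \<open>The structure \<open>\<Omega>\<^sub>G\<close> determined by a lift \<open>G = \<Gamma>(\<phi>)\<close>.\<close>

definition Xi_of ::
  "('a, 'e::euclidean_space, 'l::real_vector, 'c) covered_lcs \<Rightarrow>
   ('b, 'f::euclidean_space, 'm::real_vector, 'd) covered_lcs \<Rightarrow> ('a \<Rightarrow> ('c \<times> 'd) set) \<Rightarrow>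
   (('c \<times> 'd) set, 'e \<times> 'f, 'l) lcs_structure" where
  "Xi_of A B G = (THE \<Omega>. \<Omega> \<in> Xi A B \<and> isotropic_embedding (cmfd A) (boxplus A B) \<Omega> G)"

definition diag_lift ::
  "('a, 'e::euclidean_space, 'l::real_vector, 'c) covered_lcs \<Rightarrow> 'a \<Rightarrow> ('c \<times> 'c) set" where
  "diag_lift A p = (let x = (SOME x. x \<in> pts (ccov A) \<and> cprj A x = p) in box_proj A A (x, x))"

definition lifted_isotopy ::
  "real set \<Rightarrow> ('a, 'e::euclidean_space, 'l::real_vector, 'c) covered_lcs \<Rightarrow> (real \<Rightarrow> 'a \<Rightarrow> 'a) \<Rightarrow>
   (real \<Rightarrow> ('c \<times> 'c) set \<Rightarrow> ('c \<times> 'c) set) \<Rightarrow> bool" where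
  "lifted_isotopy J A \<phi> \<psi> \<longleftrightarrow> smooth_isotopy J (boxplus A A) \<psi> \<and>
     (\<forall>t\<in>J. \<forall>z\<in>pts (boxplus A A). box_r A A (\<psi> t z) = map_prod id (\<phi> t) (box_r A A z))"

end

theory Submission imports Defs begin

text \<open>On the coverings the flat bundles have global parallel positive sections, and the homomorphisms \<open>\<rho>\<^sub>i\<close>
 are the logarithms of the factors \<open>kap x x'\<close> by which they change between two points of a fibre. Hence
 \<open>M\<^sub>1 \<boxplus> M\<^sub>2\<close> is the quotient of the product of the coverings by: same image in \<open>M\<^sub>1 \<times> M\<^sub>2\<close> and equal factors
 on both sides. Matching the parallel sections gives an isomorphism \<open>iso0\<close> over the quotient, and by
 connectedness any other one is a positive multiple of it; this yields the torsor, the deck group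
 homomorphism and the Lee class. A graph is isotropic for \<open>c \<cdot> iso0\<close> iff
 \<open>c iso0 (\<omega>\<^sub>2 (\<phi>\<^sub>* v, \<phi>\<^sub>* w)) = \<omega>\<^sub>1 (v, w)\<close>, and nondegeneracy determines \<open>c\<close>. For an isotopy,
 \<open>iso0 (\<omega> (\<phi>\<^sub>t\<^sub>* v, \<phi>\<^sub>t\<^sub>* w)) = k t *\<^sub>R \<omega> (v, w)\<close>, where Cartan's formula in flat frames gives
 \<open>k' = \<mu> k\<close>, so that \<open>c = 1 / k = exp (- \<integral>\<mu>)\<close>. In the Hamiltonian case the derivative vanishes by
 flatness, and \<open>\<psi>\<^sub>t\<close> is generated by the Hamiltonian \<open>- iso0 (H\<^sub>t \<circ> r\<^sub>2)\<close>.\<close>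

text \<open>The tangent space at \<open>p\<close> is the model space read in a chart chosen
  arbitrarily at \<open>p\<close>, so values of fields and forms at different points cannot be
  compared or differentiated as they stand. Every computation therefore fixes a point, its chart and
  flat frames near it, and becomes a statement about real functions on a ball. Flat frames exist
  because flatness makes the connection form of any frame closed. What is left over is locally
  constant: factors between parallel sections, between bundle isomorphisms, between sheets.
  Connectedness turns each of them into one global constant.

  The group acts by scaling the second summand, which enters with a minus sign. If a map multiplies
  this summand by some factor, the structure has to be scaled by the reciprocal. Hence the minus
  sign in front of \<open>ln (dscale g)\<close> and in the exponent of the expansion formula:
  brought back to the fibre over \<open>p\<close>, the pulled-back form is exp(\<integral>\<mu>)
  times the original one.

  Time intervals may contain their end points, or be a single point. Smoothness in time means that
  local extensions exist, and time derivatives are computed for such extensions.\<close>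

abbreviation scaleR_infix (infixr "*R" 75) where "c *R x == scaleR c x"
abbreviation (input) iff_infix :: "bool => bool => bool" (infixr "<->" 25) where "A <-> B == A = B"
abbreviation "eucl == euclid_mfd"
abbreviation "near == nearby"
abbreviation "cinv == crd_inv"
abbreviation "cvf == coord_vf"
abbreviation "fcf == frame_coef"
abbreviation "pbun == pull_bundle"
abbreviation "ssec == smooth_sec_at"
abbreviation "mfd M == smooth_manifold M"
abbreviation "smf M == smooth_at M eucl"
abbreviation "dmf M == tmap M eucl"
abbreviation "opn M == openin (mtop M)"

section \<open>Differential calculus on open subsets of normed spaces\<close>

abbreviation fd :: "('e::real_normed_vector => 'f::real_normed_vector) => 'e => 'e => 'f" where
 "fd f x == frechet_derivative f (at x)"

lemmas hd_within = has_derivative_transform_within_open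

lemma fd_eq: "(f has_derivative f') (at x) ==> fd f x = f'"
 using frechet_derivative_at by metis

lemma fd_works: "f differentiable (at x) ==> (f has_derivative fd f x) (at x)"
 using frechet_derivative_works by blast

lemma ck_on_cong_imp:
 assumes "open S" "!!x. x : S ==> f x = g x" "ck_on k S f"
 shows "ck_on k S g"
 using assms(2,3)
proof (induction k arbitrary: f g)
 case 0
 thus ?case using continuous_on_cong by (metis ck_on.simps(1))
next
 case (Suc k)
 have D: "(g has_derivative fd f x) (at x)" if "x : S" for x
 proof -
  have "(f has_derivative fd f x) (at x)"
   using Suc.prems(2) that by (auto intro: fd_works)
  thus ?thesis
   using hd_within[OF _ assms(1) that] Suc.prems(1) by blast
 qed
 have E: "fd g x = fd f x" if "x : S" for x
  using D fd_eq that by blast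
 show ?case
  unfolding ck_on.simps(2)
 proof (intro conjI ballI allI)
  fix x assume "x : S"
  thus "g differentiable at x"
   using D differentiable_def by blast
 next
  fix v
  show "ck_on k S (%x. fd g x v)"
   by (rule Suc.IH[of "%x. fd f x v"]) (use E Suc.prems in auto)
 qed
qed

text \<open>Lets the inductions below work with an explicit formula for the derivative;
  \<open>frechet_derivative\<close> is replaced on the open set, where the two agree.\<close>

lemma ck_on_SucI:
 assumes "open S" "!!x. x : S ==> (f has_derivative f' x) (at x)"
  and "!!v. ck_on k S (%x. f' x v)"
 shows "ck_on (Suc k) S f"
 unfolding ck_on.simps(2)
proof (intro conjI ballI allI)
 fix x assume "x : S"
 thus "f differentiable at x"
  using assms(2) differentiable_def by blast
next
 fix v
 show "ck_on k S (%x. fd f x v)"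
  by (rule ck_on_cong_imp[OF assms(1) _ assms(3)[of v]]) (metis assms(2) fd_eq)
qed

lemma ck_deriv:
 "ck_on (Suc k) S f ==> x : S ==> (f has_derivative fd f x) (at x)"
 by (auto intro: fd_works)

lemma ck_fd: "ck_on (Suc k) S f ==> ck_on k S (%x. fd f x v)"
 by simp

lemma ck_on_Suc_imp: "ck_on (Suc k) S f ==> ck_on k S f"
proof (induction k arbitrary: f)
 case 0
 thus ?case
  by (auto intro!: continuous_at_imp_continuous_on differentiable_imp_continuous_within)
next
 case (Suc k)
 thus ?case by simp
qed

lemma ck_on_0: "ck_on k S f ==> continuous_on S f"
proof (induction k)
 case (Suc k)
 thus ?case by (blast intro: ck_on_Suc_imp)
qed simp

lemma ck_on_subset: "ck_on k S f ==> T <= S ==> ck_on k T f"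
 by (induction k arbitrary: f) (auto intro: continuous_on_subset)

lemma ck_on_local:
 assumes "open S" "!!x. x : S ==> EX T. open T & x : T & ck_on k T f"
 shows "ck_on k S f"
 using assms(2)
proof (induction k arbitrary: f)
 case 0
 have "isCont f x" if "x : S" for x
  using 0[OF that] by (auto simp: continuous_on_eq_continuous_at)
 thus ?case
  by (simp add: continuous_at_imp_continuous_on)
next
 case (Suc k)
 show ?case
  unfolding ck_on.simps(2)
 proof (intro conjI ballI allI)
  fix x assume "x : S"
  thus "f differentiable at x"
   using Suc.prems ck_on.simps(2) by blast
 next
  fix v
  show "ck_on k S (%x. fd f x v)"
  proof (rule Suc.IH)
   fix x assume "x : S"
   then obtain T where "open T" "x : T" "ck_on (Suc k) T f"
    using Suc.prems by blast
   thus "EX T. open T & x : T & ck_on k T (%x. fd f x v)"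
    using ck_fd by blast
  qed
 qed
qed

lemma ck_on_const: "ck_on k S (%x. c)"
proof (induction k arbitrary: c)
 case 0
 thus ?case by simp
next
 case (Suc k)
 thus ?case by simp
qed

lemma ck_on_bounded_linear_comp:
 assumes "open S" "bounded_linear L" "ck_on k S f"
 shows "ck_on k S (%x. L (f x))"
 using assms(3)
proof (induction k arbitrary: f)
 case 0
 thus ?case
  using bounded_linear.continuous_on[OF assms(2)] by simp
next
 case (Suc k)
 show ?case
 proof (rule ck_on_SucI[OF assms(1)])
  show "((%x. L (f x)) has_derivative (%v. L (fd f x v))) (at x)" if "x : S" for x
   by (rule bounded_linear.has_derivative[OF assms(2) ck_deriv[OF Suc.prems that]])
  show "ck_on k S (%x. L (fd f x v))" for v
   by (rule Suc.IH[OF ck_fd[OF Suc.prems]])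
 qed
qed

lemma ck_on_id: "open S ==> ck_on k S (%x. x)"
proof (cases k)
 case (Suc j)
 assume "open S"
 thus ?thesis
  unfolding Suc by (rule ck_on_SucI[where f' = "%x v. v"]) (auto intro: ck_on_const)
qed simp

lemma ck_on_add:
 assumes "open S" "ck_on k S f" "ck_on k S g"
 shows "ck_on k S (%x. f x + g x)"
 using assms(2,3)
proof (induction k arbitrary: f g)
 case 0
 thus ?case by (auto intro: continuous_intros)
next
 case (Suc k)
 show ?case
 proof (rule ck_on_SucI[OF assms(1)])
  show "((%x. f x + g x) has_derivative (%v. fd f x v + fd g x v)) (at x)" if "x : S" for x
   by (intro derivative_intros ck_deriv[OF Suc.prems(1) that] ck_deriv[OF Suc.prems(2) that])
  show "ck_on k S (%x. fd f x v + fd g x v)" for v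
   by (rule Suc.IH[OF ck_fd[OF Suc.prems(1)] ck_fd[OF Suc.prems(2)]])
 qed
qed

lemma ck_on_bilinear:
 assumes "open S" "bounded_bilinear prd" "ck_on k S f" "ck_on k S g"
 shows "ck_on k S (%x. prd (f x) (g x))"
 using assms(3,4)
proof (induction k arbitrary: f g)
 case 0
 thus ?case using bounded_bilinear.continuous_on[OF assms(2)] by simp
next
 case (Suc k)
 show ?case
 proof (rule ck_on_SucI[OF assms(1)])
  show "((%x. prd (f x) (g x)) has_derivative (%v. prd (f x) (fd g x v) + prd (fd f x v) (g x))) (at x)" if "x : S" for x
   by (intro bounded_bilinear.FDERIV[OF assms(2)] ck_deriv[OF Suc.prems(1) that] ck_deriv[OF Suc.prems(2) that])
  show "ck_on k S (%x. prd (f x) (fd g x v) + prd (fd f x v) (g x))" for v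
   by (rule ck_on_add[OF assms(1) Suc.IH[OF ck_on_Suc_imp[OF Suc.prems(1)] ck_fd[OF Suc.prems(2)]] Suc.IH[OF ck_fd[OF Suc.prems(1)] ck_on_Suc_imp[OF Suc.prems(2)]]])
 qed
qed

lemma ck_on_sum:
 "open S ==> (!!i. i : I ==> ck_on k S (f i)) ==> ck_on k S (%x. SUM i:I. f i x)"
 by (induction I rule: infinite_finite_induct) (auto intro: ck_on_const ck_on_add)

lemma ck_on_Pair:
 assumes "open S" "ck_on k S f" "ck_on k S g"
 shows "ck_on k S (%x. (f x, g x))"
 using assms(2,3)
proof (induction k arbitrary: f g)
 case 0
 thus ?case by (auto intro: continuous_intros)
next
 case (Suc k)
 show ?case
 proof (rule ck_on_SucI[OF assms(1)])
  show "((%x. (f x, g x)) has_derivative (%v. (fd f x v, fd g x v))) (at x)" if "x : S" for x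
   by (intro derivative_intros ck_deriv[OF Suc.prems(1) that] ck_deriv[OF Suc.prems(2) that])
  show "ck_on k S (%x. (fd f x v, fd g x v))" for v
   by (rule Suc.IH[OF ck_fd[OF Suc.prems(1)] ck_fd[OF Suc.prems(2)]])
 qed
qed

text \<open>\<open>ck_on\<close> speaks about derivatives in a fixed direction only. Expanding a
  direction that varies with the point reduces it to finitely many fixed ones; the same device
  handles forms applied to varying vectors.\<close>

lemma basis_sum:
 fixes w :: "'e::euclidean_space"
 assumes "linear L"
 shows "L w = (SUM b:Basis. (w \<bullet> b) *R L b)"
proof -
 have "L w = L (SUM b:Basis. (w \<bullet> b) *R b)"
  by (simp only: euclidean_representation)
 also have "... = (SUM b:Basis. (w \<bullet> b) *R L b)"
  by (simp add: linear_sum[OF assms] linear_scale[OF assms])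
 finally show ?thesis .
qed

lemma ck_on_compose:
 fixes f :: "'a::real_normed_vector => 'b::euclidean_space" and g :: "'b => 'c::real_normed_vector"
 assumes "open S" "ck_on k S f" "ck_on k T g" "f ` S <= T"
 shows "ck_on k S (%x. g (f x))"
 using assms(2-)
proof (induction k arbitrary: g)
 case 0
 thus ?case using continuous_on_compose2 by (metis ck_on.simps(1))
next
 case (Suc k)
 have fS: "f x : T" if "x : S" for x using that Suc.prems by auto
 have gf: "(g has_derivative fd g (f x)) (at (f x))" if "x : S" for x
  by (rule ck_deriv[OF Suc.prems(2) fS[OF that]])
 show ?case
 \<comment> \<open>The chain rule differentiates \<open>g\<close> in the direction
   \<open>fd f x v\<close>, which depends on \<open>x\<close>. After the basis expansion the
   induction hypothesis applies to each \<open>fd g (f x) b\<close>.\<close>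
 proof (rule ck_on_SucI[OF assms(1), where f' = "%x v. SUM b:Basis. (fd f x v \<bullet> b) *R fd g (f x) b"])
  fix x assume x: "x : S"
  have "linear (fd g (f x))"
   using gf[OF x] has_derivative_linear by blast
  hence E: "fd g (f x) w = (SUM b:Basis. (w \<bullet> b) *R fd g (f x) b)" for w
   by (rule basis_sum)
  show "((%x. g (f x)) has_derivative (%v. SUM b:Basis. (fd f x v \<bullet> b) *R fd g (f x) b)) (at x)"
   using has_derivative_compose[OF ck_deriv[OF Suc.prems(1) x] gf[OF x]]
   unfolding E[symmetric] .
 next
  fix v
  show "ck_on k S (%x. SUM b:Basis. (fd f x v \<bullet> b) *R fd g (f x) b)"
   by (intro ck_on_sum assms(1) ck_on_bilinear[OF assms(1) bounded_bilinear_scaleR]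
     ck_on_bounded_linear_comp[OF assms(1) bounded_linear_inner_left] ck_fd Suc.prems Suc.IH
     ck_on_Suc_imp[OF Suc.prems(1)])
 qed
qed

lemma so_ckD: "smooth_on S f ==> ck_on k S f"
 by (simp add: smooth_on_def)

lemma so_cong: "open S ==> smooth_on S f ==> (!!x. x : S ==> f x = g x) ==> smooth_on S g"
 unfolding smooth_on_def using ck_on_cong_imp by blast

lemma so_subset: "smooth_on S f ==> T <= S ==> smooth_on T f"
 unfolding smooth_on_def using ck_on_subset by blast

lemma so_local:
 "open S ==> (!!x. x : S ==> EX T. open T & x : T & smooth_on T f) ==> smooth_on S f"
 unfolding smooth_on_def using ck_on_local by metis

lemma so_const [simp]: "smooth_on S (%x. c)"
 by (simp add: smooth_on_def ck_on_const)

lemma so_id: "open S ==> smooth_on S (%x. x)"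
 by (simp add: smooth_on_def ck_on_id)

lemma so_add: "open S ==> smooth_on S f ==> smooth_on S g ==> smooth_on S (%x. f x + g x)"
 by (simp add: smooth_on_def ck_on_add)

lemma so_bounded_linear:
 "open S ==> bounded_linear L ==> smooth_on S f ==> smooth_on S (%x. L (f x))"
 by (simp add: smooth_on_def ck_on_bounded_linear_comp)

lemma so_bilinear:
 "open S ==> bounded_bilinear prd ==> smooth_on S f ==> smooth_on S g ==> smooth_on S (%x. prd (f x) (g x))"
 by (simp add: smooth_on_def ck_on_bilinear)

lemma so_scaleR:
 "open S ==> smooth_on S f ==> smooth_on S g ==> smooth_on S (%x. f x *R g x)"
 by (rule so_bilinear[OF _ bounded_bilinear_scaleR])

lemma so_mult:
 fixes f g :: "_ => real"
 shows "open S ==> smooth_on S f ==> smooth_on S g ==> smooth_on S (%x. f x * g x)"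
 by (rule so_bilinear[OF _ bounded_bilinear_mult])

lemma so_inner_left: "open S ==> smooth_on S f ==> smooth_on S (%x. f x \<bullet> b)"
 by (rule so_bounded_linear[OF _ bounded_linear_inner_left])

lemma so_sum:
 "open S ==> (!!i. i : I ==> smooth_on S (f i)) ==> smooth_on S (%x. SUM i:I. f i x)"
 by (simp add: smooth_on_def ck_on_sum)

lemma so_Pair: "open S ==> smooth_on S f ==> smooth_on S g ==> smooth_on S (%x. (f x, g x))"
 by (simp add: smooth_on_def ck_on_Pair)

lemma so_compose:
 fixes f :: "'a::real_normed_vector => 'b::euclidean_space"
 shows "open S ==> smooth_on S f ==> smooth_on T g ==> f ` S <= T ==> smooth_on S (%x. g (f x))"
 unfolding smooth_on_def using ck_on_compose[of S _ f T g] by blast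

lemma so_imp_differentiable: "smooth_on S f ==> x : S ==> f differentiable (at x)"
 using so_ckD[of S f "Suc 0"] by simp

lemma so_has_derivative: "smooth_on S f ==> x : S ==> (f has_derivative fd f x) (at x)"
 by (intro fd_works so_imp_differentiable)

lemma so_continuous: "smooth_on S f ==> continuous_on S f"
 using so_ckD ck_on_0 by blast

lemma so_fd: "smooth_on S f ==> smooth_on S (%x. fd f x v)"
 unfolding smooth_on_def using ck_fd by blast

lemma so_fd_linear: "smooth_on S f ==> x : S ==> linear (fd f x)"
 using linear_frechet_derivative so_imp_differentiable by blast

text \<open>Each order \<open>k\<close> follows from order \<open>Suc k\<close>, which only asks for
  the derivatives to be of order \<open>k\<close>. This gives smoothness of the primitive in
  \<open>poincare_1form\<close>.\<close>

lemma so_derivI: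
 assumes "open S" "!!x. x : S ==> (f has_derivative f' x) (at x)" "!!v. smooth_on S (%x. f' x v)"
 shows "smooth_on S f"
 unfolding smooth_on_def
proof
 fix k
 show "ck_on k S f"
  by (rule ck_on_Suc_imp, rule ck_on_SucI[OF assms(1,2)]) (use assms(3) in "auto simp: smooth_on_def")
qed

lemma so_fd_apply:
 fixes f :: "'e::euclidean_space => 'f::real_normed_vector"
 assumes "open S" "smooth_on S f" "smooth_on S X"
 shows "smooth_on S (%x. fd f x (X x))"
proof (rule so_cong[OF assms(1)])
 show "smooth_on S (%x. SUM b:Basis. (X x \<bullet> b) *R fd f x b)"
  by (intro so_sum so_scaleR so_inner_left so_fd assms)
qed (metis basis_sum so_fd_linear assms(2))

text \<open>The derivative is a product of a derivative of \<open>f\<close> with two copies of the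
  inverse itself, so the induction hypothesis covers every factor.\<close>

lemma ck_on_inverse:
 fixes f :: "'e::real_normed_vector => real"
 assumes "open S" "ck_on k S f" "!!x. x : S ==> f x ~= 0"
 shows "ck_on k S (%x. inverse (f x))"
 using assms(2)
proof (induction k)
 case 0
 thus ?case using assms(3) by (auto intro!: continuous_intros)
next
 case (Suc k)
 have inv: "ck_on k S (%x. inverse (f x))"
  using Suc ck_on_Suc_imp by blast
 show ?case
 proof (rule ck_on_SucI[OF assms(1)])
  show "((%x. inverse (f x)) has_derivative (%v. (- inverse (f x)) * (fd f x v * inverse (f x)))) (at x)" if "x : S" for x
   by (rule has_derivative_eq_rhs[OF Deriv.has_derivative_inverse[OF assms(3)[OF that] ck_deriv[OF Suc.prems that]]])
     (auto simp: mult.assoc)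
  have "ck_on k S (%x. - inverse (f x))"
   by (rule ck_on_bounded_linear_comp[OF assms(1) _ inv, of uminus]) (intro bounded_linear_minus bounded_linear_ident)
  thus "ck_on k S (%x. (- inverse (f x)) * (fd f x v * inverse (f x)))" for v
   by (intro ck_on_bilinear[OF assms(1) bounded_bilinear_mult] ck_fd[OF Suc.prems] inv)
 qed
qed

lemma so_inverse:
 fixes f :: "'e::real_normed_vector => real"
 shows "open S ==> smooth_on S f ==> (!!x. x : S ==> f x ~= 0) ==> smooth_on S (%x. inverse (f x))"
 by (simp add: smooth_on_def ck_on_inverse)

lemma ck_on_exp:
 fixes f :: "'e::real_normed_vector => real"
 assumes "open S" "ck_on k S f"
 shows "ck_on k S (%x. exp (f x))"
 using assms(2)
proof (induction k)
 case 0
 thus ?case by (auto intro!: continuous_intros)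
next
 case (Suc k)
 show ?case
 proof (rule ck_on_SucI[OF assms(1)])
  show "((%x. exp (f x)) has_derivative (%v. exp (f x) * fd f x v)) (at x)" if "x : S" for x
   by (rule has_derivative_eq_rhs[OF has_derivative_exp[OF ck_deriv[OF Suc.prems that]]]) auto
  show "ck_on k S (%x. exp (f x) * fd f x v)" for v
   by (intro ck_on_bilinear[OF assms(1) bounded_bilinear_mult] ck_fd[OF Suc.prems] Suc.IH ck_on_Suc_imp[OF Suc.prems])
 qed
qed

lemma so_exp:
 fixes f :: "'e::real_normed_vector => real"
 shows "open S ==> smooth_on S f ==> smooth_on S (%x. exp (f x))"
 by (simp add: smooth_on_def ck_on_exp)

text \<open>Two applications of the mean value theorem to the second difference of \<open>f\<close> along \<open>v\<close>, \<open>w\<close>.\<close>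

lemma second_difference:
 fixes f :: "'e::real_normed_vector => real"
 assumes "smooth_on S f" "h > 0"
  and S: "!!s t. 0 <= s ==> s <= h ==> 0 <= t ==> t <= h ==> x + s *R v + t *R w : S"
 shows "EX s t. 0 < s & s < h & 0 < t & t < h &
  f (x + h *R v + h *R w) - f (x + h *R v) - f (x + h *R w) + f x =
   h * h * fd (%y. fd f y v) (x + s *R v + t *R w) w"
proof -
 define g where "g s = f (x + s *R v + h *R w) - f (x + s *R v + 0 *R w)" for s
 have lin: "fd F y (c *R u) = c * fd F y u" if "smooth_on S F" "y : S" for F :: "'e => real" and c y u
  using linear_scale[OF so_fd_linear[OF that]] by simp
 have d: "((%s. F (x + s *R v + t *R w)) has_real_derivative fd F (x + s *R v + t *R w) v) (at s)"
  if F: "smooth_on S F" and st: "0 <= s" "s <= h" "0 <= t" "t <= h" for F :: "'e => real" and s t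
 proof -
  have 1: "(F has_derivative fd F (x + s *R v + t *R w)) (at (x + s *R v + t *R w))"
   by (rule so_has_derivative[OF F S[OF st]])
  have 2: "((%s. x + s *R v + t *R w) has_derivative (%c. c *R v)) (at s)"
   by (auto intro!: derivative_eq_intros)
  show ?thesis
   by (rule has_derivative_imp_has_field_derivative[OF has_derivative_compose[OF 2 1]]) (simp add: lin[OF F S[OF st]])
 qed
 have d': "((%t. F (x + s *R v + t *R w)) has_real_derivative fd F (x + s *R v + t *R w) w) (at t)"
  if F: "smooth_on S F" and st: "0 <= s" "s <= h" "0 <= t" "t <= h" for F :: "'e => real" and s t
 proof -
  have 1: "(F has_derivative fd F (x + s *R v + t *R w)) (at (x + s *R v + t *R w))"
   by (rule so_has_derivative[OF F S[OF st]])
  have 2: "((%t. x + s *R v + t *R w) has_derivative (%c. c *R w)) (at t)"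
   by (auto intro!: derivative_eq_intros)
  show ?thesis
   by (rule has_derivative_imp_has_field_derivative[OF has_derivative_compose[OF 2 1]]) (simp add: lin[OF F S[OF st]])
 qed
 have "EX s. 0 < s & s < h & g h - g 0 = (h - 0) * (fd f (x + s *R v + h *R w) v - fd f (x + s *R v + 0 *R w) v)"
  by (rule MVT2[OF assms(2)]) (unfold g_def, use assms(2) in "auto intro!: DERIV_diff d[OF assms(1), of _ 0, simplified] d[OF assms(1)]")
 then obtain s where s: "0 < s" "s < h" "g h - g 0 = h * (fd f (x + s *R v + h *R w) v - fd f (x + s *R v + 0 *R w) v)"
  by auto
 have "EX t. 0 < t & t < h & fd f (x + s *R v + h *R w) v - fd f (x + s *R v + 0 *R w) v
   = (h - 0) * fd (%y. fd f y v) (x + s *R v + t *R w) w"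
  by (rule MVT2[OF assms(2)]) (use s in "auto intro!: d'[OF so_fd[OF assms(1)]]")
 then obtain t where t: "0 < t" "t < h" "fd f (x + s *R v + h *R w) v - fd f (x + s *R v + 0 *R w) v
   = h * fd (%y. fd f y v) (x + s *R v + t *R w) w"
  by auto
 have "g h - g 0 = f (x + h *R v + h *R w) - f (x + h *R v) - f (x + h *R w) + f x"
  by (simp add: g_def)
 with s t show ?thesis
  by (intro exI[of _ s] exI[of _ t]) auto
qed

text \<open>Schwarz's theorem. Up to the factor \<open>h * h\<close>, the same second difference is
  a value of either mixed derivative at points close to \<open>x\<close>; continuity of both at
  \<open>x\<close> then bounds their difference by every positive \<open>e\<close>.\<close>

lemma fd_fd_commute_real:
 fixes f :: "'e::euclidean_space => real"
 assumes "open S" "smooth_on S f" "x : S"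
 shows "fd (%y. fd f y v) x w = fd (%y. fd f y w) x v"
proof -
 let ?A = "%y. fd (%y. fd f y v) y w" and ?B = "%y. fd (%y. fd f y w) y v"
 have cont: "isCont ?A x" "isCont ?B x"
  using so_continuous[OF so_fd[OF so_fd[OF assms(2)]]] assms(1,3)
  by (auto simp: continuous_on_eq_continuous_at)
 obtain r where r: "r > 0" "ball x r <= S"
  using assms(1,3) open_contains_ball by blast
 have "abs (?A x - ?B x) <= e" if e: "e > 0" for e
 proof -
  obtain d1 where d1: "d1 > 0" "!!y. dist y x < d1 ==> dist (?A y) (?A x) < e/2"
   using cont(1)[unfolded continuous_at_eps_delta, rule_format, of "e/2"] half_gt_zero[OF e] by blast
  obtain d2 where d2: "d2 > 0" "!!y. dist y x < d2 ==> dist (?B y) (?B x) < e/2"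
   using cont(2)[unfolded continuous_at_eps_delta, rule_format, of "e/2"] half_gt_zero[OF e] by blast
  define d where "d = Min {d1, d2, r}"
  \<comment> \<open>With this side length the whole parallelogram stays strictly within distance
    \<open>d\<close> of \<open>x\<close>; the summand 1 covers the case that both directions
    vanish.\<close>
  define h where "h = d / (2 * (norm v + norm w + 1))"
  have d: "d > 0" "d <= d1" "d <= d2" "d <= r" using d1 d2 r by (auto simp: d_def)
  have n: "norm v + norm w + 1 > 0" by (smt (verit) norm_ge_zero)
  have h: "h > 0" using d n by (simp add: h_def)
  have near: "dist (x + s *R v + t *R w) x < d" if "0 <= s" "s <= h" "0 <= t" "t <= h" for s t
  proof -
   have "dist (x + s *R v + t *R w) x <= s * norm v + t * norm w"
    unfolding dist_norm using norm_triangle_ineq[of "s *R v" "t *R w"] that by simp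
   also have "... <= h * norm v + h * norm w"
    using that by (intro add_mono mult_right_mono) auto
   also have "... < h * (2 * (norm v + norm w + 1))"
   proof -
    have "norm v + norm w < 2 * (norm v + norm w + 1)" by (smt (verit) norm_ge_zero)
    from mult_strict_left_mono[OF this h] show ?thesis by (simp only: distrib_left)
   qed
   also have "... = d" using n by (simp add: h_def)
   finally show ?thesis .
  qed
  have inS: "x + s *R v + t *R w : S" if "0 <= s" "s <= h" "0 <= t" "t <= h" for s t
  proof -
   have "dist x (x + s *R v + t *R w) < r"
    using near[OF that] d(4) by (simp add: dist_commute)
   thus ?thesis using r(2) by auto
  qed
  have inS': "x + s *R w + t *R v : S" if "0 <= s" "s <= h" "0 <= t" "t <= h" for s t
   using inS[of t s] that by (simp add: algebra_simps)
  obtain s t where st: "0 < s" "s < h" "0 < t" "t < h"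
   "f (x + h *R v + h *R w) - f (x + h *R v) - f (x + h *R w) + f x = h * h * ?A (x + s *R v + t *R w)"
   using second_difference[OF assms(2) h inS] by blast
  obtain s' t' where st': "0 < s'" "s' < h" "0 < t'" "t' < h"
   "f (x + h *R w + h *R v) - f (x + h *R w) - f (x + h *R v) + f x = h * h * ?B (x + s' *R w + t' *R v)"
   using second_difference[OF assms(2) h inS'] by blast
  have "h * h * ?A (x + s *R v + t *R w) = h * h * ?B (x + s' *R w + t' *R v)"
   using st(5) st'(5) by (simp add: algebra_simps)
  hence eq: "?A (x + s *R v + t *R w) = ?B (x + t' *R v + s' *R w)"
   using h by (simp add: algebra_simps)
  have "dist (?A (x + s *R v + t *R w)) (?A x) < e/2"
   using near[of s t] st d by (intro d1(2)) auto
  moreover have "dist (?B (x + t' *R v + s' *R w)) (?B x) < e/2"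
   using near[of t' s'] st' d by (intro d2(2)) auto
  ultimately show ?thesis
   using eq unfolding dist_real_def by linarith
 qed
 hence "abs (?A x - ?B x) <= 0"
  using field_le_epsilon[of "abs (?A x - ?B x)" 0] by simp
 thus ?thesis by simp
qed

lemma fd_bounded_linear_comp:
 assumes "bounded_linear L" "f differentiable (at x)"
 shows "fd (%y. L (f y)) x v = L (fd f x v)"
 using fd_eq[OF bounded_linear.has_derivative[OF assms(1) fd_works[OF assms(2)]]] by simp

lemma fd_fd_commute:
 fixes f :: "'e::euclidean_space => 'f::euclidean_space"
 assumes "open S" "smooth_on S f" "x : S"
 shows "fd (%y. fd f y v) x w = fd (%y. fd f y w) x v"
proof (rule euclidean_eqI)
 fix b :: 'f assume "b : Basis"
 have bl: "bounded_linear (%z. z \<bullet> b)" by (rule bounded_linear_inner_left)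
 have s: "smooth_on S (%y. f y \<bullet> b)" by (rule so_inner_left[OF assms(1,2)])
 have *: "fd (%y. fd f y u) x u' \<bullet> b = fd (%y. fd (%y. f y \<bullet> b) y u) x u'" for u u'
 proof -
  have "fd (%y. fd f y u) x u' \<bullet> b = fd (%y. fd f y u \<bullet> b) x u'"
   by (rule fd_bounded_linear_comp[OF bl, symmetric])
     (rule so_imp_differentiable[OF so_fd[OF assms(2)] assms(3)])
  also have "fd (%y. fd f y u \<bullet> b) x = fd (%y. fd (%y. f y \<bullet> b) y u) x"
  proof (rule frechet_derivative_transform_within_open[OF _ assms(1,3)])
   show "(%y. fd f y u \<bullet> b) differentiable at x"
    by (rule so_imp_differentiable[OF so_inner_left[OF assms(1) so_fd[OF assms(2)]] assms(3)])
   show "fd f y u \<bullet> b = fd (%y. f y \<bullet> b) y u" if "y : S" for y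
    by (rule fd_bounded_linear_comp[OF bl, symmetric]) (rule so_imp_differentiable[OF assms(2) that])
  qed
  finally show ?thesis by simp
 qed
 show "fd (%y. fd f y v) x w \<bullet> b = fd (%y. fd f y w) x v \<bullet> b"
  unfolding * by (rule fd_fd_commute_real[OF assms(1) s assms(3)])
qed

text \<open>The primitive is \<open>g x = \<integral> tht (c + t (x - c)) (x - c) dt\<close> over \<open>[0, 1]\<close>.\<close>

lemma poincare_1form:
 fixes tht :: "'e::euclidean_space => 'e => real"
 assumes lin: "!!x. x : ball c r ==> linear (tht x)"
  and sm: "!!v. smooth_on (ball c r) (%x. tht x v)"
  and closed: "!!x v w. x : ball c r ==> fd (%x. tht x v) x w = fd (%x. tht x w) x v"
 shows "EX g. smooth_on (ball c r) g & (ALL x:ball c r. (g has_derivative tht x) (at x))"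
proof -
 let ?B = "ball c r"
 define p where "p x t = c + t *R (x - c)" for x and t :: real
 have pB: "p x t : ?B" if "x : ?B" "0 <= t" "t <= 1" for x t
 proof -
  have "p x t = (1 - t) *R c + t *R x" by (simp add: p_def algebra_simps)
  moreover have "c : ?B" using that(1) by (smt (verit) centre_in_ball mem_ball zero_le_dist)
  ultimately show ?thesis
   using that convexD_alt[OF convex_ball, of c c r x t] by simp
 qed
 have th: "tht x v = (SUM b:Basis. (v \<bullet> b) * tht x b)" if "x : ?B" for x v
  using basis_sum[OF lin[OF that], of v] by simp
 define f where "f x t = (SUM b:Basis. ((x - c) \<bullet> b) * tht (p x t) b)" for x t
 define f' where "f' x t v = (SUM b:Basis. (v \<bullet> b) * tht (p x t) b + ((x - c) \<bullet> b) * fd (%y. tht y b) (p x t) (t *R v))" for x t v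
 have der_th: "((%x. tht (p x t) b) has_derivative (%v. fd (%y. tht y b) (p x t) (t *R v))) (at x)"
  if "x : ?B" "0 <= t" "t <= 1" for x t b
 proof -
  have "((%x. p x t) has_derivative (%v. t *R v)) (at x)"
   unfolding p_def by (auto intro!: derivative_eq_intros)
  from has_derivative_compose[OF this so_has_derivative[OF sm pB[OF that]]]
  show ?thesis .
 qed
 have der_f: "((%x. f x t) has_derivative f' x t) (at x)" if "x : ?B" "0 <= t" "t <= 1" for x t
  unfolding f_def f'_def
  by (rule has_derivative_eq_rhs, rule has_derivative_sum, rule has_derivative_mult[OF _ der_th[OF that]])
    (auto intro!: derivative_eq_intros sum.cong simp: algebra_simps)
 define F where "F x t = Blinfun (f' x t)" for x t
 have F: "blinfun_apply (F x t) = f' x t" if "x : ?B" "0 <= t" "t <= 1" for x t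
  unfolding F_def by (rule bounded_linear_Blinfun_apply) (rule has_derivative_bounded_linear[OF der_f[OF that]])
 have cont_p: "continuous_on A (%z. p (fst z) (snd z))" for A
  unfolding p_def by (intro continuous_intros)
 have cont_comp: "continuous_on (?B \<times> cbox 0 1) (%z. h (p (fst z) (snd z)))" if "smooth_on ?B h" for h :: "'e => real"
  by (rule continuous_on_compose2[OF so_continuous[OF that] cont_p]) (auto intro: pB simp del: mem_ball)
 have fdlin: "fd (%y. tht y b) (p x t) (t *R v) = t * fd (%y. tht y b) (p x t) v"
  if "x : ?B" "0 <= t" "t <= 1" for x t b v
  using linear_scale[OF so_fd_linear[OF sm pB[OF that]]] by simp
 have contF: "continuous_on (?B \<times> cbox 0 1) (%(x, t). F x t)"
 proof (rule continuous_on_blinfun_componentwise)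
  fix i :: 'e assume "i : Basis"
  have "continuous_on (?B \<times> cbox 0 1) (%z. SUM b:Basis. (i \<bullet> b) * tht (p (fst z) (snd z)) b
    + ((fst z - c) \<bullet> b) * (snd z * fd (%y. tht y b) (p (fst z) (snd z)) i))"
   by (intro continuous_intros cont_comp[OF sm] cont_comp[OF so_fd[OF sm]])
  thus "continuous_on (?B \<times> cbox 0 1) (%x. blinfun_apply (case x of (x, t) => F x t) i)"
   by (rule continuous_on_eq) (auto simp: F f'_def fdlin simp del: mem_ball)
 qed
 have contf: "continuous_on (cbox 0 1) (f x)" if "x : ?B" for x
 proof -
  have "continuous_on (cbox 0 1) (%t. tht (p x t) b)" for b
   by (rule continuous_on_compose2[OF so_continuous[OF sm]])
     (auto intro!: pB that continuous_intros simp: p_def[abs_def] simp del: mem_ball, auto intro!: pB[unfolded p_def] that simp del: mem_ball)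
  thus ?thesis
   unfolding f_def by (intro continuous_intros)
 qed
 define g where "g x = integral (cbox 0 1) (f x)" for x
 have der_g: "(g has_derivative tht x) (at x)" if x: "x : ?B" for x
 proof -
  have "((%x. integral (cbox 0 1) (f x)) has_derivative integral (cbox 0 1) (F x)) (at x within ?B)"
  proof (rule leibniz_rule[OF _ _ contF x convex_ball])
   show "((%x. f x t) has_derivative blinfun_apply (F x t)) (at x within ball c r)"
    if "x : ball c r" "t : cbox 0 1" for x t
    using der_f[of x t] F[of x t] that by (auto intro: has_derivative_at_withinI simp del: mem_ball)
   show "f x integrable_on cbox 0 1" if "x : ball c r" for x
    by (rule integrable_continuous[OF contf[OF that]])
  qed
  hence 1: "(g has_derivative integral (cbox 0 1) (F x)) (at x)"
   unfolding g_def using at_within_open[OF x open_ball] by metis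
  have "blinfun_apply (integral (cbox 0 1) (F x)) v = tht x v" for v
  proof -
   have cF: "continuous_on (cbox 0 1) (F x)"
    using continuous_on_compose2[OF contF, of "cbox 0 1" "%t. (x, t)"] x
    by (force intro: continuous_on_Pair continuous_on_const continuous_on_id simp del: mem_ball)
   have "blinfun_apply (integral (cbox 0 1) (F x)) v = integral (cbox 0 1) (%t. blinfun_apply (F x t) v)"
    by (rule blinfun_apply_integral) (rule integrable_continuous[OF cF])
   \<comment> \<open>Closedness exchanges the direction of differentiation with the argument of the
     form. The integrand becomes the derivative of \<open>t * tht (p x t) v\<close> in
     \<open>t\<close>, and only the end point \<open>t = 1\<close> contributes.\<close>
   also have "... = integral (cbox 0 1) (%t. tht (p x t) v + t * fd (%y. tht y v) (p x t) (x - c))"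
   proof (rule integral_cong)
    fix t :: real assume "t : cbox 0 1"
    hence t: "0 <= t" "t <= 1" by auto
    have "(SUM b:Basis. ((x - c) \<bullet> b) * fd (%y. tht y b) (p x t) v)
     = (SUM b:Basis. ((x - c) \<bullet> b) * fd (%y. tht y v) (p x t) b)"
     using closed[OF pB[OF x t]] by simp
    also have "... = fd (%y. tht y v) (p x t) (x - c)"
     using basis_sum[OF so_fd_linear[OF sm[of v] pB[OF x t]], of "x - c"] by simp
    finally have "t * (SUM b:Basis. ((x - c) \<bullet> b) * fd (%y. tht y b) (p x t) v)
     = t * fd (%y. tht y v) (p x t) (x - c)" by simp
    hence "(SUM b:Basis. ((x - c) \<bullet> b) * (t * fd (%y. tht y b) (p x t) v))
     = t * fd (%y. tht y v) (p x t) (x - c)"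
     unfolding sum_distrib_left by (simp add: mult.left_commute)
    thus "blinfun_apply (F x t) v = tht (p x t) v + t * fd (%y. tht y v) (p x t) (x - c)"
     unfolding F[OF x t] f'_def fdlin[OF x t] th[OF pB[OF x t], of v] sum.distrib by simp
   qed
   also have "... = 1 * tht (p x 1) v - 0 * tht (p x 0) v"
   proof (rule integral_unique, unfold cbox_interval, rule fundamental_theorem_of_calculus[where f = "%t. t * tht (p x t) v"])
    fix t :: real assume "t : {0..1}"
    hence t: "0 <= t" "t <= 1" by auto
    have "((%t. p x t) has_derivative (%s. s *R (x - c))) (at t)"
     unfolding p_def by (auto intro!: derivative_eq_intros)
    from has_derivative_compose[OF this so_has_derivative[OF sm pB[OF x t]]]
    have "((%t. tht (p x t) v) has_derivative (%s. fd (%y. tht y v) (p x t) (s *R (x - c)))) (at t)" .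
    hence "((%t. tht (p x t) v) has_real_derivative fd (%y. tht y v) (p x t) (x - c)) (at t)"
     by (rule has_derivative_imp_has_field_derivative)
       (use linear_scale[OF so_fd_linear[OF sm pB[OF x t]]] in simp)
    hence "((%t. t * tht (p x t) v) has_real_derivative tht (p x t) v + t * fd (%y. tht y v) (p x t) (x - c)) (at t)"
     by (auto intro!: derivative_eq_intros)
    thus "((%t. t * tht (p x t) v) has_vector_derivative tht (p x t) v + t * fd (%y. tht y v) (p x t) (x - c)) (at t within {0..1})"
     using has_real_derivative_iff_has_vector_derivative has_vector_derivative_at_within by blast
   qed simp
   also have "... = tht x v" by (simp add: p_def)
   finally show ?thesis .
  qed
  hence "blinfun_apply (integral (cbox 0 1) (F x)) = tht x" by blast
  with 1 show ?thesis by simp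
 qed
 have "smooth_on ?B g"
  by (rule so_derivI[OF open_ball der_g sm])
 with der_g show ?thesis by blast
qed

section \<open>Calculus on manifolds\<close>

text \<open>A homeomorphism onto an open set, phrased by open images and preimages. In this form it
  can be checked directly for product charts and for charts of the quotient, without
  subtopologies.\<close>

definition top_chart :: "'a topology => 'a set => ('a => 'e::euclidean_space) => bool" where
 "top_chart X U ka <-> openin X U & inj_on ka U & (ALL S. open S --> openin X {q : U. ka q : S}) &
   (ALL W. openin X W & W <= U --> open (ka ` W))"

lemma top_chart_iff:
 "top_chart X U ka <->
   openin X U & open (ka ` U) & homeomorphic_map (subtopology X U) (top_of_set (ka ` U)) ka"
proof (cases "openin X U")
 case True
 hence UX: "topspace (subtopology X U) = U"
  by (simp add: openin_subset inf.absorb2)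
 show ?thesis
 proof
  assume L: "top_chart X U ka"
  have "continuous_map (subtopology X U) euclidean ka"
   unfolding continuous_map_def UX using L True
   by (auto simp: top_chart_def openin_open_subtopology)
  hence "continuous_map (subtopology X U) (top_of_set (ka ` U)) ka"
   by (auto simp: continuous_map_in_subtopology UX)
  moreover have "open_map (subtopology X U) (top_of_set (ka ` U)) ka"
   unfolding open_map_def using L True
   by (auto simp: top_chart_def openin_open_subtopology intro!: openin_open_subtopology[THEN iffD2])
  ultimately show "openin X U & open (ka ` U) & homeomorphic_map (subtopology X U) (top_of_set (ka ` U)) ka"
   using L UX by (auto simp: top_chart_def intro!: bijective_open_imp_homeomorphic_map)
 next
  assume R: "openin X U & open (ka ` U) & homeomorphic_map (subtopology X U) (top_of_set (ka ` U)) ka"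
  hence c: "continuous_map (subtopology X U) (top_of_set (ka ` U)) ka"
   and o: "open_map (subtopology X U) (top_of_set (ka ` U)) ka" and i: "inj_on ka U"
   unfolding homeomorphic_eq_everything_map UX by blast+
  have "openin X {q : U. ka q : S}" if "open S" for S
  proof -
   have "openin (subtopology X U) {q : U. ka q : ka ` U Int S}"
    using c that unfolding continuous_map_def UX by (metis openin_open_Int)
   hence "openin X {q : U. ka q : ka ` U Int S}"
    using True openin_open_subtopology by blast
   moreover have "{q : U. ka q : ka ` U Int S} = {q : U. ka q : S}" by auto
   ultimately show ?thesis by simp
  qed
  moreover have "open (ka ` W)" if "openin X W" "W <= U" for W
  proof -
   have "openin (top_of_set (ka ` U)) (ka ` W)"
    using o that True unfolding open_map_def by (simp add: openin_open_subtopology)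
   thus ?thesis
    using R openin_open_trans by blast
  qed
  ultimately show "top_chart X U ka"
   using True i by (auto simp: top_chart_def)
 qed
qed (auto simp: top_chart_def)

lemma smooth_manifold_iff:
 "mfd M <->
   Hausdorff_space (mtop M) & second_countable (mtop M) & pts M = (UN (U, ka):atlas M. U) &
   (ALL (U, ka):atlas M. top_chart (mtop M) U ka) &
   (ALL (U, ka):atlas M. ALL (V, ka'):atlas M. smooth_on (ka ` (U Int V)) (ka' o inv_into U ka))"
 unfolding smooth_manifold_def top_chart_iff ..

lemma chart_top_chart: "mfd M ==> (U, ka) : atlas M ==> top_chart (mtop M) U ka"
 unfolding smooth_manifold_iff by blast

lemma chart_openin: "mfd M ==> (U, ka) : atlas M ==> opn M U"
 using chart_top_chart unfolding top_chart_def by blast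

lemma chart_inj: "mfd M ==> (U, ka) : atlas M ==> inj_on ka U"
 using chart_top_chart unfolding top_chart_def by blast

lemma chart_inv: "mfd M ==> (U, ka) : atlas M ==> q : U ==> inv_into U ka (ka q) = q"
 using chart_inj inv_into_f_f by metis

lemma chart_img:
 "mfd M ==> (U, ka) : atlas M ==> opn M W ==> W <= U ==> open (ka ` W)"
 using chart_top_chart unfolding top_chart_def by blast

lemma chart_pre:
 "mfd M ==> (U, ka) : atlas M ==> open S ==> opn M {q : U. ka q : S}"
 using chart_top_chart unfolding top_chart_def by blast

lemma chart_transition:
 "mfd M ==> (U, ka) : atlas M ==> (V, ka') : atlas M ==>
   smooth_on (ka ` (U Int V)) (%x. ka' (inv_into U ka x))"
 unfolding smooth_manifold_iff o_def by blast

lemma chart_exists: "mfd M ==> p : pts M ==> EX U ka. (U, ka) : atlas M & p : U"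
 unfolding smooth_manifold_iff by auto

lemma chart_subset: "mfd M ==> (U, ka) : atlas M ==> U <= pts M"
 using chart_openin openin_subset by metis

subsection \<open>Germs\<close>

lemma nearbyI: "opn M W ==> p : W ==> (!!q. q : W ==> P q) ==> near M p P"
 unfolding nearby_def by blast

lemma nearbyE:
 assumes "near M p P"
 obtains W where "opn M W" "p : W" "!!q. q : W ==> P q"
 using assms unfolding nearby_def by blast

lemma near_self: "near M p P ==> P p"
 unfolding nearby_def by blast

lemma near_conj: "near M p P ==> near M p Q ==> near M p (%q. P q & Q q)"
 unfolding nearby_def using openin_Int by (metis IntE IntI)

lemma near_mono: "near M p P ==> (!!q. P q ==> Q q) ==> near M p Q"
 unfolding nearby_def by blast

lemma near_mono2: "near M p P ==> near M p Q ==> (!!q. P q ==> Q q ==> R q) ==> near M p R"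
 using near_mono[OF near_conj[of M p P Q], of R] by blast

lemma near_mono3:
 "near M p P ==> near M p Q ==> near M p R ==> (!!q. P q ==> Q q ==> R q ==> S q) ==> near M p S"
 using near_mono2[OF near_conj[of M p P Q], of R S] by blast

lemma near_nearby: "near M p P ==> near M p (%q. near M q P)"
 unfolding nearby_def by blast

lemma near_open: "opn M W ==> p : W ==> near M p (%q. q : W)"
 unfolding nearby_def by blast

lemma near_in_pts: "p : pts M ==> near M p (%q. q : pts M)"
 by (rule near_open) auto

lemma near_all: "p : pts M ==> (!!q. P q) ==> near M p P"
 by (rule nearbyI[of M "pts M"]) auto

lemma near_finite:
 "finite I ==> p : pts M ==> (!!i. i : I ==> near M p (P i)) ==> near M p (%q. ALL i:I. P i q)"
proof (induction I rule: finite_induct)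
 case empty
 thus ?case by (simp add: near_all)
next
 case (insert i I)
 hence "near M p (P i)" "near M p (%q. ALL i:I. P i q)" by simp_all
 thus ?case by (rule near_mono2) simp
qed

lemma openin_iff_nearby: "opn M W <-> (ALL p:W. near M p (%q. q : W))"
 unfolding nearby_def openin_subopen[of _ W] subset_eq ..

subsection \<open>Smoothness at a point\<close>

lemma sa_iff:
 "smooth_at M N p f <-> (EX c:atlas M. EX d:atlas N. EX W. opn M W & p : W & W <= fst c &
  f ` W <= fst d & smooth_on (snd c ` W) (%x. snd d (f (inv_into (fst c) (snd c) x))))"
 unfolding smooth_at_def o_def case_prod_beta ..

lemma smooth_atE:
 assumes "smooth_at M N p f"
 obtains U ka V ka' W where "(U, ka) : atlas M" "(V, ka') : atlas N" "opn M W" "p : W" "W <= U"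
  "f ` W <= V" "smooth_on (ka ` W) (%x. ka' (f (inv_into U ka x)))"
proof -
 obtain c d W where "c : atlas M" "d : atlas N" "opn M W" "p : W" "W <= fst c"
  "f ` W <= fst d" "smooth_on (snd c ` W) (%x. snd d (f (inv_into (fst c) (snd c) x)))"
  using assms unfolding sa_iff by (elim bexE exE conjE)
 thus ?thesis using that[of "fst c" "snd c" "fst d" "snd d" W] by simp
qed

lemma smooth_atI:
 assumes "(U, ka) : atlas M" "(V, ka') : atlas N" "opn M W" "p : W" "W <= U"
  "f ` W <= V" "smooth_on (ka ` W) (%x. ka' (f (inv_into U ka x)))"
 shows "smooth_at M N p f"
 unfolding sa_iff
 by (rule bexI[OF _ assms(1)], rule bexI[OF _ assms(2)], rule exI[of _ W]) (use assms in simp)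

lemma sa_pts: "smooth_at M N p f ==> p : pts M"
 by (erule smooth_atE) (use openin_subset in blast)

lemma sa_pts_image: "mfd N ==> smooth_at M N p f ==> f p : pts N"
 by (erule smooth_atE) (use chart_subset in blast)

lemma sa_nearby: "smooth_at M N p f ==> near M p (%q. smooth_at M N q f)"
 by (erule smooth_atE) (auto intro!: nearbyI smooth_atI)

lemma sa_continuous:
 assumes M: "mfd M" and N: "mfd N"
  and f: "smooth_at M N p f" and S: "opn N S" "f p : S"
 shows "near M p (%q. f q : S)"
proof -
 obtain U ka V ka' W where *: "(U, ka) : atlas M" "(V, ka') : atlas N" "opn M W" "p : W" "W <= U"
  "f ` W <= V" "smooth_on (ka ` W) (%x. ka' (f (inv_into U ka x)))"
  using f by (rule smooth_atE)
 let ?h = "%x. ka' (f (inv_into U ka x))"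
 have oW: "open (ka ` W)" by (rule chart_img[OF M *(1,3,5)])
 have oS: "open (ka' ` (V Int S))"
  by (rule chart_img[OF N *(2)]) (use S chart_openin[OF N *(2)] in auto)
 have "open (ka ` W Int ?h -` (ka' ` (V Int S)))"
  using continuous_open_preimage[OF so_continuous[OF *(7)] oW oS] .
 hence o: "opn M (W Int {q : U. ka q : ka ` W Int ?h -` (ka' ` (V Int S))})"
  by (intro openin_Int *(3) chart_pre[OF M *(1)])
 have inv: "inv_into U ka (ka q) = q" if "q : W" for q
  using chart_inv[OF M *(1)] *(5) that by auto
 show ?thesis
 proof (rule nearbyI[OF o])
  show "p : W Int {q : U. ka q : ka ` W Int ?h -` (ka' ` (V Int S))}"
   using * S inv[OF *(4)] by auto
 next
  fix q assume "q : W Int {q : U. ka q : ka ` W Int ?h -` (ka' ` (V Int S))}"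
  hence "q : W" "?h (ka q) : ka' ` (V Int S)" by blast+
  hence q: "q : W" "ka' (f q) : ka' ` (V Int S)" using inv by simp_all
  thus "f q : S"
   using chart_inj[OF N *(2)] *(6) by (auto simp: inj_on_def image_subset_iff)
 qed
qed

lemma near_preimage:
 "mfd M ==> mfd N ==> smooth_at M N p f ==> near N (f p) P ==> near M p (%q. P (f q))"
 by (erule nearbyE) (rule near_mono[OF sa_continuous])

text \<open>\<open>smooth_at\<close> provides some pair of charts only. The transition maps on both
  sides carry smoothness over to any prescribed pair, after shrinking the neighbourhood by
  continuity.\<close>

lemma sa_charts:
 assumes M: "mfd M" and N: "mfd N" and f: "smooth_at M N p f"
  and U: "(U, ka) : atlas M" "p : U" and V: "(V, ka') : atlas N" "f p : V"
 obtains W where "opn M W" "p : W" "W <= U" "f ` W <= V" "open (ka ` W)"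
  "smooth_on (ka ` W) (%x. ka' (f (inv_into U ka x)))"
proof -
 obtain U0 ka0 V0 ka0' W0 where *: "(U0, ka0) : atlas M" "(V0, ka0') : atlas N" "opn M W0" "p : W0" "W0 <= U0"
  "f ` W0 <= V0" "smooth_on (ka0 ` W0) (%x. ka0' (f (inv_into U0 ka0 x)))"
  using f by (rule smooth_atE)
 obtain W1 where W1: "opn M W1" "p : W1" "!!q. q : W1 ==> f q : V"
  using sa_continuous[OF M N f chart_openin[OF N V(1)] V(2)] by (auto elim: nearbyE)
 define W where "W = W0 Int W1 Int U"
 have W: "opn M W" "p : W" "W <= U" "f ` W <= V" "W <= U0" "W <= W0"
  using * W1 U chart_openin[OF M U(1)] by (auto simp: W_def)
 have oW: "open (ka ` W)" by (rule chart_img[OF M U(1) W(1,3)])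
 let ?h = "%x. ka0' (f (inv_into U0 ka0 x))" and ?ta = "%x. ka0 (inv_into U ka x)" and ?sgm = "%y. ka' (inv_into V0 ka0' y)"
 have inv: "inv_into U ka (ka q) = q" "inv_into U0 ka0 (ka0 q) = q" "inv_into V0 ka0' (ka0' (f q)) = f q" if "q : W" for q
 proof -
  have "q : U" "q : U0" "f q : V0" using that W(3,5,6) *(6) by blast+
  thus "inv_into U ka (ka q) = q" "inv_into U0 ka0 (ka0 q) = q" "inv_into V0 ka0' (ka0' (f q)) = f q"
   using chart_inv[OF M U(1)] chart_inv[OF M *(1)] chart_inv[OF N *(2)] by simp_all
 qed
 have fW: "f q : V0 Int V" if "q : W" for q using that W(4,6) *(6) by blast
 have 1: "smooth_on (ka ` W) ?ta"
  by (rule so_subset[OF chart_transition[OF M U(1) *(1)]]) (use W in auto)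
 have 2: "smooth_on (ka ` W) (%x. ?h (?ta x))"
  by (rule so_compose[OF oW 1 *(7)]) (use W inv in auto)
 have 3: "smooth_on (ka ` W) (%x. ?sgm (?h (?ta x)))"
  by (rule so_compose[OF oW 2 chart_transition[OF N *(2) V(1)]]) (use inv fW in auto)
 have "smooth_on (ka ` W) (%x. ka' (f (inv_into U ka x)))"
  by (rule so_cong[OF oW 3]) (use inv in auto)
 with W oW show ?thesis using that by blast
qed

lemma sa_cong:
 assumes M: "mfd M" and f: "smooth_at M N p f" and eq: "near M p (%q. g q = f q)"
 shows "smooth_at M N p g"
proof -
 obtain U ka V ka' W where *: "(U, ka) : atlas M" "(V, ka') : atlas N" "opn M W" "p : W" "W <= U"
  "f ` W <= V" "smooth_on (ka ` W) (%x. ka' (f (inv_into U ka x)))"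
  using f by (rule smooth_atE)
 obtain W1 where W1: "opn M W1" "p : W1" "!!q. q : W1 ==> g q = f q"
  using eq by (auto elim: nearbyE)
 have oW: "open (ka ` (W Int W1))"
  by (rule chart_img[OF M *(1)]) (use *(3,5) W1(1) in auto)
 show ?thesis
 proof (rule smooth_atI[OF *(1,2)])
  show "smooth_on (ka ` (W Int W1)) (%x. ka' (g (inv_into U ka x)))"
  proof (rule so_cong[OF oW])
   show "smooth_on (ka ` (W Int W1)) (%x. ka' (f (inv_into U ka x)))"
    by (rule so_subset[OF *(7)]) auto
  qed (use chart_inv[OF M *(1)] *(5) W1(3) in auto)
 qed (use * W1 in auto)
qed

lemma sa_compose:
 assumes M: "mfd M" and N: "mfd N" and P: "mfd P"
  and f: "smooth_at M N p f" and g: "smooth_at N P (f p) g"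
 shows "smooth_at M P p (%q. g (f q))"
proof -
 obtain U ka where U: "(U, ka) : atlas M" "p : U"
  using chart_exists[OF M sa_pts[OF f]] by blast
 obtain V ka' where V: "(V, ka') : atlas N" "f p : V"
  using chart_exists[OF N sa_pts[OF g]] by blast
 obtain Z ka'' where Z: "(Z, ka'') : atlas P" "g (f p) : Z"
  using chart_exists[OF P sa_pts_image[OF P g]] by blast
 obtain W where W: "opn M W" "p : W" "W <= U" "f ` W <= V" "open (ka ` W)"
  "smooth_on (ka ` W) (%x. ka' (f (inv_into U ka x)))"
  using sa_charts[OF M N f U V] .
 obtain Y where Y: "opn N Y" "f p : Y" "Y <= V" "g ` Y <= Z" "open (ka' ` Y)"
  "smooth_on (ka' ` Y) (%x. ka'' (g (inv_into V ka' x)))"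
  using sa_charts[OF N P g V Z] .
 obtain W1 where W1: "opn M W1" "p : W1" "!!q. q : W1 ==> f q : Y"
  using sa_continuous[OF M N f Y(1,2)] by (auto elim: nearbyE)
 have oW: "open (ka ` (W Int W1))"
  by (rule chart_img[OF M U(1)]) (use W W1(1) in auto)
 have inv: "inv_into U ka (ka q) = q" if "q : W" for q
  using chart_inv[OF M U(1)] W(3) that by auto
 have inv': "inv_into V ka' (ka' y) = y" if "y : Y" for y
  using chart_inv[OF N V(1)] Y(3) that by auto
 show ?thesis
 proof (rule smooth_atI[OF U(1) Z(1)])
  show "smooth_on (ka ` (W Int W1)) (%x. ka'' (g (f (inv_into U ka x))))"
  proof (rule so_cong[OF oW])
   show "smooth_on (ka ` (W Int W1)) (%x. ka'' (g (inv_into V ka' (ka' (f (inv_into U ka x))))))"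
    by (rule so_compose[OF oW so_subset[OF W(6)] Y(6)]) (use W1(3) inv in auto)
  qed (use inv inv' W1(3) in auto)
 qed (use W W1 Y in auto)
qed

lemma sa_id: "mfd M ==> p : pts M ==> smooth_at M M p (%q. q)"
proof -
 assume M: "mfd M" and p: "p : pts M"
 obtain U ka where U: "(U, ka) : atlas M" "p : U" using chart_exists[OF M p] by blast
 show ?thesis
  by (rule smooth_atI[OF U(1) U(1) chart_openin[OF M U(1)] U(2)])
    (use chart_transition[OF M U(1) U(1)] in auto)
qed

lemma sa_const:
 assumes M: "mfd M" and N: "mfd N" and "p : pts M" "c : pts N"
 shows "smooth_at M N p (%q. c)"
proof -
 obtain U ka where U: "(U, ka) : atlas M" "p : U" using chart_exists[OF M assms(3)] by blast
 obtain V ka' where V: "(V, ka') : atlas N" "c : V" using chart_exists[OF N assms(4)] by blast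
 show ?thesis
  by (rule smooth_atI[OF U(1) V(1) chart_openin[OF M U(1)] U(2)]) (use V in auto)
qed

lemma smooth_map_continuous:
 assumes M: "mfd M" and N: "mfd N" and f: "smooth_map M N f"
 shows "continuous_map (mtop M) (mtop N) f"
 unfolding continuous_map_def
proof (intro conjI allI impI)
 show "f : pts M \<rightarrow> pts N"
  using f sa_pts_image[OF N, of M _ f] by (auto simp: smooth_map_def)
 fix S assume S: "opn N S"
 show "opn M {x : pts M. f x : S}"
  unfolding openin_iff_nearby
 proof
  fix p assume p: "p : {x : pts M. f x : S}"
  hence "near M p (%q. f q : S)"
   using sa_continuous[OF M N _ S] f by (auto simp: smooth_map_def)
  from near_mono2[OF this near_in_pts] p show "near M p (%q. q : {x : pts M. f x : S})" by auto
 qed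
qed

subsection \<open>Euclidean spaces as manifolds\<close>

lemma euclid_simps [simp]: "pts (eucl :: ('e::euclidean_space, 'e) manifold) = UNIV"
  "mtop (eucl :: ('e, 'e) manifold) = euclidean" "atlas (eucl :: ('e, 'e) manifold) = {(UNIV, id)}"
 by (simp_all add: euclid_mfd_def)

lemma second_countable_euclid: "second_countable (euclidean :: 'e::euclidean_space topology)"
proof -
 obtain B :: "'e set set" where B: "countable B" "topological_basis B"
  using ex_countable_basis by blast
 show ?thesis
  unfolding second_countable_def
  by (rule exI[of _ B]) (use B in "auto simp: topological_basis_open intro: topological_basisE[OF B(2)]")
qed

lemma euclid_m: "mfd (eucl :: ('e::euclidean_space, 'e) manifold)"
 unfolding smooth_manifold_iff
 by (auto simp: second_countable_euclid top_chart_def so_id inv_id id_def[symmetric]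
   intro: so_cong[OF open_UNIV so_id[OF open_UNIV]])

lemma sa_euclid_iff:
 fixes f :: "'e::euclidean_space => 'f::euclidean_space"
 shows "smf eucl x f <-> (EX S. open S & x : S & smooth_on S f)"
 by (simp add: smooth_at_def o_def)

lemma so_imp_smooth_at: "open S ==> smooth_on S f ==> x : S ==> smf eucl x f"
 unfolding sa_euclid_iff by blast

subsection \<open>The preferred charts\<close>

definition cdom :: "('a, 'e) manifold => 'a => 'a set" where
 "cdom M p = fst (chart_at M p)"

abbreviation cimg :: "('a, 'e) manifold => 'a => 'e set" where
 "cimg M p == crd M p ` cdom M p"

lemma crd_inv_eq: "cinv M p = inv_into (cdom M p) (crd M p)"
 by (simp add: crd_inv_def cdom_def)

context
 fixes M :: "('a, 'e::euclidean_space) manifold" and p :: 'a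
 assumes M: "mfd M" and p: "p : pts M"
begin

lemma chart_at_atlas: "(cdom M p, crd M p) : atlas M" and mem_cdom: "p : cdom M p"
proof -
 have "EX c. c : atlas M & p : fst c"
  using chart_exists[OF M p] by force
 hence "chart_at M p : atlas M & p : fst (chart_at M p)"
  unfolding chart_at_def by (rule someI_ex)
 thus "(cdom M p, crd M p) : atlas M" "p : cdom M p"
  by (auto simp: cdom_def crd_def)
qed

lemma openin_cdom: "opn M (cdom M p)"
 by (rule chart_openin[OF M chart_at_atlas])

lemma cdom_subset: "cdom M p <= pts M"
 by (rule chart_subset[OF M chart_at_atlas])

lemma open_cimg: "open (cimg M p)"
 by (rule chart_img[OF M chart_at_atlas openin_cdom]) auto

lemma crd_inv_crd: "q : cdom M p ==> cinv M p (crd M p q) = q"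
 unfolding crd_inv_eq by (rule chart_inv[OF M chart_at_atlas])

lemma crd_crd_inv: "x : cimg M p ==> crd M p (cinv M p x) = x"
 using crd_inv_crd by auto

lemma crd_inv_cdom: "x : cimg M p ==> cinv M p x : cdom M p"
 using crd_inv_crd by auto

lemma near_cdom: "near M p (%q. q : cdom M p)"
 by (rule near_open[OF openin_cdom mem_cdom])

lemma crd_smooth: "q : cdom M p ==> smf M q (crd M p)"
 by (rule smooth_atI[OF chart_at_atlas _ openin_cdom, of UNIV id])
   (use so_cong[OF open_cimg so_id[OF open_cimg]] crd_crd_inv in "auto simp: crd_inv_eq")

lemma crd_inv_smooth: "x : cimg M p ==> smooth_at eucl M x (cinv M p)"
 by (rule smooth_atI[OF _ chart_at_atlas, of UNIV id _ "cimg M p"])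
   (use so_cong[OF open_cimg so_id[OF open_cimg]] crd_crd_inv crd_inv_cdom open_cimg in "auto simp: inv_id")

end

lemma crd_euclid [simp]: "crd eucl p = (%x. x)" and cdom_euclid [simp]: "cdom eucl p = UNIV"
 and crd_inv_euclid [simp]: "cinv eucl p = (%x. x)"
proof -
 have "(cdom eucl p, crd eucl p) : atlas eucl"
  by (rule chart_at_atlas[OF euclid_m]) simp
 hence "crd eucl p = id" "cdom eucl p = UNIV" by auto
 thus "crd eucl p = (%x. x)" "cdom eucl p = UNIV" "cinv eucl p = (%x. x)"
  by (auto simp: crd_inv_eq id_def inv_id[unfolded id_def])
qed

lemma openin_crd_preimage:
 "mfd M ==> p : pts M ==> open S ==> opn M {q : cdom M p. crd M p q : S}"
 by (rule chart_pre[OF _ chart_at_atlas])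

lemma near_crd:
 assumes "mfd M" "p : pts M" "q : cdom M p" "open S" "crd M p q : S"
 shows "near M q (%r. r : cdom M p & crd M p r : S)"
 using near_open[OF openin_crd_preimage[OF assms(1,2,4)], of q] assms by simp

text \<open>Moves a germ to a coordinate ball, where convexity and connectedness are available: for
  primitives, for functions with zero derivative, for straight paths.\<close>

lemma near_cball:
 assumes M: "mfd M" and p: "p : pts M" and P: "near M p P"
 obtains r where "r > 0" "ball (crd M p p) r <= cimg M p" "ALL x:ball (crd M p p) r. P (cinv M p x)"
proof -
 obtain W where W: "opn M W" "p : W" "!!q. q : W ==> P q" using P by (auto elim: nearbyE)
 have "open (crd M p ` (W Int cdom M p))"
  by (rule chart_img[OF M chart_at_atlas[OF M p]]) (use W openin_cdom[OF M p] in auto)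
 moreover have "crd M p p : crd M p ` (W Int cdom M p)" using W mem_cdom[OF M p] by auto
 ultimately obtain r where r: "r > 0" "ball (crd M p p) r <= crd M p ` (W Int cdom M p)"
  using open_contains_ball by meson
 show ?thesis
 proof (rule that[OF r(1)])
  show "ball (crd M p p) r <= cimg M p" using r(2) by auto
  show "ALL x:ball (crd M p p) r. P (cinv M p x)"
   using r(2) W(3) crd_inv_crd[OF M p] by (auto simp del: mem_ball)
 qed
qed

lemma near_ball:
 assumes M: "mfd M" and p: "p : pts M" and r: "r > 0"
 shows "near M p (%q. q : cdom M p & crd M p q : ball (crd M p p) r)"
 by (rule near_crd[OF M p mem_cdom[OF M p]]) (use r in auto)

subsection \<open>The tangent map\<close>

lemma sa_has_derivative:
 assumes M: "mfd M" and N: "mfd N" and f: "smooth_at M N p f"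
 shows "((%x. crd N (f p) (f (cinv M p x))) has_derivative tmap M N f p) (at (crd M p p))"
proof -
 note p = sa_pts[OF f] and fp = sa_pts_image[OF N f]
 obtain W where W: "opn M W" "p : W" "W <= cdom M p" "f ` W <= cdom N (f p)" "open (crd M p ` W)"
  "smooth_on (crd M p ` W) (%x. crd N (f p) (f (inv_into (cdom M p) (crd M p) x)))"
  using sa_charts[OF M N f chart_at_atlas[OF M p] mem_cdom[OF M p] chart_at_atlas[OF N fp] mem_cdom[OF N fp]] .
 have x: "crd M p p : crd M p ` W" using W(2) by (rule imageI)
 show ?thesis
  unfolding tmap_def o_def crd_inv_eq by (rule so_has_derivative[OF W(6) x])
qed

lemma tmap_eqI:
 "((%x. crd N (f p) (f (cinv M p x))) has_derivative L) (at (crd M p p)) ==> tmap M N f p = L"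
 unfolding tmap_def o_def by (rule fd_eq)

lemma tmap_linear: "mfd M ==> mfd N ==> smooth_at M N p f ==> linear (tmap M N f p)"
 by (rule has_derivative_linear[OF sa_has_derivative])

lemma eventually_crd_inv:
 assumes M: "mfd M" and p: "p : pts M" and P: "near M p P"
 shows "\<forall>\<^sub>F x in nhds (crd M p p). P (cinv M p x)"
proof -
 obtain r where "r > 0" "ball (crd M p p) r <= cimg M p" "ALL x:ball (crd M p p) r. P (cinv M p x)"
  using near_cball[OF M p P] .
 thus ?thesis
  unfolding eventually_nhds by (intro exI[of _ "ball (crd M p p) r"]) auto
qed

lemma tmap_cong:
 assumes M: "mfd M" and N: "mfd N" and f: "smooth_at M N p f"
  and eq: "near M p (%q. g q = f q)"
 shows "tmap M N g p = tmap M N f p"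
proof (rule tmap_eqI)
 have "\<forall>\<^sub>F x in nhds (crd M p p). g (cinv M p x) = f (cinv M p x)"
  by (rule eventually_crd_inv[OF M sa_pts[OF f] eq])
 hence ev: "\<forall>\<^sub>F x in at (crd M p p). crd N (f p) (f (cinv M p x)) = crd N (f p) (g (cinv M p x))"
  unfolding at_within_def eventually_inf_principal by eventually_elim simp
 have e: "g p = f p" using near_self[OF eq] .
 show "((%x. crd N (g p) (g (cinv M p x))) has_derivative tmap M N f p) (at (crd M p p))"
  unfolding e
  by (rule has_derivative_transform_eventually[OF sa_has_derivative[OF M N f] ev])
    (use crd_inv_crd[OF M sa_pts[OF f] mem_cdom[OF M sa_pts[OF f]]] e in auto)
qed

lemma tmap_compose:
 assumes M: "mfd M" and N: "mfd N" and P: "mfd P"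
  and f: "smooth_at M N p f" and g: "smooth_at N P (f p) g"
 shows "tmap M P (%q. g (f q)) p = (%v. tmap N P g (f p) (tmap M N f p v))"
proof (rule tmap_eqI)
 note p = sa_pts[OF f] and fp = sa_pts[OF g]
 have ip: "cinv M p (crd M p p) = p" by (rule crd_inv_crd[OF M p mem_cdom[OF M p]])
 have 1: "((%x. crd P (g (f p)) (g (cinv N (f p) (crd N (f p) (f (cinv M p x)))))) has_derivative
   (%v. tmap N P g (f p) (tmap M N f p v))) (at (crd M p p))"
  by (rule has_derivative_compose[OF sa_has_derivative[OF M N f]])
    (use sa_has_derivative[OF N P g] ip in simp)
 have "near M p (%q. f q : cdom N (f p))"
  by (rule sa_continuous[OF M N f openin_cdom[OF N fp] mem_cdom[OF N fp]])
 from eventually_crd_inv[OF M p this]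
 have ev: "\<forall>\<^sub>F x in at (crd M p p). crd P (g (f p)) (g (cinv N (f p) (crd N (f p) (f (cinv M p x)))))
   = crd P (g (f p)) (g (f (cinv M p x)))"
  unfolding at_within_def eventually_inf_principal by eventually_elim (simp add: crd_inv_crd[OF N fp])
 show "((%x. crd P (g (f p)) (g (f (cinv M p x)))) has_derivative
   (%v. tmap N P g (f p) (tmap M N f p v))) (at (crd M p p))"
  by (rule has_derivative_transform_eventually[OF 1 ev]) (simp_all add: ip crd_inv_crd[OF N fp mem_cdom[OF N fp]])
qed

lemma tmap_id: "mfd M ==> p : pts M ==> tmap M M (%q. q) p = (%v. v)"
proof (rule tmap_eqI)
 assume M: "mfd M" and p: "p : pts M"
 show "((%x. crd M p (cinv M p x)) has_derivative (%v. v)) (at (crd M p p))"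
  by (rule hd_within[OF has_derivative_ident open_cimg[OF M p]])
    (use mem_cdom[OF M p] crd_crd_inv[OF M p] in auto)
qed

lemma tmap_const [simp]: "tmap M N (%q. c) p = (%v. 0)"
 by (rule tmap_eqI) simp

lemma tmap_euclid [simp]: "dmf eucl f x = fd f x"
 by (simp add: tmap_def o_def)

lemma tmap_real: "dmf M f p = fd (%x. f (cinv M p x)) (crd M p p)"
 by (simp add: tmap_def o_def)

lemma tmap_crd_self: "mfd M ==> p : pts M ==> dmf M (crd M p) p = (%v. v)"
 using tmap_id[of M p] by (simp add: tmap_def o_def)

context
 fixes M :: "('a, 'e::euclidean_space) manifold" and p :: 'a
 assumes M: "mfd M" and p: "p : pts M"
begin

text \<open>Identifies \<open>cvf M p\<close> at \<open>q\<close> with the differential of the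
  inverse chart. By the chain rule it is therefore inverse to the differential of
  \<open>crd M p\<close>, which is the content of the next two lemmas.\<close>

lemma coord_vf_eq_tmap:
 assumes "q : cdom M p"
 shows "cvf M p v q = tmap eucl M (cinv M p) (crd M p q) v"
 using crd_inv_crd[OF M p assms] by (simp add: coord_vf_def tmap_def o_def)

lemma tmap_crd_coord_vf:
 assumes q: "q : cdom M p"
 shows "dmf M (crd M p) q (cvf M p v q) = v"
proof -
 have x: "crd M p q : cimg M p" using q by auto
 have i: "cinv M p (crd M p q) = q" by (rule crd_inv_crd[OF M p q])
 have "dmf eucl (%x. crd M p (cinv M p x)) (crd M p q) v
   = dmf M (crd M p) q (cvf M p v q)"
  using tmap_compose[OF euclid_m M euclid_m crd_inv_smooth[OF M p x], of "crd M p"]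
  by (simp add: i crd_smooth[OF M p q] coord_vf_eq_tmap[OF q])
 moreover have "dmf eucl (%x. crd M p (cinv M p x)) (crd M p q)
   = dmf eucl (%x. x) (crd M p q)"
  by (rule tmap_cong[OF euclid_m euclid_m])
    (use crd_crd_inv[OF M p] open_cimg[OF M p] x in \<open>auto intro!: nearbyI[of _ "cimg M p"] sa_id euclid_m\<close>)
 ultimately show ?thesis by simp
qed

lemma coord_vf_tmap_crd:
 assumes q: "q : cdom M p"
 shows "cvf M p (dmf M (crd M p) q v) q = v"
proof -
 have x: "crd M p q : cimg M p" using q by auto
 have qp: "q : pts M" using q cdom_subset[OF M p] by auto
 have "tmap M M (%r. cinv M p (crd M p r)) q v = cvf M p (dmf M (crd M p) q v) q"
  using tmap_compose[OF M euclid_m M crd_smooth[OF M p q] crd_inv_smooth[OF M p x]]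
  by (simp add: coord_vf_eq_tmap[OF q])
 moreover have "tmap M M (%r. cinv M p (crd M p r)) q = tmap M M (%r. r) q"
  by (rule tmap_cong[OF M M sa_id[OF M qp]])
    (use crd_inv_crd[OF M p] openin_cdom[OF M p] q in \<open>auto intro!: nearbyI[of _ "cdom M p"]\<close>)
 ultimately show ?thesis using tmap_id[OF M qp] by simp
qed

lemma coord_vf_self: "cvf M p v p = v"
 using coord_vf_tmap_crd[OF mem_cdom[OF M p], of v] tmap_crd_self[OF M p] by simp

lemma coord_vf_linear: "q : cdom M p ==> linear (%v. cvf M p v q)"
 using tmap_linear[OF euclid_m M crd_inv_smooth[OF M p, of "crd M p q"]]
 by (simp add: coord_vf_eq_tmap linear_iff)

lemma smooth_vf_at_coord: "smooth_vf_at M p (cvf M p v)"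
 unfolding smooth_vf_at_def
proof (rule sa_cong[OF M])
 show "smf M p (%q. v)"
  by (rule sa_const[OF M euclid_m p]) simp
 show "near M p (%q. dmf M (crd M p) q (cvf M p v q) = v)"
  by (rule near_mono[OF near_cdom[OF M p]]) (rule tmap_crd_coord_vf)
qed

lemma tmap_coord_vf:
 assumes q: "q : cdom M p" and f: "smf M q f"
 shows "dmf M f q (cvf M p v q) = fd (%x. f (cinv M p x)) (crd M p q) v"
proof -
 have x: "crd M p q : cimg M p" using q by auto
 have i: "cinv M p (crd M p q) = q" by (rule crd_inv_crd[OF M p q])
 show ?thesis
  using tmap_compose[OF euclid_m M euclid_m crd_inv_smooth[OF M p x], of f] f
  by (simp add: i coord_vf_eq_tmap[OF q])
qed

end

subsection \<open>Real-valued functions\<close>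

lemma sa_crd_inv_iff:
 assumes M: "mfd M" and p: "p : pts M" and q: "q : cdom M p"
 shows "smf M q f <-> smf eucl (crd M p q) (%x. f (cinv M p x))"
proof -
 have x: "crd M p q : cimg M p" using q by auto
 have i: "cinv M p (crd M p q) = q" by (rule crd_inv_crd[OF M p q])
 show ?thesis
 proof
  assume "smf M q f"
  thus "smf eucl (crd M p q) (%x. f (cinv M p x))"
   using sa_compose[OF euclid_m M euclid_m crd_inv_smooth[OF M p x], of f] i by simp
 next
  assume "smf eucl (crd M p q) (%x. f (cinv M p x))"
  hence "smf M q (%r. f (cinv M p (crd M p r)))"
   by (rule sa_compose[OF M euclid_m euclid_m crd_smooth[OF M p q]])
  thus "smf M q f"
   by (rule sa_cong[OF M])
     (use crd_inv_crd[OF M p] openin_cdom[OF M p] q in \<open>auto intro!: nearbyI[of _ "cdom M p"]\<close>)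
 qed
qed

lemma sa_coord:
 assumes M: "mfd M" and f: "smf M p f"
 obtains r where "r > 0" "ball (crd M p p) r <= cimg M p" "smooth_on (ball (crd M p p) r) (%x. f (cinv M p x))"
proof -
 note p = sa_pts[OF f]
 obtain S where S: "open S" "crd M p p : S" "smooth_on S (%x. f (cinv M p x))"
  using f sa_crd_inv_iff[OF M p mem_cdom[OF M p]] sa_euclid_iff by blast
 then obtain r where r: "r > 0" "ball (crd M p p) r <= S Int cimg M p"
  using open_contains_ball[of "S Int cimg M p"] open_cimg[OF M p] mem_cdom[OF M p] by blast
 thus ?thesis using that so_subset[OF S(3)] by blast
qed

lemma sa_op2:
 fixes M :: "('a, 'e::euclidean_space) manifold"
 assumes M: "mfd M" and f: "smf M p f" and g: "smf M p g"
  and op: "!!(S :: 'e set) u v. open S ==> smooth_on S u ==> smooth_on S v ==> smooth_on S (%x. F (u x) (v x))"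
 shows "smf M p (%q. F (f q) (g q))"
proof -
 note p = sa_pts[OF f]
 have F: "smf eucl (crd M p p) (%x. F (f (cinv M p x)) (g (cinv M p x)))"
 proof -
  obtain S where S: "open S" "crd M p p : S" "smooth_on S (%x. f (cinv M p x))"
   using f sa_crd_inv_iff[OF M p mem_cdom[OF M p]] sa_euclid_iff by blast
  obtain T where T: "open T" "crd M p p : T" "smooth_on T (%x. g (cinv M p x))"
   using g sa_crd_inv_iff[OF M p mem_cdom[OF M p]] sa_euclid_iff by blast
  have "smooth_on (S Int T) (%x. F (f (cinv M p x)) (g (cinv M p x)))"
   by (rule op[OF open_Int[OF S(1) T(1)] so_subset[OF S(3)] so_subset[OF T(3)]]) auto
  with S T show ?thesis unfolding sa_euclid_iff by blast
 qed
 thus ?thesis using sa_crd_inv_iff[OF M p mem_cdom[OF M p]] by blast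
qed

lemma sa_add:
 "mfd M ==> smf M p f ==> smf M p g ==> smf M p (%q. f q + g q)"
 by (rule sa_op2[where F = "(+)"]) (auto intro: so_add)

lemma sa_mult:
 fixes f g :: "_ => real"
 shows "mfd M ==> smf M p f ==> smf M p g ==> smf M p (%q. f q * g q)"
 by (rule sa_op2[where F = "(*)"]) (auto intro: so_mult)

lemma sa_bounded_linear:
 "mfd M ==> bounded_linear L ==> smf M p f ==> smf M p (%q. L (f q))"
 by (rule sa_op2[where F = "%x y. L x"]) (auto intro: so_bounded_linear)

lemma sa_sum:
 assumes M: "mfd M" and p: "p : pts M" and "!!i. i : I ==> smf M p (f i)"
 shows "smf M p (%q. SUM i:I. f i q)"
 using assms(3)
 by (induction I rule: infinite_finite_induct)
   (auto intro: sa_add[OF M] sa_const[OF M euclid_m p])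

lemma sa_real_compose:
 "mfd M ==> smf M p f ==> open S ==> f p : S ==> smooth_on S F ==> smf M p (%q. F (f q))"
 by (rule sa_compose[OF _ euclid_m euclid_m _ so_imp_smooth_at])

lemma sa_inverse:
 fixes f :: "_ => real"
 assumes "mfd M" "smf M p f" "f p ~= 0"
 shows "smf M p (%q. inverse (f q))"
 by (rule sa_real_compose[OF assms(1,2), of "- {0}"])
   (use assms(3) in "auto intro!: so_inverse so_id")

lemma sa_divide:
 fixes f g :: "_ => real"
 shows "mfd M ==> smf M p f ==> smf M p g ==> g p ~= 0 ==> smf M p (%q. f q / g q)"
 unfolding divide_inverse by (intro sa_mult sa_inverse)

lemma sa_exp:
 fixes f :: "_ => real"
 shows "mfd M ==> smf M p f ==> smf M p (%q. exp (f q))"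
 by (rule sa_real_compose[where S = UNIV]) (auto intro!: so_exp so_id)

lemma has_derivative_real:
 "mfd M ==> smf M p f ==>
  ((%x. f (cinv M p x)) has_derivative dmf M f p) (at (crd M p p))"
 using sa_has_derivative[OF _ euclid_m, of M p f] by simp

lemma crd_inv_crd_self: "mfd M ==> p : pts M ==> cinv M p (crd M p p) = p"
 using crd_inv_crd mem_cdom by metis

lemma tmap_mult:
 fixes f g :: "_ => real"
 assumes "mfd M" "smf M p f" "smf M p g"
 shows "dmf M (%q. f q * g q) p v = f p * dmf M g p v + dmf M f p v * g p"
 using fd_eq[OF has_derivative_mult[OF has_derivative_real[OF assms(1,2)] has_derivative_real[OF assms(1,3)]]]
 by (simp add: tmap_real crd_inv_crd_self[OF assms(1) sa_pts[OF assms(2)]])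

lemma tmap_add:
 assumes "mfd M" "smf M p f" "smf M p g"
 shows "dmf M (%q. f q + g q) p v = dmf M f p v + dmf M g p v"
 using fd_eq[OF has_derivative_add[OF has_derivative_real[OF assms(1,2)] has_derivative_real[OF assms(1,3)]]]
 by (simp add: tmap_real)

lemma tmap_cmult:
 fixes f :: "_ => real"
 assumes "mfd M" "smf M p f"
 shows "dmf M (%q. c * f q) p v = c * dmf M f p v"
 using tmap_mult[OF assms(1) sa_const[OF assms(1) euclid_m sa_pts[OF assms(2)]] assms(2), of c v]
 by simp

text \<open>In coordinates this is the vanishing derivative on a ball, which is convex. The constant
  ratios of flat sections and of flat morphisms all originate here.\<close>

lemma tmap_zero_imp_const:
 fixes f :: "_ => 'f::euclidean_space"
 assumes M: "mfd M" and p: "p : pts M"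
  and f: "near M p (%q. smf M q f & (ALL v. dmf M f q v = 0))"
 shows "near M p (%q. f q = f p)"
proof -
 obtain r where r: "r > 0" "ball (crd M p p) r <= cimg M p"
  "ALL x:ball (crd M p p) r. smf M (cinv M p x) f & (ALL v. dmf M f (cinv M p x) v = 0)"
  using near_cball[OF M p f] .
 let ?B = "ball (crd M p p) r"
 have "EX c. ALL x:?B. f (cinv M p x) = c"
 proof (rule has_derivative_zero_constant[OF convex_ball])
  fix x assume x: "x : ?B"
  hence x': "x : cimg M p" using r(2) by blast
  have sm: "smf M (cinv M p x) f" using r(3) x by blast
  hence s: "smf eucl x (%x. f (cinv M p x))"
   using sa_crd_inv_iff[OF M p crd_inv_cdom[OF M p x']] crd_crd_inv[OF M p x'] by metis
  have "fd (%x. f (cinv M p x)) x v = 0" for v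
   using tmap_coord_vf[OF M p crd_inv_cdom[OF M p x'] sm, of v] r(3) x crd_crd_inv[OF M p x'] by simp
  hence "fd (%x. f (cinv M p x)) x = (%v. 0)" by blast
  moreover have "((%x. f (cinv M p x)) has_derivative fd (%x. f (cinv M p x)) x) (at x)"
   using s sa_euclid_iff so_has_derivative by blast
  ultimately show "((%x. f (cinv M p x)) has_derivative (%h. 0)) (at x within ?B)"
   by (simp add: has_derivative_at_withinI)
 qed
 then obtain c where c: "!!x. x : ?B ==> f (cinv M p x) = c" by blast
 have fp: "f p = c" using c[of "crd M p p"] r(1) crd_inv_crd_self[OF M p] by simp
 show ?thesis
 proof (rule near_mono[OF near_ball[OF M p r(1)]])
  fix q assume "q : cdom M p & crd M p q : ?B"
  thus "f q = f p" using c[of "crd M p q"] crd_inv_crd[OF M p, of q] fp by simp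
 qed
qed

subsection \<open>Products\<close>

lemma prod_mfd_simps [simp]:
 "mtop (prod_mfd M N) = prod_topology (mtop M) (mtop N)"
 "atlas (prod_mfd M N) = {(U \<times> V, map_prod ka ka') | U ka V ka'. (U, ka) : atlas M & (V, ka') : atlas N}"
 by (simp_all add: prod_mfd_def)

lemma second_countable_prod:
 assumes "second_countable X" "second_countable Y"
 shows "second_countable (prod_topology X Y)"
proof -
 obtain B where B: "countable B" "!!V. V : B ==> openin X V" "!!U x. openin X U ==> x : U ==> EX V:B. x : V & V <= U"
  using assms(1) unfolding second_countable_def by metis
 obtain C where C: "countable C" "!!V. V : C ==> openin Y V" "!!U x. openin Y U ==> x : U ==> EX V:C. x : V & V <= U"
  using assms(2) unfolding second_countable_def by metis
 show ?thesis
  unfolding second_countable_def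
 proof (intro exI[of _ "(%(U, V). U \<times> V) ` (B \<times> C)"] conjI allI impI ballI)
  show "countable ((%(U, V). U \<times> V) ` (B \<times> C))" using B(1) C(1) by blast
  show "openin (prod_topology X Y) V" if "V : (%(U, V). U \<times> V) ` (B \<times> C)" for V
   using that B(2) C(2) by (auto simp: openin_prod_Times_iff)
  fix W z assume W: "openin (prod_topology X Y) W & z : W"
  obtain x y where z: "z = (x, y)" by force
  then obtain U V where UV: "openin X U" "openin Y V" "x : U" "y : V" "U \<times> V <= W"
   using W unfolding openin_prod_topology_alt by blast
  obtain U' where U': "U' : B" "x : U'" "U' <= U" using B(3)[OF UV(1,3)] by blast
  obtain V' where V': "V' : C" "y : V'" "V' <= V" using C(3)[OF UV(2,4)] by blast
  show "EX V:(%(U, V). U \<times> V) ` (B \<times> C). z : V & V <= W"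
   by (rule bexI[of _ "U' \<times> V'"]) (use U' V' UV z in auto)
 qed
qed

lemma inv_into_map_prod:
 assumes "inj_on ka U" "inj_on ka' V" "x : ka ` U" "y : ka' ` V"
 shows "inv_into (U \<times> V) (map_prod ka ka') (x, y) = (inv_into U ka x, inv_into V ka' y)"
 using assms by (intro inv_into_f_eq) (auto intro: map_prod_inj_on inv_into_into f_inv_into_f)

lemma top_chart_prod:
 assumes "top_chart X U ka" "top_chart Y V ka'"
 shows "top_chart (prod_topology X Y) (U \<times> V) (map_prod ka ka')"
 unfolding top_chart_def
proof (intro conjI allI impI)
 show "openin (prod_topology X Y) (U \<times> V)"
  using assms by (simp add: top_chart_def openin_prod_Times_iff)
 show "inj_on (map_prod ka ka') (U \<times> V)"
  using assms by (intro map_prod_inj_on) (auto simp: top_chart_def)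
 show "openin (prod_topology X Y) {q : U \<times> V. map_prod ka ka' q : S}" if oS: "open S" for S
  unfolding openin_prod_topology_alt
 proof (intro allI impI)
  fix x y assume "(x, y) : {q : U \<times> V. map_prod ka ka' q : S}"
  hence xy: "x : U" "y : V" "(ka x, ka' y) : S" by auto
  obtain S1 S2 where S: "open S1" "open S2" "(ka x, ka' y) : S1 \<times> S2" "S1 \<times> S2 <= S"
   using open_prod_elim[OF oS xy(3)] .
  have "openin X {q : U. ka q : S1} & openin Y {q : V. ka' q : S2} & x : {q : U. ka q : S1} &
   y : {q : V. ka' q : S2} & {q : U. ka q : S1} \<times> {q : V. ka' q : S2} <= {q : U \<times> V. map_prod ka ka' q : S}"
   using assms S xy by (auto simp: top_chart_def)
  thus "EX Ua Va. openin X Ua & openin Y Va & x : Ua & y : Va & Ua \<times> Va <= {q : U \<times> V. map_prod ka ka' q : S}"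
   by blast
 qed
 show "open (map_prod ka ka' ` W)" if W: "openin (prod_topology X Y) W & W <= U \<times> V" for W
 proof (rule Topological_Spaces.openI)
  fix z assume "z : map_prod ka ka' ` W"
  then obtain x y where xy: "(x, y) : W" "z = (ka x, ka' y)" by force
  then obtain U' V' where *: "openin X U'" "openin Y V'" "x : U'" "y : V'" "U' \<times> V' <= W"
   using W unfolding openin_prod_topology_alt by blast
  hence "U' <= U" "V' <= V" using W by auto
  hence "open (ka ` U')" "open (ka' ` V')" using assms * by (auto simp: top_chart_def)
  hence "open (ka ` U' \<times> ka' ` V')" by (rule open_Times)
  moreover have "z : ka ` U' \<times> ka' ` V'" using * xy by auto
  moreover have "ka ` U' \<times> ka' ` V' <= map_prod ka ka' ` W"
  proof -
   have "ka ` U' \<times> ka' ` V' = map_prod ka ka' ` (U' \<times> V')" by auto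
   thus ?thesis using *(5) by (simp add: image_mono)
  qed
  ultimately show "EX T. open T & z : T & T <= map_prod ka ka' ` W" by blast
 qed
qed

lemma prod_m:
 assumes M: "mfd M" and N: "mfd N"
 shows "mfd (prod_mfd M N)"
 unfolding smooth_manifold_iff
proof (intro conjI)
 show "Hausdorff_space (mtop (prod_mfd M N))" "second_countable (mtop (prod_mfd M N))"
  using M N by (auto simp: smooth_manifold_iff Hausdorff_space_prod_topology second_countable_prod)
 show "pts (prod_mfd M N) = (UN (U, ka):atlas (prod_mfd M N). U)"
  using M N by (auto simp: smooth_manifold_iff; blast)
 show "ALL (U, ka):atlas (prod_mfd M N). top_chart (mtop (prod_mfd M N)) U ka"
  using chart_top_chart[OF M] chart_top_chart[OF N] by (auto intro: top_chart_prod)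
 have "smooth_on (map_prod ka et ` (U \<times> V Int U' \<times> V')) (map_prod ka' et' o inv_into (U \<times> V) (map_prod ka et))"
  if c: "(U, ka) : atlas M" "(V, et) : atlas N" "(U', ka') : atlas M" "(V', et') : atlas N" for U ka V et U' ka' V' et'
 proof -
  let ?O = "ka ` (U Int U')" and ?Q = "et ` (V Int V')"
  have im: "map_prod ka et ` (U \<times> V Int U' \<times> V') = ?O \<times> ?Q" by (auto simp: Times_Int_Times[symmetric])
  have o: "open ?O" "open ?Q"
   by (rule chart_img[OF M c(1)], use chart_openin[OF M] c in auto)
     (rule chart_img[OF N c(2)], use chart_openin[OF N] c in auto)
  have oo: "open (?O \<times> ?Q)" using o by (rule open_Times)
  have "smooth_on (?O \<times> ?Q) (%z. (ka' (inv_into U ka (fst z)), et' (inv_into V et (snd z))))"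
   by (intro so_Pair[OF oo] so_compose[OF oo _ chart_transition[OF M c(1,3)]]
     so_compose[OF oo _ chart_transition[OF N c(2,4)]]
     so_bounded_linear[OF oo bounded_linear_fst] so_bounded_linear[OF oo bounded_linear_snd] so_id[OF oo]) auto
  thus ?thesis
   unfolding im
   by (rule so_cong[OF oo]) (auto simp: inv_into_map_prod[OF chart_inj[OF M c(1)] chart_inj[OF N c(2)]])
 qed
 thus "ALL (U, ka):atlas (prod_mfd M N). ALL (V, ka'):atlas (prod_mfd M N). smooth_on (ka ` (U Int V)) (ka' o inv_into U ka)"
  by auto
qed

context
 fixes M :: "('a, 'e::euclidean_space) manifold" and N :: "('b, 'f::euclidean_space) manifold"
 assumes M: "mfd M" and N: "mfd N"
begin

lemma sa_fst_snd:
 assumes z: "z : pts M \<times> pts N"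
 shows "smooth_at (prod_mfd M N) M z fst" "smooth_at (prod_mfd M N) N z snd"
proof -
 obtain U ka where U: "(U, ka) : atlas M" "fst z : U" using chart_exists[OF M] z by force
 obtain V ka' where V: "(V, ka') : atlas N" "snd z : V" using chart_exists[OF N] z by force
 have at: "(U \<times> V, map_prod ka ka') : atlas (prod_mfd M N)" using U V by auto
 have im: "map_prod ka ka' ` (U \<times> V) = ka ` U \<times> ka' ` V" by auto
 have o: "open (ka ` U \<times> ka' ` V)"
  using chart_img[OF prod_m[OF M N] at chart_openin[OF prod_m[OF M N] at]] im by simp
 note i = inv_into_map_prod[OF chart_inj[OF M U(1)] chart_inj[OF N V(1)]]
 have z': "z : U \<times> V" using U V by (cases z) auto
 show "smooth_at (prod_mfd M N) M z fst"
 proof (rule smooth_atI[OF at U(1) chart_openin[OF prod_m[OF M N] at] z'])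
  show "smooth_on (map_prod ka ka' ` (U \<times> V)) (%x. ka (fst (inv_into (U \<times> V) (map_prod ka ka') x)))"
   unfolding im
   by (rule so_cong[OF o so_bounded_linear[OF o bounded_linear_fst so_id[OF o]]])
     (auto simp: i chart_inv[OF M U(1)])
 qed auto
 show "smooth_at (prod_mfd M N) N z snd"
 proof (rule smooth_atI[OF at V(1) chart_openin[OF prod_m[OF M N] at] z'])
  show "smooth_on (map_prod ka ka' ` (U \<times> V)) (%x. ka' (snd (inv_into (U \<times> V) (map_prod ka ka') x)))"
   unfolding im
   by (rule so_cong[OF o so_bounded_linear[OF o bounded_linear_snd so_id[OF o]]])
     (auto simp: i chart_inv[OF N V(1)])
 qed auto
qed

lemma sa_Pair:
 assumes P: "mfd P" and f: "smooth_at P M p f" and g: "smooth_at P N p g"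
 shows "smooth_at P (prod_mfd M N) p (%q. (f q, g q))"
proof -
 obtain Z et where Z: "(Z, et) : atlas P" "p : Z" using chart_exists[OF P sa_pts[OF f]] by blast
 obtain U ka where U: "(U, ka) : atlas M" "f p : U" using chart_exists[OF M sa_pts_image[OF M f]] by blast
 obtain V ka' where V: "(V, ka') : atlas N" "g p : V" using chart_exists[OF N sa_pts_image[OF N g]] by blast
 obtain W where W: "opn P W" "p : W" "W <= Z" "f ` W <= U" "open (et ` W)"
  "smooth_on (et ` W) (%x. ka (f (inv_into Z et x)))"
  using sa_charts[OF P M f Z U] .
 obtain Y where Y: "opn P Y" "p : Y" "Y <= Z" "g ` Y <= V" "open (et ` Y)"
  "smooth_on (et ` Y) (%x. ka' (g (inv_into Z et x)))"
  using sa_charts[OF P N g Z V] .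
 have o: "open (et ` (W Int Y))"
  by (rule chart_img[OF P Z(1)]) (use W Y in auto)
 have at: "(U \<times> V, map_prod ka ka') : atlas (prod_mfd M N)" using U V by auto
 show ?thesis
 proof (rule smooth_atI[OF Z(1) at])
  show "smooth_on (et ` (W Int Y)) (%x. map_prod ka ka' (f (inv_into Z et x), g (inv_into Z et x)))"
   unfolding map_prod_simp
   by (intro so_Pair[OF o] so_subset[OF W(6)] so_subset[OF Y(6)]) auto
 qed (use W Y in auto)
qed

end

section \<open>Evaluation of forms in coordinates\<close>

text \<open>A product rule in which the derivative of \<open>a\<close> is known only for each fixed
  vector. Writing \<open>X\<close> in the basis leaves a finite sum of ordinary products; the
  identity \<open>fdsum\<close> reassembles the terms.\<close>

lemma has_derivative_linear_family:
 fixes a :: "'f::euclidean_space => 'g::euclidean_space => 'h::real_normed_vector"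
 assumes T: "open T" "F y : T" and lin: "!!z. z : T ==> linear (a z)"
  and da: "!!v. (%z. a z v) differentiable (at (F y))"
  and F: "(F has_derivative F') (at y within S)" and X: "(X has_derivative X') (at y within S)" and y: "y : S"
 shows "((%x. a (F x) (X x)) has_derivative (%w. fd (%z. a z (X y)) (F y) (F' w) + a (F y) (X' w))) (at y within S)"
proof -
 have der: "((%z. a z v) has_derivative fd (%z. a z v) (F y)) (at (F y))" for v
  by (rule fd_works[OF da])
 have fdsum: "fd (%z. a z v) (F y) u = (SUM b:Basis. (v \<bullet> b) *R fd (%z. a z b) (F y) u)" for u v
 proof -
  have "((%z. SUM b:Basis. (v \<bullet> b) *R a z b) has_derivative (%u. SUM b:Basis. (v \<bullet> b) *R fd (%z. a z b) (F y) u)) (at (F y))"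
   by (rule has_derivative_sum) (rule has_derivative_scaleR_right[OF der])
  hence "((%z. a z v) has_derivative (%u. SUM b:Basis. (v \<bullet> b) *R fd (%z. a z b) (F y) u)) (at (F y))"
   by (rule hd_within[OF _ T]) (use basis_sum[OF lin, of _ v] in simp)
  from fd_eq[OF this] show ?thesis by simp
 qed
 have comp: "((%x. a (F x) b) has_derivative (%w. fd (%z. a z b) (F y) (F' w))) (at y within S)" for b
  using has_derivative_compose[OF F der[of b]] .
 have inn: "((%x. X x \<bullet> b) has_derivative (%w. X' w \<bullet> b)) (at y within S)" for b
  by (rule bounded_linear.has_derivative[OF bounded_linear_inner_left X])
 have sum: "((%x. SUM b:Basis. (X x \<bullet> b) *R a (F x) b) has_derivative
   (%w. SUM b:Basis. (X y \<bullet> b) *R fd (%z. a z b) (F y) (F' w) + (X' w \<bullet> b) *R a (F y) b)) (at y within S)"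
  by (rule has_derivative_sum) (rule has_derivative_scaleR[OF inn comp])
 have rhs: "(%w. SUM b:Basis. (X y \<bullet> b) *R fd (%z. a z b) (F y) (F' w) + (X' w \<bullet> b) *R a (F y) b)
   = (%w. fd (%z. a z (X y)) (F y) (F' w) + a (F y) (X' w))"
 proof (rule ext)
  fix w
  show "(SUM b:Basis. (X y \<bullet> b) *R fd (%z. a z b) (F y) (F' w) + (X' w \<bullet> b) *R a (F y) b)
   = fd (%z. a z (X y)) (F y) (F' w) + a (F y) (X' w)"
   unfolding fdsum[of "X y"] basis_sum[OF lin[OF T(2)], of "X' w"] sum.distrib ..
 qed
 have "(F \<longlongrightarrow> F y) (at y within S)"
  using has_derivative_continuous[OF F] by (simp add: continuous_within)
 hence ev: "\<forall>\<^sub>F x in at y within S. F x : T"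
  by (rule topological_tendstoD[OF _ T])
 have "\<forall>\<^sub>F x in at y within S. (SUM b:Basis. (X x \<bullet> b) *R a (F x) b) = a (F x) (X x)"
  by (rule eventually_mono[OF ev]) (use basis_sum[OF lin] in simp)
 from has_derivative_transform_eventually[OF sum[unfolded rhs] this _ y] show ?thesis
  using basis_sum[OF lin[OF T(2)], of "X y"] by simp
qed

text \<open>Only the second vector is expanded in the basis; for each basis vector in its place the
  linear case applies to the first one.\<close>

lemma has_derivative_bilinear_family:
 fixes a :: "'f::euclidean_space => 'g::euclidean_space => 'k::euclidean_space => 'h::real_normed_vector"
 assumes T: "open T" "F y : T" and lin1: "!!z w. z : T ==> linear (%v. a z v w)"
  and lin2: "!!z v. z : T ==> linear (a z v)"
  and da: "!!v w. (%z. a z v w) differentiable (at (F y))"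
  and F: "(F has_derivative F') (at y within S)" and X: "(X has_derivative X') (at y within S)"
  and Y: "(Y has_derivative Y') (at y within S)" and y: "y : S"
 shows "((%x. a (F x) (X x) (Y x)) has_derivative
  (%w. fd (%z. a z (X y) (Y y)) (F y) (F' w) + a (F y) (X' w) (Y y) + a (F y) (X y) (Y' w))) (at y within S)"
proof -
 let ?A = "%z u. a z (fst u) (snd u)"
 let ?B = "%z v. SUM c:Basis. (Y z \<bullet> c) *R a (F z) v c"
 have der: "((%x. a (F x) (X x) c) has_derivative
   (%w. fd (%z. a z (X y) c) (F y) (F' w) + a (F y) (X' w) c)) (at y within S)" for c
  by (rule has_derivative_linear_family[where a = "%z v. a z v c", OF T lin1 da F X y])
 have inn: "((%x. Y x \<bullet> c) has_derivative (%w. Y' w \<bullet> c)) (at y within S)" for c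
  by (rule bounded_linear.has_derivative[OF bounded_linear_inner_left Y])
 have sum: "((%x. SUM c:Basis. (Y x \<bullet> c) *R a (F x) (X x) c) has_derivative
   (%w. SUM c:Basis. (Y y \<bullet> c) *R (fd (%z. a z (X y) c) (F y) (F' w) + a (F y) (X' w) c)
     + (Y' w \<bullet> c) *R a (F y) (X y) c)) (at y within S)"
  by (rule has_derivative_sum) (rule has_derivative_scaleR[OF inn der])
 have fdsum: "fd (%z. a z v w) (F y) u = (SUM c:Basis. (w \<bullet> c) *R fd (%z. a z v c) (F y) u)" for u v w
 proof -
  have "((%z. SUM c:Basis. (w \<bullet> c) *R a z v c) has_derivative (%u. SUM c:Basis. (w \<bullet> c) *R fd (%z. a z v c) (F y) u)) (at (F y))"
   by (rule has_derivative_sum) (rule has_derivative_scaleR_right[OF fd_works[OF da]])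
  hence "((%z. a z v w) has_derivative (%u. SUM c:Basis. (w \<bullet> c) *R fd (%z. a z v c) (F y) u)) (at (F y))"
   by (rule hd_within[OF _ T]) (use basis_sum[OF lin2, of _ v w] in simp)
  from fd_eq[OF this] show ?thesis by simp
 qed
 have rhs: "(%w. SUM c:Basis. (Y y \<bullet> c) *R (fd (%z. a z (X y) c) (F y) (F' w) + a (F y) (X' w) c)
     + (Y' w \<bullet> c) *R a (F y) (X y) c)
   = (%w. fd (%z. a z (X y) (Y y)) (F y) (F' w) + a (F y) (X' w) (Y y) + a (F y) (X y) (Y' w))"
 proof (rule ext)
  fix w
  show "(SUM c:Basis. (Y y \<bullet> c) *R (fd (%z. a z (X y) c) (F y) (F' w) + a (F y) (X' w) c)
     + (Y' w \<bullet> c) *R a (F y) (X y) c)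
   = fd (%z. a z (X y) (Y y)) (F y) (F' w) + a (F y) (X' w) (Y y) + a (F y) (X y) (Y' w)"
   unfolding fdsum[of "X y" "Y y"] basis_sum[OF lin2[OF T(2)], of "X' w" "Y y"]
    basis_sum[OF lin2[OF T(2)], of "X y" "Y' w"] sum.distrib scaleR_add_right ..
 qed
 have "(F \<longlongrightarrow> F y) (at y within S)"
  using has_derivative_continuous[OF F] by (simp add: continuous_within)
 hence ev: "\<forall>\<^sub>F x in at y within S. F x : T"
  by (rule topological_tendstoD[OF _ T])
 have "\<forall>\<^sub>F x in at y within S. (SUM c:Basis. (Y x \<bullet> c) *R a (F x) (X x) c) = a (F x) (X x) (Y x)"
  by (rule eventually_mono[OF ev]) (use basis_sum[OF lin2] in simp)
 from has_derivative_transform_eventually[OF sum[unfolded rhs] this _ y] show ?thesis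
  using basis_sum[OF lin2[OF T(2)], of "X y" "Y y"] by simp
qed

text \<open>The second derivatives of \<open>F\<close> cancel.\<close>

lemma pullback_closed_1form:
 fixes a :: "'f::euclidean_space => 'f => real" and F :: "'e::euclidean_space => 'f"
 assumes S: "open S" "y : S" "smooth_on S F" and T: "open T" "F y : T"
  and lin: "!!z. z : T ==> linear (a z)" and da: "!!v. (%z. a z v) differentiable (at (F y))"
  and closed: "!!v w. fd (%z. a z v) (F y) w = fd (%z. a z w) (F y) v"
 shows "fd (%x. a (F x) (fd F x v)) y w = fd (%x. a (F x) (fd F x w)) y v"
proof -
 have F: "(F has_derivative fd F y) (at y within UNIV)"
  using so_has_derivative[OF S(3,2)] by simp
 have dF: "((%x. fd F x v) has_derivative fd (%x. fd F x v) y) (at y within UNIV)" for v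
  using so_has_derivative[OF so_fd[OF S(3)] S(2)] by simp
 have "fd (%x. a (F x) (fd F x v)) y = (%w. fd (%z. a z (fd F y v)) (F y) (fd F y w) + a (F y) (fd (%x. fd F x v) y w))" for v
  by (rule fd_eq) (rule has_derivative_linear_family[OF T lin da F dF UNIV_I])
 thus ?thesis
  using closed[of "fd F y v" "fd F y w"] fd_fd_commute[OF S(1,3,2), of v w] by simp
qed

lemma so_of_smooth_at:
 assumes "open S" "!!x. x : S ==> smf eucl x f"
 shows "smooth_on S f"
 by (rule so_local[OF assms(1)]) (use assms(2) in "simp add: sa_euclid_iff")

section \<open>Flat line bundles\<close>

lemma frame_coef_scaleR [simp]: "e ~= 0 ==> fcf (c *R e) e = c"
 unfolding frame_coef_def by (rule the_equality) auto

text \<open>Positive smooth local frames that need not belong to the given atlas of frames.\<close>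

definition sframe :: "('a, 'e::euclidean_space) manifold => ('a, 'l::real_vector) lbundle => 'a set => ('a => 'l) => bool" where
 "sframe M E U e <-> opn M U & (ALL q:U. e q : fibre E q & e q ~= 0 & ssec M E q e &
   (ALL V f. (V, f) : frames E & q : V --> (EX c>0. e q = c *R f q)))"

lemma sframeD:
 assumes "sframe M E U e" "q : U"
 shows "e q : fibre E q" "e q ~= 0" "ssec M E q e" "opn M U"
 using assms by (simp_all add: sframe_def)

lemma sframe_pts: "sframe M E U e ==> q : U ==> q : pts M"
 by (rule subsetD[OF openin_subset]) (rule sframeD(4))

lemma smooth_secE:
 assumes "ssec M E p s"
 obtains U e g where "(U, e) : frames E" "p : U" "smf M p (g :: _ => real)" "near M p (%q. q : U & s q = g q *R e q)"
proof -
 obtain c g where "c : frames E" "p : fst c" "smf M p (g :: _ => real)" "near M p (%q. q : fst c & s q = g q *R snd c q)"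
  using assms unfolding smooth_sec_at_def case_prod_beta by (elim bexE conjE exE)
 thus ?thesis using that[of "fst c" "snd c" g] by simp
qed

lemma smooth_secI:
 assumes "(U, e) : frames E" "p : U" "smf M p (g :: _ => real)" "near M p (%q. q : U & s q = g q *R e q)"
 shows "ssec M E p s"
 unfolding smooth_sec_at_def
 by (rule bexI[OF _ assms(1)], unfold case_prod_conv, intro conjI exI[of _ g]) (use assms in auto)

context
 fixes M :: "('a, 'e::euclidean_space) manifold" and E :: "('a, 'l::real_vector) lbundle"
 assumes M: "mfd M" and E: "oriented_line_bundle M E"
begin

lemma fibre_line: "p : pts M ==> EX x. x ~= 0 & fibre E p = span {x}"
 using conjunct1[OF E[unfolded oriented_line_bundle_def]] by (rule bspec)

lemma frame_exists: "p : pts M ==> EX U e. (U, e) : frames E & p : U"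
proof -
 assume "p : pts M"
 hence "p : (UN (U, e):frames E. U)"
  using conjunct1[OF conjunct2[OF E[unfolded oriented_line_bundle_def]]] by simp
 thus ?thesis by auto
qed

lemma frameD:
 assumes "(U, e) : frames E"
 shows "opn M U" "q : U ==> e q : fibre E q" "q : U ==> e q ~= 0"
proof -
 have "ALL (U, e):frames E. opn M U & (ALL p:U. e p : fibre E p & e p ~= 0)"
  by (rule conjunct1[OF conjunct2[OF conjunct2[OF E[unfolded oriented_line_bundle_def]]]])
 from bspec[OF this assms]
 show "opn M U" "q : U ==> e q : fibre E q" "q : U ==> e q ~= 0" by auto
qed

lemma frame_transition:
 assumes "(U, e) : frames E" "(V, f) : frames E"
 shows "EX g::'a => real. ALL p:U Int V. smf M p g & g p > 0 & f p = g p *R e p"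
proof -
 have "ALL (U, e):frames E. ALL (V, e'):frames E. EX g::'a => real. ALL p:U Int V.
    smf M p g & g p > 0 & e' p = g p *R e p"
  by (rule conjunct2[OF conjunct2[OF conjunct2[OF E[unfolded oriented_line_bundle_def]]]])
 from bspec[OF this assms(1), unfolded case_prod_conv, THEN bspec, OF assms(2), unfolded case_prod_conv]
 show ?thesis .
qed

lemma fibre_iff:
 assumes p: "p : pts M" and e: "e : fibre E p" "e ~= 0"
 shows "x : fibre E p <-> (EX c. x = c *R e)"
proof -
 obtain y where y: "fibre E p = span {y}" using fibre_line[OF p] by blast
 obtain c where c: "e = c *R y" using e y by (auto simp: span_singleton)
 hence "c ~= 0" using e by auto
 hence "k *R y = (k / c) *R e" "k *R e = (k * c) *R y" for k using c by simp_all
 thus ?thesis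
  unfolding y span_singleton image_iff by (metis UNIV_I)
qed

lemma fibre_scaleR: "p : pts M ==> x : fibre E p ==> c *R x : fibre E p"
 using fibre_line[of p] span_scale by metis

lemma fibre_add: "p : pts M ==> x : fibre E p ==> y : fibre E p ==> x + y : fibre E p"
 using fibre_line[of p] span_add by metis

lemma fibre_zero: "p : pts M ==> 0 : fibre E p"
 using fibre_line[of p] span_zero by metis

lemma fibre_coef:
 assumes "p : pts M" "e : fibre E p" "e ~= 0" "x : fibre E p"
 shows "x = fcf x e *R e"
proof -
 obtain c where "x = c *R e" using fibre_iff[OF assms(1-3)] assms(4) by blast
 thus ?thesis using assms(3) by simp
qed

lemma frame_smooth_sec:
 assumes f: "(U, e) : frames E" and p: "p : U"
 shows "ssec M E p e"
proof (rule smooth_secI[OF assms])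
 show "smf M p (%q. 1 :: real)"
  by (rule sa_const[OF M euclid_m]) (use frameD(1)[OF f] openin_subset p in auto)
 show "near M p (%q. q : U & e q = 1 *R e q)"
  using near_open[OF frameD(1)[OF f] p] by simp
qed

lemma frame_sframe:
 assumes "(U, e) : frames E"
 shows "sframe M E U e"
 unfolding sframe_def
proof (intro conjI ballI allI impI)
 fix q assume q: "q : U"
 show "ssec M E q e" by (rule frame_smooth_sec[OF assms q])
 fix V f assume V: "(V, f) : frames E & q : V"
 obtain g :: "'a => real" where "ALL p:V Int U. smf M p g & g p > 0 & e p = g p *R f p"
  using frame_transition[of V f U e] V assms by blast
 with q V show "EX c>0. e q = c *R f q" by blast
qed (use frameD[OF assms] in auto)

lemma sframe_rep:
 assumes e: "sframe M E U e" "p : U" and s: "ssec M E p s"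
 obtains g :: "'a => real" where "smf M p g" "near M p (%q. s q = g q *R e q)"
proof -
 obtain V f b where V: "(V, f) : frames E" "p : V" "smf M p (b :: _ => real)" "near M p (%q. q : V & s q = b q *R f q)"
  using s by (rule smooth_secE)
 obtain V' f' a where V': "(V', f') : frames E" "p : V'" "smf M p (a :: _ => real)" "near M p (%q. q : V' & e q = a q *R f' q)"
  using sframeD(3)[OF e] by (rule smooth_secE)
 obtain t :: "'a => real" where t: "ALL q:V' Int V. smf M q t & t q > 0 & f q = t q *R f' q"
  using frame_transition[OF V'(1) V(1)] by blast
 have ap: "a p ~= 0" using near_self[OF V'(4)] sframeD(2)[OF e] by auto
 have a0: "near M p (%q. a q : - {0})"
  by (rule sa_continuous[OF M euclid_m V'(3)]) (use ap in auto)
 show ?thesis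
 proof (rule that)
  show "smf M p (%q. b q * t q / a q)"
   by (intro sa_divide sa_mult M V V' ap) (use t V V' in auto)
  show "near M p (%q. s q = (b q * t q / a q) *R e q)"
   by (rule near_mono3[OF a0 V(4) V'(4)]) (use t in auto)
 qed
qed

lemma ss_cong:
 assumes "ssec M E p s" "near M p (%q. s' q = s q)"
 shows "ssec M E p s'"
proof -
 obtain V f b where V: "(V, f) : frames E" "p : V" "smf M p (b :: _ => real)" "near M p (%q. q : V & s q = b q *R f q)"
  using assms(1) by (rule smooth_secE)
 show ?thesis
  by (rule smooth_secI[OF V(1-3)]) (rule near_mono2[OF V(4) assms(2)], simp)
qed

lemma ss_scaleR:
 assumes s: "ssec M E p s" and g: "smf M p (g :: 'a => real)"
 shows "ssec M E p (%q. g q *R s q)"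
proof -
 obtain V f b where V: "(V, f) : frames E" "p : V" "smf M p (b :: _ => real)" "near M p (%q. q : V & s q = b q *R f q)"
  using s by (rule smooth_secE)
 show ?thesis
  by (rule smooth_secI[OF V(1,2) sa_mult[OF M g V(3)]]) (rule near_mono[OF V(4)], simp)
qed

lemma ss_sframeI:
 assumes e: "sframe M E U e" "p : U" and g: "smf M p (g :: 'a => real)" and s: "near M p (%q. s q = g q *R e q)"
 shows "ssec M E p s"
 by (rule ss_cong[OF ss_scaleR[OF sframeD(3)[OF e] g] s])

lemma near_sframe: "sframe M E U e ==> p : U ==> near M p (%q. q : U)"
 using near_open sframeD(4) by metis

lemma sframe_coef_smooth:
 assumes e: "sframe M E U e" "p : U" and s: "ssec M E p s"
 shows "smf M p (%q. fcf (s q) (e q))"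
  "near M p (%q. s q = fcf (s q) (e q) *R e q)"
proof -
 obtain g :: "'a => real" where g: "smf M p g" "near M p (%q. s q = g q *R e q)"
  using sframe_rep[OF assms] .
 have n: "near M p (%q. fcf (s q) (e q) = g q)"
  by (rule near_mono2[OF near_sframe[OF e] g(2)]) (use sframeD(2)[OF e(1)] in simp)
 show "smf M p (%q. fcf (s q) (e q))"
  by (rule sa_cong[OF M g(1) n])
 show "near M p (%q. s q = fcf (s q) (e q) *R e q)"
  by (rule near_mono2[OF n g(2)]) simp
qed

text \<open>Smoothness of the ratio is \<open>sframe_rep\<close>. Its sign at \<open>p\<close> is
  found by writing both frames as positive multiples of one frame of the atlas.\<close>

lemma sframe_ratio:
 assumes e: "sframe M E U e" "p : U" and f: "sframe M E V f" "p : V"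
 obtains g :: "'a => real" where "smf M p g" "g p > 0" "near M p (%q. f q = g q *R e q)"
proof -
 obtain g :: "'a => real" where g: "smf M p g" "near M p (%q. f q = g q *R e q)"
  using sframe_rep[OF e sframeD(3)[OF f]] .
 obtain W h where W: "(W, h) : frames E" "p : W" using frame_exists[OF sframe_pts[OF e]] by blast
 obtain c where c: "c > 0" "e p = c *R h p" using e W unfolding sframe_def by blast
 obtain d where d: "d > 0" "f p = d *R h p" using f W unfolding sframe_def by blast
 have "d *R h p = (g p * c) *R h p" using near_self[OF g(2)] c d by simp
 hence "d = g p * c" using frameD(3)[OF W] by simp
 hence "g p > 0" using c d by (metis zero_less_mult_pos2)
 with g show ?thesis using that by blast
qed

end

subsection \<open>Flat frames\<close>

definition flat_bundle ::
 "('a, 'e::euclidean_space) manifold => ('a, 'l::real_vector) lbundle => ('a, 'e, 'l) connexion => bool" where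
 "flat_bundle M E D <-> mfd M & oriented_line_bundle M E & flat_connection M E D"

definition flatf ::
 "('a, 'e::euclidean_space) manifold => ('a, 'l::real_vector) lbundle => ('a, 'e, 'l) connexion => 'a set => ('a => 'l) => bool" where
 "flatf M E D U e <-> sframe M E U e & (ALL q:U. ALL v. D e q v = 0)"

lemma sa_tmap_vf:
 fixes g :: "'a => 'f::euclidean_space"
 assumes M: "mfd M" and g: "smf M p g" and X: "smooth_vf_at M p X"
 shows "smf M p (%q. dmf M g q (X q))"
proof -
 note p = sa_pts[OF g]
 let ?X = "%q. dmf M (crd M p) q (X q)"
 let ?g = "%x. g (cinv M p x)"
 obtain r where r: "r > 0" "ball (crd M p p) r <= cimg M p" "smooth_on (ball (crd M p p) r) ?g"
  using sa_coord[OF M g] .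
 obtain r' where r': "r' > 0" "ball (crd M p p) r' <= cimg M p" "smooth_on (ball (crd M p p) r') (%x. ?X (cinv M p x))"
  using sa_coord[OF M X[unfolded smooth_vf_at_def]] .
 let ?B = "ball (crd M p p) (min r r')"
 have "smooth_on ?B (%x. fd ?g x (?X (cinv M p x)))"
  by (rule so_fd_apply[OF open_ball so_subset[OF r(3)] so_subset[OF r'(3)]]) auto
 hence "smf M p (%q. fd ?g (crd M p q) (?X (cinv M p (crd M p q))))"
  by (intro sa_compose[OF M euclid_m euclid_m crd_smooth[OF M p mem_cdom[OF M p]]]
    so_imp_smooth_at[of ?B]) (use r(1) r'(1) in auto)
 thus ?thesis
 proof (rule sa_cong[OF M])
  show "near M p (%q. dmf M g q (X q) = fd ?g (crd M p q) (?X (cinv M p (crd M p q))))"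
  proof (rule near_mono2[OF near_cdom[OF M p] sa_nearby[OF g]])
   fix q assume q: "q : cdom M p" and gq: "smf M q g"
   show "dmf M g q (X q) = fd ?g (crd M p q) (?X (cinv M p (crd M p q)))"
    using tmap_coord_vf[OF M p q gq, of "?X q"] coord_vf_tmap_crd[OF M p q] crd_inv_crd[OF M p q] by simp
  qed
 qed
qed

lemma ext_d_1:
 "ext_d M D al p [v, w] = D (%q. al q [cvf M p w q]) p v - D (%q. al q [cvf M p v q]) p w"
 by (simp add: ext_d_def lessThan_Suc)

lemma ext_d_2:
 "ext_d M D al p [u, v, w] = D (%q. al q [cvf M p v q, cvf M p w q]) p u
   - D (%q. al q [cvf M p u q, cvf M p w q]) p v + D (%q. al q [cvf M p u q, cvf M p v q]) p w"
 by (simp add: ext_d_def lessThan_Suc eval_nat_numeral)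

text \<open>If the connection just differentiates coefficients in suitable frames, its axioms are
  the rules for sums and products, and its curvature is the commutator of two second derivatives of
  a coefficient. This is how pullback connections are recognised as flat.\<close>

lemma fbI:
 assumes M: "mfd M" and E: "oriented_line_bundle M E"
  and ex: "!!p. p : pts M ==> EX U e. p : U & sframe M E U e &
   (ALL q:U. ALL s g. smf M q g & near M q (%r. s r = g r *R e r) -->
     D s q = (%v. dmf M g q v *R e q))"
 shows "flat_bundle M E D"
proof -
 have bc: "bundle_connection M E D"
  unfolding bundle_connection_def
 proof (intro ballI allI impI)
  fix p s assume p: "p : pts M" and s: "ssec M E p s"
  obtain U e where e: "p : U" "sframe M E U e"
   and D: "!!q s g. q : U ==> smf M q g ==> near M q (%r. s r = g r *R e r) ==>
     D s q = (%v. dmf M g q v *R e q)"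
   using ex[OF p] by blast
  obtain g :: "'a => real" where g: "smf M p g" "near M p (%q. s q = g q *R e q)"
   using sframe_rep[OF M E e(2,1) s] .
  note Ds = D[OF e(1) g]
  have lin: "linear (dmf M g p)" by (rule tmap_linear[OF M euclid_m g(1)])
  have "linear (D s p)"
   unfolding Ds using lin by (simp add: linear_iff scaleR_add_left)
  moreover have "ALL v. D s p v : fibre E p"
   unfolding Ds using fibre_scaleR[OF M E p sframeD(1)[OF e(2,1)]] by blast
  moreover have "D (%q. s q + s' q) p v = D s p v + D s' p v" if s': "ssec M E p s'" for s' v
  proof -
   obtain h :: "'a => real" where h: "smf M p h" "near M p (%q. s' q = h q *R e q)"
    using sframe_rep[OF M E e(2,1) s'] .
   have "D (%q. s q + s' q) p = (%v. dmf M (%q. g q + h q) p v *R e p)"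
    by (rule D[OF e(1) sa_add[OF M g(1) h(1)]], rule near_mono2[OF g(2) h(2)]) (simp add: scaleR_add_left)
   thus ?thesis
    using tmap_add[OF M g(1) h(1)] by (simp add: Ds D[OF e(1) h] scaleR_add_left)
  qed
  moreover have "D (%q. f q *R s q) p v = dmf M f p v *R s p + f p *R D s p v"
   if f: "smf M p f" for f :: "'a => real" and v
  proof -
   have "D (%q. f q *R s q) p = (%v. dmf M (%q. f q * g q) p v *R e p)"
    by (rule D[OF e(1) sa_mult[OF M f g(1)]], rule near_mono[OF g(2)]) simp
   thus ?thesis
    using tmap_mult[OF M f g(1)] near_self[OF g(2)] by (simp add: Ds scaleR_add_left)
  qed
  moreover have "D s' p = D s p" if "near M p (%q. s' q = s q)" for s'
  proof -
   have "near M p (%q. s' q = g q *R e q)"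
    by (rule near_mono2[OF that g(2)]) simp
   from D[OF e(1) g(1) this] show ?thesis using Ds by simp
  qed
  moreover have "ssec M E p (%q. D s q (X q))" if X: "smooth_vf_at M p X" for X
  proof (rule ss_sframeI[OF M E e(2,1) sa_tmap_vf[OF M g(1) X]])
   show "near M p (%q. D s q (X q) = dmf M g q (X q) *R e q)"
    by (rule near_mono3[OF near_nearby[OF g(2)] sa_nearby[OF g(1)] near_sframe[OF M E e(2,1)]])
      (simp add: D)
  qed
  ultimately show "linear (D s p) & (ALL v. D s p v : fibre E p) &
   (ALL s'. ssec M E p s' --> (ALL v. D (%q. s q + s' q) p v = D s p v + D s' p v)) &
   (ALL f::'a => real. smf M p f -->
    (ALL v. D (%q. f q *R s q) p v = dmf M f p v *R s p + f p *R D s p v)) &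
   (ALL s'. near M p (%q. s' q = s q) --> D s' p = D s p) &
   (ALL X. smooth_vf_at M p X --> ssec M E p (%q. D s q (X q)))"
   by simp
 qed
 have "ext_d M D (%q vs. D s q (hd vs)) p [v, w] = 0" if p: "p : pts M" and s: "ssec M E p s" for p s v w
 proof -
  obtain U e where e: "p : U" "sframe M E U e"
   and D: "!!q s g. q : U ==> smf M q g ==> near M q (%r. s r = g r *R e r) ==>
     D s q = (%v. dmf M g q v *R e q)"
   using ex[OF p] by blast
  obtain g :: "'a => real" where g: "smf M p g" "near M p (%q. s q = g q *R e q)"
   using sframe_rep[OF M E e(2,1) s] .
  obtain r where r: "r > 0" "ball (crd M p p) r <= cimg M p" "smooth_on (ball (crd M p p) r) (%x. g (cinv M p x))"
   using sa_coord[OF M g(1)] .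
  have x: "crd M p p : ball (crd M p p) r" using r(1) by simp
  have *: "D (%q. D s q (cvf M p w q)) p v = fd (%x. fd (%x. g (cinv M p x)) x w) (crd M p p) v *R e p" for v w
  proof -
   have "D (%q. D s q (cvf M p w q)) p = (%v. dmf M (%q. dmf M g q (cvf M p w q)) p v *R e p)"
    by (rule D[OF e(1) sa_tmap_vf[OF M g(1) smooth_vf_at_coord[OF M p]]],
      rule near_mono3[OF near_nearby[OF g(2)] sa_nearby[OF g(1)] near_sframe[OF M E e(2,1)]])
      (simp add: D)
   moreover have "dmf M (%q. dmf M g q (cvf M p w q)) p
     = fd (%x. fd (%x. g (cinv M p x)) x w) (crd M p p)"
    unfolding tmap_real[of M "%q. dmf M g q (cvf M p w q)"]
   proof (rule frechet_derivative_transform_within_open[OF _ open_ball x, symmetric])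
    show "(%x. fd (%x. g (cinv M p x)) x w) differentiable at (crd M p p)"
     by (rule so_imp_differentiable[OF so_fd[OF r(3)] x])
    fix x assume x: "x : ball (crd M p p) r"
    hence x': "x : cimg M p" using r(2) by blast
    have "smf eucl x (%x. g (cinv M p x))"
     by (rule so_imp_smooth_at[OF open_ball r(3) x])
    hence "smf M (cinv M p x) g"
     using sa_crd_inv_iff[OF M p crd_inv_cdom[OF M p x'], of g] crd_crd_inv[OF M p x'] by simp
    from tmap_coord_vf[OF M p crd_inv_cdom[OF M p x'] this, of w]
    show "fd (%x. g (cinv M p x)) x w = dmf M g (cinv M p x) (cvf M p w (cinv M p x))"
     using crd_crd_inv[OF M p x'] by simp
   qed
   ultimately show ?thesis by simp
  qed
  show ?thesis
   unfolding ext_d_1 list.sel * using fd_fd_commute[OF open_ball r(3) x, of v w] by simp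
 qed
 with bc M E show ?thesis
  unfolding flat_bundle_def flat_connection_def by blast
qed

lemma fbD:
 assumes "flat_bundle M E D"
 shows "mfd M" "oriented_line_bundle M E" "bundle_connection M E D"
 using assms unfolding flat_bundle_def flat_connection_def by blast+

lemma connectionD:
 assumes D: "bundle_connection M E D" and p: "p : pts M" and s: "ssec M E p s"
 shows "linear (D s p)" "D s p v : fibre E p"
  "smf M p (f :: _ => real) ==> D (%q. f q *R s q) p v = dmf M f p v *R s p + f p *R D s p v"
  "near M p (%q. s' q = s q) ==> D s' p = D s p"
  "smooth_vf_at M p X ==> ssec M E p (%q. D s q (X q))"
 using D[unfolded bundle_connection_def, rule_format, OF p s] by blast+

text \<open>Let \<open>tht\<close> be the connection form of a frame \<open>e\<close>. Flatness says
  that \<open>tht\<close> is closed, so \<open>- tht\<close> has a primitive \<open>g\<close> on a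
  coordinate ball, and \<open>exp g\<close> times \<open>e\<close> is parallel. The exponential also
  keeps the frame positive.\<close>

lemma flat_ex:
 assumes FB: "flat_bundle M E D" and p: "p : pts M"
 obtains U e where "p : U" "flatf M E D U e"
proof -
 note M = fbD(1)[OF FB] and E = fbD(2)[OF FB] and DC = fbD(3)[OF FB]
 note cD = connectionD[OF DC]
 obtain U e where Ue: "(U, e) : frames E" "p : U" using frame_exists[OF M E p] by blast
 note sf = frame_sframe[OF M E Ue(1)]
 note Upts = sframe_pts[OF sf] and esec = sframeD(3)[OF sf]
 define tht where "tht q v = fcf (D e q v) (e q)" for q v
 have De: "D e q v = tht q v *R e q" if "q : U" for q v
  unfolding tht_def by (rule fibre_coef[OF M E Upts[OF that] sframeD(1,2)[OF sf that] cD(2)[OF Upts[OF that] esec[OF that]]])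
 have tht_lin: "linear (tht q)" if q: "q : U" for q
 proof -
  have l: "linear (D e q)" by (rule cD(1)[OF Upts[OF q] esec[OF q]])
  have "(tht q (u + v)) *R e q = (tht q u + tht q v) *R e q" for u v
   using linear_add[OF l, of u v] De[OF q] by (simp add: scaleR_add_left)
  moreover have "(tht q (c *R v)) *R e q = (c * tht q v) *R e q" for c v
   using linear_scale[OF l, of c v] De[OF q] by simp
  ultimately show ?thesis
   using sframeD(2)[OF sf q] by (simp add: linear_iff)
 qed
 have tht_smooth: "smf M q (%r. tht r (cvf M q v r))" if q: "q : U" for q v
  unfolding tht_def
  by (rule sframe_coef_smooth(1)[OF M E sf q cD(5)[OF Upts[OF q] esec[OF q] smooth_vf_at_coord[OF M Upts[OF q]]]])
 have tht_closed: "fd (%z. tht (cinv M q z) (cvf M q w (cinv M q z))) (crd M q q) v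
   = fd (%z. tht (cinv M q z) (cvf M q v (cinv M q z))) (crd M q q) w" if q: "q : U" for q v w
 proof -
  note qp = Upts[OF q]
  have *: "D (%r. D e r (cvf M q w r)) q v = (dmf M (%r. tht r (cvf M q w r)) q v + tht q w * tht q v) *R e q" for v w
  proof -
   have 1: "near M q (%r. D e r (cvf M q w r) = tht r (cvf M q w r) *R e r)"
    by (rule near_mono[OF near_sframe[OF M E sf q]]) (rule De)
   have "D (%r. D e r (cvf M q w r)) q = D (%r. tht r (cvf M q w r) *R e r) q"
    by (rule cD(4)[OF qp _ 1]) (rule ss_scaleR[OF M E esec[OF q] tht_smooth[OF q]])
   thus ?thesis
    using cD(3)[OF qp esec[OF q] tht_smooth[OF q], of w v] coord_vf_self[OF M qp] De[OF q]
    by (simp add: scaleR_add_left)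
  qed
  have "ext_d M D (%q vs. D e q (hd vs)) q [v, w] = 0"
   using FB esec[OF q] qp unfolding flat_bundle_def flat_connection_def by blast
  hence "(dmf M (%r. tht r (cvf M q w r)) q v) *R e q = (dmf M (%r. tht r (cvf M q v r)) q w) *R e q"
   unfolding ext_d_1 list.sel * by (simp add: scaleR_add_left algebra_simps)
  thus ?thesis
   using sframeD(2)[OF sf q] by (simp add: tmap_real)
 qed
 define a where "a x v = tht (cinv M p x) (cvf M p v (cinv M p x))" for x v
 have "near M p (%q. q : U & (ALL b:Basis. smf M q (%r. tht r (cvf M p b r))))"
  by (rule near_conj[OF near_sframe[OF M E sf Ue(2)]], rule near_finite[OF finite_Basis p])
    (rule sa_nearby[OF tht_smooth[OF Ue(2)]])
 then obtain r where r: "r > 0" "ball (crd M p p) r <= cimg M p"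
  "ALL x:ball (crd M p p) r. cinv M p x : U & (ALL b:Basis. smf M (cinv M p x) (%r. tht r (cvf M p b r)))"
  by (rule near_cball[OF M p])
 let ?B = "ball (crd M p p) r"
 have B: "x : cimg M p" "cinv M p x : U" "cinv M p x : cdom M p" "crd M p (cinv M p x) = x" if "x : ?B" for x
  using that r(2,3) crd_inv_cdom[OF M p] crd_crd_inv[OF M p] by blast+
 have a_lin: "linear (a x)" if x: "x : ?B" for x
  unfolding a_def
  using linear_compose[OF coord_vf_linear[OF M p B(3)[OF x]] tht_lin[OF B(2)[OF x]]] by (simp add: o_def)
 have a_smooth_Basis: "smooth_on ?B (%x. a x b)" if b: "b : Basis" for b
 proof (rule so_of_smooth_at[OF open_ball])
  fix x assume x: "x : ?B"
  have "smf M (cinv M p x) (%r. tht r (cvf M p b r))" using r(3) x b by blast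
  thus "smf eucl x (%x. a x b)"
   unfolding a_def sa_crd_inv_iff[OF M p B(3)[OF x]] B(4)[OF x] .
 qed
 have a_smooth: "smooth_on ?B (%x. a x v)" for v
 proof (rule so_cong[OF open_ball])
  show "smooth_on ?B (%x. SUM b:Basis. (v \<bullet> b) *R a x b)"
   by (intro so_sum so_scaleR so_const open_ball a_smooth_Basis)
 qed (use basis_sum[OF a_lin] in simp)
 \<comment> \<open>\<open>ext_d\<close> at a point \<open>q\<close> uses the coordinate fields of
   the chart chosen at \<open>q\<close>, so \<open>tht_closed\<close> holds in a different chart for
   each point. The transition map \<open>?F\<close> to that chart pulls the closed form back to the
   fixed chart of \<open>p\<close>.\<close>
 have a_closed: "fd (%x. a x v) x w = fd (%x. a x w) x v" if x: "x : ?B" for x v w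
 proof -
  define q where "q = cinv M p x"
  have q: "q : U" "q : cdom M p" "crd M p q = x" using B[OF x] by (auto simp: q_def)
  note qp = Upts[OF q(1)]
  let ?F = "%y. crd M q (cinv M p y)"
  let ?a = "%z v. tht (cinv M q z) (cvf M q v (cinv M q z))"
  define S where "S = crd M p ` (cdom M p Int cdom M q Int U)"
  define T where "T = crd M q ` (cdom M q Int U)"
  have S: "open S" "x : S"
   unfolding S_def using q mem_cdom[OF M qp]
   by (auto intro!: chart_img[OF M chart_at_atlas[OF M p]] openin_Int openin_cdom[OF M p] openin_cdom[OF M qp] sframeD(4)[OF sf q(1)])
  have "open T"
   unfolding T_def
   by (rule chart_img[OF M chart_at_atlas[OF M qp]]) (use openin_cdom[OF M qp] sframeD(4)[OF sf q(1)] in auto)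
  moreover have "?F x : T"
   unfolding T_def using q mem_cdom[OF M qp] q_def by auto
  ultimately have T: "open T" "?F x : T" .
  have F: "smooth_on S ?F"
   unfolding crd_inv_eq by (rule so_subset[OF chart_transition[OF M chart_at_atlas[OF M p] chart_at_atlas[OF M qp]]]) (auto simp: S_def)
  have Fx: "?F x = crd M q q" using q_def by simp
  have lin: "linear (?a z)" if "z : T" for z
  proof -
   obtain y where y: "y : cdom M q" "y : U" "z = crd M q y" using `z : T` by (auto simp: T_def)
   hence i: "cinv M q z = y" using crd_inv_crd[OF M qp] by simp
   show ?thesis
    unfolding i using linear_compose[OF coord_vf_linear[OF M qp y(1)] tht_lin[OF y(2)]] by (simp add: o_def)
  qed
  have dif: "(%z. ?a z v) differentiable (at (?F x))" for v
   unfolding Fx using has_derivative_real[OF M tht_smooth[OF q(1)]] differentiable_def by blast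
  have eq: "a y v = ?a (?F y) (fd ?F y v)" if "y : S" for y v
  proof -
   obtain t where t: "t : cdom M p" "t : cdom M q" "t : U" "y = crd M p t" using `y : S` by (auto simp: S_def)
   have i: "cinv M p y = t" "cinv M q (crd M q t) = t" using crd_inv_crd[OF M p t(1)] crd_inv_crd[OF M qp t(2)] t(4) by auto
   have "fd ?F y v = dmf M (crd M q) t (cvf M p v t)"
    using tmap_coord_vf[OF M p t(1) crd_smooth[OF M qp t(2)], of v] t(4) by simp
   hence "cvf M q (fd ?F y v) t = cvf M p v t"
    using coord_vf_tmap_crd[OF M qp t(2)] by simp
   thus ?thesis by (simp add: a_def i)
  qed
  have tr: "fd (%x. a x v) x = fd (%x. ?a (?F x) (fd ?F x v)) x" for v
   by (rule frechet_derivative_transform_within_open[OF so_imp_differentiable[OF a_smooth x] S]) (rule eq)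
  show ?thesis
   unfolding tr by (rule pullback_closed_1form[OF S F T lin dif]) (assumption, unfold Fx, rule tht_closed[OF q(1)])
 qed
 have na: "linear (%v. - a x v)" if "x : ?B" for x
  using a_lin[OF that] by (simp add: linear_iff)
 have nas: "smooth_on ?B (%x. - a x v)" for v
  by (rule so_bounded_linear[OF open_ball _ a_smooth, of uminus]) (intro bounded_linear_minus bounded_linear_ident)
 have nac: "fd (%x. - a x v) x w = fd (%x. - a x w) x v" if x: "x : ?B" for x v w
  using a_closed[OF x, of v w] fd_eq[OF has_derivative_minus[OF so_has_derivative[OF a_smooth x]]] by simp
 obtain g where g: "smooth_on ?B g" "ALL x:?B. (g has_derivative (%v. - a x v)) (at x)"
  using poincare_1form[OF na nas nac] by blast
 define W where "W = {q : cdom M p. crd M p q : ?B}"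
 have WU: "q : U" "q : cdom M p" "crd M p q : ?B" if "q : W" for q
 proof -
  show "q : cdom M p" "crd M p q : ?B" using that by (auto simp: W_def)
  thus "q : U" using B(2) crd_inv_crd[OF M p] by metis
 qed
 define h where "h q = exp (g (crd M p q))" for q
 have h: "smf M q h" if q: "q : W" for q
  unfolding h_def
  by (rule sa_exp[OF M], rule sa_compose[OF M euclid_m euclid_m crd_smooth[OF M p WU(2)[OF q]]])
    (rule so_imp_smooth_at[OF open_ball g(1) WU(3)[OF q]])
 have "flatf M E D W (%q. h q *R e q)"
  unfolding flatf_def sframe_def
 proof (intro conjI ballI allI impI)
  show "opn M W" unfolding W_def by (rule openin_crd_preimage[OF M p open_ball])
  fix q assume q: "q : W"
  note qU = WU(1)[OF q]
  show "h q *R e q : fibre E q" by (rule fibre_scaleR[OF M E Upts[OF qU] sframeD(1)[OF sf qU]])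
  show "h q *R e q ~= 0" using sframeD(2)[OF sf qU] by (simp add: h_def)
  show "ssec M E q (%q. h q *R e q)" by (rule ss_scaleR[OF M E esec[OF qU] h[OF q]])
  show "EX c>0. h q *R e q = c *R f q" if V: "(V, f) : frames E & q : V" for V f
  proof -
   obtain c where "c > 0" "e q = c *R f q" using sf qU V unfolding sframe_def by blast
   thus ?thesis by (intro exI[of _ "h q * c"]) (simp add: h_def)
  qed
  fix v
  define u where "u = dmf M (crd M p) q v"
  have v: "v = cvf M p u q" unfolding u_def using coord_vf_tmap_crd[OF M p WU(2)[OF q]] by simp
  have i: "cinv M p (crd M p q) = q" by (rule crd_inv_crd[OF M p WU(2)[OF q]])
  have "dmf M h q v = fd (%x. h (cinv M p x)) (crd M p q) u"
   unfolding v by (rule tmap_coord_vf[OF M p WU(2)[OF q] h[OF q]])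
  also have "... = exp (g (crd M p q)) * (- a (crd M p q) u)"
  proof -
   have "((%x. exp (g x)) has_derivative (%v. exp (g (crd M p q)) * (- a (crd M p q) v))) (at (crd M p q))"
    by (rule has_derivative_eq_rhs[OF has_derivative_exp[OF bspec[OF g(2) WU(3)[OF q]]]]) auto
   hence "((%x. h (cinv M p x)) has_derivative (%v. exp (g (crd M p q)) * (- a (crd M p q) v))) (at (crd M p q))"
    by (rule hd_within[OF _ open_ball WU(3)[OF q]]) (simp add: h_def B(4) del: mem_ball)
   from fd_eq[OF this] show ?thesis by simp
  qed
  also have "... = - (h q * tht q v)" by (simp add: a_def i v h_def)
  finally have "dmf M h q v = - (h q * tht q v)" .
  thus "D (%q. h q *R e q) q v = 0"
   using cD(3)[OF Upts[OF qU] esec[OF qU] h[OF q], of v] De[OF qU] by simp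
 qed
 moreover have "p : W" using mem_cdom[OF M p] r(1) by (simp add: W_def)
 ultimately show ?thesis using that by blast
qed

lemma ffD:
 assumes "flatf M E D U e"
 shows "sframe M E U e" "q : U ==> D e q v = 0"
 using assms by (simp_all add: flatf_def)

lemma flatf_conn:
 assumes FB: "flat_bundle M E D" and e: "flatf M E D U e" "p : U"
  and g: "smf M p g" and s: "near M p (%q. s q = g q *R e q)"
 shows "D s p = (%v. dmf M g p v *R e p)"
proof
 fix v
 note M = fbD(1)[OF FB] and E = fbD(2)[OF FB] and DC = fbD(3)[OF FB]
 note p = sframe_pts[OF ffD(1)[OF e(1)] e(2)]
 note es = sframeD(3)[OF ffD(1)[OF e(1)] e(2)]
 have "D s p = D (%q. g q *R e q) p"
  by (rule connectionD(4)[OF DC p ss_scaleR[OF M E es g] s])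
 thus "D s p v = dmf M g p v *R e p"
  using connectionD(3)[OF DC p es g, of v] ffD(2)[OF e] by simp
qed

lemma flat_section_const:
 assumes FB: "flat_bundle M E D" and e: "flatf M E D U e" "p : U"
  and s: "near M p (%q. ssec M E q s & (ALL v. D s q v = 0))"
 shows "EX c. near M p (%q. s q = c *R e q)"
proof -
 note M = fbD(1)[OF FB] and E = fbD(2)[OF FB] and sf = ffD(1)[OF e(1)]
 have sp: "ssec M E p s" using near_self[OF s] by blast
 obtain g :: "'a => real" where g: "smf M p g" "near M p (%q. s q = g q *R e q)"
  using sframe_rep[OF M E sf e(2) sp] .
 have "near M p (%q. smf M q g & (ALL v. dmf M g q v = 0))"
 proof (rule near_mono3[OF near_conj[OF sa_nearby[OF g(1)] near_nearby[OF g(2)]] s near_sframe[OF M E sf e(2)]])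
  fix q assume "smf M q g & near M q (%q. s q = g q *R e q)"
   "ssec M E q s & (ALL v. D s q v = 0)" "q : U"
  thus "smf M q g & (ALL v. dmf M g q v = 0)"
   using flatf_conn[OF FB e(1) `q : U`, of g s] sframeD(2)[OF sf `q : U`] by auto
 qed
 from tmap_zero_imp_const[OF M sa_pts[OF g(1)] this]
 have "near M p (%q. s q = g p *R e q)"
  by (rule near_mono2[OF _ g(2)]) simp
 thus ?thesis ..
qed

lemma flat_section_smooth:
 assumes FB: "flat_bundle M E D" and e: "flatf M E D U e" "p : U"
  and s: "near M p (%q. s q = c *R e q)"
 shows "near M p (%q. ssec M E q s & (ALL v. D s q v = 0))"
proof -
 note M = fbD(1)[OF FB] and E = fbD(2)[OF FB] and sf = ffD(1)[OF e(1)]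
 show ?thesis
 proof (rule near_mono2[OF near_nearby[OF s] near_sframe[OF M E sf e(2)]])
  fix q assume q: "near M q (%q. s q = c *R e q)" "q : U"
  have c: "smf M q (%q. c)"
   by (rule sa_const[OF M euclid_m sframe_pts[OF sf q(2)]]) simp
  show "ssec M E q s & (ALL v. D s q v = 0)"
   using flatf_conn[OF FB e(1) q(2) c q(1)] ss_sframeI[OF M E sf q(2) c q(1)] by simp
 qed
qed

lemma flat_ratio:
 assumes FB: "flat_bundle M E D" and e: "flatf M E D U e" "p : U" and f: "flatf M E D V f" "p : V"
 obtains c where "c > 0" "near M p (%q. f q = c *R e q)"
proof -
 note M = fbD(1)[OF FB] and E = fbD(2)[OF FB] and sf = ffD(1)
 have "near M p (%q. ssec M E q f & (ALL v. D f q v = 0))"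
  by (rule near_mono[OF near_sframe[OF M E sf[OF f(1)] f(2)]])
    (use sframeD(3)[OF sf[OF f(1)]] ffD(2)[OF f(1)] in blast)
 then obtain c where c: "near M p (%q. f q = c *R e q)"
  using flat_section_const[OF FB e] by blast
 obtain g :: "'a => real" where g: "g p > 0" "near M p (%q. f q = g q *R e q)"
  using sframe_ratio[OF M E sf[OF e(1)] e(2) sf[OF f(1)] f(2)] by metis
 have "c = g p"
  using near_self[OF c] near_self[OF g(2)] sframeD(2)[OF sf[OF e(1)] e(2)] by simp
 with g(1) c show ?thesis using that by blast
qed

subsection \<open>Pullback bundles\<close>

lemma pull_bundle_simps [simp]:
 "fibre (pbun M f E) p = fibre E (f p)"
 "frames (pbun M f E) = {(pts M Int f -` U, e o f) | U e. (U, e) : frames E}"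
 by (simp_all add: pull_bundle_def)

lemma smD: "smooth_map M N f ==> p : pts M ==> smooth_at M N p f"
 by (simp add: smooth_map_def)

context
 fixes M :: "('a, 'e::euclidean_space) manifold" and N :: "('b, 'f::euclidean_space) manifold"
  and f :: "'a => 'b" and E :: "('b, 'l::real_vector) lbundle" and D :: "('b, 'f, 'l) connexion"
 assumes M: "mfd M" and FB: "flat_bundle N E D" and f: "smooth_map M N f"
begin

private lemmas N = fbD(1)[OF FB] and NE = fbD(2)[OF FB]

lemma smooth_map_pts: "p : pts M ==> f p : pts N"
 by (rule sa_pts_image[OF N smD[OF f]])

lemma openin_preimage: "opn N U ==> opn M (pts M Int f -` U)"
 using openin_continuous_map_preimage[OF smooth_map_continuous[OF M N f], of U]
 by (simp add: Int_def)

lemma near_pull: "p : pts M ==> near N (f p) P ==> near M p (%q. P (f q))"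
 by (rule near_preimage[OF M N smD[OF f]])

lemma sa_pull:
 "p : pts M ==> smf N (f p) (g :: 'b => real) ==> smf M p (%q. g (f q))"
 by (rule sa_compose[OF M N euclid_m smD[OF f]])

lemma pull_oriented_line_bundle: "oriented_line_bundle M (pbun M f E)"
 unfolding oriented_line_bundle_def
proof (intro conjI)
 show "ALL p:pts M. EX x. x ~= 0 & fibre (pbun M f E) p = span {x}"
  using fibre_line[OF N NE smooth_map_pts] by simp
 show "pts M = (UN (U, e):frames (pbun M f E). U)"
 proof (intro equalityI subsetI)
  fix p assume p: "p : pts M"
  obtain U e where "(U, e) : frames E" "f p : U" using frame_exists[OF N NE smooth_map_pts[OF p]] by blast
  thus "p : (UN (U, e):frames (pbun M f E). U)" using p by auto
 qed auto
 show "ALL (U, e):frames (pbun M f E). opn M U & (ALL p:U. e p : fibre (pbun M f E) p & e p ~= 0)"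
  using frameD[OF N NE] openin_preimage by auto
 have "EX g::'a => real. ALL p:(pts M Int f -` U) Int (pts M Int f -` V). smf M p g & g p > 0 & (e' o f) p = g p *R (e o f) p"
  if UV: "(U, e) : frames E" "(V, e') : frames E" for U e V e'
 proof -
  obtain g :: "'b => real" where "ALL p:U Int V. smf N p g & g p > 0 & e' p = g p *R e p"
   using frame_transition[OF N NE UV] by blast
  thus ?thesis
   by (intro exI[of _ "%q. g (f q)"] ballI) (auto intro: sa_pull)
 qed
 thus "ALL (U, e):frames (pbun M f E). ALL (V, e'):frames (pbun M f E). EX g::'a => real. ALL p:U Int V.
    smf M p g & g p > 0 & e' p = g p *R e p"
  by fastforce
qed

lemma pull_smooth_sec:
 assumes p: "p : pts M" and s: "ssec N E (f p) s"
 shows "ssec M (pbun M f E) p (%q. s (f q))"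
proof -
 obtain U e g where U: "(U, e) : frames E" "f p : U" "smf N (f p) (g :: _ => real)"
  "near N (f p) (%q. q : U & s q = g q *R e q)"
  using s by (rule smooth_secE)
 show ?thesis
 proof (rule smooth_secI[OF _ _ sa_pull[OF p U(3)]])
  show "(pts M Int f -` U, e o f) : frames (pbun M f E)" using U by auto
  show "p : pts M Int f -` U" using p U by simp
  show "near M p (%q. q : pts M Int f -` U & s (f q) = g (f q) *R (e o f) q)"
   by (rule near_mono2[OF near_in_pts[OF p] near_pull[OF p U(4)]]) simp
 qed
qed

lemma pull_sframe:
 assumes e: "sframe N E U e"
 shows "sframe M (pbun M f E) (pts M Int f -` U) (%q. e (f q))"
 unfolding sframe_def
proof (intro conjI ballI allI impI)
 show "opn M (pts M Int f -` U)"
 proof (cases "U = {}")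
  case False
  thus ?thesis using sframeD(4)[OF e] openin_preimage by blast
 qed simp
 fix q assume q: "q : pts M Int f -` U"
 hence fq: "f q : U" by simp
 show "e (f q) : fibre (pbun M f E) q" "e (f q) ~= 0"
  using sframeD(1,2)[OF e fq] by simp_all
 show "ssec M (pbun M f E) q (%q. e (f q))"
  by (rule pull_smooth_sec) (use q sframeD(3)[OF e fq] in auto)
 show "EX c>0. e (f q) = c *R h q" if "(V, h) : frames (pbun M f E) & q : V" for V h
  using that e fq unfolding sframe_def by auto
qed

text \<open>The definition of \<open>pull_conn\<close> selects an arbitrary frame \<open>e0\<close>
  of the atlas. Near \<open>f p\<close> it is \<open>a\<close> times the flat frame, the coefficient
  with respect to it is \<open>g / (a o f)\<close>, and the product rule makes \<open>a\<close>
  cancel.\<close>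

lemma pull_conn_eq:
 assumes e: "flatf N E D U e" and p: "p : pts M" "f p : U"
  and g: "smf M p g" and s: "near M p (%q. s q = g q *R e (f q))"
 shows "pull_conn M N f E D s p = (%v. dmf M g p v *R e (f p))"
proof
 fix v
 define c where "c = (SOME c. c : frames E & f p : fst c)"
 define e0 where "e0 = snd c"
 have "EX c. c : frames E & f p : fst c"
  using frame_exists[OF N NE smooth_map_pts[OF p(1)]] by force
 hence "c : frames E & f p : fst c" unfolding c_def by (rule someI_ex)
 hence c: "(fst c, e0) : frames E" "f p : fst c" by (auto simp: e0_def)
 note sf = ffD(1)[OF e]
 obtain a :: "'b => real" where a: "smf N (f p) a" "a (f p) > 0" "near N (f p) (%y. e0 y = a y *R e y)"
  using sframe_ratio[OF N NE sf p(2) frame_sframe[OF N NE c(1)] c(2)] .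
 have af: "smf M p (%q. a (f q))" by (rule sa_pull[OF p(1) a(1)])
 have apos: "near M p (%q. a (f q) : {0<..})"
  by (rule sa_continuous[OF M euclid_m af]) (use a(2) in auto)
 define g0 where "g0 q = fcf (s q) (e0 (f q))" for q
 have g0: "near M p (%q. g0 q = g q / a (f q))"
 proof (rule near_mono2[OF near_conj[OF apos near_pull[OF p(1) a(3)]] near_conj[OF s near_pull[OF p(1) near_sframe[OF N NE sf p(2)]]]])
  fix q assume *: "a (f q) : {0<..} & e0 (f q) = a (f q) *R e (f q)" "s q = g q *R e (f q) & f q : U"
  hence "e0 (f q) ~= 0" "s q = (g q / a (f q)) *R e0 (f q)" using sframeD(2)[OF sf] by auto
  thus "g0 q = g q / a (f q)" unfolding g0_def using frame_coef_scaleR by metis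
 qed
 have g0s: "smf M p g0"
  by (rule sa_cong[OF M sa_divide[OF M g af] g0]) (use a(2) in simp)
 have "near M p (%q. g q = g0 q * a (f q))"
  by (rule near_mono2[OF g0 apos]) auto
 hence "dmf M g p v = dmf M (%q. g0 q * a (f q)) p v"
  using tmap_cong[OF M euclid_m sa_mult[OF M g0s af]] by simp
 also have "... = g0 p * dmf N a (f p) (tmap M N f p v) + dmf M g0 p v * a (f p)"
  using tmap_mult[OF M g0s af] tmap_compose[OF M N euclid_m smD[OF f p(1)] a(1)] by simp
 finally have t: "dmf M g p v = ..." .
 have "pull_conn M N f E D s p v = dmf M g0 p v *R e0 (f p) + g0 p *R D e0 (f p) (tmap M N f p v)"
  by (simp add: pull_conn_def g0_def[abs_def] e0_def c_def Let_def)
 also have "D e0 (f p) = (%u. dmf N a (f p) u *R e (f p))"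
  by (rule flatf_conn[OF FB e p(2) a(1,3)])
 also have "e0 (f p) = a (f p) *R e (f p)" by (rule near_self[OF a(3)])
 finally show "pull_conn M N f E D s p v = dmf M g p v *R e (f p)"
  unfolding t by (simp add: scaleR_add_left)
qed

lemma pull_flat_bundle: "flat_bundle M (pbun M f E) (pull_conn M N f E D)"
proof (rule fbI[OF M pull_oriented_line_bundle])
 fix p assume p: "p : pts M"
 obtain U e where U: "f p : U" "flatf N E D U e"
  by (rule flat_ex[OF FB smooth_map_pts[OF p]])
 show "EX U e. p : U & sframe M (pbun M f E) U e &
   (ALL q:U. ALL s g. smf M q g & near M q (%r. s r = g r *R e r) -->
     pull_conn M N f E D s q = (%v. dmf M g q v *R e q))"
  by (rule exI[of _ "pts M Int f -` U"], rule exI[of _ "%q. e (f q)"])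
    (use p U pull_sframe[OF ffD(1)[OF U(2)]] pull_conn_eq[OF U(2)] in auto)
qed

lemma pull_flat_frame:
 assumes e: "flatf N E D U e"
 shows "flatf M (pbun M f E) (pull_conn M N f E D) (pts M Int f -` U) (%q. e (f q))"
 unfolding flatf_def
proof (intro conjI ballI allI)
 show "sframe M (pbun M f E) (pts M Int f -` U) (%q. e (f q))"
  by (rule pull_sframe[OF ffD(1)[OF e]])
 fix q v assume q: "q : pts M Int f -` U"
 have "pull_conn M N f E D (%q. e (f q)) q = (%v. dmf M (%q. 1 :: real) q v *R e (f q))"
  by (rule pull_conn_eq[OF e]) (use q near_all[of q M "%_. True"] in "auto intro: sa_const M euclid_m")
 thus "pull_conn M N f E D (%q. e (f q)) q v = 0" by simp
qed

end

subsection \<open>Morphisms of flat line bundles\<close>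

text \<open>Linear isomorphism of one fibre onto another. A bundle map is constrained on the fibres
  alone and arbitrary elsewhere in the ambient space, so \<open>linear\<close> does not describe
  it.\<close>

definition liso :: "'l::real_vector set => 'm::real_vector set => ('l => 'm) => bool" where
 "liso F F' h <-> bij_betw h F F' & (ALL x:F. ALL y:F. ALL a b. h (a *R x + b *R y) = a *R h x + b *R h y)"

lemma li_scaleR: "liso F F' h ==> x : F ==> h (a *R x) = a *R h x"
 unfolding liso_def using scaleR_zero_left by (metis add.right_neutral)

lemma li_add: "liso F F' h ==> x : F ==> y : F ==> h (x + y) = h x + h y"
 unfolding liso_def by (metis scaleR_one)

lemma li_diff: "liso F F' h ==> x : F ==> y : F ==> h (x - y) = h x - h y"
proof -
 assume "liso F F' h" "x : F" "y : F"
 hence "h (1 *R x + (-1) *R y) = 1 *R h x + (-1) *R h y" unfolding liso_def by blast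
 thus ?thesis by simp
qed

lemma li_mem: "liso F F' h ==> x : F ==> h x : F'"
 unfolding liso_def by (auto simp: bij_betw_def)

lemma li_inj: "liso F F' h ==> x : F ==> y : F ==> h x = h y ==> x = y"
 unfolding liso_def bij_betw_def inj_on_def by blast

lemma li_inv: "liso F F' h ==> x : F ==> inv_into F h (h x) = x"
 unfolding liso_def bij_betw_def by (blast intro: inv_into_f_f)

lemma li_inv_mem: "liso F F' h ==> y : F' ==> inv_into F h y : F"
 unfolding liso_def bij_betw_def by (blast intro: inv_into_into)

lemma li_f_inv: "liso F F' h ==> y : F' ==> h (inv_into F h y) = y"
 unfolding liso_def bij_betw_def by (blast intro: f_inv_into_f)

lemma line_isoI:
 assumes F: "e ~= 0" "F = span {e}" and F': "e' ~= 0" "F' = span {e'}" and c: "c ~= 0"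
  and h: "!!a. h (a *R e) = (a * c) *R e'"
 shows "liso F F' h"
 unfolding liso_def bij_betw_def F(2) F'(2) span_singleton
proof (intro conjI)
 show "inj_on h (range (%k. k *R e))"
  by (rule inj_onI) (use c F'(1) h in auto)
 show "h ` range (%k. k *R e) = range (%k. k *R e')"
 proof (intro equalityI subsetI)
  fix x assume "x : range (%k. k *R e')"
  then obtain k where "x = k *R e'" by blast
  hence "x = h ((k / c) *R e)" using c h by simp
  thus "x : h ` range (%k. k *R e)" by blast
 qed (use h in auto)
 show "ALL x:range (%k. k *R e). ALL y:range (%k. k *R e). ALL a b. h (a *R x + b *R y) = a *R h x + b *R h y"
 proof (intro ballI allI)
  fix x y a b assume "x : range (%k. k *R e)" "y : range (%k. k *R e)"
  then obtain k l where kl: "x = k *R e" "y = l *R e" by blast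
  have "a *R x + b *R y = (a * k + b * l) *R e" by (simp add: kl scaleR_add_left)
  thus "h (a *R x + b *R y) = a *R h x + b *R h y"
   by (simp only: h) (simp add: h kl scaleR_add_left algebra_simps)
 qed
qed

lemma fibre_eq_span:
 assumes "mfd M" "oriented_line_bundle M E" "p : pts M" "e : fibre E p" "e ~= 0"
 shows "fibre E p = span {e}"
 unfolding span_singleton using fibre_iff[OF assms] by auto

lemma li_inverse:
 assumes M: "mfd M" and E: "oriented_line_bundle M E" and p: "p : pts M" and h: "liso (fibre E p) F h"
 shows "liso F (fibre E p) (inv_into (fibre E p) h)" (is "liso _ _ ?i")
 unfolding liso_def
proof (intro conjI ballI allI)
 show "bij_betw ?i F (fibre E p)" using bij_betw_inv_into h by (auto simp: liso_def)
 fix x y and a b :: real assume xy: "x : F" "y : F"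
 note m = li_inv_mem[OF h xy(1)] li_inv_mem[OF h xy(2)]
 note s = fibre_scaleR[OF M E p m(1), of a] fibre_scaleR[OF M E p m(2), of b]
 have "h (a *R ?i x + b *R ?i y) = a *R x + b *R y"
  using li_add[OF h s] li_scaleR[OF h m(1)] li_scaleR[OF h m(2)] li_f_inv[OF h xy(1)] li_f_inv[OF h xy(2)] by simp
 with li_inv[OF h fibre_add[OF M E p s]] show "?i (a *R x + b *R y) = a *R ?i x + b *R ?i y" by simp
qed

lemma fm_liso:
 "flat_morphism M E D N E' D' ph Ph ==> p : pts M ==> liso (fibre E p) (fibre E' (ph p)) (Ph p)"
 unfolding flat_morphism_def liso_def by (elim conjE bspec)

lemma fm_smooth: "flat_morphism M E D N E' D' ph Ph ==> smooth_map M N ph"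
 unfolding flat_morphism_def by (elim conjE)

lemma fm_frames:
 assumes m: "flat_morphism M E D N E' D' ph Ph" and U: "(U, e) : frames E" and V: "(V, e') : frames E'"
 shows "EX g. ALL p:pts M. p : U & ph p : V -->
    smf M p g & (g p :: real) > 0 & Ph p (e p) = g p *R e' (ph p)"
 using bspec[OF bspec[OF conjunct1[OF conjunct2[OF conjunct2[OF m[unfolded flat_morphism_def]]]] U, unfolded case_prod_conv] V, unfolded case_prod_conv] .

lemma fm_conn:
 assumes m: "flat_morphism M E D N E' D' ph Ph" and "p : pts M" "ssec M E p s"
 shows "D s p v = inv_into (fibre E p) (Ph p) (pull_conn M N ph E' D' (%q. Ph q (s q)) p v)"
 using conjunct2[OF conjunct2[OF conjunct2[OF m[unfolded flat_morphism_def]]]] assms(2,3) by simp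

text \<open>Between flat frames the morphism is multiplication by a function \<open>h\<close>. The
  frame \<open>e\<close> has derivative zero, and compatibility of the connections transfers this to
  \<open>dh = 0\<close>.\<close>

lemma fm_const:
 assumes FB: "flat_bundle M E D" and FB': "flat_bundle N E' D'"
  and m: "flat_morphism M E D N E' D' ph Ph"
  and e: "flatf M E D U e" "p : U" and e': "flatf N E' D' V e'" "ph p : V"
 obtains c where "c > 0" "near M p (%q. Ph q (e q) = c *R e' (ph q))"
proof -
 note M = fbD(1)[OF FB] and E = fbD(2)[OF FB]
 note N = fbD(1)[OF FB'] and E' = fbD(2)[OF FB']
 note sm = fm_smooth[OF m] and li = fm_liso[OF m]
 note sf = ffD(1)[OF e(1)] and sf' = ffD(1)[OF e'(1)]
 note p = sframe_pts[OF sf e(2)]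
 obtain U0 f where f: "(U0, f) : frames E" "p : U0" using frame_exists[OF M E p] by blast
 obtain V0 f' where f': "(V0, f') : frames E'" "ph p : V0" using frame_exists[OF N E' sframe_pts[OF sf' e'(2)]] by blast
 obtain g where g: "ALL p:pts M. p : U0 & ph p : V0 -->
    smf M p (g :: _ => real) & g p > 0 & Ph p (f p) = g p *R f' (ph p)"
  using fm_frames[OF m f(1) f'(1)] by blast
 obtain a where a: "smf M p (a :: _ => real)" "a p > 0" "near M p (%q. e q = a q *R f q)"
  using sframe_ratio[OF M E frame_sframe[OF M E f(1)] f(2) sf e(2)] .
 obtain b where b: "smf N (ph p) (b :: _ => real)" "b (ph p) > 0" "near N (ph p) (%q. f' q = b q *R e' q)"
  using sframe_ratio[OF N E' sf' e'(2) frame_sframe[OF N E' f'(1)] f'(2)] .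
 define h where "h q = a q * g q * b (ph q)" for q
 have h: "smf M p h"
  unfolding h_def by (intro sa_mult M a(1) sa_pull[OF M FB' sm p b(1)]) (use g p f f' in blast)
 have hp: "h p > 0" using a(2) b(2) g p f f' by (simp add: h_def)
 have n1: "near M p (%q. q : U0)" by (rule near_sframe[OF M E frame_sframe[OF M E f(1)] f(2)])
 have n2: "near M p (%q. ph q : V0)"
  by (rule near_pull[OF M FB' sm p near_sframe[OF N E' frame_sframe[OF N E' f'(1)] f'(2)]])
 have n3: "near M p (%q. f' (ph q) = b (ph q) *R e' (ph q))"
  by (rule near_pull[OF M FB' sm p b(3)])
 have eq: "near M p (%q. Ph q (e q) = h q *R e' (ph q))"
 proof (rule near_mono3[OF near_conj[OF n1 n2] n3 near_conj[OF a(3) near_in_pts[OF p]]])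
  fix q assume q: "q : U0 & ph q : V0" "f' (ph q) = b (ph q) *R e' (ph q)" "e q = a q *R f q & q : pts M"
  hence "Ph q (e q) = a q *R Ph q (f q)"
   using li_scaleR[OF li frameD(2)[OF M E f(1)]] by simp
  also have "... = h q *R e' (ph q)" using g q by (simp add: h_def)
  finally show "Ph q (e q) = h q *R e' (ph q)" .
 qed
 have "near M p (%q. smf M q h & (ALL v. dmf M h q v = 0))"
 proof (rule near_mono3[OF near_conj[OF sa_nearby[OF h] near_nearby[OF eq]] near_sframe[OF M E sf e(2)]
    near_pull[OF M FB' sm p near_sframe[OF N E' sf' e'(2)]]])
  fix q assume q: "smf M q h & near M q (%q. Ph q (e q) = h q *R e' (ph q))" "q : U" "ph q : V"
  note qp = sframe_pts[OF sf q(2)]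
  have "dmf M h q v = 0" for v
  proof -
   have P: "pull_conn M N ph E' D' (%q. Ph q (e q)) q = (%v. dmf M h q v *R e' (ph q))"
    by (rule pull_conn_eq[OF M FB' sm e'(1) qp q(3)]) (use q in auto)
   have y: "dmf M h q v *R e' (ph q) : fibre E' (ph q)"
    by (rule fibre_scaleR[OF N E' sframe_pts[OF sf' q(3)] sframeD(1)[OF sf' q(3)]])
   have "0 = inv_into (fibre E q) (Ph q) (dmf M h q v *R e' (ph q))"
    using fm_conn[OF m qp sframeD(3)[OF sf q(2)], of v] ffD(2)[OF e(1) q(2), of v] unfolding P by simp
   hence "Ph q 0 = dmf M h q v *R e' (ph q)"
    using li_f_inv[OF li[OF qp] y] by simp
   moreover have "Ph q 0 = 0"
    using li_scaleR[OF li[OF qp] fibre_zero[OF M E qp], of 0] by simp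
   ultimately show ?thesis using sframeD(2)[OF sf' q(3)] by simp
  qed
  with q show "smf M q h & (ALL v. dmf M h q v = 0)" by blast
 qed
 from tmap_zero_imp_const[OF M p this]
 have "near M p (%q. Ph q (e q) = h p *R e' (ph q))"
  by (rule near_mono2[OF _ eq]) simp
 with hp show ?thesis using that by blast
qed

text \<open>Converse of \<open>fm_const\<close>: one pair of flat frames around each point, related
  by a positive constant, is enough. All bundle morphisms constructed later are verified this
  way.\<close>

lemma flat_morphismI:
 assumes FB: "flat_bundle M E D" and FB': "flat_bundle N E' D'" and sm: "smooth_map M N ph"
  and li: "!!p. p : pts M ==> liso (fibre E p) (fibre E' (ph p)) (Ph p)"
  and const: "!!p. p : pts M ==> EX U e V e' c. flatf M E D U e & p : U & flatf N E' D' V e' & ph p : V &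
   c > 0 & near M p (%q. Ph q (e q) = c *R e' (ph q))"
 shows "flat_morphism M E D N E' D' ph Ph"
proof -
 note M = fbD(1)[OF FB] and E = fbD(2)[OF FB]
 note N = fbD(1)[OF FB'] and E' = fbD(2)[OF FB']
 have fr: "EX g::_ => real. ALL p:pts M. p : U0 & ph p : V0 -->
    smf M p g & g p > 0 & Ph p (f p) = g p *R f' (ph p)"
  if f: "(U0, f) : frames E" and f': "(V0, f') : frames E'" for U0 f V0 f'
 \<comment> \<open>One transition function has to serve all points, while the constants are given
   locally. Reading the coefficient off pointwise defines it globally; near each point it is then
   compared with a smooth expression.\<close>
 proof (rule exI[of _ "%p. fcf (Ph p (f p)) (f' (ph p))"], intro ballI impI)
  fix p assume p: "p : pts M" and pU: "p : U0 & ph p : V0"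
  obtain U e V e' c where *: "flatf M E D U e" "p : U" "flatf N E' D' V e'" "ph p : V"
   "c > 0" "near M p (%q. Ph q (e q) = c *R e' (ph q))"
   using const[OF p] by blast
  note sf = ffD(1)[OF *(1)] and sf' = ffD(1)[OF *(3)]
  obtain a where a: "smf M p (a :: _ => real)" "a p > 0" "near M p (%q. f q = a q *R e q)"
   by (rule sframe_ratio[OF M E sf *(2) frame_sframe[OF M E f]]) (use pU in auto)
  obtain b where b: "smf N (ph p) (b :: _ => real)" "b (ph p) > 0" "near N (ph p) (%q. e' q = b q *R f' q)"
   by (rule sframe_ratio[OF N E' frame_sframe[OF N E' f'] _ sf' *(4)]) (use pU in auto)
  have n3: "near M p (%q. e' (ph q) = b (ph q) *R f' (ph q))"
   by (rule near_pull[OF M FB' sm p b(3)])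
  have n2: "near M p (%q. ph q : V0)"
   by (rule near_pull[OF M FB' sm p near_sframe[OF N E' frame_sframe[OF N E' f']]]) (use pU in auto)
  have eq: "near M p (%q. Ph q (f q) = (a q * c * b (ph q)) *R f' (ph q) & ph q : V0)"
  proof (rule near_mono3[OF near_conj[OF a(3) *(6)] near_conj[OF n2 n3] near_sframe[OF M E sf *(2)]])
   fix q assume q: "f q = a q *R e q & Ph q (e q) = c *R e' (ph q)" "ph q : V0 & e' (ph q) = b (ph q) *R f' (ph q)" "q : U"
   hence "Ph q (f q) = a q *R Ph q (e q)"
    using li_scaleR[OF li[OF sframe_pts[OF sf q(3)]] sframeD(1)[OF sf q(3)]] by simp
   thus "Ph q (f q) = (a q * c * b (ph q)) *R f' (ph q) & ph q : V0" using q by simp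
  qed
  have g: "near M p (%q. fcf (Ph q (f q)) (f' (ph q)) = a q * c * b (ph q))"
   by (rule near_mono[OF eq]) (use frameD(3)[OF N E' f'] in auto)
  have "smf M p (%q. fcf (Ph q (f q)) (f' (ph q)))"
   by (rule sa_cong[OF M _ g])
     (intro sa_mult M a(1) sa_pull[OF M FB' sm p b(1)] sa_const euclid_m p, simp)
  thus "smf M p (%p. fcf (Ph p (f p)) (f' (ph p))) &
   fcf (Ph p (f p)) (f' (ph p)) > 0 & Ph p (f p) = fcf (Ph p (f p)) (f' (ph p)) *R f' (ph p)"
   using near_self[OF g] near_self[OF eq] a(2) b(2) *(5) by simp
 qed
 have conn: "D s p v = inv_into (fibre E p) (Ph p) (pull_conn M N ph E' D' (%q. Ph q (s q)) p v)"
  if p: "p : pts M" and s: "ssec M E p s" for p s v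
 proof -
  obtain U e V e' c where *: "flatf M E D U e" "p : U" "flatf N E' D' V e'" "ph p : V"
   "c > 0" "near M p (%q. Ph q (e q) = c *R e' (ph q))"
   using const[OF p] by blast
  note sf = ffD(1)[OF *(1)] and sf' = ffD(1)[OF *(3)]
  obtain h where h: "smf M p (h :: _ => real)" "near M p (%q. s q = h q *R e q)"
   using sframe_rep[OF M E sf *(2) s] .
  have "near M p (%q. Ph q (s q) = (c * h q) *R e' (ph q))"
  proof (rule near_mono3[OF h(2) *(6) near_sframe[OF M E sf *(2)]])
   fix q assume "s q = h q *R e q" "Ph q (e q) = c *R e' (ph q)" "q : U"
   thus "Ph q (s q) = (c * h q) *R e' (ph q)"
    using li_scaleR[OF li[OF sframe_pts[OF sf]] sframeD(1)[OF sf]] by simp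
  qed
  hence "pull_conn M N ph E' D' (%q. Ph q (s q)) p = (%v. dmf M (%q. c * h q) p v *R e' (ph p))"
   by (intro pull_conn_eq[OF M FB' sm *(3) p *(4)] sa_mult M h(1) sa_const euclid_m p) simp_all
  hence "pull_conn M N ph E' D' (%q. Ph q (s q)) p v = dmf M h p v *R (c *R e' (ph p))"
   using tmap_cmult[OF M h(1)] by simp
  also have "... = Ph p (dmf M h p v *R e p)"
   using li_scaleR[OF li[OF p] sframeD(1)[OF sf *(2)]] near_self[OF *(6)] by simp
  also have "... = Ph p (D s p v)" using flatf_conn[OF FB *(1,2) h] by simp
  finally show ?thesis
   using li_inv[OF li[OF p] connectionD(2)[OF fbD(3)[OF FB] p s]] by simp
 qed
 show ?thesis
  unfolding flat_morphism_def
 proof (intro conjI)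
  show "ALL p:pts M. bij_betw (Ph p) (fibre E p) (fibre E' (ph p)) &
    (ALL x:fibre E p. ALL y:fibre E p. ALL a b. Ph p (a *R x + b *R y) = a *R Ph p x + b *R Ph p y)"
   by (rule ballI) (rule li[unfolded liso_def])
  show "ALL p:pts M. ALL s. ssec M E p s -->
    (ALL v. D s p v = inv_into (fibre E p) (Ph p) (pull_conn M N ph E' D' (%q. Ph q (s q)) p v))"
   by (intro ballI allI impI conn)
  show "ALL (U, e):frames E. ALL (V, e'):frames E'. EX g. ALL p:pts M. p : U & ph p : V -->
    smf M p g & (g p :: real) > 0 & Ph p (e p) = g p *R e' (ph p)"
   unfolding split_beta by (intro ballI fr) simp_all
 qed (rule sm)
qed

section \<open>Paths and lifting\<close>

text \<open>Continuity of a path in epsilon form on an arbitrary set of times; arguments about lifts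
  are local in time and use it directly. \<open>path_cont_iff\<close> relates it to
  \<open>continuous_map\<close>.\<close>

definition pcont :: "'a topology => real set => (real => 'a) => bool" where
 "pcont X I ga <-> (ALL t:I. ga t : topspace X &
   (ALL V. openin X V & ga t : V --> (EX ep>0. ALL t':I. abs (t' - t) < ep --> ga t' : V)))"

lemma pcontD:
 assumes "pcont X I ga" "t : I"
 shows "ga t : topspace X" "openin X V ==> ga t : V ==> EX ep>0. ALL t':I. abs (t' - t) < ep --> ga t' : V"
 using assms by (simp_all add: pcont_def)

lemma path_cont_iff: "pcont X I ga <-> continuous_map (top_of_set I) X ga"
proof
 assume L: "pcont X I ga"
 show "continuous_map (top_of_set I) X ga"
  unfolding continuous_map_def
 proof (intro conjI allI impI)
  show "ga : topspace (top_of_set I) \<rightarrow> topspace X" using L by (simp add: pcont_def)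
  fix V assume V: "openin X V"
  show "openin (top_of_set I) {x : topspace (top_of_set I). ga x : V}"
   unfolding openin_euclidean_subtopology_iff
  proof (intro conjI ballI)
   fix t assume "t : {x : topspace (top_of_set I). ga x : V}"
   hence t: "t : I" "ga t : V" by auto
   then obtain e where "e > 0" "ALL t':I. abs (t' - t) < e --> ga t' : V" using pcontD(2)[OF L t(1) V t(2)] by blast
   thus "EX e>0. ALL x':I. dist x' t < e --> x' : {x : topspace (top_of_set I). ga x : V}"
    by (intro exI[of _ e]) (simp add: dist_real_def)
  qed auto
 qed
next
 assume R: "continuous_map (top_of_set I) X ga"
 show "pcont X I ga"
  unfolding pcont_def
 proof (intro ballI conjI allI impI)
  fix t assume t: "t : I"
  show "ga t : topspace X" using R t by (auto simp: continuous_map_def)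
  fix V assume V: "openin X V & ga t : V"
  hence "openin (top_of_set I) {x : I. ga x : V}" using R by (simp add: continuous_map_def)
  then obtain e where "e > 0" "ALL x':I. dist x' t < e --> x' : {x : I. ga x : V}"
   unfolding openin_euclidean_subtopology_iff using t V by blast
  thus "EX e>0. ALL t':I. abs (t' - t) < e --> ga t' : V"
   by (intro exI[of _ e]) (simp add: dist_real_def)
 qed
qed

lemma pathin_iff: "pathin X ga <-> pcont X {0..1} ga"
 by (simp add: pathin_def path_cont_iff)

lemma path_cont_subset: "pcont X I ga ==> K <= I ==> pcont X K ga"
 unfolding path_cont_iff using continuous_map_from_subtopology_mono by blast

lemma path_cont_compose: "pcont X I ga ==> continuous_map X Y f ==> pcont Y I (%t. f (ga t))"
 unfolding path_cont_iff using continuous_map_compose[of _ X ga Y f] by (simp add: o_def)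

lemma path_cont_reparam:
 assumes "pcont X I ga" "continuous_on K h" "h ` K <= I"
 shows "pcont X K (%t. ga (h t))"
proof -
 have "continuous_map (top_of_set K) (top_of_set I) h" using assms(2,3) by auto
 from continuous_map_compose[OF this assms(1)[unfolded path_cont_iff]] show ?thesis by (simp add: path_cont_iff o_def)
qed

lemma path_cont_join:
 assumes g: "pcont X {a..b} g" and h: "pcont X {b..c} h" and eq: "g b = h b" and ab: "a <= b" "b <= c"
 shows "pcont X {a..c} (%t. if t <= b then g t else h t)"
 unfolding pcont_def
proof (intro ballI conjI allI impI)
 fix t assume t: "t : {a..c}"
 show "(if t <= b then g t else h t) : topspace X"
  using pcontD(1)[OF g, of t] pcontD(1)[OF h, of t] t by auto
 fix V assume V: "openin X V & (if t <= b then g t else h t) : V"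
 have 1: "EX e>0. ALL t':{a..b}. abs (t' - t) < e --> g t' : V"
 proof (cases "t <= b")
  case True thus ?thesis using pcontD(2)[OF g, of t V] V t by auto
 next
  case False thus ?thesis by (intro exI[of _ "t - b"]) auto
 qed
 have 2: "EX e>0. ALL t':{b..c}. abs (t' - t) < e --> h t' : V"
 proof (cases "t >= b")
  case True thus ?thesis using pcontD(2)[OF h, of t V] V t eq by (cases "t = b") auto
 next
  case False thus ?thesis by (intro exI[of _ "b - t"]) auto
 qed
 obtain e1 where e1: "e1 > 0" "ALL t':{a..b}. abs (t' - t) < e1 --> g t' : V" using 1 by blast
 obtain e2 where e2: "e2 > 0" "ALL t':{b..c}. abs (t' - t) < e2 --> h t' : V" using 2 by blast
 show "EX e>0. ALL t':{a..c}. abs (t' - t) < e --> (if t' <= b then g t' else h t') : V"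
  by (rule exI[of _ "min e1 e2"]) (use e1 e2 in auto)
qed

lemma interval_local_const:
 fixes f :: "real => 'a"
 assumes "is_interval I" "a : I" "b : I" and loc: "!!t. t : I ==> EX e>0. ALL t':I. abs (t' - t) < e --> f t' = f t"
 shows "f a = f b"
proof (rule connected_local_const[OF _ assms(2,3)])
 show "connected I" using assms(1) is_interval_connected by blast
 show "ALL a:I. eventually (%b. f a = f b) (at a within I)"
 proof
  fix t assume "t : I"
  then obtain e where "e > 0" "ALL t':I. abs (t' - t) < e --> f t' = f t" using loc by blast
  thus "eventually (%b. f t = f b) (at t within I)"
   unfolding eventually_at by (intro exI[of _ e]) (simp add: dist_real_def)
 qed
qed

lemma local_const_eq:
 assumes X: "connected_space X" and ab: "a : topspace X" "b : topspace X"
  and loc: "!!x. x : topspace X ==> EX W. openin X W & x : W & (ALL y:W. f y = f x)"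
 shows "f a = f b"
proof -
 have op: "openin X {x : topspace X. P (f x)}" for P
 proof (rule iffD2[OF openin_subopen], rule ballI)
  fix x assume x: "x : {x : topspace X. P (f x)}"
  then obtain W where W: "openin X W" "x : W" "ALL y:W. f y = f x" using loc[of x] by auto
  have "y : {x : topspace X. P (f x)}" if "y : W" for y
   using x bspec[OF W(3) that] subsetD[OF openin_subset[OF W(1)] that] by simp
  with W(1,2) show "EX T. openin X T & x : T & T <= {x : topspace X. P (f x)}"
   by (intro exI[of _ W]) blast
 qed
 have "topspace X - {x : topspace X. f x = f a} = {x : topspace X. f x ~= f a}" by auto
 hence "closedin X {x : topspace X. f x = f a}" using op[of "%y. y ~= f a"] by (simp add: closedin_def)
 with op[of "%y. y = f a"] have "{x : topspace X. f x = f a} = {} | {x : topspace X. f x = f a} = topspace X"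
  using X unfolding connected_space_clopen_in by blast
 moreover have "a : {x : topspace X. f x = f a}" using ab by simp
 ultimately have "b : {x : topspace X. f x = f a}" using ab by blast
 thus ?thesis by simp
qed

text \<open>The common formal core of covering spaces and of parallel transport: a family of local
 sections of \<open>pr : T \<rightarrow> X\<close>, which are evenly stacked over small open sets and agree near every
 point where they agree.\<close>

locale sheets =
 fixes X :: "'b topology" and T :: "'t set" and pr :: "'t => 'b" and S :: "('b set \<times> ('b => 't)) set"
 assumes S_open: "(V, s) : S ==> openin X V"
  and S_sec: "(V, s) : S ==> b : V ==> s b : T & pr (s b) = b"
  and S_agree: "(V, s) : S ==> (V', s') : S ==> b : V ==> b : V' ==> s b = s' b ==>
    EX W. openin X W & b : W & W <= V Int V' & (ALL c:W. s c = s' c)"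
  and S_even: "b : topspace X ==> EX V R. openin X V & b : V & (ALL s:R. (V, s) : S) &
    (ALL ta:T. pr ta : V --> (EX s:R. s (pr ta) = ta)) &
    (ALL s:R. ALL s':R. ALL c:V. s c = s' c --> (ALL b:V. s b = s' b))"
begin

text \<open>Instead of a topology on \<open>T\<close>, a lift is required to follow one of the given
  sections for a short time around each instant.\<close>

definition lift :: "real set => (real => 'b) => (real => 't) => bool" where
 "lift I ga u <-> (ALL t:I. EX V s ep. (V, s) : S & ga t : V & ep > 0 &
   (ALL t':I. abs (t' - t) < ep --> ga t' : V & u t' = s (ga t')))"

lemma liftE:
 assumes "lift I ga u" "t : I"
 obtains V s ep where "(V, s) : S" "ga t : V" "ep > 0" "ALL t':I. abs (t' - t) < ep --> ga t' : V & u t' = s (ga t')" "u t = s (ga t)"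
proof -
 obtain V s e where *: "(V, s) : S" "ga t : V" "e > 0" "ALL t':I. abs (t' - t) < e --> ga t' : V & u t' = s (ga t')"
  using assms unfolding lift_def by blast
 thus ?thesis using that[of V s e] assms(2) by auto
qed

lemma lift_mem: "lift I ga u ==> t : I ==> u t : T" and lift_pr: "lift I ga u ==> t : I ==> pr (u t) = ga t"
 by (erule (1) liftE, use S_sec in metis)+

lemma lift_subset: "lift I ga u ==> K <= I ==> lift K ga u"
 unfolding lift_def by (meson subsetD)

lemma lift_cong: "lift I ga u ==> (!!t. t : I ==> ga' t = ga t) ==> (!!t. t : I ==> u' t = u t) ==> lift I ga' u'"
 unfolding lift_def by simp


text \<open>If two lifts disagree at some time, they disagree nearby, because the even stacking makes \<open>T\<close> Hausdorff over \<open>X\<close>.\<close>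

lemma lift_local_agree:
 assumes ga: "pcont X I ga" and u: "lift I ga u" and u': "lift I ga u'" and t: "t : I"
 shows "EX e>0. ALL t':I. abs (t' - t) < e --> (u t' = u' t') = (u t = u' t)"
proof -
 obtain V s e where *: "(V, s) : S" "ga t : V" "e > 0" "ALL t':I. abs (t' - t) < e --> ga t' : V & u t' = s (ga t')" "u t = s (ga t)"
  using liftE[OF u t] .
 obtain V' s' e' where **: "(V', s') : S" "ga t : V'" "e' > 0" "ALL t':I. abs (t' - t) < e' --> ga t' : V' & u' t' = s' (ga t')" "u' t = s' (ga t)"
  using liftE[OF u' t] .
 obtain Z R where Z: "openin X Z" "ga t : Z" "ALL s:R. (Z, s) : S" "ALL ta:T. pr ta : Z --> (EX s:R. s (pr ta) = ta)"
  "ALL s:R. ALL s':R. ALL c:Z. s c = s' c --> (ALL b:Z. s b = s' b)"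
  using S_even[OF pcontD(1)[OF ga t]] by blast
 obtain r where r: "r : R" "r (ga t) = u t" using Z(2,4) lift_mem[OF u t] lift_pr[OF u t] by metis
 obtain r' where r': "r' : R" "r' (ga t) = u' t" using Z(2,4) lift_mem[OF u' t] lift_pr[OF u' t] by metis
 obtain W where W: "openin X W" "ga t : W" "W <= V Int Z" "ALL c:W. s c = r c"
  using S_agree[OF *(1) Z(3)[rule_format, OF r(1)] *(2) Z(2)] *(5) r(2) by auto
 obtain W' where W': "openin X W'" "ga t : W'" "W' <= V' Int Z" "ALL c:W'. s' c = r' c"
  using S_agree[OF **(1) Z(3)[rule_format, OF r'(1)] **(2) Z(2)] **(5) r'(2) by auto
 obtain d where d: "d > 0" "ALL t':I. abs (t' - t) < d --> ga t' : W Int W'"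
  using pcontD(2)[OF ga t openin_Int[OF W(1) W'(1)]] W(2) W'(2) by blast
 show ?thesis
 proof (rule exI[of _ "min d (min e e')"], intro conjI ballI impI)
  fix t' assume t': "t' : I" "abs (t' - t) < min d (min e e')"
  hence "ga t' : W" "ga t' : W'" "u t' = s (ga t')" "u' t' = s' (ga t')" using d *(4) **(4) by auto
  hence "u t' = r (ga t')" "u' t' = r' (ga t')" "ga t' : Z" using W(3,4) W'(4) by auto
  thus "(u t' = u' t') = (u t = u' t)"
   using Z(5)[rule_format, OF r(1) r'(1)] r(2) r'(2) Z(2) by metis
 qed (use d *(3) **(3) in auto)
qed

text \<open>Agreement of two lifts, as a truth value depending on time, is locally constant by
  \<open>lift_local_agree\<close>, hence constant on an interval.\<close>

lemma lift_unique:
 assumes "pcont X I ga" "is_interval I" "lift I ga u" "lift I ga u'" "t0 : I" "u t0 = u' t0" "t : I"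
 shows "u t = u' t"
 using interval_local_const[OF assms(2,5,7), of "%t. u t = u' t"] lift_local_agree[OF assms(1,3,4)] assms(6) by simp

lemma lift_near_section:
 assumes ga: "pcont X I ga" and u: "lift I ga u" and t: "t : I" and s: "(V, s) : S" "ga t : V" "u t = s (ga t)"
 shows "EX e>0. ALL t':I. abs (t' - t) < e --> ga t' : V & u t' = s (ga t')"
proof -
 obtain V' s' e' where *: "(V', s') : S" "ga t : V'" "e' > 0" "ALL t':I. abs (t' - t) < e' --> ga t' : V' & u t' = s' (ga t')" "u t = s' (ga t)"
  using liftE[OF u t] .
 obtain W where W: "openin X W" "ga t : W" "W <= V Int V'" "ALL c:W. s c = s' c"
  using S_agree[OF s(1) *(1) s(2) *(2)] *(5) s(3) by auto
 obtain d where d: "d > 0" "ALL t':I. abs (t' - t) < d --> ga t' : W"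
  using pcontD(2)[OF ga t W(1,2)] by blast
 show ?thesis
  by (rule exI[of _ "min d e'"]) (use d *(3,4) W(3,4) in auto)
qed

lemma lift_section:
 assumes ga: "pcont X I ga" and s: "(V, s) : S" and sub: "!!t. t : I ==> ga t : V"
 shows "lift I ga (%t. s (ga t))"
 unfolding lift_def
 by (intro ballI exI[of _ V] exI[of _ s] exI[of _ 1]) (use s sub in auto)

text \<open>At the joining time a single section through the common value describes both halves, by
  \<open>lift_near_section\<close> applied to each.\<close>

lemma lift_join:
 assumes ga: "pcont X {a..c} ga" and u: "lift {a..b} ga u" and w: "lift {b..c} ga w" and eq: "u b = w b" and ab: "a <= b" "b <= c"
 shows "lift {a..c} ga (%t. if t <= b then u t else w t)"
 unfolding lift_def
proof
 fix t assume t: "t : {a..c}"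
 have ga1: "pcont X {a..b} ga" and ga2: "pcont X {b..c} ga" using path_cont_subset[OF ga] ab by auto
 have m: "(if t <= b then u t else w t) : T" "pr (if t <= b then u t else w t) = ga t"
  using lift_mem[OF u, of t] lift_mem[OF w, of t] lift_pr[OF u, of t] lift_pr[OF w, of t] t by auto
 obtain Z R where Z: "openin X Z" "ga t : Z" "ALL s:R. (Z, s) : S" "ALL ta:T. pr ta : Z --> (EX s:R. s (pr ta) = ta)"
  using S_even[OF pcontD(1)[OF ga t]] by blast
 obtain s where s: "s : R" "s (ga t) = (if t <= b then u t else w t)" using Z(2,4) m by metis
 note sS = Z(3)[rule_format, OF s(1)]
 have 1: "EX e>0. ALL t':{a..b}. abs (t' - t) < e --> ga t' : Z & u t' = s (ga t')"
 proof (cases "t <= b")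
  case True
  thus ?thesis using lift_near_section[OF ga1 u _ sS Z(2)] t s(2) by auto
 next
  case False
  thus ?thesis by (intro exI[of _ "t - b"]) auto
 qed
 have 2: "EX e>0. ALL t':{b..c}. abs (t' - t) < e --> ga t' : Z & w t' = s (ga t')"
 proof (cases "t >= b")
  case True
  hence "w t = s (ga t)" using s(2) eq by (cases "t = b") auto
  thus ?thesis using lift_near_section[OF ga2 w _ sS Z(2)] t True by auto
 next
  case False
  thus ?thesis by (intro exI[of _ "b - t"]) auto
 qed
 obtain e1 where e1: "e1 > 0" "ALL t':{a..b}. abs (t' - t) < e1 --> ga t' : Z & u t' = s (ga t')" using 1 by blast
 obtain e2 where e2: "e2 > 0" "ALL t':{b..c}. abs (t' - t) < e2 --> ga t' : Z & w t' = s (ga t')" using 2 by blast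
 show "EX V s e. (V, s) : S & ga t : V & e > 0 &
   (ALL t':{a..c}. abs (t' - t) < e --> ga t' : V & (if t' <= b then u t' else w t') = s (ga t'))"
  by (intro exI[of _ Z] exI[of _ s] exI[of _ "min e1 e2"]) (use sS Z(2) e1 e2 in auto)
qed

text \<open>Bisection: short intervals stay in an evenly stacked set, and adjacent lifts can be
  joined. The value may be prescribed at either end, because the next lemma starts at an interior
  time and goes in both directions.\<close>

lemma lift_exists_both:
 assumes ga: "pcont X {a..b} ga" and ab: "a <= b"
 shows "(ALL ta:T. pr ta = ga a --> (EX u. lift {a..b} ga u & u a = ta)) &
     (ALL ta:T. pr ta = ga b --> (EX u. lift {a..b} ga u & u b = ta))"
proof -
 define P where "P c d <-> a <= c & d <= b --> (ALL ta:T. pr ta = ga c --> (EX u. lift {c..d} ga u & u c = ta)) &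
     (ALL ta:T. pr ta = ga d --> (EX u. lift {c..d} ga u & u d = ta))" for c d
 have "P a b"
  using ab
 proof (induct rule: Bolzano)
  case (trans c d f)
  show ?case
   unfolding P_def
  proof (intro impI conjI ballI)
   assume cf: "a <= c & f <= b"
   have ga': "pcont X {c..f} ga" using path_cont_subset[OF ga] cf by auto
   have 1: "(ALL ta:T. pr ta = ga c --> (EX u. lift {c..d} ga u & u c = ta))" "(ALL ta:T. pr ta = ga d --> (EX u. lift {c..d} ga u & u d = ta))"
    using trans(1,4) cf trans(3) by (auto simp: P_def)
   have 2: "(ALL ta:T. pr ta = ga d --> (EX u. lift {d..f} ga u & u d = ta))" "(ALL ta:T. pr ta = ga f --> (EX u. lift {d..f} ga u & u f = ta))"
    using trans(2,3) cf trans(4) by (auto simp: P_def)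
   {
    fix ta assume "ta : T" "pr ta = ga c"
    then obtain u where u: "lift {c..d} ga u" "u c = ta" using 1 by blast
    have "u d : T" "pr (u d) = ga d" using lift_mem[OF u(1), of d] lift_pr[OF u(1), of d] trans(3) by auto
    then obtain w where w: "lift {d..f} ga w" "w d = u d" using 2 by blast
    have "lift {c..f} ga (%t. if t <= d then u t else w t)"
     by (rule lift_join[OF ga' u(1) w(1)]) (use w trans(3,4) in auto)
    thus "EX u. lift {c..f} ga u & u c = ta"
     by (intro exI[of _ "%t. if t <= d then u t else w t"]) (use u(2) trans(3) in auto)
   next
    fix ta assume "ta : T" "pr ta = ga f"
    then obtain w where w: "lift {d..f} ga w" "w f = ta" using 2 by blast
    have "w d : T" "pr (w d) = ga d" using lift_mem[OF w(1), of d] lift_pr[OF w(1), of d] trans(4) by auto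
    then obtain u where u: "lift {c..d} ga u" "u d = w d" using 1 by blast
    have "lift {c..f} ga (%t. if t <= d then u t else w t)"
     by (rule lift_join[OF ga' u(1) w(1)]) (use u trans(3,4) in auto)
    thus "EX u. lift {c..f} ga u & u f = ta"
     by (intro exI[of _ "%t. if t <= d then u t else w t"]) (use u(2) w(2) trans(4) in auto)
   }
  qed
 next
  case (local x)
  have x: "x : {a..b}" using local by simp
  obtain Z R where Z: "openin X Z" "ga x : Z" "ALL s:R. (Z, s) : S" "ALL ta:T. pr ta : Z --> (EX s:R. s (pr ta) = ta)"
   using S_even[OF pcontD(1)[OF ga x]] by blast
  obtain d where d: "d > 0" "ALL t':{a..b}. abs (t' - x) < d --> ga t' : Z"
   using pcontD(2)[OF ga x Z(1,2)] by blast
  have "P c f" if cf: "c <= x & x <= f & f - c < d" for c f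
   unfolding P_def
  proof (intro impI conjI ballI)
   assume ac: "a <= c & f <= b"
   have ga': "pcont X {c..f} ga" using path_cont_subset[OF ga] ac by auto
   have inZ: "ga t : Z" if "t : {c..f}" for t using d that cf ac by auto
   have ex: "EX u. lift {c..f} ga u & u t = ta" if ta: "ta : T" "pr ta = ga t" and t: "t : {c..f}" for ta t
   proof -
    have "pr ta : Z" using inZ[OF t] ta(2) by simp
    then obtain s where s: "s : R" "s (ga t) = ta" using bspec[OF Z(4) ta(1)] ta(2) by auto
    have "lift {c..f} ga (%t. s (ga t))"
     by (rule lift_section[OF ga' bspec[OF Z(3) s(1)] inZ])
    with s(2) show ?thesis by (intro exI[of _ "%t. s (ga t)"]) simp
   qed
   show "EX u. lift {c..f} ga u & u c = ta" if "ta : T" "pr ta = ga c" for ta using ex[OF that] cf by auto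
   show "EX u. lift {c..f} ga u & u f = ta" if "ta : T" "pr ta = ga f" for ta using ex[OF that] cf by auto
  qed
  thus ?case using d(1) by blast
 qed
 thus ?thesis by (simp add: P_def)
qed

lemma lift_exists_compact:
 assumes ga: "pcont X {a..b} ga" and c: "a <= c" "c <= b" and ta: "ta : T" "pr ta = ga c"
 shows "EX u. lift {a..b} ga u & u c = ta"
proof -
 have ga1: "pcont X {a..c} ga" and ga2: "pcont X {c..b} ga" using path_cont_subset[OF ga] c by auto
 obtain u where u: "lift {a..c} ga u" "u c = ta" using lift_exists_both[OF ga1 c(1)] ta by blast
 obtain w where w: "lift {c..b} ga w" "w c = ta" using lift_exists_both[OF ga2 c(2)] ta by blast
 have "lift {a..b} ga (%t. if t <= c then u t else w t)"
  by (rule lift_join[OF ga u(1) w(1)]) (use u w c in auto)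
 thus ?thesis by (intro exI[of _ "%t. if t <= c then u t else w t"]) (use u in auto)
qed

text \<open>Lifts over compact subintervals containing \<open>c\<close> agree by uniqueness, so the
  value at \<open>t\<close> can be taken from the interval spanned by \<open>t\<close> and
  \<open>c\<close>.\<close>

lemma lift_exists:
 assumes ga: "pcont X I ga" and I: "is_interval I" and c: "c : I" and ta: "ta : T" "pr ta = ga c"
 shows "EX u. lift I ga u & u c = ta"
proof -
 have sub: "{a..b} <= I" if "a : I" "b : I" for a b
  by (rule subsetI) (use mem_is_interval_1_I[OF I that] in simp)
 have ex: "EX u. lift {a..b} ga u & u c = ta" if "a : I" "b : I" "a <= c" "c <= b" for a b
  by (rule lift_exists_compact[OF path_cont_subset[OF ga sub] _ _ ta]) (use that in auto)
 define w where "w a b = (SOME u. lift {a..b} ga u & u c = ta)" for a b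
 have w: "lift {a..b} ga (w a b)" "w a b c = ta" if "a : I" "b : I" "a <= c" "c <= b" for a b
  using someI_ex[OF ex[OF that]] unfolding w_def by auto
 define u where "u t = w (min t c) (max t c) t" for t
 have uw: "u t = w a b t" if ab: "a : I" "b : I" "a <= c" "c <= b" and t: "t : {a..b}" for a b t
 proof -
  have m: "min t c : I" "max t c : I" using c t sub[OF ab(1,2)] by (auto simp: min_def max_def)
  have s: "{min t c..max t c} <= {a..b}" using ab t by auto
  show ?thesis
   unfolding u_def
   by (rule lift_unique[OF path_cont_subset[OF ga sub[OF m]] is_interval_cc w(1)[OF m] lift_subset[OF w(1)[OF ab] s], of c])
     (use w(2) m ab in auto)
 qed
 have "lift I ga u"
  unfolding lift_def
 proof
  fix t assume t: "t : I"
  \<comment> \<open>The compact interval must contain a neighbourhood of \<open>t\<close> relative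
    to \<open>I\<close>. Take a point of \<open>I\<close> to the left of \<open>t\<close> and
    \<open>c\<close>, or \<open>min t c\<close> itself when it is the left end of \<open>I\<close>;
    the right side is analogous.\<close>
  obtain a where a: "a : I" "a <= c" "a <= t" "EX d>0. ALL t':I. t' > t - d --> a <= t'"
  proof (cases "EX x:I. x < min t c")
   case True
   then obtain x where x: "x : I" "x < min t c" by blast
   have d: "EX d>0. ALL t':I. t' > t - d --> x <= t'" by (rule exI[of _ "t - x"]) (use x in auto)
   show ?thesis by (rule that[OF x(1) _ _ d]) (use x in auto)
  next
   case False
   hence "min t c <= t'" if "t' : I" for t' using that by force
   hence d: "EX d>0. ALL t':I. t' > t - d --> min t c <= t'" by (intro exI[of _ 1]) auto
   have "min t c : I" using c t by (simp add: min_def)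
   thus ?thesis by (rule that[OF _ _ _ d]) auto
  qed
  obtain b where b: "b : I" "c <= b" "t <= b" "EX d>0. ALL t':I. t' < t + d --> t' <= b"
  proof (cases "EX x:I. x > max t c")
   case True
   then obtain x where x: "x : I" "x > max t c" by blast
   have d: "EX d>0. ALL t':I. t' < t + d --> t' <= x" by (rule exI[of _ "x - t"]) (use x in auto)
   show ?thesis by (rule that[OF x(1) _ _ d]) (use x in auto)
  next
   case False
   hence "t' <= max t c" if "t' : I" for t' using that by force
   hence d: "EX d>0. ALL t':I. t' < t + d --> t' <= max t c" by (intro exI[of _ 1]) auto
   have "max t c : I" using c t by (simp add: max_def)
   thus ?thesis by (rule that[OF _ _ _ d]) auto
  qed
  obtain d1 where d1: "d1 > 0" "ALL t':I. t' > t - d1 --> a <= t'" using a(4) by blast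
  obtain d2 where d2: "d2 > 0" "ALL t':I. t' < t + d2 --> t' <= b" using b(4) by blast
  have tab: "t : {a..b}" using a b by auto
  obtain V s e where *: "(V, s) : S" "ga t : V" "e > 0" "ALL t':{a..b}. abs (t' - t) < e --> ga t' : V & w a b t' = s (ga t')" "w a b t = s (ga t)"
   using liftE[OF w(1)[OF a(1) b(1) a(2) b(2)] tab] .
  show "EX V s e. (V, s) : S & ga t : V & e > 0 & (ALL t':I. abs (t' - t) < e --> ga t' : V & u t' = s (ga t'))"
  proof (intro exI[of _ V] exI[of _ s] exI[of _ "min e (min d1 d2)"] conjI ballI impI)
   fix t' assume t': "t' : I" "abs (t' - t) < min e (min d1 d2)"
   hence "t' : {a..b}" using d1 d2 by (auto simp: abs_if split: if_splits)
   thus "ga t' : V" "u t' = s (ga t')" using *(4) t' uw[OF a(1) b(1) a(2) b(2)] by auto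
  qed (use * d1 d2 in auto)
 qed
 moreover have "u c = ta" using uw[OF c c] w(2)[OF c c] by simp
 ultimately show ?thesis by blast
qed

end

context sheets
begin

lemma lift_reparam:
 assumes u: "lift I ga u" and h: "continuous_on K h" "h ` K <= I"
 shows "lift K (%t. ga (h t)) (%t. u (h t))"
 unfolding lift_def
proof
 fix t assume t: "t : K"
 hence ht: "h t : I" using h(2) by blast
 obtain V s e where *: "(V, s) : S" "ga (h t) : V" "e > 0"
  "ALL t':I. abs (t' - h t) < e --> ga t' : V & u t' = s (ga t')" "u (h t) = s (ga (h t))"
  using liftE[OF u ht] .
 obtain d where d: "d > 0" "ALL x':K. dist x' t < d --> dist (h x') (h t) < e"
  using h(1) t *(3) unfolding continuous_on_iff by metis
 show "EX V s e. (V, s) : S & ga (h t) : V & e > 0 &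
   (ALL t':K. abs (t' - t) < e --> ga (h t') : V & u (h t') = s (ga (h t')))"
 proof (intro exI[of _ V] exI[of _ s] exI[of _ d] conjI ballI impI)
  fix t' assume t': "t' : K" "abs (t' - t) < d"
  hence "abs (h t' - h t) < e" "h t' : I" using d(2) h(2) by (auto simp: dist_real_def)
  thus "ga (h t') : V" "u (h t') = s (ga (h t'))" using *(4) by auto
 qed (use * d in auto)
qed

end

section \<open>Coverings\<close>

definition csec :: "('c, 'e::euclidean_space) manifold => ('a, 'e) manifold => ('c => 'a) => ('a set \<times> ('a => 'c)) set" where
 "csec C M q = {(V, inv_into U q) | U V. opn M V & opn C U & bij_betw q U V &
   (ALL y:V. smooth_at M C y (inv_into U q))}"

lemma cov_sectionE:
 assumes "(V, s) : csec C M q"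
 obtains U where "s = inv_into U q" "opn M V" "opn C U" "bij_betw q U V"
  "!!y. y : V ==> smooth_at M C y s" "!!y. y : V ==> s y : U & q (s y) = y" "!!x. x : U ==> q x : V & s (q x) = x"
proof -
 obtain U where U: "s = inv_into U q" "opn M V" "opn C U" "bij_betw q U V" "ALL y:V. smooth_at M C y (inv_into U q)"
  using assms unfolding csec_def by blast
 have 1: "s y : U & q (s y) = y" if "y : V" for y
  using U(4) that unfolding U(1) bij_betw_def by (auto intro: inv_into_into f_inv_into_f)
 have 2: "q x : V & s (q x) = x" if "x : U" for x
  using U(4) that unfolding U(1) bij_betw_def by (auto intro: inv_into_f_f)
 show ?thesis by (rule that[OF U(1-4)]) (use U(1,5) 1 2 in auto)
qed

lemma covD:
 assumes "smooth_covering C M q"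
 shows "smooth_map C M q" "q ` pts C = pts M"
  "p : pts M ==> EX V \<U>. opn M V & p : V &
    \<Union>\<U> = pts C Int q -` V & pairwise disjnt \<U> &
    (ALL U:\<U>. opn C U & bij_betw q U V & (ALL y:V. smooth_at M C y (inv_into U q)))"
 using assms by (simp_all add: smooth_covering_def)

context
 fixes C :: "('c, 'e::euclidean_space) manifold" and M :: "('a, 'e) manifold" and q :: "'c => 'a"
 assumes C: "mfd C" and M: "mfd M" and cov: "smooth_covering C M q"
begin

lemma covering_sheets: "sheets (mtop M) (pts C) q (csec C M q)"
proof
 show "opn M V" if "(V, s) : csec C M q" for V s
  using that by (rule cov_sectionE)
 show "s b : pts C & q (s b) = b" if s: "(V, s) : csec C M q" and b: "b : V" for V s b
 proof -
  obtain U where U: "s = inv_into U q" "opn M V" "opn C U" "bij_betw q U V"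
   "!!y. y : V ==> smooth_at M C y s" "!!y. y : V ==> s y : U & q (s y) = y" "!!x. x : U ==> q x : V & s (q x) = x"
   by (rule cov_sectionE[OF s]) (rule that)
  show ?thesis using U(6)[OF b] subsetD[OF openin_subset[OF U(3)]] by simp
 qed
 show "EX W. opn M W & b : W & W <= V Int V' & (ALL c:W. s c = s' c)"
  if s: "(V, s) : csec C M q" and s': "(V', s') : csec C M q" and b: "b : V" "b : V'" "s b = s' b" for V s V' s' b
 proof -
  obtain U where U: "s = inv_into U q" "opn M V" "opn C U" "bij_betw q U V"
   "!!y. y : V ==> smooth_at M C y s" "!!y. y : V ==> s y : U & q (s y) = y" "!!x. x : U ==> q x : V & s (q x) = x"
   by (rule cov_sectionE[OF s]) (rule that)
  obtain U' where U': "s' = inv_into U' q" "opn M V'" "opn C U'" "bij_betw q U' V'"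
   "!!y. y : V' ==> smooth_at M C y s'" "!!y. y : V' ==> s' y : U' & q (s' y) = y" "!!x. x : U' ==> q x : V' & s' (q x) = x"
   by (rule cov_sectionE[OF s']) (rule that)
  have "near M b (%c. s c : U')"
   by (rule sa_continuous[OF M C U(5)[OF b(1)] U'(3)]) (use U'(6)[OF b(2)] b(3) in simp)
  then obtain W where W: "opn M W" "b : W" "!!c. c : W ==> s c : U'" by (rule nearbyE) (rule that)
  have "s c = s' c" if "c : W Int V Int V'" for c
   using U'(7)[OF W(3), of c] U(6)[of c] that by simp
  thus ?thesis
   by (intro exI[of _ "W Int V Int V'"]) (use W b U(2) U'(2) in auto)
 qed
 show "EX V R. opn M V & b : V & (ALL s:R. (V, s) : csec C M q) &
    (ALL ta:pts C. q ta : V --> (EX s:R. s (q ta) = ta)) &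
    (ALL s:R. ALL s':R. ALL c:V. s c = s' c --> (ALL b:V. s b = s' b))" if b: "b : topspace (mtop M)" for b
 proof -
  obtain V \<U> where V: "opn M V" "b : V" "\<Union>\<U> = pts C Int q -` V" "pairwise disjnt \<U>"
   "ALL U:\<U>. opn C U & bij_betw q U V & (ALL y:V. smooth_at M C y (inv_into U q))"
   using covD(3)[OF cov b] by (elim exE conjE) (rule that)
  show ?thesis
  proof (rule exI[of _ V], rule exI[of _ "(%U. inv_into U q) ` \<U>"], intro conjI ballI impI)
   show "opn M V" "b : V" using V by auto
   show "(V, s) : csec C M q" if "s : (%U. inv_into U q) ` \<U>" for s
    using that V(1,5) unfolding csec_def by auto
   fix ta assume ta: "ta : pts C" "q ta : V"
   then obtain U where U: "U : \<U>" "ta : U" using V(3) by blast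
   hence "inv_into U q (q ta) = ta" using V(5) by (auto simp: bij_betw_def)
   thus "EX s:(%U. inv_into U q) ` \<U>. s (q ta) = ta" using U(1) by blast
  next
   fix s s' c d assume s: "s : (%U. inv_into U q) ` \<U>" "s' : (%U. inv_into U q) ` \<U>" and c: "c : V" "s c = s' c" and d: "d : V"
   obtain U U' where U: "U : \<U>" "s = inv_into U q" "U' : \<U>" "s' = inv_into U' q" using s by blast
   have "s c : U" "s' c : U'" using U V(5) c by (auto simp: bij_betw_def intro: inv_into_into)
   hence "~ disjnt U U'" using c(2) by (auto simp: disjnt_def)
   hence "U = U'" using pairwiseD[OF V(4) U(1,3)] by blast
   thus "s d = s' d" using U by simp
  qed
 qed
qed

lemma csec_smooth: "(V, s) : csec C M q ==> y : V ==> smooth_at M C y s"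
 by (erule cov_sectionE) simp

lemma csec_open: "(V, s) : csec C M q ==> opn M V"
 by (erule cov_sectionE) simp

lemma csec_right: "(V, s) : csec C M q ==> y : V ==> q (s y) = y"
 by (erule cov_sectionE) simp

lemma csec_through:
 assumes "x : pts C"
 obtains V s where "(V, s) : csec C M q" "q x : V" "s (q x) = x"
proof -
 interpret S: sheets "mtop M" "pts C" q "csec C M q" by (rule covering_sheets)
 have qx: "q x : pts M" using covD(2)[OF cov] assms by blast
 obtain V R where V: "q x : V" "ALL s:R. (V, s) : csec C M q" "ALL ta:pts C. q ta : V --> (EX s:R. s (q ta) = ta)"
  using S.S_even[OF qx] by (elim exE conjE) (rule that)
 then obtain s where "s : R" "s (q x) = x" using assms by blast
 with V show ?thesis using that[of V s] by simp
qed

lemma csec_near: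
 assumes s: "(V, s) : csec C M q" and x: "x : pts C" "q x : V" "s (q x) = x"
 shows "near C x (%w. q w : V & s (q w) = w)"
proof -
 obtain U where U: "s = inv_into U q" "opn M V" "opn C U" "bij_betw q U V"
  "!!y. y : V ==> smooth_at M C y s" "!!y. y : V ==> s y : U & q (s y) = y" "!!x. x : U ==> q x : V & s (q x) = x"
  by (rule cov_sectionE[OF s]) (rule that)
 have "x : U" using U(6)[OF x(2)] x(3) by simp
 from near_open[OF U(3) this] show ?thesis by (rule near_mono) (rule U(7))
qed

text \<open>By continuity \<open>f\<close> stays in one sheet near \<open>p\<close>, where it is a
  smooth local section applied to the projection of \<open>f\<close>.\<close>

lemma sa_into_cover:
 assumes N: "mfd N" and fp: "f p : pts C" and cont: "!!W. opn C W ==> f p : W ==> near N p (%w. f w : W)"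
  and sm: "smooth_at N M p (%w. q (f w))"
 shows "smooth_at N C p f"
proof -
 obtain V s where s: "(V, s) : csec C M q" "q (f p) : V" "s (q (f p)) = f p"
  using csec_through[OF fp] .
 obtain W where W: "opn C W" "f p : W" "!!w. w : W ==> q w : V & s (q w) = w"
  using csec_near[OF s(1) fp s(2,3)] by (rule nearbyE) (rule that)
 show ?thesis
  by (rule sa_cong[OF N sa_compose[OF N M C sm csec_smooth[OF s(1,2)]]])
    (rule near_mono[OF cont[OF W(1,2)]], use W(3) in auto)
qed

end

subsection \<open>Lifting isotopies\<close>

lemma near_prod:
 assumes "near (prod_mfd M N) (p, q) P"
 obtains U V where "opn M U" "p : U" "opn N V" "q : V" "!!a b. a : U ==> b : V ==> P (a, b)"
proof -
 obtain W where W: "openin (prod_topology (mtop M) (mtop N)) W" "(p, q) : W" "!!z. z : W ==> P z"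
  using assms by (auto elim!: nearbyE)
 obtain U V where "opn M U" "opn N V" "p : U" "q : V" "U \<times> V <= W"
  using W(1)[unfolded openin_prod_topology_alt, rule_format, OF W(2)] by blast
 thus ?thesis using that[of U V] W(3) by blast
qed

lemma near_prod_real:
 assumes "near (prod_mfd eucl N) (t :: real, q) P"
 obtains e V where "e > 0" "opn N V" "q : V" "!!t' b. abs (t' - t) < e ==> b : V ==> P (t', b)"
proof -
 obtain U V where U: "openin (mtop (eucl :: (real, real) manifold)) U" "t : U" "opn N V" "q : V"
  "!!a b. a : U ==> b : V ==> P (a, b)"
  using assms by (rule near_prod) (rule that)
 hence "open U" by simp
 then obtain e where e: "e > 0" "ALL y. dist y t < e --> y : U" using U(2) open_dist by metis
 show ?thesis by (rule that[OF e(1) U(3,4)]) (use e(2) U(5) in "auto simp: dist_real_def")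
qed

lemma isotopy_extension:
 assumes "smooth_isotopy J M ph" "t : J" "p : pts M"
 obtains F where "smooth_at (prod_mfd eucl M) M (t, p) F"
  "near (prod_mfd eucl M) (t, p) (%z. fst z : J & snd z : pts M --> F z = ph (fst z) (snd z))" "F (t, p) = ph t p"
proof -
 have "smooth_map_on (prod_mfd eucl M) (J \<times> pts M) M (%(t, p). ph t p)"
  using assms(1) by (simp add: smooth_isotopy_def)
 then obtain F where F: "smooth_at (prod_mfd eucl M) M (t, p) F"
  "near (prod_mfd eucl M) (t, p) (%q. q : J \<times> pts M --> F q = (case q of (t, p) => ph t p))"
  using assms(2,3) unfolding smooth_map_on_def by blast
 have n: "near (prod_mfd eucl M) (t, p) (%z. fst z : J & snd z : pts M --> F z = ph (fst z) (snd z))"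
  by (rule near_mono[OF F(2)]) auto
 show ?thesis by (rule that[OF F(1) n]) (use near_self[OF n] assms in simp)
qed

lemma isotopy_continuous:
 assumes M: "mfd M" and ph: "smooth_isotopy J M ph" and t: "t : J" and p: "p : pts M" and W: "opn M W" "ph t p : W"
 obtains e V where "e > 0" "opn M V" "p : V" "!!t' b. t' : J ==> abs (t' - t) < e ==> b : V ==> ph t' b : W"
proof -
 obtain F where F: "smooth_at (prod_mfd eucl M) M (t, p) F"
  "near (prod_mfd eucl M) (t, p) (%z. fst z : J & snd z : pts M --> F z = ph (fst z) (snd z))" "F (t, p) = ph t p"
  using isotopy_extension[OF ph t p] .
 have "near (prod_mfd eucl M) (t, p) (%z. F z : W)"
  by (rule sa_continuous[OF prod_m[OF euclid_m M] M F(1) W(1)]) (use F(3) W(2) in simp)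
 from near_conj[OF this F(2)] obtain e V where e: "e > 0" "opn M V" "p : V"
  "!!t' b. abs (t' - t) < e ==> b : V ==> F (t', b) : W & (fst (t', b) : J & snd (t', b) : pts M --> F (t', b) = ph (fst (t', b)) (snd (t', b)))"
  by (rule near_prod_real) (rule that)
 show ?thesis
 proof (rule that[OF e(1-3)])
  fix t' b assume "t' : J" "abs (t' - t) < e" "b : V"
  thus "ph t' b : W" using e(4)[of t' b] openin_subset[OF e(2)] by auto
 qed
qed

lemma isotopyD:
 assumes "smooth_isotopy J M ph"
 shows "t : J ==> diffeo M M (ph t)" "p : pts M ==> ph 0 p = p"
 using assms by (simp_all add: smooth_isotopy_def)

lemma diffeoD:
 assumes "diffeo M N f"
 shows "smooth_map M N f" "bij_betw f (pts M) (pts N)" "smooth_map N M (inv_into (pts M) f)"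
 using assms by (simp_all add: diffeo_def)

lemma isotopy_path:
 assumes M: "mfd M" and ph: "smooth_isotopy J M ph" and p: "p : pts M"
 shows "pcont (mtop M) J (%t. ph t p)"
 unfolding pcont_def
proof (intro ballI conjI allI impI)
 fix t assume t: "t : J"
 show "ph t p : pts M" using diffeoD(2)[OF isotopyD(1)[OF ph t]] p by (auto simp: bij_betw_def)
 fix W assume W: "opn M W & ph t p : W"
 obtain e V where e: "e > 0" "opn M V" "p : V" "!!t' b. t' : J ==> abs (t' - t) < e ==> b : V ==> ph t' b : W"
  by (rule isotopy_continuous[OF M ph t p]) (use W that in auto)
 thus "EX e>0. ALL t':J. abs (t' - t) < e --> ph t' p : W" by blast
qed

text \<open>The path of each point is lifted separately, which settles existence but not regularity
  in the point. For that, one local section has to describe the lifts of all nearby points at once.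
  Bijectivity at time \<open>t\<close> comes from lifting along the same paths back to time
  0.\<close>

lemma isotopy_lift:
 assumes C: "mfd C" and M: "mfd M" and cov: "smooth_covering C M q"
  and J: "is_interval J" "0 : J" and et: "smooth_isotopy J M et"
 shows "EX ps. smooth_isotopy J C ps & (ALL t:J. ALL z:pts C. q (ps t z) = et t (q z))"
proof -
 interpret S: sheets "mtop M" "pts C" q "csec C M q" by (rule covering_sheets[OF C M cov])
 note qs = covD(1)[OF cov]
 have qpts: "q z : pts M" if "z : pts C" for z using covD(2)[OF cov] that by blast
 have path: "pcont (mtop M) J (%t. et t (q z))" if "z : pts C" for z
  by (rule isotopy_path[OF M et qpts[OF that]])
 define ps0 where "ps0 z = (SOME u. S.lift J (%t. et t (q z)) u & u 0 = z)" for z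
 have ps0: "S.lift J (%t. et t (q z)) (ps0 z) & ps0 z 0 = z" if z: "z : pts C" for z
 proof -
  have "EX u. S.lift J (%t. et t (q z)) u & u 0 = z"
   by (rule S.lift_exists[OF path[OF z] J z]) (use isotopyD(2)[OF et qpts[OF z]] in simp)
  thus ?thesis unfolding ps0_def by (rule someI_ex)
 qed
 define ps where "ps t z = ps0 z t" for t z
 have L: "S.lift J (%t. et t (q z)) (%t. ps t z)" and zero: "ps 0 z = z" if "z : pts C" for z
  using ps0[OF that] by (simp_all add: ps_def)
 have pspts: "ps t z : pts C" and qps: "q (ps t z) = et t (q z)" if "t : J" "z : pts C" for t z
  using S.lift_mem[OF L[OF that(2)] that(1)] S.lift_pr[OF L[OF that(2)] that(1)] by auto
 \<comment> \<open>Near time \<open>t\<close>, and for all points near \<open>z0\<close>, the lifts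
   are one section \<open>s\<close> applied to the isotopy below. Joint smoothness follows from
   this; it is spread over \<open>J\<close> as a locally constant property of
   \<open>t\<close>.\<close>
 define Q where "Q z0 t <-> (EX V s e W. (V, s) : csec C M q & e > 0 & opn C W & z0 : W &
   (ALL t':J. abs (t' - t) < e --> (ALL z:W. et t' (q z) : V & ps t' z = s (et t' (q z)))))" for z0 t
 have jc: "EX e>0. EX W. opn C W & z0 : W & (ALL t':J. abs (t' - a) < e --> (ALL z:W. et t' (q z) : V))"
  if z0: "z0 : pts C" and a: "a : J" and V: "opn M V" "et a (q z0) : V" for z0 a V
 proof -
  obtain e Y where e: "e > 0" "opn M Y" "q z0 : Y" "!!t' b. t' : J ==> abs (t' - a) < e ==> b : Y ==> et t' b : V"
   by (rule isotopy_continuous[OF M et a qpts[OF z0] V]) (rule that)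
  obtain W where W: "opn C W" "z0 : W" "!!z. z : W ==> q z : Y"
   using sa_continuous[OF C M smD[OF qs z0] e(2,3)] by (rule nearbyE) (rule that)
  show ?thesis using e W by blast
 qed
 \<comment> \<open>If \<open>s\<close> describes the lifts of all nearby points at a single time
   \<open>a'\<close>, uniqueness of lifts extends this to the window around \<open>a\<close> during
   which the paths stay in \<open>V\<close>.\<close>
 have spread: "Q z0 a''"
  if z0: "z0 : pts C" and s: "(V, s) : csec C M q" and W: "opn C W" "z0 : W"
   and eW: "ALL t':J. abs (t' - a) < e --> (ALL z:W. et t' (q z) : V)"
   and a': "a' : J" "abs (a' - a) < e" and W': "opn C W'" "z0 : W'" "ALL z:W'. ps a' z = s (et a' (q z))"
   and a'': "a'' : J" "abs (a'' - a) < e" for z0 V s W a e a' W' a''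
 proof -
  define I where "I = J Int {a - e<..<a + e}"
  have I: "is_interval I" unfolding I_def by (intro is_interval_Int J(1) is_interval_oo)
  have eq: "ps t z = s (et t (q z))" if t: "t : I" and z: "z : W Int W'" for t z
  proof -
   have zC: "z : pts C" using z openin_subset[OF W(1)] by blast
   have p: "pcont (mtop M) I (%t. et t (q z))" by (rule path_cont_subset[OF path[OF zC]]) (auto simp: I_def)
   have "S.lift I (%t. et t (q z)) (%t. s (et t (q z)))"
    by (rule S.lift_section[OF p s]) (use eW z in "auto simp: I_def abs_if")
   moreover have "S.lift I (%t. et t (q z)) (%t. ps t z)"
    by (rule S.lift_subset[OF L[OF zC]]) (auto simp: I_def)
   ultimately show ?thesis
    using S.lift_unique[OF p I, of "%t. ps t z" "%t. s (et t (q z))" a' t] t z W'(3) a' by (auto simp: I_def abs_if split: if_splits)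
  qed
  show "Q z0 a''"
   unfolding Q_def
  proof (intro exI[of _ V] exI[of _ s] exI[of _ "e - abs (a'' - a)"] exI[of _ "W Int W'"] conjI ballI impI)
   fix t' z assume t': "t' : J" "abs (t' - a'') < e - abs (a'' - a)" and z: "z : W Int W'"
   hence t1: "abs (t' - a) < e" by linarith
   hence "t' : I" using t'(1) by (auto simp: I_def abs_if split: if_splits)
   from eq[OF this z] show "ps t' z = s (et t' (q z))" .
   show "et t' (q z) : V" using eW t'(1) t1 z by blast
  qed (use s a'' W W' in auto)
 qed
 have Qall: "Q z0 t" if z0: "z0 : pts C" and t: "t : J" for z0 t
 proof -
  have Q0: "Q z0 0"
  proof -
   obtain V s where s: "(V, s) : csec C M q" "q z0 : V" "s (q z0) = z0"
    using csec_through[OF C M cov z0] .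
   obtain W' where W': "opn C W'" "z0 : W'" "!!w. w : W' ==> q w : V & s (q w) = w"
    using csec_near[OF C M cov s(1) z0 s(2,3)] by (rule nearbyE) (rule that)
   have "et 0 (q z0) : V" using isotopyD(2)[OF et qpts[OF z0]] s(2) by simp
   from jc[OF z0 J(2) csec_open[OF C M cov s(1)] this] obtain e W where
    e: "e > 0" "opn C W" "z0 : W" "ALL t':J. abs (t' - 0) < e --> (ALL z:W. et t' (q z) : V)" by blast
   have "ps 0 z = s (et 0 (q z))" if "z : W'" for z
   proof -
    have zC: "z : pts C" using that openin_subset[OF W'(1)] by blast
    show ?thesis using zero[OF zC] isotopyD(2)[OF et qpts[OF zC]] W'(3)[OF that] by simp
   qed
   thus ?thesis
    using spread[OF z0 s(1) e(2,3,4) J(2) _ W'(1,2) _ J(2)] e(1) by simp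
  qed
  have "EX e>0. ALL a':J. abs (a' - a) < e --> Q z0 a' = Q z0 a" if a: "a : J" for a
  proof -
   obtain V s where s: "(V, s) : csec C M q" "q (ps a z0) : V" "s (q (ps a z0)) = ps a z0"
    using csec_through[OF C M cov pspts[OF a z0]] .
   note qa = qps[OF a z0]
   from jc[OF z0 a csec_open[OF C M cov s(1)]] s(2) qa obtain e W where
    e: "e > 0" "opn C W" "z0 : W" "ALL t':J. abs (t' - a) < e --> (ALL z:W. et t' (q z) : V)" by auto
   have key: "Q z0 a''" if a': "a' : J" "abs (a' - a) < e" "Q z0 a'" and a'': "a'' : J" "abs (a'' - a) < e" for a' a''
   proof -
    obtain V' s' e' W' where Q': "(V', s') : csec C M q" "e' > 0" "opn C W'" "z0 : W'"
     "ALL t':J. abs (t' - a') < e' --> (ALL z:W'. et t' (q z) : V' & ps t' z = s' (et t' (q z)))"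
     using a'(3) unfolding Q_def by blast
    have Q1: "et a' (q z) : V'" "ps a' z = s' (et a' (q z))" if "z : W'" for z using Q'(2,5) a'(1) that by auto
    define I where "I = J Int {a - e<..<a + e}"
    have I: "is_interval I" unfolding I_def by (intro is_interval_Int J(1) is_interval_oo)
    have p: "pcont (mtop M) I (%t. et t (q z0))" by (rule path_cont_subset[OF path[OF z0]]) (auto simp: I_def)
    have "S.lift I (%t. et t (q z0)) (%t. s (et t (q z0)))"
     by (rule S.lift_section[OF p s(1)]) (use e in "auto simp: I_def abs_if")
    moreover have "S.lift I (%t. et t (q z0)) (%t. ps t z0)"
     by (rule S.lift_subset[OF L[OF z0]]) (auto simp: I_def)
    ultimately have "ps a' z0 = s (et a' (q z0))"
     using S.lift_unique[OF p I, of "%t. ps t z0" "%t. s (et t (q z0))" a a'] s(3) qa a e(1) a' by (auto simp: I_def abs_if split: if_splits)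
    hence "s (et a' (q z0)) = s' (et a' (q z0))" using Q1[OF Q'(4)] by simp
    moreover have "et a' (q z0) : V" using e a' by blast
    ultimately obtain Y where Y: "opn M Y" "et a' (q z0) : Y" "ALL c:Y. s c = s' c"
     using S.S_agree[OF s(1) Q'(1)] Q1(1)[OF Q'(4)] by blast
    obtain e1 W1 where W1: "e1 > 0" "opn C W1" "z0 : W1" "ALL t':J. abs (t' - a') < e1 --> (ALL z:W1. et t' (q z) : Y)"
     using jc[OF z0 a'(1) Y(1,2)] by blast
    show ?thesis
    proof (rule spread[OF z0 s(1) e(2,3,4) a'(1,2) _ _ _ a''])
     show "opn C (W' Int W1)" "z0 : W' Int W1" using Q' W1 by auto
     show "ALL z:W' Int W1. ps a' z = s (et a' (q z))" using Q1(2) W1(1,4) Y(3) a'(1) by auto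
    qed
   qed
   show ?thesis
   proof (intro exI[of _ e] conjI ballI impI)
    fix a' assume "a' : J" "abs (a' - a) < e"
    thus "Q z0 a' = Q z0 a" using key[of a' a] key[of a a'] a e(1) by (intro iffI) simp_all
   qed (rule e(1))
  qed
  from interval_local_const[OF J(1,2) t, of "Q z0", OF this] Q0 show ?thesis by simp
 qed
 have LF: "EX V s e W. (V, s) : csec C M q & e > 0 & opn C W & z0 : W &
   (ALL t':J. abs (t' - t) < e --> (ALL z:W. et t' (q z) : V & ps t' z = s (et t' (q z))))" if "z0 : pts C" "t : J" for z0 t
  using Qall[OF that] unfolding Q_def .
 have sm: "smooth_map C C (ps t)" if t: "t : J" for t
  unfolding smooth_map_def
 proof
  fix z0 assume z0: "z0 : pts C"
  obtain V s e W where *: "(V, s) : csec C M q" "e > 0" "opn C W" "z0 : W"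
   "ALL t':J. abs (t' - t) < e --> (ALL z:W. et t' (q z) : V & ps t' z = s (et t' (q z)))" using LF[OF z0 t] by blast
  have W: "et t (q z) : V" "ps t z = s (et t (q z))" if "z : W" for z using *(2,5) t that by auto
  have 1: "smooth_at C M z0 (%z. et t (q z))"
   by (rule sa_compose[OF C M M smD[OF qs z0] smD[OF diffeoD(1)[OF isotopyD(1)[OF et t]] qpts[OF z0]]])
  show "smooth_at C C z0 (ps t)"
   by (rule sa_cong[OF C sa_compose[OF C M C 1 csec_smooth[OF C M cov *(1) W(1)[OF *(4)]]]])
     (rule nearbyI[OF *(3,4)], rule W(2))
 qed
 have inj: "z = z'" if t: "t : J" and z: "z : pts C" "z' : pts C" and eq: "ps t z = ps t z'" for t z z'
 proof -
  have "et t (q z) = et t (q z')" using qps[OF t z(1)] qps[OF t z(2)] eq by simp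
  hence qq: "q z = q z'"
   using diffeoD(2)[OF isotopyD(1)[OF et t]] qpts z by (auto simp: bij_betw_def inj_on_def)
  have "ps 0 z = ps 0 z'"
   using S.lift_unique[OF path[OF z(1)] J(1) L[OF z(1)], of "%t. ps t z'" t 0] L[OF z(2)] qq t eq J(2) by simp
  thus ?thesis using zero z by simp
 qed
 have surj: "EX z:pts C. ps t z = w" if t: "t : J" and w: "w : pts C" for t w
 proof -
  obtain b where b: "b : pts M" "et t b = q w"
   using diffeoD(2)[OF isotopyD(1)[OF et t]] qpts[OF w] unfolding bij_betw_def by (metis imageE)
  have p: "pcont (mtop M) J (%t. et t b)" by (rule isotopy_path[OF M et b(1)])
  obtain u where u: "S.lift J (%t. et t b) u" "u t = w"
   using S.lift_exists[OF p J(1) t w] b(2) by auto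
  have z: "u 0 : pts C" "q (u 0) = b"
   using S.lift_mem[OF u(1) J(2)] S.lift_pr[OF u(1) J(2)] isotopyD(2)[OF et b(1)] by auto
  have "ps t (u 0) = u t"
   using S.lift_unique[OF p J(1) _ u(1) J(2) _ t, of "%t. ps t (u 0)"] L[OF z(1)] z(2) zero[OF z(1)] by simp
  with z(1) u(2) show ?thesis by blast
 qed
 have bij: "bij_betw (ps t) (pts C) (pts C)" if t: "t : J" for t
 proof (rule bij_betwI')
  show "(ps t x = ps t y) = (x = y)" if "x : pts C" "y : pts C" for x y using inj[OF t that] by blast
  show "ps t x : pts C" if "x : pts C" for x using pspts[OF t that] .
  show "EX x:pts C. y = ps t x" if "y : pts C" for y using surj[OF t that] by blast
 qed
 have smi: "smooth_map C C (inv_into (pts C) (ps t))" if t: "t : J" for t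
  unfolding smooth_map_def
 proof
  fix w0 assume w0: "w0 : pts C"
  define z0 where "z0 = inv_into (pts C) (ps t) w0"
  have z0: "z0 : pts C" "ps t z0 = w0"
   unfolding z0_def using bij[OF t] w0 by (auto simp: bij_betw_def intro: inv_into_into f_inv_into_f)
  let ?i = "inv_into (pts M) (et t)"
  note dif = isotopyD(1)[OF et t]
  have ii: "?i (et t b) = b" if "b : pts M" for b using diffeoD(2)[OF dif] that by (simp add: bij_betw_def)
  have ii': "et t (?i b) = b" if "b : pts M" for b using diffeoD(2)[OF dif] that by (auto simp: bij_betw_def intro: f_inv_into_f)
  have iq: "?i (q w0) = q z0" using ii[OF qpts[OF z0(1)]] qps[OF t z0(1)] z0(2) by simp
  obtain V s e W where *: "(V, s) : csec C M q" "e > 0" "opn C W" "z0 : W"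
   "ALL t':J. abs (t' - t) < e --> (ALL z:W. et t' (q z) : V & ps t' z = s (et t' (q z)))" using LF[OF z0(1) t] by blast
  have W: "et t (q z) : V" "ps t z = s (et t (q z))" if "z : W" for z using *(2,5) t that by auto
  obtain V' s' where s': "(V', s') : csec C M q" "q z0 : V'" "s' (q z0) = z0"
   using csec_through[OF C M cov z0(1)] .
  \<comment> \<open>Local formula for the inverse: project, undo the isotopy below, and return
    through the sheet of \<open>z0\<close>.\<close>
  let ?g = "%w. s' (?i (q w))"
  have 1: "smooth_at C M w0 (%w. ?i (q w))"
   by (rule sa_compose[OF C M M smD[OF qs w0] smD[OF diffeoD(3)[OF dif] qpts[OF w0]]])
  have g: "smooth_at C C w0 ?g"
   by (rule sa_compose[OF C M C 1]) (use csec_smooth[OF C M cov s'(1,2)] iq in simp)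
  have g0: "?g w0 = z0" using iq s'(3) by simp
  have n1: "near C w0 (%w. ?g w : W)" by (rule sa_continuous[OF C C g *(3)]) (use g0 *(4) in simp)
  have n2: "near C w0 (%w. ?i (q w) : V')"
   by (rule sa_continuous[OF C M 1 csec_open[OF C M cov s'(1)]]) (use iq s'(2) in simp)
  have qw0: "q w0 = et t (q z0)" using qps[OF t z0(1)] z0(2) by simp
  have n3: "near C w0 (%w. q w : V & s (q w) = w)"
   by (rule csec_near[OF C M cov *(1) w0]) (use W[OF *(4)] qw0 z0(2) in auto)
  show "smooth_at C C w0 (inv_into (pts C) (ps t))"
  proof (rule sa_cong[OF C g], rule near_mono3[OF n1 n2 near_conj[OF n3 near_in_pts[OF w0]]])
   fix w assume w: "?g w : W" "?i (q w) : V'" "(q w : V & s (q w) = w) & w : pts C"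
   have gC: "?g w : pts C" using w(1) openin_subset[OF *(3)] by blast
   have "q (?g w) = ?i (q w)" by (rule csec_right[OF C M cov s'(1) w(2)])
   hence "et t (q (?g w)) = q w" using ii' qpts w(3) by simp
   hence "ps t (?g w) = w" using W(2)[OF w(1)] w(3) by simp
   thus "inv_into (pts C) (ps t) w = ?g w"
    using bij[OF t] gC by (metis bij_betw_def inv_into_f_f)
  qed
 qed
 let ?P = "prod_mfd eucl C" and ?R = "prod_mfd eucl M"
 have P: "mfd ?P" and R: "mfd ?R"
  by (intro prod_m euclid_m C M)+
 have smo: "smooth_map_on ?P (J \<times> pts C) C (%(t, z). ps t z)"
  unfolding smooth_map_on_def
 proof clarify
  fix t z0 assume t: "t : J" and z0: "z0 : pts C"
  obtain V s e W where *: "(V, s) : csec C M q" "e > 0" "opn C W" "z0 : W"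
   "ALL t':J. abs (t' - t) < e --> (ALL z:W. et t' (q z) : V & ps t' z = s (et t' (q z)))" using LF[OF z0 t] by blast
  have W: "et t (q z0) : V" using *(2,4,5) t by auto
  obtain F where F: "smooth_at ?R M (t, q z0) F"
   "near ?R (t, q z0) (%z. fst z : J & snd z : pts M --> F z = et (fst z) (snd z))" "F (t, q z0) = et t (q z0)"
   using isotopy_extension[OF et t qpts[OF z0]] .
  have z: "(t, z0) : pts (eucl :: (real, real) manifold) \<times> pts C" using z0 by simp
  have in1: "smooth_at ?P ?R (t, z0) (%x. (fst x, q (snd x)))"
   by (rule sa_Pair[OF euclid_m M P sa_fst_snd(1)[OF euclid_m C z]])
     (rule sa_compose[OF P C M sa_fst_snd(2)[OF euclid_m C z]], use smD[OF qs z0] in simp)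
  have in2: "smooth_at ?P M (t, z0) (%x. F (fst x, q (snd x)))"
   by (rule sa_compose[OF P R M in1]) (use F(1) in simp)
  have in3: "smooth_at ?P C (t, z0) (%x. s (F (fst x, q (snd x))))"
   by (rule sa_compose[OF P M C in2]) (use csec_smooth[OF C M cov *(1) W] F(3) in simp)
  have n: "near ?P (t, z0) (%x. fst x : J & q (snd x) : pts M --> F (fst x, q (snd x)) = et (fst x) (q (snd x)))"
   using near_preimage[OF P R in1, of "%z. fst z : J & snd z : pts M --> F z = et (fst z) (snd z)"] F(2) by simp
  have n2: "near ?P (t, z0) (%x. abs (fst x - t) < e & snd x : W)"
  proof (rule nearbyI[of _ "{t - e<..<t + e} \<times> W"])
   show "opn ?P ({t - e<..<t + e} \<times> W)" using *(3) by (simp add: openin_prod_Times_iff)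
  qed (use *(2,4) in "auto simp: abs_if")
  show "EX F. smooth_at ?P C (t, z0) F & near ?P (t, z0) (%q. q : J \<times> pts C --> F q = (case q of (t, z) => ps t z))"
  proof (intro exI conjI)
   show "smooth_at ?P C (t, z0) (%x. s (F (fst x, q (snd x))))" by (rule in3)
   show "near ?P (t, z0) (%x. x : J \<times> pts C --> s (F (fst x, q (snd x))) = (case x of (t, z) => ps t z))"
    by (rule near_mono2[OF n n2]) (use *(5) qpts in "auto split: prod.split")
  qed
 qed
 show ?thesis
  unfolding smooth_isotopy_def diffeo_def
  by (rule exI[of _ ps]) (use smo sm bij smi zero qps in auto)
qed

section \<open>Parallel transport\<close>

text \<open>Constant multiples of flat frames, regarded as sections of the set of pairs of a point
  and a fibre vector. Where two of them meet they agree nearby, so with these sheets the bundle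
  behaves like a covering and \<open>sheets\<close> supplies parallel transport.\<close>

definition psec :: "('a, 'e::euclidean_space) manifold => ('a, 'l::real_vector) lbundle => ('a, 'e, 'l) connexion =>
  ('a set \<times> ('a => 'a \<times> 'l)) set" where
 "psec M E D = {(U, %b. (b, c *R e b)) | U e c. flatf M E D U e}"

definition par_on :: "('a, 'e::euclidean_space) manifold => ('a, 'l::real_vector) lbundle => ('a, 'e, 'l) connexion =>
  real set => (real => 'a) => (real => 'l) => bool" where
 "par_on M E D I ga u <-> sheets.lift (psec M E D) I ga (%t. (ga t, u t))"

lemma psecE:
 assumes "(V, s) : psec M E D"
 obtains e c where "flatf M E D V e" "s = (%b. (b, c *R e b))"
 using assms unfolding psec_def by blast

lemma psecI: "flatf M E D V e ==> (V, %b. (b, c *R e b)) : psec M E D"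
 unfolding psec_def by blast

context
 fixes M :: "('a, 'e::euclidean_space) manifold" and E :: "('a, 'l::real_vector) lbundle" and D :: "('a, 'e, 'l) connexion"
 assumes FB: "flat_bundle M E D"
begin

private lemmas M = fbD(1)[OF FB] and E = fbD(2)[OF FB]

lemma par_sheets: "sheets (mtop M) {(b, x). b : pts M & x : fibre E b} fst (psec M E D)"
proof
 show "opn M V" if s: "(V, s) : psec M E D" for V s
 proof -
  obtain e c where e: "flatf M E D V e" "s = (%b. (b, c *R e b))" using s by (rule psecE)
  show ?thesis using ffD(1)[OF e(1)] by (simp add: sframe_def)
 qed
 show "s b : {(b, x). b : pts M & x : fibre E b} & fst (s b) = b" if s: "(V, s) : psec M E D" and b: "b : V" for V s b
 proof -
  obtain e c where e: "flatf M E D V e" "s = (%b. (b, c *R e b))" using s by (rule psecE)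
  note sf = ffD(1)[OF e(1)]
  show ?thesis using sframe_pts[OF sf b] fibre_scaleR[OF M E sframe_pts[OF sf b] sframeD(1)[OF sf b]] by (simp add: e(2))
 qed
 show "EX W. opn M W & b : W & W <= V Int V' & (ALL c:W. s c = s' c)"
  if s: "(V, s) : psec M E D" and s': "(V', s') : psec M E D" and b: "b : V" "b : V'" "s b = s' b" for V s V' s' b
 proof -
  obtain e c where e: "flatf M E D V e" "s = (%b. (b, c *R e b))" using s by (rule psecE)
  obtain e' c' where e': "flatf M E D V' e'" "s' = (%b. (b, c' *R e' b))" using s' by (rule psecE)
  note sf = ffD(1)[OF e(1)] and sf' = ffD(1)[OF e'(1)]
  obtain k where k: "k > 0" "near M b (%q. e' q = k *R e q)" by (rule flat_ratio[OF FB e(1) b(1) e'(1) b(2)])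
  have "c *R e b = (c' * k) *R e b" using b(3) near_self[OF k(2)] by (simp add: e(2) e'(2))
  hence ck: "c = c' * k" using sframeD(2)[OF sf b(1)] by simp
  have "near M b (%q. q : V Int V' & s q = s' q)"
   by (rule near_mono3[OF near_sframe[OF M E sf b(1)] near_sframe[OF M E sf' b(2)] k(2)])
     (simp add: e(2) e'(2) ck)
  then obtain W where "opn M W" "b : W" "!!q. q : W ==> q : V Int V' & s q = s' q" by (rule nearbyE) (rule that)
  thus ?thesis by (intro exI[of _ W]) auto
 qed
 show "EX V R. opn M V & b : V & (ALL s:R. (V, s) : psec M E D) &
    (ALL ta:{(b, x). b : pts M & x : fibre E b}. fst ta : V --> (EX s:R. s (fst ta) = ta)) &
    (ALL s:R. ALL s':R. ALL c:V. s c = s' c --> (ALL b:V. s b = s' b))" if b: "b : topspace (mtop M)" for b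
 proof -
  obtain U e where U: "b : U" "flatf M E D U e" by (rule flat_ex[OF FB b])
  note sf = ffD(1)[OF U(2)]
  show ?thesis
  proof (rule exI[of _ U], rule exI[of _ "range (%c b. (b, c *R e b))"], intro conjI ballI impI)
   show "opn M U" "b : U" using sframeD(4)[OF sf U(1)] U(1) by auto
   show "(U, s) : psec M E D" if "s : range (%c b. (b, c *R e b))" for s
    using that psecI[OF U(2)] by blast
   fix ta assume "ta : {(b, x). b : pts M & x : fibre E b}" "fst ta : U"
   then obtain b x where ta: "ta = (b, x)" "b : U" "x : fibre E b" by auto
   have "x = fcf x (e b) *R e b"
    by (rule fibre_coef[OF M E sframe_pts[OF sf ta(2)] sframeD(1,2)[OF sf ta(2)] ta(3)])
   hence eq: "(%b'. (b', fcf x (e b) *R e b')) (fst ta) = ta" using ta(1) by simp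
   show "EX s:range (%c b. (b, c *R e b)). s (fst ta) = ta" by (rule bexI, rule eq) simp
  next
   fix s s' c d assume "s : range (%c b. (b, c *R e b))" "s' : range (%c b. (b, c *R e b))" "c : U" "s c = s' c" "d : U"
   thus "s d = s' d" using sframeD(2)[OF sf `c : U`] by auto
  qed
 qed
qed

lemma par_onE:
 assumes "par_on M E D I ga u" "t : I"
 obtains U e c ep where "flatf M E D U e" "ga t : U" "ep > 0" "ALL t':I. abs (t' - t) < ep --> ga t' : U & u t' = c *R e (ga t')"
proof -
 interpret S: sheets "mtop M" "{(b, x). b : pts M & x : fibre E b}" fst "psec M E D" by (rule par_sheets)
 obtain V s e where *: "(V, s) : psec M E D" "ga t : V" "e > 0"
  "ALL t':I. abs (t' - t) < e --> ga t' : V & (ga t', u t') = s (ga t')" "(ga t, u t) = s (ga t)"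
  using S.liftE[OF assms[unfolded par_on_def]] .
 obtain f c where f: "flatf M E D V f" "s = (%b. (b, c *R f b))" using *(1) by (rule psecE)
 show ?thesis by (rule that[OF f(1) *(2,3), of c]) (use *(4) f(2) in simp)
qed

lemma par_onI:
 assumes "!!t. t : I ==> EX U e c ep. flatf M E D U e & ga t : U & ep > 0 &
  (ALL t':I. abs (t' - t) < ep --> ga t' : U & u t' = c *R e (ga t'))"
 shows "par_on M E D I ga u"
proof -
 interpret S: sheets "mtop M" "{(b, x). b : pts M & x : fibre E b}" fst "psec M E D" by (rule par_sheets)
 show ?thesis
  unfolding par_on_def S.lift_def
 proof
  fix t assume t: "t : I"
  obtain U e c ep where *: "flatf M E D U e" "ga t : U" "ep > 0"
   "ALL t':I. abs (t' - t) < ep --> ga t' : U & u t' = c *R e (ga t')"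
   using assms[OF t] by (elim exE conjE) (rule that)
  show "EX V s ep. (V, s) : psec M E D & ga t : V & 0 < ep &
    (ALL t':I. abs (t' - t) < ep --> ga t' : V & (ga t', u t') = s (ga t'))"
   by (rule exI[of _ U], rule exI[of _ "%b. (b, c *R e b)"], rule exI[of _ ep]) (use * psecI[OF *(1)] in auto)
 qed
qed

lemma par_on_fibre: "par_on M E D I ga u ==> t : I ==> u t : fibre E (ga t)"
proof -
 assume u: "par_on M E D I ga u" and t: "t : I"
 interpret S: sheets "mtop M" "{(b, x). b : pts M & x : fibre E b}" fst "psec M E D" by (rule par_sheets)
 show ?thesis using S.lift_mem[OF u[unfolded par_on_def] t] by simp
qed

lemma par_on_unique:
 assumes "pcont (mtop M) I ga" "is_interval I" "par_on M E D I ga u" "par_on M E D I ga u'" "t0 : I" "u t0 = u' t0" "t : I"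
 shows "u t = u' t"
proof -
 interpret S: sheets "mtop M" "{(b, x). b : pts M & x : fibre E b}" fst "psec M E D" by (rule par_sheets)
 show ?thesis
  using S.lift_unique[OF assms(1,2) assms(3,4)[unfolded par_on_def] assms(5) _ assms(7)] assms(6) by simp
qed

lemma par_on_exists:
 assumes ga: "pcont (mtop M) I ga" and I: "is_interval I" "t0 : I" and x: "x : fibre E (ga t0)"
 shows "EX u. par_on M E D I ga u & u t0 = x"
proof -
 interpret S: sheets "mtop M" "{(b, x). b : pts M & x : fibre E b}" fst "psec M E D" by (rule par_sheets)
 obtain u where u: "S.lift I ga u" "u t0 = (ga t0, x)"
  using S.lift_exists[OF ga I, of "(ga t0, x)"] x pcontD(1)[OF ga I(2)] by auto
 have "S.lift I ga (%t. (ga t, snd (u t)))"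
  by (rule S.lift_cong[OF u(1)]) (use S.lift_pr[OF u(1)] in "auto simp: prod_eq_iff")
 thus ?thesis using u(2) by (intro exI[of _ "%t. snd (u t)"]) (simp add: par_on_def)
qed

lemma par_on_scaleR: "par_on M E D I ga u ==> par_on M E D I ga (%t. k *R u t)"
proof (rule par_onI)
 fix t assume u: "par_on M E D I ga u" and t: "t : I"
 obtain U e c ep where *: "flatf M E D U e" "ga t : U" "ep > 0" "ALL t':I. abs (t' - t) < ep --> ga t' : U & u t' = c *R e (ga t')"
  by (rule par_onE[OF u t])
 show "EX U e c ep. flatf M E D U e & ga t : U & ep > 0 &
  (ALL t':I. abs (t' - t) < ep --> ga t' : U & k *R u t' = c *R e (ga t'))"
  by (intro exI[of _ U] exI[of _ e] exI[of _ "k * c"] exI[of _ ep]) (use * in auto)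
qed

lemma par_on_reparam:
 assumes "par_on M E D I ga u" "continuous_on K h" "h ` K <= I"
 shows "par_on M E D K (%t. ga (h t)) (%t. u (h t))"
proof -
 interpret S: sheets "mtop M" "{(b, x). b : pts M & x : fibre E b}" fst "psec M E D" by (rule par_sheets)
 show ?thesis using S.lift_reparam[OF assms(1)[unfolded par_on_def] assms(2,3)] by (simp add: par_on_def)
qed

lemma par_on_join:
 assumes "pcont (mtop M) {a..c} ga" "par_on M E D {a..b} ga u" "par_on M E D {b..c} ga w" "u b = w b" "a <= b" "b <= c"
 shows "par_on M E D {a..c} ga (%t. if t <= b then u t else w t)"
proof -
 interpret S: sheets "mtop M" "{(b, x). b : pts M & x : fibre E b}" fst "psec M E D" by (rule par_sheets)
 have "S.lift {a..c} ga (%t. if t <= b then (ga t, u t) else (ga t, w t))"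
  by (rule S.lift_join[OF assms(1) assms(2,3)[unfolded par_on_def] _ assms(5,6)]) (use assms(4) in simp)
 thus ?thesis
  unfolding par_on_def by (rule S.lift_cong) auto
qed

lemma par_on_cong:
 assumes "par_on M E D I ga u" "!!t. t : I ==> ga' t = ga t" "!!t. t : I ==> u' t = u t"
 shows "par_on M E D I ga' u'"
proof -
 interpret S: sheets "mtop M" "{(b, x). b : pts M & x : fibre E b}" fst "psec M E D" by (rule par_sheets)
 show ?thesis unfolding par_on_def by (rule S.lift_cong[OF assms(1)[unfolded par_on_def]]) (use assms(2,3) in auto)
qed

lemma par_on_section:
 assumes "pcont (mtop M) I ga" "flatf M E D U e" "!!t. t : I ==> ga t : U"
 shows "par_on M E D I ga (%t. c *R e (ga t))"
proof -
 interpret S: sheets "mtop M" "{(b, x). b : pts M & x : fibre E b}" fst "psec M E D" by (rule par_sheets)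
 show ?thesis
  using S.lift_section[OF assms(1) psecI[OF assms(2), of c] assms(3)] by (simp add: par_on_def)
qed

text \<open>Positivity with respect to the orientation of the bundle. Parallel transport preserves
  it, which is why holonomies are positive and have logarithms.\<close>

definition posv :: "'a => 'l => bool" where
 "posv p x <-> (EX U e c. sframe M E U e & p : U & c > 0 & x = c *R e p)"

lemma posv_scaleR:
 assumes e: "sframe M E U e" "p : U"
 shows "posv p (c *R e p) <-> c > 0"
proof
 assume "posv p (c *R e p)"
 then obtain V f d where f: "sframe M E V f" "p : V" "d > 0" "c *R e p = d *R f p" unfolding posv_def by blast
 obtain g :: "'a => real" where g: "smf M p g" "g p > 0" "near M p (%q. f q = g q *R e q)"
  using sframe_ratio[OF M E e f(1,2)] .
 have "c *R e p = (d * g p) *R e p" using f(4) near_self[OF g(3)] by simp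
 hence "c = d * g p" using sframeD(2)[OF e] by simp
 thus "c > 0" using f(3) g(2) by simp
next
 assume "c > 0"
 thus "posv p (c *R e p)" unfolding posv_def using e by blast
qed

lemma par_on_posv:
 assumes u: "par_on M E D I ga u" and I: "is_interval I" "s : I" "t : I" and pos: "posv (ga s) (u s)"
 shows "posv (ga t) (u t)"
proof -
 have "EX d>0. ALL t':I. abs (t' - t) < d --> posv (ga t') (u t') = posv (ga t) (u t)" if t: "t : I" for t
 proof -
  obtain U e c d where *: "flatf M E D U e" "ga t : U" "d > 0" "ALL t':I. abs (t' - t) < d --> ga t' : U & u t' = c *R e (ga t')"
   by (rule par_onE[OF u t])
  have "posv (ga t') (u t') <-> c > 0" if "t' : I" "abs (t' - t) < d" for t'
   using posv_scaleR[OF ffD(1)[OF *(1)]] *(4) that by simp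
  thus ?thesis using *(3) t by (intro exI[of _ d]) simp
 qed
 from interval_local_const[OF I, of "%t. posv (ga t) (u t)", OF this] pos show ?thesis by simp
qed

lemma posv_exists:
 assumes "p : pts M"
 shows "EX x. posv p x & x : fibre E p"
proof -
 obtain U e where U: "p : U" "flatf M E D U e" by (rule flat_ex[OF FB assms])
 have "posv p (1 *R e p)" using posv_scaleR[OF ffD(1)[OF U(2)] U(1), of 1] by simp
 thus ?thesis using sframeD(1)[OF ffD(1)[OF U(2)] U(1)] by auto
qed

lemma posv_nonzero: "posv p x ==> x ~= 0"
 unfolding posv_def by (auto dest: sframeD(2))

lemma posv_ratio:
 assumes p: "p : pts M" and x: "posv p x" and y: "posv p y"
 shows "EX c>0. y = c *R x"
proof -
 obtain U e where U: "p : U" "flatf M E D U e" by (rule flat_ex[OF FB p])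
 note sf = ffD(1)[OF U(2)]
 have *: "EX c>0. z = c *R e p" if z: "posv p z" for z
 proof -
  obtain V f d where f: "sframe M E V f" "p : V" "d > 0" "z = d *R f p" using z unfolding posv_def by blast
  obtain g :: "'a => real" where g: "smf M p g" "g p > 0" "near M p (%q. f q = g q *R e q)"
   using sframe_ratio[OF M E sf U(1) f(1,2)] .
  thus ?thesis using f near_self[OF g(3)] by (intro exI[of _ "d * g p"]) simp
 qed
 obtain a b where "a > 0" "x = a *R e p" "b > 0" "y = b *R e p" using *[OF x] *[OF y] by blast
 thus ?thesis by (intro exI[of _ "b / a"]) simp
qed

lemma posv_fibre: "p : pts M ==> posv p x ==> x : fibre E p"
 unfolding posv_def by (elim exE conjE) (simp add: fibre_scaleR[OF M E] sframeD(1))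

text \<open>\<open>parallel_along\<close> admits any local parallel section. Near each point such a
  section is a constant multiple of a flat frame, which is the form used by
  \<open>par_on\<close>.\<close>

lemma parallel_along_iff:
 assumes ga: "pcont (mtop M) {0..1} ga"
 shows "parallel_along M E D ga u <-> par_on M E D {0..1} ga u"
proof
 assume L: "parallel_along M E D ga u"
 show "par_on M E D {0..1} ga u"
 proof (rule par_onI)
  fix t :: real assume t: "t : {0..1}"
  obtain s ep where s: "near M (ga t) (%q. ssec M E q s & (ALL v. D s q v = 0))" "ep > 0"
   "ALL t':{0..1}. abs (t' - t) < ep --> u t' = s (ga t')"
   using L[unfolded parallel_along_def] t by blast
  obtain U e where U: "ga t : U" "flatf M E D U e" by (rule flat_ex[OF FB pcontD(1)[OF ga t]])
  obtain c where c: "near M (ga t) (%q. s q = c *R e q)" using flat_section_const[OF FB U(2,1) s(1)] by blast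
  obtain W where W: "opn M W" "ga t : W" "!!q. q : W ==> q : U & s q = c *R e q"
   using near_conj[OF near_sframe[OF M E ffD(1)[OF U(2)] U(1)] c] by (rule nearbyE) (rule that)
  obtain d where d: "d > 0" "ALL t':{0..1}. abs (t' - t) < d --> ga t' : W" using pcontD(2)[OF ga t W(1,2)] by blast
  show "EX U e c ep. flatf M E D U e & ga t : U & ep > 0 &
   (ALL t':{0..1}. abs (t' - t) < ep --> ga t' : U & u t' = c *R e (ga t'))"
   by (intro exI[of _ U] exI[of _ e] exI[of _ c] exI[of _ "min ep d"]) (use U s d W(3) in auto)
 qed
next
 assume R: "par_on M E D {0..1} ga u"
 show "parallel_along M E D ga u"
  unfolding parallel_along_def
 proof (intro ballI conjI)
  fix t :: real assume t: "t : {0..1}"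
  show "u t : fibre E (ga t)" by (rule par_on_fibre[OF R t])
  obtain U e c d where *: "flatf M E D U e" "ga t : U" "d > 0" "ALL t':{0..1}. abs (t' - t) < d --> ga t' : U & u t' = c *R e (ga t')"
   by (rule par_onE[OF R t])
  have "near M (ga t) (%q. ssec M E q (%q. c *R e q) & (ALL v. D (%q. c *R e q) q v = 0))"
   by (rule flat_section_smooth[OF FB *(1,2), of _ c]) (rule near_all[OF pcontD(1)[OF ga t]], rule refl)
  thus "EX s. near M (ga t) (%q. ssec M E q s & (ALL v. D s q v = 0)) &
     (EX ep>0. ALL t':{0..1}. abs (t' - t) < ep --> u t' = s (ga t'))"
   using *(3,4) by blast
 qed
qed

text \<open>The fibre is a line, so any other parallel field is a multiple of \<open>u\<close> at
  time 0, hence at all times, and returns with the same factor.\<close>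

lemma holonomy_eqI:
 assumes ga: "pcont (mtop M) {0..1} ga" and loop: "ga 1 = ga 0"
  and u: "par_on M E D {0..1} ga u" "u 0 ~= 0" "u 1 = c *R u 0"
 shows "holonomy M E D ga = c"
 unfolding holonomy_def
proof (rule the_equality)
 show "EX u. parallel_along M E D ga u & u 0 ~= 0 & u 1 = c *R u 0"
  using u parallel_along_iff[OF ga] by blast
 fix d assume "EX u. parallel_along M E D ga u & u 0 ~= 0 & u 1 = d *R u 0"
 then obtain w where w: "par_on M E D {0..1} ga w" "w 0 ~= 0" "w 1 = d *R w 0"
  using parallel_along_iff[OF ga] by blast
 have 0: "(0::real) : {0..1}" "(1::real) : {0..1}" by auto
 obtain k where k: "w 0 = k *R u 0"
  using fibre_iff[OF M E pcontD(1)[OF ga 0(1)] par_on_fibre[OF u(1) 0(1)] u(2), of "w 0"] par_on_fibre[OF w(1) 0(1)] by blast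
 have "w 1 = k *R u 1"
  by (rule par_on_unique[OF ga is_interval_cc w(1) par_on_scaleR[OF u(1)] 0(1) k 0(2)])
 hence "d *R w 0 = c *R w 0" using w(3) u(3) k by simp
 thus "d = c" using w(2) by simp
qed

lemma holonomy_exists:
 assumes ga: "pcont (mtop M) {0..1} ga" and loop: "ga 1 = ga 0"
 obtains u where "par_on M E D {0..1} ga u" "u 0 ~= 0" "u 1 = holonomy M E D ga *R u 0" "holonomy M E D ga > 0"
proof -
 have 0: "(0::real) : {0..1}" "(1::real) : {0..1}" by auto
 note p0 = pcontD(1)[OF ga 0(1)]
 obtain x where x: "posv (ga 0) x" "x : fibre E (ga 0)" using posv_exists[OF p0] by blast
 obtain u where u: "par_on M E D {0..1} ga u" "u 0 = x" using par_on_exists[OF ga is_interval_cc 0(1) x(2)] by blast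
 have "posv (ga 0) (u 1)" using par_on_posv[OF u(1) is_interval_cc 0] u(2) x(1) loop by simp
 then obtain c where c: "c > 0" "u 1 = c *R u 0" using posv_ratio[OF p0 x(1)] u(2) by blast
 have "u 0 ~= 0" using u(2) posv_nonzero[OF x(1)] by simp
 with holonomy_eqI[OF ga loop u(1)] c u that show ?thesis by metis
qed

end

lemma par_on_morphism:
 assumes FB: "flat_bundle M E D" and FB': "flat_bundle N E' D'" and m: "flat_morphism M E D N E' D' ph Ph"
  and ga: "pcont (mtop M) I ga" and u: "par_on M E D I ga u"
 shows "par_on N E' D' I (%t. ph (ga t)) (%t. Ph (ga t) (u t))"
proof (rule par_onI[OF FB'])
 note M = fbD(1)[OF FB] and E = fbD(2)[OF FB] and N = fbD(1)[OF FB'] and E' = fbD(2)[OF FB']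
 note sm = fm_smooth[OF m] and li = fm_liso[OF m]
 fix t assume t: "t : I"
 obtain U e c d where *: "flatf M E D U e" "ga t : U" "d > 0" "ALL t':I. abs (t' - t) < d --> ga t' : U & u t' = c *R e (ga t')"
  by (rule par_onE[OF FB u t])
 note p = pcontD(1)[OF ga t]
 obtain V e' where V: "ph (ga t) : V" "flatf N E' D' V e'"
  by (rule flat_ex[OF FB' sa_pts_image[OF N smD[OF sm p]]])
 obtain k where k: "k > 0" "near M (ga t) (%q. Ph q (e q) = k *R e' (ph q))"
  by (rule fm_const[OF FB FB' m *(1,2) V(2,1)])
 have "near M (ga t) (%q. ph q : V)"
  by (rule near_pull[OF M FB' sm p near_sframe[OF N E' ffD(1)[OF V(2)] V(1)]])
 from near_conj[OF this k(2)] obtain W where W: "opn M W" "ga t : W"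
  "!!q. q : W ==> ph q : V & Ph q (e q) = k *R e' (ph q)" by (rule nearbyE) (rule that)
 obtain d' where d': "d' > 0" "ALL t':I. abs (t' - t) < d' --> ga t' : W" using pcontD(2)[OF ga t W(1,2)] by blast
 have eq: "ph (ga t') : V & Ph (ga t') (u t') = (c * k) *R e' (ph (ga t'))" if "t' : I" "abs (t' - t) < min d d'" for t'
 proof -
  have U: "ga t' : U" "u t' = c *R e (ga t')" using *(4) that by auto
  note sf = ffD(1)[OF *(1)]
  have "ga t' : W" using d'(2) that by simp
  thus ?thesis
   using W(3) li_scaleR[OF li[OF sframe_pts[OF sf U(1)]] sframeD(1)[OF sf U(1)], of c] U(2) by simp
 qed
 show "EX U e c ep. flatf N E' D' U e & ph (ga t) : U & 0 < ep &
   (ALL t':I. abs (t' - t) < ep --> ph (ga t') : U & Ph (ga t') (u t') = c *R e (ph (ga t')))"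
  by (rule exI[of _ V], rule exI[of _ e'], rule exI[of _ "c * k"], rule exI[of _ "min d d'"])
    (use V eq *(3) d'(1) in auto)
qed

lemma fm_holonomy:
 assumes FB: "flat_bundle M E D" and FB': "flat_bundle N E' D'" and m: "flat_morphism M E D N E' D' ph Ph"
  and ga: "pcont (mtop M) {0..1} ga" and loop: "ga 1 = ga 0"
 shows "holonomy N E' D' (%t. ph (ga t)) = holonomy M E D ga"
proof -
 note li = fm_liso[OF m]
 have 0: "(0::real) : {0..1}" "(1::real) : {0..1}" by auto
 obtain u where u: "par_on M E D {0..1} ga u" "u 0 ~= 0" "u 1 = holonomy M E D ga *R u 0" "holonomy M E D ga > 0"
  by (rule holonomy_exists[OF FB ga loop])
 note p = pcontD(1)[OF ga 0(1)] and f = par_on_fibre[OF FB u(1) 0(1)]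
 show ?thesis
 proof (rule holonomy_eqI[OF FB' _ _ par_on_morphism[OF FB FB' m ga u(1)]])
  show "pcont (mtop N) {0..1} (%t. ph (ga t))"
   by (rule path_cont_compose[OF ga smooth_map_continuous[OF fbD(1)[OF FB] fbD(1)[OF FB'] fm_smooth[OF m]]])
  show "Ph (ga 1) (u 1) = holonomy M E D ga *R Ph (ga 0) (u 0)"
   using li_scaleR[OF li[OF p] f] u(3) loop by simp
  show "Ph (ga 0) (u 0) ~= 0"
  proof
   assume "Ph (ga 0) (u 0) = 0"
   hence "Ph (ga 0) (u 0) = Ph (ga 0) (0 *R u 0)" using li_scaleR[OF li[OF p] f, of 0] by simp
   hence "u 0 = 0 *R u 0"
    by (rule li_inj[OF li[OF p] f fibre_scaleR[OF fbD(1,2)[OF FB] p f]])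
   thus False using u(2) by simp
  qed
 qed (use loop in simp)
qed

text \<open>The tautological map from the pullback to the bundle is a morphism. With
  \<open>fm_holonomy\<close>, the holonomy of a pullback along a loop is the holonomy along the
  image loop.\<close>

lemma pull_morphism:
 assumes M: "mfd M" and FB: "flat_bundle N E D" and f: "smooth_map M N f"
 shows "flat_morphism M (pbun M f E) (pull_conn M N f E D) N E D f (%p x. x)"
proof (rule flat_morphismI[OF pull_flat_bundle[OF M FB f] FB f])
 fix p assume p: "p : pts M"
 show "liso (fibre (pbun M f E) p) (fibre E (f p)) (%x. x)"
  unfolding liso_def by (simp add: bij_betw_def)
 obtain U e where U: "f p : U" "flatf N E D U e"
  by (rule flat_ex[OF FB smooth_map_pts[OF M FB f p]])
 have "near M p (%q. e (f q) = 1 *R e (f q))" by (rule near_all[OF p]) simp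
 with pull_flat_frame[OF M FB f U(2)] U p
 show "EX U e V e' c. flatf M (pbun M f E) (pull_conn M N f E D) U e & p : U & flatf N E D V e' & f p : V &
   c > 0 & near M p (%q. e q = c *R e' (f q))"
  by (intro exI[of _ "pts M Int f -` U"] exI[of _ "%q. e (f q)"] exI[of _ U] exI[of _ e] exI[of _ "1::real"]) simp
qed

subsection \<open>Paths in connected manifolds\<close>

lemma local_path:
 assumes M: "mfd M" and p: "p : pts M" and P: "near M p P"
 shows "EX W. opn M W & p : W & (ALL q:W. EX de. pcont (mtop M) {0..1} de & de 0 = p & de 1 = q & (ALL t:{0..1}. P (de t)))"
proof -
 obtain r where r: "r > 0" "ball (crd M p p) r <= cimg M p" "ALL x:ball (crd M p p) r. P (cinv M p x)"
  using near_cball[OF M p P] .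
 let ?B = "ball (crd M p p) r"
 show ?thesis
 proof (rule exI[of _ "{q : cdom M p. crd M p q : ?B}"], intro conjI ballI)
  show "opn M {q : cdom M p. crd M p q : ?B}" by (rule openin_crd_preimage[OF M p open_ball])
  show "p : {q : cdom M p. crd M p q : ?B}" using mem_cdom[OF M p] r(1) by simp
  fix q assume q: "q : {q : cdom M p. crd M p q : ?B}"
  define h where "h t = (1 - t) *R crd M p p + t *R crd M p q" for t
  have lB: "h t : ?B" if "t : {0..1}" for t
   unfolding h_def by (rule convexD_alt[OF convex_ball]) (use q r(1) that in auto)
  have cont: "continuous_on {0..1} h" unfolding h_def by (intro continuous_intros)
  have "pcont (mtop M) {0..1} (%t. cinv M p (h t))"
   unfolding pcont_def
  proof (intro ballI conjI allI impI)
   fix t :: real assume t: "t : {0..1}"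
   have x: "h t : cimg M p" using lB[OF t] r(2) by blast
   show "cinv M p (h t) : pts M" using crd_inv_cdom[OF M p x] cdom_subset[OF M p] by blast
   fix V assume V: "opn M V & cinv M p (h t) : V"
   hence "near eucl (h t) (%y. cinv M p y : V)"
    using sa_continuous[OF euclid_m M crd_inv_smooth[OF M p x]] by blast
   then obtain S where "openin (mtop (eucl :: ('b, 'b) manifold)) S" "h t : S" "!!y. y : S ==> cinv M p y : V" by (rule nearbyE) (rule that)
   hence S: "open S" "h t : S" "!!y. y : S ==> cinv M p y : V" by simp_all
   obtain e where e: "e > 0" "ALL y. dist y (h t) < e --> y : S" using S(1,2) open_dist by metis
   obtain d where "d > 0" "ALL x':{0..1}. dist x' t < d --> dist (h x') (h t) < e"
    using cont t e(1) unfolding continuous_on_iff by metis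
   thus "EX ep>0. ALL t':{0..1}. abs (t' - t) < ep --> cinv M p (h t') : V"
    using e(2) S(3) by (intro exI[of _ d]) (auto simp: dist_real_def)
  qed
  moreover have "cinv M p (h 0) = p" "cinv M p (h 1) = q"
   using crd_inv_crd_self[OF M p] crd_inv_crd[OF M p] q by (simp_all add: h_def)
  moreover have "ALL t:{0..1}. P (cinv M p (h t))" using lB r(3) by blast
  ultimately show "EX de. pcont (mtop M) {0..1} de & de 0 = p & de 1 = q & (ALL t:{0..1}. P (de t))"
   by (intro exI[of _ "%t. cinv M p (h t)"] conjI)
 qed
qed

definition pjoin :: "(real => 'a) => (real => 'a) => real => 'a" where
 "pjoin g h t = (if t <= 1/2 then g (2 * t) else h (2 * t - 1))"

lemma pjoin_path:
 assumes g: "pcont X {0..1} g" and h: "pcont X {0..1} h" and eq: "g 1 = h 0"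
 shows "pcont X {0..1} (pjoin g h)" "pcont X {0..1/2} (%t. g (2 * t))" "pcont X {1/2..1} (%t. h (2 * t - 1))"
proof -
 show 1: "pcont X {0..1/2} (%t. g (2 * t))"
  by (rule path_cont_reparam[OF g]) (auto intro!: continuous_intros)
 show 2: "pcont X {1/2..1} (%t. h (2 * t - 1))"
  by (rule path_cont_reparam[OF h]) (auto intro!: continuous_intros)
 show "pcont X {0..1} (pjoin g h)"
  using path_cont_join[OF 1 2] eq by (simp add: pjoin_def[abs_def])
qed

lemma par_on_pjoin:
 assumes FB: "flat_bundle M E D" and g: "pcont (mtop M) {0..1} g" and h: "pcont (mtop M) {0..1} h" and eq: "g 1 = h 0"
  and u: "par_on M E D {0..1} g u" and w: "par_on M E D {0..1} h w" and uw: "u 1 = w 0"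
 shows "par_on M E D {0..1} (pjoin g h) (pjoin u w)"
proof -
 have "par_on M E D {0..1/2} (%t. g (2 * t)) (%t. u (2 * t))"
  by (rule par_on_reparam[OF FB u]) (auto intro!: continuous_intros)
 hence 1: "par_on M E D {0..1/2} (pjoin g h) (%t. u (2 * t))"
  by (rule par_on_cong[OF FB]) (auto simp: pjoin_def)
 have "par_on M E D {1/2..1} (%t. h (2 * t - 1)) (%t. w (2 * t - 1))"
  by (rule par_on_reparam[OF FB w]) (auto intro!: continuous_intros)
 hence 2: "par_on M E D {1/2..1} (pjoin g h) (%t. w (2 * t - 1))"
 proof (rule par_on_cong[OF FB])
  fix t :: real assume "t : {1/2..1}"
  show "pjoin g h t = h (2 * t - 1)"
  proof (cases "t <= 1/2")
   case True
   with `t : {1/2..1}` have "2 * t = 1" by simp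
   thus ?thesis using eq True by (simp add: pjoin_def)
  qed (simp add: pjoin_def)
 qed simp
 show ?thesis
  using par_on_join[OF FB pjoin_path(1)[OF g h eq] 1 2] uw by (simp add: pjoin_def[abs_def])
qed

lemma connected_manifold_path:
 assumes M: "mfd M" and conn: "connected_space (mtop M)" and p: "p : pts M" and q: "q : pts M"
 shows "EX ga. pcont (mtop M) {0..1} ga & ga 0 = p & ga 1 = q"
proof -
 define P where "P q <-> (EX ga. pcont (mtop M) {0..1} ga & ga 0 = p & ga 1 = q)" for q
 have ext: "P z" if "P y" "pcont (mtop M) {0..1} de" "de 0 = y" "de 1 = z" for y z de
 proof -
  obtain ga where g: "pcont (mtop M) {0..1} ga" "ga 0 = p" "ga 1 = y" using `P y` unfolding P_def by blast
  show ?thesis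
   unfolding P_def by (intro exI[of _ "pjoin ga de"] conjI pjoin_path(1)) (use g that in "auto simp: pjoin_def")
 qed
 have "EX W. opn M W & x : W & (ALL y:W. P y = P x)" if x: "x : pts M" for x
 proof -
  have n: "near M x (%_. True)" by (rule near_all[OF x]) simp
  obtain W where W: "opn M W" "x : W" "ALL q:W. EX de. pcont (mtop M) {0..1} de & de 0 = x & de 1 = q & (ALL t::real:{0..1}. True)"
   using local_path[OF M x n] by (elim exE conjE) (rule that)
  have "P y = P x" if y: "y : W" for y
  proof -
   obtain de where d: "pcont (mtop M) {0..1} de" "de 0 = x" "de 1 = y" using W(3) y by blast
   have r: "pcont (mtop M) {0..1} (%t. de (1 - t))" by (rule path_cont_reparam[OF d(1)]) (auto intro!: continuous_intros)
   show ?thesis using ext[OF _ d] ext[OF _ r] d by auto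
  qed
  thus ?thesis using W by blast
 qed
 from local_const_eq[OF conn p q, of P, OF this]
 have "P p = P q" .
 moreover have "P p" unfolding P_def by (rule exI[of _ "%_. p"]) (auto simp: pcont_def p intro: exI[of _ 1])
 ultimately show ?thesis unfolding P_def by blast
qed

text \<open>A positive vector at a base point is transported along paths to all other points.
  Trivial holonomy makes the result independent of the path, and extending a path by a short one
  inside a flat frame shows that the result is parallel.\<close>

lemma global_flat_frame:
 assumes FB: "flat_bundle M E D" and conn: "connected_space (mtop M)" and ne: "pts M ~= {}"
  and hol: "!!ga. pcont (mtop M) {0..1} ga ==> ga 1 = ga 0 ==> holonomy M E D ga = 1"
 shows "EX sgm. flatf M E D (pts M) sgm"
proof -
 note M = fbD(1)[OF FB] and E = fbD(2)[OF FB]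
 have 0: "(0::real) : {0..1}" "(1::real) : {0..1}" by auto
 obtain x0 where x0: "x0 : pts M" using ne by blast
 obtain u0 where u0: "posv M E x0 u0" "u0 : fibre E x0" using posv_exists[OF FB x0] by blast
 define R where "R y x <-> (EX ga u. pcont (mtop M) {0..1} ga & ga 0 = x0 & ga 1 = y & par_on M E D {0..1} ga u & u 0 = u0 & u 1 = x)" for y x
 have ex: "EX x. R y x" if y: "y : pts M" for y
 proof -
  obtain ga where g: "pcont (mtop M) {0..1} ga" "ga 0 = x0" "ga 1 = y" using connected_manifold_path[OF M conn x0 y] by blast
  obtain u where "par_on M E D {0..1} ga u" "u 0 = u0" using par_on_exists[OF FB g(1) is_interval_cc 0(1)] u0(2) g(2) by blast
  thus ?thesis unfolding R_def using g by blast
 qed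
 have pos: "posv M E y x" if Ryx: "R y x" for y x
 proof -
  obtain ga u where g: "pcont (mtop M) {0..1} ga" "ga 0 = x0" "ga 1 = y" "par_on M E D {0..1} ga u" "u 0 = u0" "u 1 = x"
   using Ryx unfolding R_def by blast
  show ?thesis using par_on_posv[OF FB g(4) is_interval_cc 0] g u0(1) by simp
 qed
 have uniq: "x = x'" if y: "y : pts M" and Ryx: "R y x" "R y x'" for y x x'
 proof -
  obtain ga u where g: "pcont (mtop M) {0..1} ga" "ga 0 = x0" "ga 1 = y" "par_on M E D {0..1} ga u" "u 0 = u0" "u 1 = x"
   using Ryx(1) unfolding R_def by blast
  obtain ga' u' where g': "pcont (mtop M) {0..1} ga'" "ga' 0 = x0" "ga' 1 = y" "par_on M E D {0..1} ga' u'" "u' 0 = u0" "u' 1 = x'"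
   using Ryx(2) unfolding R_def by blast
  obtain k where k: "k > 0" "x = k *R x'" using posv_ratio[OF FB y pos[OF Ryx(2)] pos[OF Ryx(1)]] by blast
  \<comment> \<open>Go out along \<open>ga\<close> and return along \<open>ga'\<close>. The factor
    \<open>k\<close> makes the two parallel fields fit together at the turning point, and the round
    trip ends at \<open>k *R u0\<close>, so \<open>k\<close> is a holonomy.\<close>
  let ?de = "%t. ga' (1 - t)" and ?w = "%t. k *R u' (1 - t)"
  have d: "pcont (mtop M) {0..1} ?de" by (rule path_cont_reparam[OF g'(1)]) (auto intro!: continuous_intros)
  have w: "par_on M E D {0..1} ?de ?w"
   by (rule par_on_scaleR[OF FB], rule par_on_reparam[OF FB g'(4)]) (auto intro!: continuous_intros)
  have eq: "ga 1 = ?de 0" "u 1 = ?w 0" using g g' k by auto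
  note pj = par_on_pjoin[OF FB g(1) d eq(1) g(4) w eq(2)]
  have loop: "pjoin ga ?de 1 = pjoin ga ?de 0" using g(2) g'(2) by (simp add: pjoin_def)
  have "holonomy M E D (pjoin ga ?de) = k"
   by (rule holonomy_eqI[OF FB pjoin_path(1)[OF g(1) d eq(1)] loop pj])
     (use g(5) g'(5) posv_nonzero[OF FB u0(1)] in "auto simp: pjoin_def")
  thus ?thesis using hol[OF pjoin_path(1)[OF g(1) d eq(1)] loop] k(2) by simp
 qed
 define sgm where "sgm y = (SOME x. R y x)" for y
 have sgm: "R y (sgm y)" if "y : pts M" for y
  unfolding sgm_def using someI_ex[OF ex[OF that]] .
 have loc: "near M y (%y'. sgm y' = c *R e y')" if U: "flatf M E D U e" "y : U" and c: "sgm y = c *R e y" for y U e c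
 proof -
  note sf = ffD(1)[OF U(1)]
  note y = sframe_pts[OF sf U(2)]
  obtain W where W: "opn M W" "y : W" "ALL q:W. EX de. pcont (mtop M) {0..1} de & de 0 = y & de 1 = q & (ALL t:{0..1}. de t : U)"
   using local_path[OF M y near_sframe[OF M E sf U(2)]] by (elim exE conjE) (rule that)
  obtain ga u where g: "pcont (mtop M) {0..1} ga" "ga 0 = x0" "ga 1 = y" "par_on M E D {0..1} ga u" "u 0 = u0" "u 1 = sgm y"
   using sgm[OF y] unfolding R_def by blast
  show ?thesis
  proof (rule nearbyI[OF W(1,2)])
   fix q assume q: "q : W"
   then obtain de where d: "pcont (mtop M) {0..1} de" "de 0 = y" "de 1 = q" "ALL t:{0..1}. de t : U" using W(3) by blast
   have qp: "q : pts M" using q openin_subset[OF W(1)] by blast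
   have w: "par_on M E D {0..1} de (%t. c *R e (de t))" by (rule par_on_section[OF FB d(1) U(1)]) (use d(4) in blast)
   have eq: "ga 1 = de 0" "u 1 = c *R e (de 0)" using g d c by auto
   have "R q (c *R e q)"
    unfolding R_def
    by (intro exI[of _ "pjoin ga de"] exI[of _ "pjoin u (%t. c *R e (de t))"] conjI pjoin_path(1)[OF g(1) d(1) eq(1)]
      par_on_pjoin[OF FB g(1) d(1) eq(1) g(4) w eq(2)]) (use g d in "auto simp: pjoin_def")
   thus "sgm q = c *R e q" using uniq[OF qp sgm[OF qp]] by blast
  qed
 qed
 have "flatf M E D (pts M) sgm"
  unfolding flatf_def sframe_def
 proof (intro conjI ballI allI impI)
  fix q assume q: "q : pts M"
  note pq = pos[OF sgm[OF q]]
  show fq: "sgm q : fibre E q" by (rule posv_fibre[OF FB q pq])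
  show "sgm q ~= 0" by (rule posv_nonzero[OF FB pq])
  obtain U e where U: "q : U" "flatf M E D U e" by (rule flat_ex[OF FB q])
  note sf = ffD(1)[OF U(2)]
  have "sgm q = fcf (sgm q) (e q) *R e q" by (rule fibre_coef[OF M E q sframeD(1,2)[OF sf U(1)] fq])
  from near_self[OF flat_section_smooth[OF FB U(2,1) loc[OF U(2,1) this]]]
  show "ssec M E q sgm" "D sgm q v = 0" for v by auto
  show "EX c>0. sgm q = c *R f q" if V: "(V, f) : frames E & q : V" for V f
  proof -
   have sfV: "sframe M E V f" by (rule frame_sframe[OF M E]) (use V in blast)
   have "posv M E q (1 *R f q)" using posv_scaleR[OF FB sfV, of q 1] V by simp
   thus ?thesis using posv_ratio[OF FB q _ pq, of "f q"] by simp
  qed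
 qed simp
 thus ?thesis by blast
qed

section \<open>The parallel section on the covering\<close>

lemma lcs_flat_bundle: "lcs M Om ==> flat_bundle M (lbun Om) (lcon Om)"
 by (simp add: lcs_def flat_bundle_def)

lemma coord_ball_local_const:
 assumes M: "mfd M" and p: "p : pts M" and sub: "ball (crd M p p) r <= cimg M p"
  and loc: "!!q. q : cdom M p ==> crd M p q : ball (crd M p p) r ==> near M q (%q'. f q' = f q)"
  and q: "q : cdom M p" "crd M p q : ball (crd M p p) r" and q': "q' : cdom M p" "crd M p q' : ball (crd M p p) r"
 shows "f q = f q'"
proof -
 let ?B = "ball (crd M p p) r"
 have "f (cinv M p (crd M p q)) = f (cinv M p (crd M p q'))"
 proof (rule connected_local_const[OF _ q(2) q'(2), of "%x. f (cinv M p x)"])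
  show "connected ?B" by (rule connected_ball)
  show "ALL x:?B. eventually (%y. f (cinv M p x) = f (cinv M p y)) (at x within ?B)"
  proof
   fix x assume x: "x : ?B"
   hence xc: "x : cimg M p" using sub by blast
   note i = crd_inv_cdom[OF M p xc] crd_crd_inv[OF M p xc]
   have "near M (cinv M p x) (%q'. f q' = f (cinv M p x))" by (rule loc) (use i x in simp_all)
   from near_preimage[OF euclid_m M crd_inv_smooth[OF M p xc] this]
   obtain S where S: "openin (mtop (eucl :: ('b, 'b) manifold)) S" "x : S" "!!y. y : S ==> f (cinv M p y) = f (cinv M p x)"
    by (rule nearbyE) (rule that)
   have "open S" using S(1) by simp
   thus "eventually (%y. f (cinv M p x) = f (cinv M p y)) (at x within ?B)"
    unfolding eventually_at_topological
    by (intro exI[of _ S] conjI ballI impI S(2)) (assumption, rule S(3)[symmetric])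
  qed
 qed
 thus ?thesis using crd_inv_crd[OF M p] q q' by simp
qed

definition sig :: "('a, 'e::euclidean_space, 'l::real_vector, 'c) covered_lcs => 'c => 'l" where
 "sig A = (SOME sgm. flatf (ccov A) (pbun (ccov A) (cprj A) (lbun (cstr A)))
   (pull_conn (ccov A) (cmfd A) (cprj A) (lbun (cstr A)) (lcon (cstr A))) (pts (ccov A)) sgm)"

text \<open>For two points of one fibre of the covering both values lie in the same line. The ratio
  does not change when the section is rescaled.\<close>

definition kap :: "('a, 'e::euclidean_space, 'l::real_vector, 'c) covered_lcs => 'c => 'c => real" where
 "kap A x y = fcf (sig A y) (sig A x)"

lemma loopin_iff: "loopin X ga <-> pcont X {0..1} ga & ga 1 = ga 0"
 by (simp add: loopin_def pathin_iff)

locale ccl =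
 fixes A :: "('a, 'e::euclidean_space, 'l::real_vector, 'c) covered_lcs"
 assumes ccl: "connected_covered_lcs A"
begin

abbreviation "M == cmfd A"
abbreviation "C == ccov A"
abbreviation "E == lbun (cstr A)"
abbreviation "D == lcon (cstr A)"
abbreviation "q == cprj A"
abbreviation "om == lfrm (cstr A)"
abbreviation "ff == flatf M E D"

lemma lcs: "lcs M (cstr A)" and conn: "connected_space (mtop M)" and ne: "pts M ~= {}"
 and Cm: "mfd C" and Cconn: "connected_space (mtop C)" and cov: "smooth_covering C M q"
 using ccl by (simp_all add: connected_covered_lcs_def)

lemma normal: "x : pts C ==> y : pts C ==> q x = q y ==> EX g:carrier (deck_group (mtop C) q). g x = y"
 using ccl by (simp add: connected_covered_lcs_def)

lemma lee_zero: "loopin (mtop C) ga ==> lee_class M (cstr A) (q o ga) = 0"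
 using ccl by (simp add: connected_covered_lcs_def)

lemma FB: "flat_bundle M E D" by (rule lcs_flat_bundle[OF lcs])

lemmas ffx = flat_ex[OF FB]
lemmas Mm = fbD(1)[OF FB] and Eo = fbD(2)[OF FB]
lemmas qs = covD(1)[OF cov]

lemma qpts: "x : pts C ==> q x : pts M"
 using covD(2)[OF cov] by blast

lemma Cne: "pts C ~= {}"
 using covD(2)[OF cov] ne by blast

lemma lee_eq:
 assumes "pcont (mtop M) {0..1} ga" "ga 1 = ga 0"
 shows "lee_class M (cstr A) ga = ln (holonomy M E D ga)"
 using assms by (simp add: lee_class_def loopin_iff)

lemma pFB: "flat_bundle C (pbun C q E) (pull_conn C M q E D)"
 by (rule pull_flat_bundle[OF Cm FB qs])

text \<open>Loops in the covering have Lee class zero in the base. The holonomy of the pulled-back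
  bundle is positive with logarithm zero, hence 1, and a global parallel section exists.\<close>

lemma sig_frame: "flatf C (pbun C q E) (pull_conn C M q E D) (pts C) (sig A)"
proof -
 have "EX sgm. flatf C (pbun C q E) (pull_conn C M q E D) (pts C) sgm"
 proof (rule global_flat_frame[OF pFB Cconn Cne])
  fix ga assume g: "pcont (mtop C) {0..1} ga" and loop: "ga 1 = ga 0"
  have qg: "pcont (mtop M) {0..1} (%t. q (ga t))"
   by (rule path_cont_compose[OF g smooth_map_continuous[OF Cm Mm qs]])
  have ql: "q (ga 1) = q (ga 0)" using loop by simp
  have "ln (holonomy M E D (%t. q (ga t))) = 0"
   using lee_zero[of ga] lee_eq[OF qg ql] g loop by (simp add: loopin_iff o_def)
  moreover have "holonomy M E D (%t. q (ga t)) > 0"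
   by (rule holonomy_exists[OF FB qg ql])
  ultimately have "holonomy M E D (%t. q (ga t)) = 1" by simp
  thus "holonomy C (pbun C q E) (pull_conn C M q E D) ga = 1"
   using fm_holonomy[OF pFB FB pull_morphism[OF Cm FB qs] g loop] by simp
 qed
 thus ?thesis unfolding sig_def by (rule someI_ex)
qed

lemma sig_sframe: "sframe C (pbun C q E) (pts C) (sig A)"
 by (rule ffD(1)[OF sig_frame])

lemma sig_fibre: "x : pts C ==> sig A x : fibre E (q x)" and sig_nz: "x : pts C ==> sig A x ~= 0"
 using sframeD(1,2)[OF sig_sframe] by simp_all

lemma sig_local:
 assumes x: "x : pts C" and e: "flatf M E D U e" "q x : U"
 obtains c where "c > 0" "near C x (%y. sig A y = c *R e (q y))"
 by (rule flat_ratio[OF pFB pull_flat_frame[OF Cm FB qs e(1)] _ sig_frame x]) (use x e(2) in auto)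

lemma kap_eq:
 assumes "x : pts C" "y : pts C" "q x = q y"
 shows "sig A y = kap A x y *R sig A x"
 unfolding kap_def
 by (rule fibre_coef[OF Mm Eo qpts[OF assms(1)] sig_fibre[OF assms(1)] sig_nz[OF assms(1)]])
   (use sig_fibre[OF assms(2)] assms(3) in simp)

lemma kap_unique:
 assumes "x : pts C" "sig A y = c *R sig A x"
 shows "kap A x y = c"
 using assms sig_nz[OF assms(1)] by (simp add: kap_def)

lemma kap_pos:
 assumes "x : pts C" "y : pts C" "q x = q y"
 shows "kap A x y > 0"
proof -
 obtain U e where U: "q x : U" "flatf M E D U e" by (rule flat_ex[OF FB qpts[OF assms(1)]])
 obtain c where c: "c > 0" "near C x (%y. sig A y = c *R e (q y))" by (rule sig_local[OF assms(1) U(2,1)])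
 obtain d where d: "d > 0" "near C y (%y. sig A y = d *R e (q y))" by (rule sig_local[OF assms(2) U(2)]) (use U(1) assms(3) in auto)
 have "sig A y = (d / c) *R sig A x" using near_self[OF c(2)] near_self[OF d(2)] c(1) assms(3) by simp
 hence "kap A x y = d / c" by (rule kap_unique[OF assms(1)])
 thus ?thesis using c(1) d(1) by simp
qed

lemma kap_refl: "x : pts C ==> kap A x x = 1"
 by (rule kap_unique) simp_all

lemma kap_trans:
 assumes "x : pts C" "y : pts C" "z : pts C" "q x = q y" "q y = q z"
 shows "kap A x z = kap A x y * kap A y z"
 by (rule kap_unique[OF assms(1)])
   (use kap_eq[OF assms(1,2,4)] kap_eq[OF assms(2,3,5)] in simp)

text \<open>Over a flat frame near \<open>q x\<close> the parallel section is a constant multiple of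
  that frame around both points. Moving \<open>y\<close>, and \<open>x\<close> along with it in its
  sheet, therefore keeps the ratio.\<close>

lemma kap_local:
 assumes xy: "x : pts C" "y : pts C" "q x = q y" and s: "(V, s) : csec C M q" "q x : V" "s (q x) = x"
 shows "near C y (%y'. q y' : V & s (q y') : pts C & q (s (q y')) = q y' & kap A (s (q y')) y' = kap A x y)"
proof -
 obtain U e where U: "q x : U" "flatf M E D U e" by (rule flat_ex[OF FB qpts[OF xy(1)]])
 obtain c where c: "c > 0" "near C x (%y. sig A y = c *R e (q y))" by (rule sig_local[OF xy(1) U(2,1)])
 obtain d where d: "d > 0" "near C y (%y. sig A y = d *R e (q y))" by (rule sig_local[OF xy(2) U(2)]) (use U(1) xy(3) in auto)
 have sq: "smooth_at C C y (%y'. s (q y'))"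
  by (rule sa_compose[OF Cm Mm Cm smD[OF qs xy(2)]])
    (use csec_smooth[OF Cm Mm cov s(1,2)] xy(3) in simp)
 have sy: "s (q y) = x" using s(3) xy(3) by simp
 have n1: "near C y (%y'. sig A (s (q y')) = c *R e (q (s (q y'))))"
  by (rule near_preimage[OF Cm Cm sq, of "%z. sig A z = c *R e (q z)"]) (use c(2) sy in simp)
 have n2: "near C y (%y'. s (q y') : pts C)"
  by (rule sa_continuous[OF Cm Cm sq]) (use sy xy(1) in auto)
 have n3: "near C y (%y'. q y' : V)"
  by (rule sa_continuous[OF Cm Mm smD[OF qs xy(2)] csec_open[OF Cm Mm cov s(1)]]) (use s(2) xy(3) in simp)
 have k: "kap A x y = d / c"
  by (rule kap_unique[OF xy(1)]) (use near_self[OF c(2)] near_self[OF d(2)] c(1) xy(3) in simp)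
 show ?thesis
 proof (rule near_mono3[OF near_conj[OF n1 n2] n3 d(2)])
  fix y' assume *: "sig A (s (q y')) = c *R e (q (s (q y'))) & s (q y') : pts C" "q y' : V" "sig A y' = d *R e (q y')"
  have qs: "q (s (q y')) = q y'" by (rule csec_right[OF Cm Mm cov s(1) *(2)])
  have "kap A (s (q y')) y' = d / c"
   by (rule kap_unique) (use * qs c(1) in auto)
  with * qs k show "q y' : V & s (q y') : pts C & q (s (q y')) = q y' & kap A (s (q y')) y' = kap A x y" by simp
 qed
qed

lemma deckD:
 assumes "g : carrier (deck_group (mtop C) q)"
 shows "x : pts C ==> g x : pts C" "x : pts C ==> q (g x) = q x" "homeomorphic_map (mtop C) (mtop C) g"
proof -
 have g: "g : Bij (pts C)" "homeomorphic_map (mtop C) (mtop C) g" "ALL x:pts C. q (g x) = q x"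
  using assms by (auto simp: deck_group_def)
 show "x : pts C ==> g x : pts C" using g(1) by (auto simp: Bij_def bij_betw_def)
 show "x : pts C ==> q (g x) = q x" "homeomorphic_map (mtop C) (mtop C) g" using g by auto
qed

text \<open>By continuity of \<open>g\<close> and \<open>kap_local\<close> the ratio is locally
  constant, and the covering is connected. Thus the number attached to a deck transformation does
  not depend on the base point.\<close>

lemma deck_kap_const:
 assumes g: "g : carrier (deck_group (mtop C) q)" and x: "x : pts C" and y: "y : pts C"
 shows "kap A x (g x) = kap A y (g y)"
proof (rule local_const_eq[OF Cconn x y])
 fix x assume x: "x : pts C"
 note gx = deckD(1,2)[OF g x]
 have cont: "continuous_map (mtop C) (mtop C) g" using homeomorphic_imp_continuous_map[OF deckD(3)[OF g]] .
 obtain V s where s: "(V, s) : csec C M q" "q x : V" "s (q x) = x"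
  using csec_through[OF Cm Mm cov x] .
 have n1: "near C x (%x'. kap A (s (q x')) (g x') = kap A x (g x))"
 proof -
  have "near C (g x) (%y'. q y' : V & s (q y') : pts C & q (s (q y')) = q y' & kap A (s (q y')) y' = kap A x (g x))"
   by (rule kap_local[OF x gx(1) gx(2)[symmetric] s])
  then obtain W where W: "opn C W" "g x : W" "!!y'. y' : W ==> kap A (s (q y')) y' = kap A x (g x)"
   by (auto elim!: nearbyE)
  have o: "opn C {x : pts C. g x : W}" using cont W(1) by (simp add: continuous_map_def)
  show ?thesis
  proof (rule nearbyI[OF o])
   show "x : {x : pts C. g x : W}" using x W(2) by simp
   fix x' assume "x' : {x : pts C. g x : W}"
   thus "kap A (s (q x')) (g x') = kap A x (g x)" using W(3)[of "g x'"] deckD(2)[OF g, of x'] by simp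
  qed
 qed
 have "near C x (%x'. kap A x' (g x') = kap A x (g x))"
  by (rule near_mono2[OF n1 csec_near[OF Cm Mm cov s(1) x s(2,3)]]) simp
 thus "EX W. opn C W & x : W & (ALL y:W. kap A y (g y) = kap A x (g x))"
  by (auto simp: nearby_def)
qed

text \<open>Along a path from a point to its image under \<open>g\<close>, the values of
  \<open>sig A\<close> project to a parallel field over the loop below. Its end value is the factor
  \<open>kap\<close> times its initial one, which is therefore the holonomy.\<close>

lemma deck_hom_eq:
 assumes g: "g : carrier (deck_group (mtop C) q)" and x: "x : pts C"
 shows "deck_hom A g = ln (kap A x (g x))"
 unfolding deck_hom_def pathin_iff
proof (rule the_equality)
 have val: "lee_class M (cstr A) (q o ga) = ln (kap A x (g x))"
  if g1: "pcont (mtop C) {0..1} ga" "ga 1 = g (ga 0)" for ga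
 proof -
  have 0: "(0::real) : {0..1}" by simp
  note p0 = pcontD(1)[OF g1(1) 0]
  have qg: "pcont (mtop M) {0..1} (%t. q (ga t))"
   by (rule path_cont_compose[OF g1(1) smooth_map_continuous[OF Cm Mm qs]])
  have ql: "q (ga 1) = q (ga 0)" using g1(2) deckD(2)[OF g p0] by simp
  have "par_on C (pbun C q E) (pull_conn C M q E D) {0..1} ga (%t. 1 *R sig A (ga t))"
   by (rule par_on_section[OF pFB g1(1) sig_frame]) (rule pcontD(1)[OF g1(1)])
  from par_on_morphism[OF pFB FB pull_morphism[OF Cm FB qs] g1(1) this]
  have par: "par_on M E D {0..1} (%t. q (ga t)) (%t. sig A (ga t))" by simp
  have "holonomy M E D (%t. q (ga t)) = kap A x (g x)"
   by (rule holonomy_eqI[OF FB qg ql par])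
     (use sig_nz[OF p0] kap_eq[OF p0 deckD(1)[OF g p0]] deckD(2)[OF g p0] g1(2) deck_kap_const[OF g x p0] in auto)
  thus ?thesis using lee_eq[OF qg ql] by (simp add: o_def)
 qed
 thus "ALL ga. pcont (mtop C) {0..1} ga & ga 1 = g (ga 0) --> lee_class M (cstr A) (q o ga) = ln (kap A x (g x))"
  by blast
 fix c assume c: "ALL ga. pcont (mtop C) {0..1} ga & ga 1 = g (ga 0) --> lee_class M (cstr A) (q o ga) = c"
 obtain ga where ga: "pcont (mtop C) {0..1} ga" "ga 0 = x" "ga 1 = g x"
  using connected_manifold_path[OF Cm Cconn x deckD(1)[OF g x]] by blast
 hence "lee_class M (cstr A) (q o ga) = c" using c by blast
 with val[OF ga(1)] ga(2,3) show "c = ln (kap A x (g x))" by simp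
qed

text \<open>An evenly covered neighbourhood is shrunk to a coordinate ball. There the ratio of the
  parallel section between two sheets is locally constant on a connected set, hence
  constant.\<close>

lemma even_nbhd:
 assumes p: "p : pts M"
 obtains V R where "opn M V" "p : V" "!!s y. s : R ==> y : V ==> s y : pts C & q (s y) = y & smooth_at M C y s"
  "!!s. s : R ==> opn C (s ` V)" "!!x. x : pts C ==> q x : V ==> EX s:R. s (q x) = x"
  "!!s s' y y'. s : R ==> s' : R ==> y : V ==> y' : V ==> kap A (s y) (s' y) = kap A (s y') (s' y')"
proof -
 interpret S: sheets "mtop M" "pts C" q "csec C M q" by (rule covering_sheets[OF Cm Mm cov])
 obtain V' R where V': "opn M V'" "p : V'" "ALL s:R. (V', s) : csec C M q"
  "ALL ta:pts C. q ta : V' --> (EX s:R. s (q ta) = ta)"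
  using S.S_even[OF p] by (elim exE conjE) (rule that)
 obtain r where r: "r > 0" "ball (crd M p p) r <= cimg M p" "ALL x:ball (crd M p p) r. cinv M p x : V'"
  using near_cball[OF Mm p near_open[OF V'(1,2)]] .
 define V where "V = {y : cdom M p. crd M p y : ball (crd M p p) r}"
 have VV': "V <= V'"
 proof
  fix y assume "y : V"
  hence "y : cdom M p" "cinv M p (crd M p y) : V'" using r(3) by (auto simp: V_def simp del: mem_ball)
  thus "y : V'" using crd_inv_crd[OF Mm p] by simp
 qed
 have secs: "s y : pts C" "q (s y) = y" if "s : R" "y : V'" for s y using S.S_sec V'(3) that by blast+
 have oV: "opn M V" unfolding V_def by (rule openin_crd_preimage[OF Mm p open_ball])
 show ?thesis
 proof (rule that[of V R])
  show "opn M V" by (rule oV)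
  show "p : V" using mem_cdom[OF Mm p] r(1) by (simp add: V_def)
  show sec: "s y : pts C & q (s y) = y & smooth_at M C y s" if "s : R" "y : V" for s y
   using secs that VV' V'(3) csec_smooth[OF Cm Mm cov] by blast
  show "opn C (s ` V)" if s: "s : R" for s
   unfolding openin_iff_nearby
  proof
   fix x assume "x : s ` V"
   then obtain y where y: "y : V" "x = s y" by blast
   note sy = sec[OF s y(1)]
   have 1: "near C x (%w. q w : V' & s (q w) = w)"
    by (rule csec_near[OF Cm Mm cov bspec[OF V'(3) s]]) (use sy y VV' in auto)
   have "near C x (%w. q w : V)"
    by (rule sa_continuous[OF Cm Mm smD[OF qs] oV]) (use sy y in auto)
   thus "near C x (%w. w : s ` V)" by (rule near_mono2[OF _ 1]) (metis imageI)
  qed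
  show "EX s:R. s (q x) = x" if "x : pts C" "q x : V" for x using V'(4) VV' that by blast
  fix s s' y y' assume s: "s : R" "s' : R" and y: "y : V" "y' : V"
  have "near M z (%z'. kap A (s z') (s' z') = kap A (s z) (s' z))" if z: "z : V" for z
  proof -
   have zV: "z : V'" using z VV' by blast
   have sec: "(V', s) : csec C M q" "(V', s') : csec C M q" using V'(3) s by auto
   have qq: "q (s z) = q (s' z)" "q (s z) : V'" "s (q (s z)) = s z" using secs s zV by simp_all
   have "near C (s' z) (%y'. kap A (s (q y')) y' = kap A (s z) (s' z))"
    by (rule near_mono[OF kap_local[OF secs(1)[OF s(1) zV] secs(1)[OF s(2) zV] qq(1) sec(1) qq(2,3)]]) simp
   from near_preimage[OF Mm Cm csec_smooth[OF Cm Mm cov sec(2) zV] this]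
   have "near M z (%z'. kap A (s (q (s' z'))) (s' z') = kap A (s z) (s' z))" .
   thus ?thesis
    by (rule near_mono2[OF near_open[OF V'(1) zV]]) (use secs(2)[OF s(2)] in simp)
  qed
  thus "kap A (s y) (s' y) = kap A (s y') (s' y')"
   using coord_ball_local_const[OF Mm p r(2), of "%z. kap A (s z) (s' z)" y y'] y by (simp add: V_def)
 qed
qed

end

section \<open>The product manifold\<close>

locale box = L: ccl A + R: ccl B
 for A :: "('a, 'e::euclidean_space, 'l::real_vector, 'c) covered_lcs"
 and B :: "('b, 'f::euclidean_space, 'm::real_vector, 'd) covered_lcs"
begin

abbreviation "CC == prod_mfd L.C R.C"
abbreviation "MM == prod_mfd L.M R.M"
abbreviation "P == boxplus A B"
abbreviation "pr == box_proj A B"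
abbreviation "r == box_r A B"
abbreviation "r1 == box_r1 A B"
abbreviation "r2 == box_r2 A B"

lemma CCm: "mfd CC" and MMm: "mfd MM"
 by (intro prod_m L.Cm R.Cm L.Mm R.Mm)+

definition beq :: "'c \<times> 'd => 'c \<times> 'd => bool" where
 "beq w w' <-> w : pts CC & w' : pts CC & L.q (fst w) = L.q (fst w') & R.q (snd w) = R.q (snd w') &
   kap A (fst w) (fst w') = kap B (snd w) (snd w')"

lemma beqD:
 assumes "beq w w'"
 shows "fst w : pts L.C" "fst w' : pts L.C" "snd w : pts R.C" "snd w' : pts R.C" "w : pts CC" "w' : pts CC"
  "L.q (fst w) = L.q (fst w')" "R.q (snd w) = R.q (snd w')" "kap A (fst w) (fst w') = kap B (snd w) (snd w')"
 using assms by (auto simp: beq_def)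

lemma beq_refl: "w : pts CC ==> beq w w"
 by (auto simp: beq_def L.kap_refl R.kap_refl)

lemma beq_trans: "beq w w' ==> beq w' w'' ==> beq w w''"
 unfolding beq_def
 using L.kap_trans[of "fst w" "fst w'" "fst w''"] R.kap_trans[of "snd w" "snd w'" "snd w''"] by auto

lemma beq_sym:
 assumes "beq w w'"
 shows "beq w' w"
proof -
 note * = beqD[OF assms]
 have "kap A (fst w) (fst w') * kap A (fst w') (fst w) = 1"
  using L.kap_trans[OF *(1,2,1,7) *(7)[symmetric]] L.kap_refl[OF *(1)] by simp
 moreover have "kap B (snd w) (snd w') * kap B (snd w') (snd w) = 1"
  using R.kap_trans[OF *(3,4,3,8) *(8)[symmetric]] R.kap_refl[OF *(3)] by simp
 moreover have "kap A (fst w) (fst w') > 0" by (rule L.kap_pos[OF *(1,2,7)])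
 ultimately have "kap A (fst w') (fst w) = kap B (snd w') (snd w)"
  using *(9) by (metis mult_left_cancel order_less_irrefl)
 thus ?thesis using * by (simp add: beq_def)
qed

lemma deck12_carrier:
 "carrier (deck12 A B) = {(g, h). g : carrier (deck_group (mtop L.C) L.q) & h : carrier (deck_group (mtop R.C) R.q) & deck_hom A g = deck_hom B h}"
 by (simp add: deck12_def)

text \<open>By \<open>deck_hom_eq\<close>, equality of the two homomorphisms is equality of the two
  ratios. Conversely, transitivity of the deck groups on fibres realises equivalent points by deck
  transformations. From here on the groups are replaced by \<open>beq\<close>.\<close>

lemma box_proj_eq:
 assumes w: "w : pts CC"
 shows "pr w = {w'. beq w w'}"
proof (intro equalityI subsetI)
 have w12: "fst w : pts L.C" "snd w : pts R.C" using w by auto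
 {
  fix w' assume "w' : pr w"
  then obtain g h where gh: "g : carrier (deck_group (mtop L.C) L.q)" "h : carrier (deck_group (mtop R.C) R.q)"
   "deck_hom A g = deck_hom B h" "w' = (g (fst w), h (snd w))"
  proof -
   obtain gh where "gh : carrier (deck12 A B)" "w' = (case gh of (g, h) => map_prod g h) w"
    using `w' : pr w` unfolding box_proj_def orbit_def by blast
   thus ?thesis
    by (intro that[of "fst gh" "snd gh"]) (simp_all add: deck12_carrier case_prod_beta prod_eq_iff)
  qed
  have "ln (kap A (fst w) (g (fst w))) = ln (kap B (snd w) (h (snd w)))"
   using L.deck_hom_eq[OF gh(1) w12(1)] R.deck_hom_eq[OF gh(2) w12(2)] gh(3) by simp
  moreover have "kap A (fst w) (g (fst w)) > 0" "kap B (snd w) (h (snd w)) > 0"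
   using L.kap_pos[OF w12(1) L.deckD(1)[OF gh(1) w12(1)] L.deckD(2)[OF gh(1) w12(1), symmetric]]
    R.kap_pos[OF w12(2) R.deckD(1)[OF gh(2) w12(2)] R.deckD(2)[OF gh(2) w12(2), symmetric]] by auto
  ultimately have "kap A (fst w) (g (fst w)) = kap B (snd w) (h (snd w))" by simp
  thus "w' : {w'. beq w w'}"
   using L.deckD(1,2)[OF gh(1) w12(1)] R.deckD(1,2)[OF gh(2) w12(2)] w by (auto simp: beq_def gh(4))
 next
  fix w' assume "w' : {w'. beq w w'}"
  hence b: "beq w w'" by simp
  note * = beqD[OF b]
  obtain g where g: "g : carrier (deck_group (mtop L.C) L.q)" "g (fst w) = fst w'" using L.normal[OF *(1,2,7)] by blast
  obtain h where h: "h : carrier (deck_group (mtop R.C) R.q)" "h (snd w) = snd w'" using R.normal[OF *(3,4,8)] by blast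
  have "deck_hom A g = deck_hom B h"
   using L.deck_hom_eq[OF g(1) *(1)] R.deck_hom_eq[OF h(1) *(3)] g(2) h(2) *(9) by simp
  hence "(g, h) : carrier (deck12 A B)" using g h by (simp add: deck12_carrier)
  moreover have "w' = (%(g, h). map_prod g h) (g, h) w" using g(2) h(2) by (simp add: prod_eq_iff)
  ultimately show "w' : pr w" unfolding box_proj_def orbit_def by blast
 }
qed

lemma pr_eq_iff: "w : pts CC ==> w' : pts CC ==> pr w = pr w' <-> beq w w'"
 unfolding box_proj_eq using beq_refl beq_sym beq_trans by blast

lemma box_r_pr:
 assumes w: "w : pts CC"
 shows "r (pr w) = (L.q (fst w), R.q (snd w))"
proof -
 have "w : pr w" using box_proj_eq[OF w] beq_refl[OF w] by simp
 hence "(SOME w'. w' : pr w) : pr w" by (rule someI)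
 hence "beq w (SOME w'. w' : pr w)" using box_proj_eq[OF w] by simp
 from beqD(7,8)[OF this] show ?thesis by (simp add: box_r_def prod_eq_iff)
qed

lemma boxplus_open: "opn P S <-> S <= pr ` pts CC & opn CC {w : pts CC. pr w : S}"
proof -
 let ?O = "%S. S <= pr ` pts CC & opn CC {w : pts CC. pr w : S}"
 have "istopology ?O"
  unfolding istopology_def
 proof (intro conjI allI impI)
  fix S T assume "?O S" "?O T"
  moreover have "{w : pts CC. pr w : S Int T} = {w : pts CC. pr w : S} Int {w : pts CC. pr w : T}" by auto
  ultimately show "S Int T <= pr ` pts CC" "opn CC {w : pts CC. pr w : S Int T}" using openin_Int by auto
 next
  fix K assume K: "ALL S:K. ?O S"
  show "\<Union>K <= pr ` pts CC" using K by blast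
  have "{w : pts CC. pr w : \<Union>K} = (UN S:K. {w : pts CC. pr w : S})" by auto
  thus "opn CC {w : pts CC. pr w : \<Union>K}" using K by auto
 qed
 thus ?thesis
  by (simp add: boxplus_def Let_def topology_inverse')
qed

lemma P_pts: "pts P = pr ` pts CC"
proof
 show "pts P <= pr ` pts CC" using boxplus_open[of "pts P"] by simp
 have "{w : pts CC. pr w : pr ` pts CC} = pts CC" by blast
 hence "opn P (pr ` pts CC)" using boxplus_open[of "pr ` pts CC"] openin_topspace[of "mtop CC"] by auto
 thus "pr ` pts CC <= pts P" by (rule openin_subset)
qed

lemma P_ptsE:
 assumes "z : pts P"
 obtains w where "w : pts CC" "z = pr w"
 using assms unfolding P_pts by blast

lemma pr_pts: "w : pts CC ==> pr w : pts P"
 by (simp add: P_pts)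

text \<open>Plays the part of a deck transformation near \<open>w'\<close>: project to both bases
  and return through the sheets of \<open>w\<close>. By \<open>kap_local\<close> the points remain
  equivalent along the way.\<close>

lemma beq_transport:
 assumes b: "beq w w'"
 obtains ta where "smooth_at CC CC w' ta" "ta w' = w" "near CC w' (%u. beq (ta u) u)"
proof -
 note * = beqD[OF b]
 obtain V s where s: "(V, s) : csec L.C L.M L.q" "L.q (fst w) : V" "s (L.q (fst w)) = fst w"
  using csec_through[OF L.Cm L.Mm L.cov *(1)] .
 obtain V' s' where s': "(V', s') : csec R.C R.M R.q" "R.q (snd w) : V'" "s' (R.q (snd w)) = snd w"
  using csec_through[OF R.Cm R.Mm R.cov *(3)] .
 let ?ta = "%u. (s (L.q (fst u)), s' (R.q (snd u)))"
 have w': "w' : pts L.C \<times> pts R.C" using *(6) by simp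
 have n1: "near L.C (fst w') (%y'. L.q y' : V & s (L.q y') : pts L.C & L.q (s (L.q y')) = L.q y' & kap A (s (L.q y')) y' = kap A (fst w) (fst w'))"
  by (rule L.kap_local[OF *(1,2,7) s])
 have n2: "near R.C (snd w') (%y'. R.q y' : V' & s' (R.q y') : pts R.C & R.q (s' (R.q y')) = R.q y' & kap B (s' (R.q y')) y' = kap B (snd w) (snd w'))"
  by (rule R.kap_local[OF *(3,4,8) s'])
 note fs = sa_fst_snd[OF L.Cm R.Cm w']
 have sm: "smooth_at CC CC w' ?ta"
 proof (rule sa_Pair[OF L.Cm R.Cm CCm])
  show "smooth_at CC L.C w' (%u. s (L.q (fst u)))"
   by (rule sa_compose[OF CCm L.Mm L.Cm sa_compose[OF CCm L.Cm L.Mm fs(1) smD[OF L.qs *(2)]]])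
     (use csec_smooth[OF L.Cm L.Mm L.cov s(1,2)] *(7) in simp)
  show "smooth_at CC R.C w' (%u. s' (R.q (snd u)))"
   by (rule sa_compose[OF CCm R.Mm R.Cm sa_compose[OF CCm R.Cm R.Mm fs(2) smD[OF R.qs *(4)]]])
     (use csec_smooth[OF R.Cm R.Mm R.cov s'(1,2)] *(8) in simp)
 qed
 have N: "near CC w' (%u. beq (?ta u) u)"
  by (rule near_mono3[OF near_preimage[OF CCm L.Cm fs(1) n1] near_preimage[OF CCm R.Cm fs(2) n2] near_in_pts[OF *(6)]])
    (use *(9) in "auto simp: beq_def")
 show ?thesis
  by (rule that[OF sm _ N]) (use s(3) s'(3) *(7,8) in "simp add: prod_eq_iff")
qed

lemma pr_open:
 assumes W: "opn CC W"
 shows "opn P (pr ` W)"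
 unfolding boxplus_open
proof (intro conjI)
 have Wsub: "W <= pts CC" by (rule openin_subset[OF W])
 thus "pr ` W <= pr ` pts CC" by blast
 show "opn CC {w : pts CC. pr w : pr ` W}"
  unfolding openin_iff_nearby
 proof
  fix w' assume "w' : {w : pts CC. pr w : pr ` W}"
  then obtain w where w: "w' : pts CC" "w : W" "pr w' = pr w" by auto
  hence b: "beq w w'" using pr_eq_iff[of w w'] Wsub by auto
  obtain ta where t: "smooth_at CC CC w' ta" "ta w' = w" "near CC w' (%u. beq (ta u) u)" by (rule beq_transport[OF b])
  have "near CC w' (%u. ta u : W)" by (rule sa_continuous[OF CCm CCm t(1) W]) (use t(2) w(2) in simp)
  thus "near CC w' (%u. u : {w : pts CC. pr w : pr ` W})"
  proof (rule near_mono2[OF _ t(3)])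
   fix u assume u: "ta u : W" "beq (ta u) u"
   hence "pr (ta u) = pr u" using pr_eq_iff beqD(5,6) by blast
   thus "u : {w : pts CC. pr w : pr ` W}" using u(1) beqD(6)[OF u(2)] by (metis (mono_tags, lifting) imageI mem_Collect_eq)
  qed
 qed
qed

lemma pr_continuous: "continuous_map (mtop CC) (mtop P) pr"
 unfolding continuous_map_def using pr_pts boxplus_open by auto

lemma pr_locally_inj:
 assumes w: "w : pts CC"
 shows "EX V. opn CC V & w : V & inj_on pr V"
proof -
 have w12: "fst w : pts L.C" "snd w : pts R.C" "w : pts L.C \<times> pts R.C" using w by auto
 obtain V s where s: "(V, s) : csec L.C L.M L.q" "L.q (fst w) : V" "s (L.q (fst w)) = fst w"
  using csec_through[OF L.Cm L.Mm L.cov w12(1)] .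
 obtain V' s' where s': "(V', s') : csec R.C R.M R.q" "R.q (snd w) : V'" "s' (R.q (snd w)) = snd w"
  using csec_through[OF R.Cm R.Mm R.cov w12(2)] .
 note fs = sa_fst_snd[OF L.Cm R.Cm w12(3)]
 have "near CC w (%u. s (L.q (fst u)) = fst u & s' (R.q (snd u)) = snd u & u : pts CC)"
  by (rule near_mono3[OF near_preimage[OF CCm L.Cm fs(1) csec_near[OF L.Cm L.Mm L.cov s(1) w12(1) s(2,3)]]
     near_preimage[OF CCm R.Cm fs(2) csec_near[OF R.Cm R.Mm R.cov s'(1) w12(2) s'(2,3)]] near_in_pts[OF w]]) simp
 then obtain W where W: "opn CC W" "w : W" "!!u. u : W ==> s (L.q (fst u)) = fst u & s' (R.q (snd u)) = snd u & u : pts CC"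
  by (rule nearbyE) (rule that)
 have "inj_on pr W"
 proof (rule inj_onI)
  fix u u' assume u: "u : W" "u' : W" "pr u = pr u'"
  hence "beq u u'" using pr_eq_iff W(3) by blast
  from beqD(7,8)[OF this] show "u = u'" using W(3)[OF u(1)] W(3)[OF u(2)] by (metis prod_eq_iff)
 qed
 with W show ?thesis by blast
qed

lemma P_atlas: "atlas P = {(pr ` V, ka o inv_into V pr) | V ka. opn CC V & inj_on pr V & (EX U. (U, ka) : atlas CC & V <= U)}"
 by (simp only: boxplus_def Let_def manifold.simps)

lemma P_atlasE:
 assumes "(Y, mu) : atlas P"
 obtains V ka U where "Y = pr ` V" "mu = ka o inv_into V pr" "opn CC V" "inj_on pr V" "(U, ka) : atlas CC" "V <= U"
 using assms unfolding P_atlas by blast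

lemma P_atlasI:
 assumes "opn CC V" "inj_on pr V" "(U, ka) : atlas CC" "V <= U"
 shows "(pr ` V, ka o inv_into V pr) : atlas P"
 unfolding P_atlas using assms by blast

lemma P_top_chart:
 assumes V: "opn CC V" "inj_on pr V" and U: "(U, ka) : atlas CC" "V <= U"
 shows "top_chart (mtop P) (pr ` V) (ka o inv_into V pr)"
 unfolding top_chart_def
proof (intro conjI allI impI)
 have i: "inv_into V pr (pr w) = w" if "w : V" for w using V(2) that by simp
 note tc = chart_top_chart[OF CCm U(1)]
 show "opn P (pr ` V)" by (rule pr_open[OF V(1)])
 show "inj_on (ka o inv_into V pr) (pr ` V)"
  using chart_inj[OF CCm U(1)] U(2) i by (auto simp: inj_on_def subset_iff)
 show "opn P {z : pr ` V. (ka o inv_into V pr) z : S}" if S: "open S" for S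
 proof -
  have "{z : pr ` V. (ka o inv_into V pr) z : S} = pr ` (V Int {w : U. ka w : S})" using i U(2) by auto
  thus ?thesis using pr_open[OF openin_Int[OF V(1) chart_pre[OF CCm U(1) S]]] by simp
 qed
 fix W assume W: "opn P W & W <= pr ` V"
 have "(ka o inv_into V pr) ` W = ka ` (V Int {w : pts CC. pr w : W})"
 proof (intro equalityI subsetI)
  fix x assume "x : (ka o inv_into V pr) ` W"
  then obtain w where "w : V" "pr w : W" "x = ka w" using W i by fastforce
  thus "x : ka ` (V Int {w : pts CC. pr w : W})" using openin_subset[OF V(1)] by blast
 next
  fix x assume "x : ka ` (V Int {w : pts CC. pr w : W})"
  then obtain w where w: "w : V" "pr w : W" "x = ka w" by blast
  hence "x = (ka o inv_into V pr) (pr w)" using i by simp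
  thus "x : (ka o inv_into V pr) ` W" using w(2) by blast
 qed
 moreover have "opn CC {w : pts CC. pr w : W}" using W boxplus_open by blast
 ultimately show "open ((ka o inv_into V pr) ` W)"
  using chart_img[OF CCm U(1) openin_Int[OF V(1)] le_infI1[OF U(2)]] by simp
qed

text \<open>A common point of two charts comes from two equivalent points of the product covering.
  In these charts the transition map is the smooth map \<open>ta\<close> of
  \<open>beq_transport\<close> between them.\<close>

lemma P_transition:
 assumes V: "opn CC V" "inj_on pr V" "(U, ka) : atlas CC" "V <= U"
  and V': "opn CC V'" "inj_on pr V'" "(U', ka') : atlas CC" "V' <= U'"
 shows "smooth_on ((ka o inv_into V pr) ` (pr ` V Int pr ` V')) ((ka' o inv_into V' pr) o inv_into (pr ` V) (ka o inv_into V pr))"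
proof (rule so_local)
 note tc = P_top_chart[OF V] and tc' = P_top_chart[OF V']
 have i: "inv_into V pr (pr w) = w" if "w : V" for w using V(2) that by simp
 have i': "inv_into V' pr (pr w) = w" if "w : V'" for w using V'(2) that by simp
 show "open ((ka o inv_into V pr) ` (pr ` V Int pr ` V'))"
  using tc pr_open[OF V(1)] pr_open[OF V'(1)] by (auto simp: top_chart_def)
 fix x assume "x : (ka o inv_into V pr) ` (pr ` V Int pr ` V')"
 then obtain w w' where w: "w : V" "w' : V'" "pr w = pr w'" "x = ka w" using i by fastforce
 have wC: "w : pts CC" "w' : pts CC" using w openin_subset[OF V(1)] openin_subset[OF V'(1)] by blast+
 hence b: "beq w' w" using pr_eq_iff w(3) by metis
 obtain ta where t: "smooth_at CC CC w ta" "ta w = w'" "near CC w (%u. beq (ta u) u)" by (rule beq_transport[OF b])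
 obtain W where W: "opn CC W" "w : W" "W <= U" "ta ` W <= U'" "open (ka ` W)"
  "smooth_on (ka ` W) (%x. ka' (ta (inv_into U ka x)))"
  by (rule sa_charts[OF CCm CCm t(1) V(3) _ V'(3)]) (use w V(4) V'(4) t(2) in auto)
 have "near CC w (%u. ta u : V')" by (rule sa_continuous[OF CCm CCm t(1) V'(1)]) (use t(2) w(2) in simp)
 from near_mono3[OF this t(3) near_open[OF V(1) w(1)], of "%u. ta u : V' & beq (ta u) u & u : V"]
 have "near CC w (%u. ta u : V' & beq (ta u) u & u : V)" by simp
 then obtain W1 where W1: "opn CC W1" "w : W1" "!!u. u : W1 ==> ta u : V' & beq (ta u) u & u : V" by (rule nearbyE) (rule that)
 have op: "open (ka ` (W Int W1))" by (rule chart_img[OF CCm V(3) openin_Int[OF W(1) W1(1)]]) (use W(3) in blast)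
 show "EX T. open T & x : T & smooth_on T ((ka' o inv_into V' pr) o inv_into (pr ` V) (ka o inv_into V pr))"
 proof (intro exI[of _ "ka ` (W Int W1)"] conjI op)
  show "x : ka ` (W Int W1)" using w(4) W(2) W1(2) by blast
  show "smooth_on (ka ` (W Int W1)) ((ka' o inv_into V' pr) o inv_into (pr ` V) (ka o inv_into V pr))"
  proof (rule so_cong[OF op so_subset[OF W(6)]])
   fix y assume "y : ka ` (W Int W1)"
   then obtain u where u: "u : W" "u : W1" "y = ka u" by blast
   note u1 = W1(3)[OF u(2)]
   have "u : U" using u(1) W(3) by blast
   hence "inv_into U ka y = u" unfolding u(3) by (rule chart_inv[OF CCm V(3)])
   moreover have "inv_into (pr ` V) (ka o inv_into V pr) y = pr u"
   proof (rule inv_into_f_eq)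
    show "inj_on (ka o inv_into V pr) (pr ` V)" using tc by (simp add: top_chart_def)
   qed (use u u1 i in auto)
   moreover have "pr u = pr (ta u)" using u1 pr_eq_iff beqD(5,6) by metis
   ultimately show "ka' (ta (inv_into U ka y)) = ((ka' o inv_into V' pr) o inv_into (pr ` V) (ka o inv_into V pr)) y"
    using i' u1 by simp
  qed blast
 qed
qed

lemma P_chart_around:
 assumes w: "w : pts CC"
 obtains V U ka where "opn CC V" "inj_on pr V" "(U, ka) : atlas CC" "V <= U" "w : V"
proof -
 obtain V where V: "opn CC V" "w : V" "inj_on pr V" using pr_locally_inj[OF w] by blast
 obtain U ka where U: "(U, ka) : atlas CC" "w : U" using chart_exists[OF CCm w] by blast
 show ?thesis
  by (rule that[OF openin_Int[OF V(1) chart_openin[OF CCm U(1)]] inj_on_subset[OF V(3)] U(1)]) (use V U in auto)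
qed

text \<open>The covering \<open>r\<close>: over a product of coordinate balls, \<open>kap\<close> takes the same value at all points
 of two given sheets, so the sheets of the product covering are either identified or kept apart.\<close>

lemma box_even:
 assumes p: "p : pts MM"
 obtains V T where "opn MM V" "p : V" "!!t. t : T ==> ALL y:V. smooth_at MM CC y t"
  "!!t. t : T ==> opn P (pr ` t ` V)"
  "!!t y. t : T ==> y : V ==> t y : pts CC & r (pr (t y)) = y"
  "!!z. z : pts P ==> r z : V ==> EX t:T. pr (t (r z)) = z"
  "!!t t' y y'. t : T ==> t' : T ==> y : V ==> y' : V ==> pr (t y) = pr (t' y) ==> pr (t y') = pr (t' y')"
proof -
 have p12: "fst p : pts L.M" "snd p : pts R.M" using p by auto
 obtain V1 R1 where V1: "opn L.M V1" "fst p : V1" "!!s y. s : R1 ==> y : V1 ==> s y : pts L.C & L.q (s y) = y & smooth_at L.M L.C y s"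
  "!!s. s : R1 ==> opn L.C (s ` V1)" "!!x. x : pts L.C ==> L.q x : V1 ==> EX s:R1. s (L.q x) = x"
  "!!s s' y y'. s : R1 ==> s' : R1 ==> y : V1 ==> y' : V1 ==> kap A (s y) (s' y) = kap A (s y') (s' y')"
  by (rule L.even_nbhd[OF p12(1)]) (rule that)
 obtain V2 R2 where V2: "opn R.M V2" "snd p : V2" "!!s y. s : R2 ==> y : V2 ==> s y : pts R.C & R.q (s y) = y & smooth_at R.M R.C y s"
  "!!s. s : R2 ==> opn R.C (s ` V2)" "!!x. x : pts R.C ==> R.q x : V2 ==> EX s:R2. s (R.q x) = x"
  "!!s s' y y'. s : R2 ==> s' : R2 ==> y : V2 ==> y' : V2 ==> kap B (s y) (s' y) = kap B (s y') (s' y')"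
  by (rule R.even_nbhd[OF p12(2)]) (rule that)
 define T where "T = {%y. (s (fst y), s' (snd y)) | s s'. s : R1 & s' : R2}"
 let ?V = "V1 \<times> V2"
 have TE: "EX s s'. s : R1 & s' : R2 & t = (%y. (s (fst y), s' (snd y)))" if "t : T" for t using that unfolding T_def by blast
 show ?thesis
 proof (rule that[of ?V T])
  show "opn MM ?V" using V1(1) V2(1) by (simp add: openin_prod_Times_iff)
  show "p : ?V" using V1(2) V2(2) by (simp add: mem_Times_iff)
  show "ALL y:?V. smooth_at MM CC y t" if t: "t : T" for t
  proof
   fix y assume y: "y : ?V"
   obtain s s' where ss: "s : R1" "s' : R2" "t = (%y. (s (fst y), s' (snd y)))" using TE[OF t] by blast
   have yM: "y : pts L.M \<times> pts R.M" using y openin_subset[OF V1(1)] openin_subset[OF V2(1)] by auto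
   note fs = sa_fst_snd[OF L.Mm R.Mm yM]
   show "smooth_at MM CC y t"
    unfolding ss(3)
    by (rule sa_Pair[OF L.Cm R.Cm MMm sa_compose[OF MMm L.Mm L.Cm fs(1)] sa_compose[OF MMm R.Mm R.Cm fs(2)]])
      (use V1(3)[OF ss(1)] V2(3)[OF ss(2)] y in auto)
  qed
  show "opn P (pr ` t ` ?V)" if t: "t : T" for t
  proof (rule pr_open)
   obtain s s' where ss: "s : R1" "s' : R2" "t = (%y. (s (fst y), s' (snd y)))" using TE[OF t] by blast
   have "t ` ?V = (s ` V1) \<times> (s' ` V2)" unfolding ss(3) by force
   thus "opn CC (t ` ?V)" using V1(4)[OF ss(1)] V2(4)[OF ss(2)] by (simp add: openin_prod_Times_iff)
  qed
  show tv: "t y : pts CC & r (pr (t y)) = y" if t: "t : T" and y: "y : ?V" for t y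
  proof -
   obtain s s' where ss: "s : R1" "s' : R2" "t = (%y. (s (fst y), s' (snd y)))" using TE[OF t] by blast
   have "t y : pts CC" using V1(3)[OF ss(1)] V2(3)[OF ss(2)] y by (auto simp: ss(3))
   thus ?thesis using box_r_pr[of "t y"] V1(3)[OF ss(1)] V2(3)[OF ss(2)] y by (auto simp: ss(3) prod_eq_iff)
  qed
  show "EX t:T. pr (t (r z)) = z" if z: "z : pts P" "r z : ?V" for z
  proof -
   obtain w where w: "w : pts CC" "z = pr w" using z(1) by (rule P_ptsE)
   have rz: "r z = (L.q (fst w), R.q (snd w))" using box_r_pr[OF w(1)] w(2) by simp
   obtain s where s: "s : R1" "s (L.q (fst w)) = fst w" using V1(5)[of "fst w"] w(1) z(2) rz by auto
   obtain s' where s': "s' : R2" "s' (R.q (snd w)) = snd w" using V2(5)[of "snd w"] w(1) z(2) rz by auto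
   show ?thesis
   proof (rule bexI)
    show "pr ((%y. (s (fst y), s' (snd y))) (r z)) = z" using rz s s' w(2) by simp
    show "(%y. (s (fst y), s' (snd y))) : T" using s s' unfolding T_def by blast
   qed
  qed
  fix t t' y y' assume t: "t : T" "t' : T" and y: "y : ?V" "y' : ?V" and eq: "pr (t y) = pr (t' y)"
  obtain s s' where ss: "s : R1" "s' : R2" "t = (%y. (s (fst y), s' (snd y)))" using TE[OF t(1)] by blast
  obtain u u' where uu: "u : R1" "u' : R2" "t' = (%y. (u (fst y), u' (snd y)))" using TE[OF t(2)] by blast
  have b: "beq (t y) (t' y)" using pr_eq_iff tv[OF t(1) y(1)] tv[OF t(2) y(1)] eq by blast
  have k: "kap A (s (fst y)) (u (fst y)) = kap B (s' (snd y)) (u' (snd y))" using beqD(9)[OF b] by (simp add: ss(3) uu(3))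
  have yy: "fst y : V1" "fst y' : V1" "snd y : V2" "snd y' : V2" using y by auto
  have k': "kap A (s (fst y')) (u (fst y')) = kap B (s' (snd y')) (u' (snd y'))"
   using k V1(6)[OF ss(1) uu(1) yy(1,2)] V2(6)[OF ss(2) uu(2) yy(3,4)] by simp
  have "beq (t y') (t' y')"
   using tv[OF t(1) y(2)] tv[OF t(2) y(2)] k' V1(3)[OF ss(1) yy(2)] V1(3)[OF uu(1) yy(2)] V2(3)[OF ss(2) yy(4)] V2(3)[OF uu(2) yy(4)]
   by (simp add: beq_def ss(3) uu(3))
  thus "pr (t y') = pr (t' y')" using pr_eq_iff beqD(5,6) by blast
 qed
qed

lemma r_pts: "z : pts P ==> r z : pts MM"
 using box_r_pr L.qpts R.qpts by (auto elim!: P_ptsE)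

text \<open>Points with different images are separated in the product of the bases. Points with the
  same image lie in two sheets over an evenly covered set, and sheets that meet coincide.\<close>

lemma P_Hausdorff: "Hausdorff_space (mtop P)"
 unfolding Hausdorff_space_def
proof (intro allI impI)
 fix z z' assume zz: "z : pts P & z' : pts P & z ~= z'"
 have rc: "opn P {z : pts P. r z : S}" if S: "opn MM S" for S
 proof -
  have "opn CC {w : pts CC. (L.q (fst w), R.q (snd w)) : S}"
   unfolding openin_iff_nearby
  proof
   fix w assume w: "w : {w : pts CC. (L.q (fst w), R.q (snd w)) : S}"
   hence w': "w : pts L.C \<times> pts R.C" by simp
   note fs = sa_fst_snd[OF L.Cm R.Cm w']
   have "smooth_at CC MM w (%w. (L.q (fst w), R.q (snd w)))"
    by (rule sa_Pair[OF L.Mm R.Mm CCm sa_compose[OF CCm L.Cm L.Mm fs(1)] sa_compose[OF CCm R.Cm R.Mm fs(2)]])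
      (use smD[OF L.qs] smD[OF R.qs] w' in auto)
   from sa_continuous[OF CCm MMm this S] w
   have 1: "near CC w (%w. (L.q (fst w), R.q (snd w)) : S)" by simp
   have 2: "near CC w (%u. u : pts CC)" by (rule near_in_pts) (use w in simp)
   show "near CC w (%u. u : {w : pts CC. (L.q (fst w), R.q (snd w)) : S})"
    by (rule near_mono2[OF 1 2]) simp
  qed
  moreover have "{w : pts CC. pr w : {z : pts P. r z : S}} = {w : pts CC. (L.q (fst w), R.q (snd w)) : S}"
   using box_r_pr pr_pts by auto
  ultimately show ?thesis unfolding boxplus_open P_pts by auto
 qed
 show "EX U V. opn P U & opn P V & z : U & z' : V & disjnt U V"
 proof (cases "r z = r z'")
  case False
  have "Hausdorff_space (mtop MM)" using MMm by (simp add: smooth_manifold_iff)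
  then obtain S S' where S: "opn MM S" "opn MM S'" "r z : S" "r z' : S'" "disjnt S S'"
   unfolding Hausdorff_space_def using False r_pts zz by metis
  have "disjnt {z : pts P. r z : S} {z : pts P. r z : S'}" using S(5) unfolding disjnt_iff by blast
  moreover have "z : {z : pts P. r z : S}" "z' : {z : pts P. r z : S'}" using S(3,4) zz by blast+
  ultimately show ?thesis using rc[OF S(1)] rc[OF S(2)] by blast
 next
  case True
  obtain V T where V: "opn MM V" "r z : V" "!!t. t : T ==> ALL y:V. smooth_at MM CC y t"
   "!!t. t : T ==> opn P (pr ` t ` V)" "!!t y. t : T ==> y : V ==> t y : pts CC & r (pr (t y)) = y"
   "!!z. z : pts P ==> r z : V ==> EX t:T. pr (t (r z)) = z"
   "!!t t' y y'. t : T ==> t' : T ==> y : V ==> y' : V ==> pr (t y) = pr (t' y) ==> pr (t y') = pr (t' y')"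
   by (rule box_even[OF r_pts[OF conjunct1[OF zz]]]) (rule that)
  obtain t where t: "t : T" "pr (t (r z)) = z" using V(6)[of z] V(2) zz by blast
  obtain t' where t': "t' : T" "pr (t' (r z)) = z'" using V(6)[of z'] V(2) zz True by auto
  have "disjnt (pr ` t ` V) (pr ` t' ` V)"
  proof (rule ccontr)
   assume "~ disjnt (pr ` t ` V) (pr ` t' ` V)"
   then obtain y y' where y: "y : V" "y' : V" "pr (t y) = pr (t' y')" by (auto simp: disjnt_iff)
   hence "y = y'" using V(5)[OF t(1) y(1)] V(5)[OF t'(1) y(2)] by metis
   thus False using V(7)[OF t(1) t'(1) y(1) V(2)] y t t' zz by auto
  qed
  thus ?thesis
   using V(4)[OF t(1)] V(4)[OF t'(1)] t t' V(2) by (intro exI[of _ "pr ` t ` V"] exI[of _ "pr ` t' ` V"]) auto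
 qed
qed

lemma Pm: "mfd P"
 unfolding smooth_manifold_iff
proof (intro conjI)
 show "Hausdorff_space (mtop P)" by (rule P_Hausdorff)
 show "second_countable (mtop P)"
 proof (rule second_countable_open_map_image[OF pr_continuous])
  show "open_map (mtop CC) (mtop P) pr" unfolding open_map_def using pr_open by blast
  show "pr ` pts CC = pts P" using P_pts by simp
  show "second_countable (mtop CC)" using CCm by (simp add: smooth_manifold_iff)
 qed
 show "pts P = (UN (U, ka):atlas P. U)"
 proof (intro equalityI subsetI)
  fix z assume "z : pts P"
  then obtain w where w: "w : pts CC" "z = pr w" by (rule P_ptsE)
  obtain V U ka where V: "opn CC V" "inj_on pr V" "(U, ka) : atlas CC" "V <= U" "w : V" by (rule P_chart_around[OF w(1)])
  have "z : (case (pr ` V, ka o inv_into V pr) of (U, ka) => U)" using w(2) V(5) by simp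
  thus "z : (UN (U, ka):atlas P. U)" using P_atlasI[OF V(1-4)] by blast
 next
  fix z assume "z : (UN (U, ka):atlas P. U)"
  then obtain Y mu where Y: "(Y, mu) : atlas P" "z : Y" by blast
  from Y(1) obtain V ka U where V: "Y = pr ` V" "opn CC V" by (rule P_atlasE)
  thus "z : pts P" unfolding P_pts using Y(2) openin_subset[OF V(2)] by blast
 qed
 have 1: "top_chart (mtop P) Y mu" if c: "(Y, mu) : atlas P" for Y mu
 proof -
  obtain V ka U where V: "Y = pr ` V" "mu = ka o inv_into V pr" "opn CC V" "inj_on pr V" "(U, ka) : atlas CC" "V <= U"
   using c by (rule P_atlasE)
  show ?thesis unfolding V(1,2) by (rule P_top_chart[OF V(3-6)])
 qed
 thus "ALL (U, ka):atlas P. top_chart (mtop P) U ka" by blast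
 have 2: "smooth_on (mu ` (Y Int Y')) (mu' o inv_into Y mu)" if c: "(Y, mu) : atlas P" and c': "(Y', mu') : atlas P" for Y mu Y' mu'
 proof -
  obtain V ka U where V: "Y = pr ` V" "mu = ka o inv_into V pr" "opn CC V" "inj_on pr V" "(U, ka) : atlas CC" "V <= U"
   using c by (rule P_atlasE)
  obtain V' ka' U' where V': "Y' = pr ` V'" "mu' = ka' o inv_into V' pr" "opn CC V'" "inj_on pr V'" "(U', ka') : atlas CC" "V' <= U'"
   using c' by (rule P_atlasE)
  show ?thesis unfolding V(1,2) V'(1,2) by (rule P_transition[OF V(3-6) V'(3-6)])
 qed
 thus "ALL (U, ka):atlas P. ALL (V, ka'):atlas P. smooth_on (ka ` (U Int V)) (ka' o inv_into U ka)" by blast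
qed

lemma pr_smooth: "smooth_map CC P pr"
 unfolding smooth_map_def
proof
 fix w assume w: "w : pts CC"
 obtain V U ka where V: "opn CC V" "inj_on pr V" "(U, ka) : atlas CC" "V <= U" "w : V" by (rule P_chart_around[OF w])
 have oV: "open (ka ` V)" by (rule chart_img[OF CCm V(3,1,4)])
 show "smooth_at CC P w pr"
 proof (rule smooth_atI[OF V(3) P_atlasI[OF V(1-4)] V(1,5,4)])
  show "smooth_on (ka ` V) (%x. (ka o inv_into V pr) (pr (inv_into U ka x)))"
   by (rule so_cong[OF oV so_id[OF oV]]) (use chart_inv[OF CCm V(3)] V(2,4) in auto)
 qed blast
qed

lemma pr_inv_smooth:
 assumes V: "opn CC V" "inj_on pr V" "(U, ka) : atlas CC" "V <= U" and z: "z : pr ` V"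
 shows "smooth_at P CC z (inv_into V pr)"
proof (rule smooth_atI[OF P_atlasI[OF V] V(3) pr_open[OF V(1)] z])
 have oV: "open (ka ` V)" by (rule chart_img[OF CCm V(3,1,4)])
 have i: "inv_into V pr (pr w) = w" if "w : V" for w using V(2) that by simp
 have im: "(ka o inv_into V pr) ` pr ` V = ka ` V" using i by force
 show "inv_into V pr ` pr ` V <= U" using i V(4) by auto
 show "smooth_on ((ka o inv_into V pr) ` pr ` V) (%x. ka (inv_into V pr (inv_into (pr ` V) (ka o inv_into V pr) x)))"
  unfolding im
 proof (rule so_cong[OF oV so_id[OF oV]])
  fix x assume "x : ka ` V"
  then obtain w where w: "w : V" "x = ka w" by blast
  have "inv_into (pr ` V) (ka o inv_into V pr) x = pr w"
  proof (rule inv_into_f_eq)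
   show "inj_on (ka o inv_into V pr) (pr ` V)" using P_top_chart[OF V] by (simp add: top_chart_def)
  qed (use w i in auto)
  thus "x = ka (inv_into V pr (inv_into (pr ` V) (ka o inv_into V pr) x))" using w i by simp
 qed
qed simp

lemma r_smooth: "smooth_map P MM r"
 unfolding smooth_map_def
proof
 fix z assume "z : pts P"
 then obtain w where w: "w : pts CC" "z = pr w" by (rule P_ptsE)
 obtain V U ka where V: "opn CC V" "inj_on pr V" "(U, ka) : atlas CC" "V <= U" "w : V" by (rule P_chart_around[OF w(1)])
 have i: "inv_into V pr (pr w) = w" if "w : V" for w using V(2) that by simp
 have w': "w : pts L.C \<times> pts R.C" using w by simp
 note fs = sa_fst_snd[OF L.Cm R.Cm w']
 have "smooth_at CC MM w (%w. (L.q (fst w), R.q (snd w)))"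
  by (rule sa_Pair[OF L.Mm R.Mm CCm sa_compose[OF CCm L.Cm L.Mm fs(1)] sa_compose[OF CCm R.Cm R.Mm fs(2)]])
    (use smD[OF L.qs] smD[OF R.qs] w' in auto)
 hence "smooth_at P MM z (%z. (L.q (fst (inv_into V pr z)), R.q (snd (inv_into V pr z))))"
  using sa_compose[OF Pm CCm MMm pr_inv_smooth[OF V(1-4), of z], of "%w. (L.q (fst w), R.q (snd w))"] w(2) V(5) i by simp
 thus "smooth_at P MM z r"
 proof (rule sa_cong[OF Pm])
  show "near P z (%z. r z = (L.q (fst (inv_into V pr z)), R.q (snd (inv_into V pr z))))"
   by (rule nearbyI[OF pr_open[OF V(1)]]) (use w V(5) i box_r_pr openin_subset[OF V(1)] in auto)
 qed
qed

text \<open>By \<open>box_even\<close>, two sheets that agree at one point agree everywhere over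
  \<open>V\<close>, so distinct sheets are disjoint. Afterwards the results on coverings, in
  particular lifting of isotopies, are applied to \<open>r\<close> itself.\<close>

lemma r_covering: "smooth_covering P MM r"
 unfolding smooth_covering_def
proof (intro conjI ballI)
 show "smooth_map P MM r" by (rule r_smooth)
 show "r ` pts P = pts MM"
 proof (intro equalityI subsetI)
  fix p assume p: "p : pts MM"
  have pp: "fst p : L.q ` pts L.C" "snd p : R.q ` pts R.C"
   unfolding covD(2)[OF L.cov] covD(2)[OF R.cov] using p by auto
  obtain x where "x : pts L.C" "L.q x = fst p" using pp(1) by (auto elim!: imageE)
  moreover obtain y where "y : pts R.C" "R.q y = snd p" using pp(2) by (auto elim!: imageE)
  ultimately have "(x, y) : pts CC" "r (pr (x, y)) = p" using box_r_pr[of "(x, y)"] by (auto simp: prod_eq_iff)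
  thus "p : r ` pts P" using pr_pts by blast
 qed (use r_pts in blast)
 fix p assume p: "p : pts MM"
 obtain V T where V: "opn MM V" "p : V" "!!t. t : T ==> ALL y:V. smooth_at MM CC y t"
  "!!t. t : T ==> opn P (pr ` t ` V)" "!!t y. t : T ==> y : V ==> t y : pts CC & r (pr (t y)) = y"
  "!!z. z : pts P ==> r z : V ==> EX t:T. pr (t (r z)) = z"
  "!!t t' y y'. t : T ==> t' : T ==> y : V ==> y' : V ==> pr (t y) = pr (t' y) ==> pr (t y') = pr (t' y')"
  by (rule box_even[OF p]) (rule that)
 let ?U = "(%t. pr ` t ` V) ` T"
 have bij: "bij_betw r (pr ` t ` V) V" if t: "t : T" for t
  unfolding bij_betw_def
 proof
  have e: "r (pr (t y)) = y" if "y : V" for y using V(5)[OF t that] by simp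
  show "inj_on r (pr ` t ` V)"
  proof (rule inj_onI)
   fix z z' assume "z : pr ` t ` V" "z' : pr ` t ` V" "r z = r z'"
   then obtain y y' where "y : V" "y' : V" "z = pr (t y)" "z' = pr (t y')" by (elim imageE) (rule that, simp_all)
   with e `r z = r z'` show "z = z'" by simp
  qed
  have "(%y. r (pr (t y))) ` V = id ` V" by (rule image_cong[OF refl]) (simp add: e)
  thus "r ` pr ` t ` V = V" by (simp add: image_image)
 qed
 have inv: "inv_into (pr ` t ` V) r y = pr (t y)" if t: "t : T" and y: "y : V" for t y
 proof (rule inv_into_f_eq)
  show "inj_on r (pr ` t ` V)" using bij[OF t] by (simp add: bij_betw_def)
  show "pr (t y) : pr ` t ` V" by (intro imageI y)
  show "r (pr (t y)) = y" using V(5)[OF t y] by simp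
 qed
 show "EX V \<U>. opn MM V & p : V & \<Union>\<U> = pts P Int r -` V & pairwise disjnt \<U> &
    (ALL U:\<U>. opn P U & bij_betw r U V & (ALL y:V. smooth_at MM P y (inv_into U r)))"
 proof (intro exI[of _ V] exI[of _ ?U] conjI ballI, rule V(1), rule V(2))
  show "\<Union>?U = pts P Int r -` V"
  proof (intro equalityI subsetI)
   fix z assume "z : \<Union>?U"
   then obtain t y where "t : T" "y : V" "z = pr (t y)" by blast
   thus "z : pts P Int r -` V" using V(5)[of t y] pr_pts by auto
  next
   fix z assume z: "z : pts P Int r -` V"
   then obtain t where "t : T" "pr (t (r z)) = z" using V(6) by blast
   hence "z : pr ` t ` V" using z by blast
   with `t : T` show "z : \<Union>?U" by blast
  qed
  show "pairwise disjnt ?U"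
   unfolding pairwise_def
  proof (intro ballI impI)
   fix S S' assume "S : ?U" "S' : ?U" "S ~= S'"
   then obtain t t' where t: "t : T" "S = pr ` t ` V" "t' : T" "S' = pr ` t' ` V" by blast
   show "disjnt S S'"
   proof (rule ccontr)
    assume "~ disjnt S S'"
    then obtain y y' where y: "y : V" "y' : V" "pr (t y) = pr (t' y')" using t by (auto simp: disjnt_iff)
    hence "y = y'" using V(5)[OF t(1) y(1)] V(5)[OF t(3) y(2)] by metis
    hence "pr (t x) = pr (t' x)" if "x : V" for x using V(7)[OF t(1,3) y(1) that] y by simp
    hence "S = S'" unfolding t(2,4) by (simp add: image_image)
    thus False using `S ~= S'` by blast
   qed
  qed
  fix S assume "S : ?U"
  then obtain t where t: "t : T" "S = pr ` t ` V" by blast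
  show "opn P S" "bij_betw r S V" using V(4)[OF t(1)] bij[OF t(1)] t(2) by auto
  fix y assume y: "y : V"
  have "t y : pts CC" using V(5)[OF t(1) y] by blast
  have "smooth_at MM P y (%y. pr (t y))"
   by (rule sa_compose[OF MMm CCm Pm bspec[OF V(3)[OF t(1)] y] smD[OF pr_smooth `t y : pts CC`]])
  thus "smooth_at MM P y (inv_into S r)"
   by (rule sa_cong[OF MMm]) (rule nearbyI[OF V(1) y], use inv[OF t(1)] t(2) in simp)
 qed
qed

lemma P_connected: "connected_space (mtop P)"
proof -
 have "connected_space (mtop CC)" using L.Cconn R.Cconn by (simp add: connected_space_prod_topology)
 thus ?thesis
  using connected_space_quotient_map_image connectedin_continuous_map_image[OF pr_continuous, of "pts CC"] P_pts
  by (simp add: connectedin_topspace[symmetric])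
qed

lemma P_ne: "pts P ~= {}"
 using L.Cne R.Cne by (simp add: P_pts)

end

section \<open>Bundle-valued 2-forms\<close>

lemma length_2_conv: "(ALL vs. length vs = 2 --> P vs) <-> (ALL v w. P [v, w])"
 by (auto simp: numeral_2_eq_2 length_Suc_conv)

lemma length_3_conv: "(ALL vs. length vs = 3 --> P vs) <-> (ALL u v w. P [u, v, w])"
 by (auto simp: numeral_3_eq_3 length_Suc_conv)

lemma bundle_form2_iff:
 "bundle_form M E 2 al <-> (ALL p vs. p ~: pts M | length vs ~= 2 --> al p vs = 0) &
   (ALL p:pts M. ALL v w. al p [v, w] : fibre E p & linear (%v. al p [v, w]) & linear (%w. al p [v, w]) & al p [v, v] = 0) &
   (ALL p:pts M. ALL X Y. smooth_vf_at M p X & smooth_vf_at M p Y --> ssec M E p (%q. al q [X q, Y q]))"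
proof -
 have 2: "(ALL Xs. length Xs = 2 & (ALL X:set Xs. Q X) --> R Xs) <-> (ALL X Y. Q X & Q Y --> R [X, Y])" for Q :: "'z => bool" and R
  using length_2_conv[of "%Xs. (ALL X:set Xs. Q X) --> R Xs"] by (simp add: imp_conjL)
 have 3: "(ALL i<2. S i) <-> S 0 & S 1" for S :: "nat => bool" by (auto simp: less_2_cases_iff)
 show ?thesis
  unfolding bundle_form_def length_2_conv 2 3 by (simp; intro conj_cong refl ball_cong) blast
qed

text \<open>Coefficient of the form in the frame \<open>e\<close>, with both vectors read in the one
  chart of \<open>m\<close> at every nearby point. It is differentiable in the coordinate
  \<open>z\<close>, whereas the raw values of the form refer to a different chart at each
  point.\<close>

definition f2c :: "('a, 'e::euclidean_space) manifold => ('a, 'e, 'l::real_vector) eform => ('a => 'l) => 'a => 'e => 'e => 'e => real" where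
 "f2c M al e m z v w =
   (let q = cinv M m z in fcf (al q [cvf M m v q, cvf M m w q]) (e q))"

lemma coord_vf_compose:
 assumes M: "mfd M" and N: "mfd N" and f: "smooth_at N M q f" and m: "m : pts M" "f q : cdom M m"
 shows "tmap N M f q v = cvf M m (dmf N (%q. crd M m (f q)) q v) (f q)"
 using tmap_compose[OF N M euclid_m f crd_smooth[OF M m(1) m(2)]] coord_vf_tmap_crd[OF M m(1) m(2)] by simp

context
 fixes M :: "('a, 'e::euclidean_space) manifold" and E :: "('a, 'l::real_vector) lbundle" and D and al
 assumes FB: "flat_bundle M E D" and al: "bundle_form M E 2 al"
begin

private lemmas Mm = fbD(1)[OF FB] and Eo = fbD(2)[OF FB]

lemma form2_fibre: "p : pts M ==> al p [v, w] : fibre E p"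
 and form2_linear1: "p : pts M ==> linear (%v. al p [v, w])"
 and form2_linear2: "p : pts M ==> linear (%w. al p [v, w])"
 and form2_alt: "p : pts M ==> al p [v, v] = 0"
 and form2_smooth: "p : pts M ==> smooth_vf_at M p X ==> smooth_vf_at M p Y ==> ssec M E p (%q. al q [X q, Y q])"
 using al unfolding bundle_form2_iff by blast+

lemma form2_outside: "p ~: pts M | length vs ~= 2 ==> al p vs = 0"
 using al unfolding bundle_form2_iff by blast

context
 fixes U e m
 assumes e: "flatf M E D U e" and m: "m : U"
begin

private lemma mM: "m : pts M" by (rule sframe_pts[OF ffD(1)[OF e] m])

lemma form2_coef_eq:
 assumes q: "q : cdom M m" "q : U"
 shows "al q [cvf M m v q, cvf M m w q] = f2c M al e m (crd M m q) v w *R e q"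
proof -
 have "q : pts M" by (rule sframe_pts[OF ffD(1)[OF e] q(2)])
 from fibre_coef[OF Mm Eo this sframeD(1,2)[OF ffD(1)[OF e] q(2)] form2_fibre[OF this]]
 show ?thesis by (simp add: f2c_def crd_inv_crd[OF Mm mM q(1)] Let_def)
qed

lemma form2_coef_linear:
 assumes q: "q : cdom M m" "q : U"
 shows "linear (%v. f2c M al e m (crd M m q) v w)" "linear (f2c M al e m (crd M m q) v)"
  "f2c M al e m (crd M m q) v v = 0"
  "f2c M al e m (crd M m q) v w = - f2c M al e m (crd M m q) w v"
proof -
 have qM: "q : pts M" by (rule sframe_pts[OF ffD(1)[OF e] q(2)])
 have e0: "e q ~= 0" by (rule sframeD(2)[OF ffD(1)[OF e] q(2)])
 note c = form2_coef_eq[OF q]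
 note cl = coord_vf_linear[OF Mm mM q(1)]
 have l1: "linear (%v. f2c M al e m (crd M m q) v w *R e q)" for w
  using linear_compose[OF cl form2_linear1[OF qM]] unfolding c[symmetric] by (simp add: o_def)
 have l2: "linear (%w. f2c M al e m (crd M m q) v w *R e q)" for v
  using linear_compose[OF cl form2_linear2[OF qM]] unfolding c[symmetric] by (simp add: o_def)
 have l: "linear g" if "linear (%v. g v *R e q)" for g :: "'e => real"
 proof (rule linearI)
  show "g (x + y) = g x + g y" for x y using linear_add[OF that, of x y] e0 by (simp add: scaleR_left.add[symmetric])
  show "g (k *R x) = k *R g x" for k x using linear_scale[OF that, of k x] e0 by simp
 qed
 show L1: "linear (%v. f2c M al e m (crd M m q) v w)" for w by (rule l[OF l1])
 show L2: "linear (f2c M al e m (crd M m q) v)" for v by (rule l[OF l2])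
 show a: "f2c M al e m (crd M m q) v v = 0" for v using c[of v v] form2_alt[OF qM] e0 by simp
 show "f2c M al e m (crd M m q) v w = - f2c M al e m (crd M m q) w v"
  using a[of "v + w"] a[of v] a[of w] linear_add[OF L1, of v w] linear_add[OF L2] by simp
qed

lemma form2_coef_expand:
 assumes q: "q : cdom M m" "q : U"
 shows "f2c M al e m (crd M m q) v w = (SUM b:Basis. SUM b':Basis. (v \<bullet> b) * ((w \<bullet> b') * f2c M al e m (crd M m q) b b'))"
proof -
 have "f2c M al e m (crd M m q) b w = (SUM b':Basis. (w \<bullet> b') * f2c M al e m (crd M m q) b b')" for b
  using basis_sum[OF form2_coef_linear(2)[OF q], of b w] by simp
 thus ?thesis using basis_sum[OF form2_coef_linear(1)[OF q, of w], of v] by (simp add: sum_distrib_left)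
qed

lemma form2_coef_smooth: "smf M m (%q. f2c M al e m (crd M m q) v w)"
proof (rule sa_cong[OF Mm])
 let ?s = "%q. al q [cvf M m v q, cvf M m w q]"
 show "smf M m (%q. fcf (?s q) (e q))"
  by (rule sframe_coef_smooth(1)[OF Mm Eo ffD(1)[OF e] m form2_smooth[OF mM smooth_vf_at_coord[OF Mm mM] smooth_vf_at_coord[OF Mm mM]]])
 show "near M m (%q. f2c M al e m (crd M m q) v w = fcf (?s q) (e q))"
  by (rule near_mono[OF near_cdom[OF Mm mM]]) (simp add: f2c_def Let_def crd_inv_crd[OF Mm mM])
qed

lemma form2_coef_differentiable: "(%z. f2c M al e m z v w) differentiable (at (crd M m m))"
proof -
 have "((%x. f2c M al e m (crd M m (cinv M m x)) v w) has_derivative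
   dmf M (%q. f2c M al e m (crd M m q) v w) m) (at (crd M m m))"
  by (rule has_derivative_real[OF Mm form2_coef_smooth])
 hence "((%x. f2c M al e m x v w) has_derivative
   dmf M (%q. f2c M al e m (crd M m q) v w) m) (at (crd M m m))"
  by (rule hd_within[OF _ open_cimg[OF Mm mM]])
    (simp_all add: crd_crd_inv[OF Mm mM] mem_cdom[OF Mm mM])
 thus ?thesis by (auto simp: differentiable_def)
qed

lemma near_form2: "near M m (%q. q : cdom M m & q : U)"
 by (rule near_conj[OF near_cdom[OF Mm mM] near_sframe[OF Mm Eo ffD(1)[OF e] m]])

lemma form2_dom:
 obtains T where "open T" "crd M m m : T" "!!z. z : T ==> EX q. q : cdom M m & q : U & z = crd M m q"
proof -
 obtain r where r: "r > 0" "ball (crd M m m) r <= cimg M m" "ALL x:ball (crd M m m) r. cinv M m x : cdom M m & cinv M m x : U"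
  by (rule near_cball[OF Mm mM near_form2])
 show ?thesis
 proof (rule that[of "ball (crd M m m) r"])
  fix z assume z: "z : ball (crd M m m) r"
  hence "z = crd M m (cinv M m z)" using crd_crd_inv[OF Mm mM] r(2) by auto
  with r(3) z show "EX q. q : cdom M m & q : U & z = crd M m q" by blast
 qed (use r in auto)
qed

lemma form2_conn:
 assumes "smf M m g" "near M m (%q. s q = g q *R e q)"
 shows "D s m v = fd (%x. g (cinv M m x)) (crd M m m) v *R e m"
 using flatf_conn[OF FB e m assms] by (simp add: tmap_real)

lemma ext_d_2_coef:
 "ext_d M D al m [u, v, w] = (let a = f2c M al e m; z = crd M m m in
   fd (%z. a z v w) z u - fd (%z. a z u w) z v + fd (%z. a z u v) z w) *R e m"
proof -
 let ?a = "f2c M al e m"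
 have "D (%q. al q [cvf M m v q, cvf M m w q]) m u = fd (%z. ?a z v w) (crd M m m) u *R e m" for u v w
 proof -
  have "D (%q. al q [cvf M m v q, cvf M m w q]) m u = fd (%x. ?a (crd M m (cinv M m x)) v w) (crd M m m) u *R e m"
   by (rule form2_conn[OF form2_coef_smooth near_mono[OF near_form2]]) (use form2_coef_eq in blast)
  also have "fd (%x. ?a (crd M m (cinv M m x)) v w) (crd M m m) = fd (%z. ?a z v w) (crd M m m)"
  proof (rule fd_eq)
   show "((%x. ?a (crd M m (cinv M m x)) v w) has_derivative fd (%z. ?a z v w) (crd M m m)) (at (crd M m m))"
    by (rule hd_within[OF fd_works[OF form2_coef_differentiable] open_cimg[OF Mm mM]])
      (simp_all add: crd_crd_inv[OF Mm mM] mem_cdom[OF Mm mM])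
  qed
  finally show ?thesis .
 qed
 thus ?thesis by (simp add: ext_d_2 Let_def scaleR_left_diff_distrib scaleR_left_distrib)
qed

end

end

section \<open>Closed 2-forms under pullback and under differences\<close>

definition closed_form2 :: "('a, 'e::euclidean_space) manifold => ('a, 'l::real_vector) lbundle => ('a, 'e, 'l) connexion => ('a, 'e, 'l) eform => bool" where
 "closed_form2 M E D al <-> bundle_form M E 2 al & (ALL p:pts M. ALL u v w. ext_d M D al p [u, v, w] = 0)"

lemma lcs_closed_form: "lcs M Om ==> closed_form2 M (lbun Om) (lcon Om) (lfrm Om)"
 unfolding lcs_def closed_form2_def length_3_conv by blast

text \<open>In coordinates the pullback has coefficients
  \<open>?a (?F x) (fd ?F x v) (fd ?F x w)\<close>. In the cyclic sum of their derivatives the terms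
  with second derivatives of \<open>?F\<close> cancel, by symmetry of those derivatives and
  antisymmetry of the form; the rest is closedness of \<open>al\<close> at the image
  vectors.\<close>

lemma closed_form2_pull:
 fixes N :: "('b, 'f::euclidean_space) manifold" and M :: "('a, 'e::euclidean_space) manifold" and E :: "('a, 'l::real_vector) lbundle"
 assumes N: "mfd N" and FB: "flat_bundle M E D" and f: "smooth_map N M f" and c: "closed_form2 M E D al"
 shows "closed_form2 N (pbun N f E) (pull_conn N M f E D) (pull_form N M f al)"
proof -
 note Mm = fbD(1)[OF FB] and Eo = fbD(2)[OF FB]
 note fp = smooth_map_pts[OF N FB f]
 note FB' = pull_flat_bundle[OF N FB f]
 have al: "bundle_form M E 2 al" using c by (simp add: closed_form2_def)
 note lin = tmap_linear[OF N Mm smD[OF f]]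
 have bf: "bundle_form N (pbun N f E) 2 (pull_form N M f al)"
  unfolding bundle_form2_iff
 proof (intro conjI ballI allI impI)
  fix p :: 'b and vs :: "'f list" assume "p ~: pts N | length vs ~= 2"
  thus "pull_form N M f al p vs = 0" using form2_outside[OF FB al] by (auto simp: pull_form_def)
 next
  fix p and v w :: 'f assume p: "p : pts N"
  show "pull_form N M f al p [v, w] : fibre (pbun N f E) p" using form2_fibre[OF FB al fp[OF p]] p by (simp add: pull_form_def)
  show "linear (%v. pull_form N M f al p [v, w])"
   using linear_compose[OF lin[OF p] form2_linear1[OF FB al fp[OF p]]] p by (simp add: pull_form_def o_def)
  show "linear (%w. pull_form N M f al p [v, w])"
   using linear_compose[OF lin[OF p] form2_linear2[OF FB al fp[OF p]]] p by (simp add: pull_form_def o_def)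
  show "pull_form N M f al p [v, v] = 0" using form2_alt[OF FB al fp[OF p]] p by (simp add: pull_form_def)
 next
  fix p X Y assume p: "p : pts N" and "smooth_vf_at N p X & smooth_vf_at N p Y"
  hence X: "smooth_vf_at N p X" and Y: "smooth_vf_at N p Y" by auto
  obtain U e where e: "f p : U" "flatf M E D U e" by (rule flat_ex[OF FB fp[OF p]])
  let ?m = "f p"
  let ?a = "f2c M al e ?m" and ?x = "%X q. dmf N (%q. crd M ?m (f q)) q (X q)"
  have crdf: "smf N p (%q. crd M ?m (f q))"
   by (rule sa_compose[OF N Mm euclid_m smD[OF f p] crd_smooth[OF Mm fp[OF p] mem_cdom[OF Mm fp[OF p]]]])
  have near: "near N p (%q. f q : cdom M ?m & f q : U)" by (rule near_pull[OF N FB f p near_form2[OF FB al e(2,1)]])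
  have sx: "smf N p (%q. ?x X q \<bullet> b)" if "smooth_vf_at N p X" for X b
   by (rule sa_bounded_linear[OF N bounded_linear_inner_left sa_tmap_vf[OF N crdf that]])
  let ?g = "%q. SUM b:Basis. SUM b':Basis. (?x X q \<bullet> b) * ((?x Y q \<bullet> b') * ?a (crd M ?m (f q)) b b')"
  show "ssec N (pbun N f E) p (%q. pull_form N M f al q [X q, Y q])"
  proof (rule ss_sframeI[OF N fbD(2)[OF FB'] pull_sframe[OF N FB f ffD(1)[OF e(2)]]])
   show "p : pts N Int f -` U" using p e by simp
   show "smf N p ?g"
    by (intro sa_sum[OF N p] sa_mult[OF N] sx[OF X] sx[OF Y]
      sa_compose[OF N Mm euclid_m smD[OF f p] form2_coef_smooth[OF FB al e(2,1)]])
   show "near N p (%q. pull_form N M f al q [X q, Y q] = ?g q *R e (f q))"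
   proof (rule near_mono2[OF near near_in_pts[OF p]])
    fix q assume q: "f q : cdom M ?m & f q : U" "q : pts N"
    note cv = coord_vf_compose[OF Mm N smD[OF f q(2)] fp[OF p] conjunct1[OF q(1)]]
    have "pull_form N M f al q [X q, Y q] = ?a (crd M ?m (f q)) (?x X q) (?x Y q) *R e (f q)"
     using q(2) form2_coef_eq[OF FB al e(2,1), of "f q"] q(1) cv by (simp add: pull_form_def)
    also have "?a (crd M ?m (f q)) (?x X q) (?x Y q) = ?g q"
     using form2_coef_expand[OF FB al e(2,1)] q(1) by blast
    finally show "pull_form N M f al q [X q, Y q] = ?g q *R e (f q)" .
   qed
  qed
 qed
 have "ext_d N (pull_conn N M f E D) (pull_form N M f al) p [u, v, w] = 0" if p: "p : pts N" for p u v w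
 proof -
  obtain U e where e: "f p : U" "flatf M E D U e" by (rule flat_ex[OF FB fp[OF p]])
  let ?m = "f p" and ?x0 = "crd N p p"
  let ?a = "f2c M al e ?m" and ?b = "f2c N (pull_form N M f al) (%q. e (f q)) p" and ?F = "%x. crd M ?m (f (cinv N p x))"
  note pf = pull_flat_frame[OF N FB f e(2)]
  have pU: "p : pts N Int f -` U" using p e by simp
  have crdf: "smf N p (%q. crd M ?m (f q))"
   by (rule sa_compose[OF N Mm euclid_m smD[OF f p] crd_smooth[OF Mm fp[OF p] mem_cdom[OF Mm fp[OF p]]]])
  obtain r where r: "r > 0" "ball ?x0 r <= cimg N p" "ALL x:ball ?x0 r. (f (cinv N p x) : cdom M ?m & f (cinv N p x) : U) & smf N (cinv N p x) (%q. crd M ?m (f q))"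
   by (rule near_cball[OF N p near_conj[OF near_pull[OF N FB f p near_form2[OF FB al e(2,1)]] sa_nearby[OF crdf]]])
  have smF: "smooth_on (ball ?x0 r) ?F"
  proof (rule so_of_smooth_at[OF open_ball])
   fix x assume x: "x : ball ?x0 r"
   show "smf eucl x ?F"
    by (rule sa_compose[OF euclid_m N euclid_m crd_inv_smooth[OF N p]])
      (use r x in auto)
  qed
  have x0: "?x0 : ball ?x0 r" using r(1) by simp
  have F0: "?F ?x0 = crd M ?m ?m" by (simp add: crd_inv_crd_self[OF N p])
  have b: "?b x v w = ?a (?F x) (fd ?F x v) (fd ?F x w)" if x: "x : ball ?x0 r" for x v w
  proof -
   let ?q = "cinv N p x"
   have q: "?q : cdom N p" "crd N p ?q = x" using crd_inv_cdom[OF N p] crd_crd_inv[OF N p] r(2) x by auto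
   have qN: "?q : pts N" using q(1) cdom_subset[OF N p] by blast
   have fq: "f ?q : cdom M ?m" "f ?q : U" using r(3) x by auto
   have tq: "tmap N M f ?q (cvf N p v ?q) = cvf M ?m (fd ?F x v) (f ?q)" for v
    unfolding coord_vf_compose[OF Mm N smD[OF f qN] fp[OF p] fq(1)]
    using tmap_coord_vf[OF N p q(1), of "%q. crd M ?m (f q)" v] r(3) x q(2) by auto
   have "?b x v w *R e (f ?q) = ?a (?F x) (fd ?F x v) (fd ?F x w) *R e (f ?q)"
    using form2_coef_eq[OF FB' bf pf pU q(1), of v w] form2_coef_eq[OF FB al e(2,1) fq, of "fd ?F x v" "fd ?F x w"] qN fq q(2)
    by (auto simp: pull_form_def tq)
   thus ?thesis using sframeD(2)[OF ffD(1)[OF e(2)] fq(2)] by simp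
  qed
  obtain T where T: "open T" "crd M ?m ?m : T" "!!z. z : T ==> EX q. q : cdom M ?m & q : U & z = crd M ?m q"
   by (rule form2_dom[OF FB al e(2,1)]) (rule that)
  have tl1: "linear (%v. ?a z v w)" and tl2: "linear (?a z v)" and tan: "?a z v w = - ?a z w v" if "z : T" for z v w
   using T(3)[OF that] form2_coef_linear[OF FB al e(2,1)] by blast+
  let ?f = "fd ?F ?x0" and ?g = "%u v. fd (%x. fd ?F x v) ?x0 u" and ?z = "crd M ?m ?m"
  have db: "fd (%x. ?b x v w) ?x0 u = fd (%z. ?a z (?f v) (?f w)) ?z (?f u) + ?a ?z (?g u v) (?f w) + ?a ?z (?f v) (?g u w)" for u v w
  proof -
   note d1 = so_has_derivative[OF smF x0]
   note d2 = so_has_derivative[OF so_fd[OF smF] x0]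
   have "((%x. ?a (?F x) (fd ?F x v) (fd ?F x w)) has_derivative
     (%u. fd (%z. ?a z (?f v) (?f w)) (?F ?x0) (?f u) + ?a (?F ?x0) (?g u v) (?f w) + ?a (?F ?x0) (?f v) (?g u w))) (at ?x0 within UNIV)"
    by (rule has_derivative_bilinear_family[OF T(1) _ tl1 tl2 _ d1 d2 d2 UNIV_I])
      (unfold F0, use T(2) form2_coef_differentiable[OF FB al e(2,1)] in auto)
   hence "((%x. ?b x v w) has_derivative
     (%u. fd (%z. ?a z (?f v) (?f w)) (?F ?x0) (?f u) + ?a (?F ?x0) (?g u v) (?f w) + ?a (?F ?x0) (?f v) (?g u w))) (at ?x0)"
    by (rule hd_within[OF _ open_ball x0]) (rule b[symmetric])
   from fd_eq[OF this] show ?thesis unfolding F0 by simp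
  qed
  have sym: "?g u v = ?g v u" for u v by (rule fd_fd_commute[OF open_ball smF x0])
  have cl: "fd (%z. ?a z (?f v) (?f w)) ?z (?f u) - fd (%z. ?a z (?f u) (?f w)) ?z (?f v) + fd (%z. ?a z (?f u) (?f v)) ?z (?f w) = 0"
   using ext_d_2_coef[OF FB al e(2,1), of "?f u" "?f v" "?f w"] c fp[OF p] sframeD(2)[OF ffD(1)[OF e(2)] e(1)]
   by (simp add: closed_form2_def Let_def)
  have "fd (%x. ?b x v w) ?x0 u - fd (%x. ?b x u w) ?x0 v + fd (%x. ?b x u v) ?x0 w = 0"
   using cl tan[OF T(2), of "?f v" "?g w u"] unfolding db sym[of v u] sym[of w u] sym[of w v] by linarith
  thus ?thesis unfolding ext_d_2_coef[OF FB' bf pf pU] by (simp add: Let_def)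
 qed
 with bf show ?thesis by (simp add: closed_form2_def)
qed

text \<open>In flat frames the morphism is a constant factor, and both connections differentiate
  coefficients.\<close>

lemma conn_diff_morphism:
 fixes E :: "('a, 'l::real_vector) lbundle" and E' :: "('a, 'm::real_vector) lbundle" and M :: "('a, 'e::euclidean_space) manifold"
 assumes FB: "flat_bundle M E D" and FB': "flat_bundle M E' D'" and m: "flat_morphism M E' D' M E D id Ph"
  and p: "p : pts M" and s: "ssec M E p s" and s': "ssec M E' p s'"
 shows "ssec M E p (%q. s q - Ph q (s' q))"
  "D (%q. s q - Ph q (s' q)) p v = D s p v - Ph p (D' s' p v)"
proof -
 note Mm = fbD(1)[OF FB] and Eo = fbD(2)[OF FB] and Eo' = fbD(2)[OF FB']
 obtain U e where e: "p : U" "flatf M E D U e" by (rule flat_ex[OF FB p])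
 obtain U' e' where e': "p : U'" "flatf M E' D' U' e'" by (rule flat_ex[OF FB' p])
 note se = ffD(1)[OF e(2)] and se' = ffD(1)[OF e'(2)]
 obtain g where g: "smf M p g" "near M p (%q. s q = g q *R e q)" by (rule sframe_rep[OF Mm Eo se e(1) s])
 obtain g' where g': "smf M p g'" "near M p (%q. s' q = g' q *R e' q)" by (rule sframe_rep[OF Mm Eo' se' e'(1) s'])
 obtain c where c: "c > 0" "near M p (%q. Ph q (e' q) = c *R e (id q))"
  by (rule fm_const[OF FB' FB m e'(2,1) e(2)]) (use e(1) in simp_all)
 have Ph: "Ph q (k *R e' q) = k *R Ph q (e' q)" if "q : U'" for q k
  by (rule li_scaleR[OF fm_liso[OF m sframe_pts[OF se' that]] sframeD(1)[OF se' that]])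
 have n: "near M p (%q. s q - Ph q (s' q) = (g q + (- c) * g' q) *R e q)"
  by (rule near_mono2[OF near_conj[OF g(2) g'(2)] near_conj[OF c(2) near_sframe[OF Mm Eo' se' e'(1)]]])
    (simp add: Ph scaleR_left_diff_distrib)
 have sm: "smf M p (%q. (- c) * g' q)"
  by (rule sa_mult[OF Mm sa_const[OF Mm euclid_m p] g'(1)]) simp
 have sg: "smf M p (%q. g q + (- c) * g' q)" by (rule sa_add[OF Mm g(1) sm])
 show "ssec M E p (%q. s q - Ph q (s' q))" by (rule ss_sframeI[OF Mm Eo se e(1) sg n])
 show "D (%q. s q - Ph q (s' q)) p v = D s p v - Ph p (D' s' p v)"
  using near_self[OF c(2)] unfolding flatf_conn[OF FB e(2,1) sg n] flatf_conn[OF FB e(2,1) g] flatf_conn[OF FB' e'(2,1) g']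
   Ph[OF e'(1)] tmap_add[OF Mm g(1) sm] tmap_cmult[OF Mm g'(1)]
  by (simp add: scaleR_left_diff_distrib)
qed

lemma closed_form2_diff:
 fixes E :: "('a, 'l::real_vector) lbundle" and E' :: "('a, 'm::real_vector) lbundle" and M :: "('a, 'e::euclidean_space) manifold"
 assumes FB: "flat_bundle M E D" and FB': "flat_bundle M E' D'" and m: "flat_morphism M E' D' M E D id Ph"
  and al: "closed_form2 M E D al" and be: "closed_form2 M E' D' be"
 shows "closed_form2 M E D (%p vs. if p : pts M & length vs = 2 then al p vs - Ph p (be p vs) else 0)"
proof -
 note Mm = fbD(1)[OF FB] and Eo = fbD(2)[OF FB]
 have a: "bundle_form M E 2 al" and b: "bundle_form M E' 2 be" using al be by (auto simp: closed_form2_def)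
 let ?g = "%p vs. if p : pts M & length vs = 2 then al p vs - Ph p (be p vs) else 0"
 note li = fm_liso[OF m, unfolded id_def]
 have lin: "linear (%v. f v - Ph p (h v))" if p: "p : pts M" and f: "linear f" and h: "linear h" "!!v. h v : fibre E' p" for p and f :: "'e => 'l" and h :: "'e => 'm"
 proof (rule linear_compose_sub[OF f linearI])
  show "Ph p (h (x + y)) = Ph p (h x) + Ph p (h y)" for x y using li_add[OF li[OF p] h(2) h(2)] linear_add[OF h(1)] by simp
  show "Ph p (h (k *R x)) = k *R Ph p (h x)" for k x using li_scaleR[OF li[OF p] h(2)] linear_scale[OF h(1)] by simp
 qed
 have Ph0: "Ph p 0 = 0" if "p : pts M" for p
  using li_scaleR[OF li[OF that] fibre_zero[OF Mm fbD(2)[OF FB'] that], of 0] by simp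
 have fib: "al p [v, w] - Ph p (be p [v, w]) : fibre E p" if p: "p : pts M" for p v w
  using fibre_add[OF Mm Eo p form2_fibre[OF FB a p] fibre_scaleR[OF Mm Eo p li_mem[OF li[OF p] form2_fibre[OF FB' b p]], of "-1"], of v w v w] by simp
 have sm: "ssec M E p (%q. ?g q [X q, Y q])"
  "D (%q. ?g q [X q, Y q]) p u = D (%q. al q [X q, Y q]) p u - Ph p (D' (%q. be q [X q, Y q]) p u)"
  if p: "p : pts M" and X: "smooth_vf_at M p X" and Y: "smooth_vf_at M p Y" for p X Y u
 proof -
  have n: "near M p (%q. ?g q [X q, Y q] = al q [X q, Y q] - Ph q (be q [X q, Y q]))"
   by (rule near_mono[OF near_in_pts[OF p]]) simp
  note cd = conn_diff_morphism[OF FB FB' m p form2_smooth[OF FB a p X Y] form2_smooth[OF FB' b p X Y]]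
  show "ssec M E p (%q. ?g q [X q, Y q])" by (rule ss_cong[OF Mm Eo cd(1) n])
  show "D (%q. ?g q [X q, Y q]) p u = D (%q. al q [X q, Y q]) p u - Ph p (D' (%q. be q [X q, Y q]) p u)"
   using connectionD(4)[OF fbD(3)[OF FB] p cd(1) n] cd(2) by simp
 qed
 have bf: "bundle_form M E 2 ?g"
  unfolding bundle_form2_iff
 proof (intro conjI ballI allI impI)
  fix p v w assume p: "p : pts M"
  show "?g p [v, w] : fibre E p" using fib[OF p] p by simp
  show "linear (%v. ?g p [v, w])"
   using lin[OF p form2_linear1[OF FB a p] form2_linear1[OF FB' b p] form2_fibre[OF FB' b p]] p by simp
  show "linear (%w. ?g p [v, w])"
   using lin[OF p form2_linear2[OF FB a p] form2_linear2[OF FB' b p] form2_fibre[OF FB' b p]] p by simp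
  show "?g p [v, v] = 0" using form2_alt[OF FB a p] form2_alt[OF FB' b p] Ph0[OF p] by simp
 next
  fix p X Y assume p: "p : pts M" and XY: "smooth_vf_at M p X & smooth_vf_at M p Y"
  show "ssec M E p (%q. ?g q [X q, Y q])" by (rule sm(1)[OF p conjunct1[OF XY] conjunct2[OF XY]])
 qed auto
 have "ext_d M D ?g p [u, v, w] = 0" if p: "p : pts M" for p u v w
 proof -
  note cs = smooth_vf_at_coord[OF Mm p]
  have D'f: "D' (%q. be q [cvf M p v q, cvf M p w q]) p u : fibre E' p" for u v w
   by (rule connectionD(2)[OF fbD(3)[OF FB'] p form2_smooth[OF FB' b p cs cs]])
  have "Ph p (ext_d M D' be p [u, v, w]) = Ph p (D' (%q. be q [cvf M p v q, cvf M p w q]) p u)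
    - Ph p (D' (%q. be q [cvf M p u q, cvf M p w q]) p v) + Ph p (D' (%q. be q [cvf M p u q, cvf M p v q]) p w)"
   unfolding ext_d_2 li_diff[OF li[OF p] D'f D'f, symmetric]
   by (rule li_add[OF li[OF p] _ D'f])
     (use fibre_add[OF Mm fbD(2)[OF FB'] p D'f fibre_scaleR[OF Mm fbD(2)[OF FB'] p D'f, of "-1"]] in simp)
  hence "ext_d M D ?g p [u, v, w] = ext_d M D al p [u, v, w] - Ph p (ext_d M D' be p [u, v, w])"
   unfolding ext_d_2 sm(2)[OF p cs cs] by simp
  thus ?thesis using al be p Ph0[OF p] by (simp add: closed_form2_def)
 qed
 with bf show ?thesis by (simp add: closed_form2_def)
qed

text \<open>Pointwise uniqueness makes the locally valid constant a well-defined function, which is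
  locally constant. This produces both the ratio of two bundle isomorphisms and the factor belonging
  to a graph.\<close>

lemma connected_scale:
 assumes conn: "connected_space (mtop M)" and ne: "pts M ~= {}"
  and ex: "!!p. p : pts M ==> EX c>0. near M p (Q c)" and uniq: "!!p c d. p : pts M ==> Q c p ==> Q d p ==> c = d"
 shows "EX c>0::real. ALL p:pts M. Q c p"
proof -
 define f where "f p = (THE c. Q c p)" for p
 have f: "near M p (Q (f p)) & f p > 0" if p: "p : pts M" for p
 proof -
  obtain c where c: "c > 0" "near M p (Q c)" using ex[OF p] by blast
  have "f p = c" unfolding f_def by (rule the_equality[of "%c. Q c p", OF near_self[OF c(2)]]) (rule uniq[OF p _ near_self[OF c(2)]])
  with c show ?thesis by simp
 qed
 have loc: "EX W. opn M W & p : W & (ALL y:W. f y = f p)" if p: "p : pts M" for p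
 proof -
  obtain W where W: "opn M W" "p : W" "!!q. q : W ==> Q (f p) q & q : pts M"
   by (rule nearbyE[OF near_conj[OF conjunct1[OF f[OF p]] near_in_pts[OF p]]]) (rule that)
  have "f y = f p" if "y : W" for y using uniq[of y] W(3)[OF that] near_self[OF conjunct1[OF f]] by blast
  with W show ?thesis by blast
 qed
 obtain p0 where p0: "p0 : pts M" using ne by blast
 have "Q (f p0) p" if "p : pts M" for p
  using near_self[OF conjunct1[OF f[OF that]]] local_const_eq[OF conn that p0 loc] by simp
 thus ?thesis using f[OF p0] by blast
qed

section \<open>Isomorphisms between the pulled-back bundles, and the structures they define\<close>

context box
begin

abbreviation "F1 == pbun P r1 L.E"
abbreviation "F2 == pbun P r2 R.E"
abbreviation "K1 == pull_conn P L.M r1 L.E L.D"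
abbreviation "K2 == pull_conn P R.M r2 R.E R.D"
abbreviation "BS == box_struct A B"
abbreviation "iso_emb == isotropic_embedding L.M P"
abbreviation "lsym S S' == lcs_symplecto P S P S'"
abbreviation "x1 z == fst (r z)"
abbreviation "x2 z == snd (r z)"
abbreviation "T1 == tmap P L.M r1"
abbreviation "T2 == tmap P R.M r2"

lemma r1s: "smooth_map P L.M r1" and r2s: "smooth_map P R.M r2"
proof -
 have "smooth_at P L.M z (%z. x1 z)" "smooth_at P R.M z (%z. x2 z)" if z: "z : pts P" for z
  using sa_compose[OF Pm MMm L.Mm smD[OF r_smooth z]] sa_compose[OF Pm MMm R.Mm smD[OF r_smooth z]]
   sa_fst_snd[OF L.Mm R.Mm, of "r z"] r_pts[OF z] by simp_all
 thus "smooth_map P L.M r1" "smooth_map P R.M r2" by (simp_all add: smooth_map_def o_def)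
qed

lemmas FB1 = pull_flat_bundle[OF Pm L.FB r1s] and FB2 = pull_flat_bundle[OF Pm R.FB r2s]

lemma r1_pts: "z : pts P ==> x1 z : pts L.M" and r2_pts: "z : pts P ==> x2 z : pts R.M"
 using r_pts[of z] by (auto simp: mem_Times_iff)

lemma box_iso_eq: "box_iso A B Ph <-> flat_morphism P F2 K2 P F1 K1 id Ph"
 by (simp add: box_iso_def)

lemma box_iso_line: "box_iso A B Ph ==> z : pts P ==> liso (fibre R.E (x2 z)) (fibre L.E (x1 z)) (Ph z)"
 unfolding box_iso_eq using fm_liso[of P F2 K2 P F1 K1 id Ph z] by simp

lemma box_iso_const:
 assumes Ph: "box_iso A B Ph" and z: "z : pts P" and e: "L.ff U e" "x1 z : U"
  and e': "R.ff V e'" "x2 z : V"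
 shows "EX c>0. near P z (%q. Ph q (e' (x2 q)) = c *R e (x1 q))"
proof -
 obtain c where "c > 0" "near P z (%q. Ph q (e' (r2 q)) = c *R e (r1 (id q)))"
  by (rule fm_const[OF FB2 FB1 Ph[unfolded box_iso_eq] pull_flat_frame[OF Pm R.FB r2s e'(1)] _ pull_flat_frame[OF Pm L.FB r1s e(1)]])
    (use z e(2) e'(2) in simp_all)
 thus ?thesis by auto
qed

lemma box_isoI:
 assumes li: "!!z. z : pts P ==> liso (fibre R.E (x2 z)) (fibre L.E (x1 z)) (Ph z)"
  and const: "!!z U e V e'. z : pts P ==> L.ff U e ==> x1 z : U ==> R.ff V e' ==> x2 z : V ==>
   EX c>0. near P z (%q. Ph q (e' (x2 q)) = c *R e (x1 q))"
 shows "box_iso A B Ph"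
 unfolding box_iso_eq
proof (rule flat_morphismI[OF FB2 FB1])
 show "smooth_map P P id" using sa_id[OF Pm] by (simp add: smooth_map_def id_def)
 show "liso (fibre F2 z) (fibre F1 (id z)) (Ph z)" if "z : pts P" for z using li[OF that] by simp
 fix z assume z: "z : pts P"
 obtain U e where e: "x1 z : U" "L.ff U e" by (rule L.ffx[OF r1_pts[OF z]])
 obtain V e' where e': "x2 z : V" "R.ff V e'" by (rule R.ffx[OF r2_pts[OF z]])
 obtain c where c: "c > 0" "near P z (%q. Ph q (e' (x2 q)) = c *R e (x1 q))" using const[OF z e(2,1) e'(2,1)] by blast
 show "EX U e V e' c. flatf P F2 K2 U e & z : U & flatf P F1 K1 V e' & id z : V & c > 0 & near P z (%q. Ph q (e q) = c *R e' (id q))"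
  by (intro exI conjI, rule pull_flat_frame[OF Pm R.FB r2s e'(2)], use z e' in simp, rule pull_flat_frame[OF Pm L.FB r1s e(2)], use z e in simp, rule c(1))
    (use c(2) in simp)
qed

lemma near_pr:
 assumes w: "w : pts CC" and Q: "near CC w Q"
 shows "near P (pr w) (%z. EX w'. w' : pts CC & z = pr w' & Q w')"
proof -
 obtain W where W: "opn CC W" "w : W" "!!u. u : W ==> Q u & u : pts CC"
  by (rule nearbyE[OF near_conj[OF Q near_in_pts[OF w]]]) (rule that)
 show ?thesis by (rule nearbyI[OF pr_open[OF W(1)]]) (use W in blast)+
qed

definition iso0 :: "('c \<times> 'd) set => 'm => 'l" where
 "iso0 z xi = (let w = SOME w. w : z in fcf xi (sig B (snd w)) *R sig A (fst w))"

text \<open>The definition uses an arbitrary representative of the orbit. Within an orbit both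
  parallel sections change by the same factor, which is the last condition of \<open>beq\<close>, so
  the choice cancels.\<close>

lemma iso0_pr:
 assumes w: "w : pts CC"
 shows "iso0 (pr w) (c *R sig B (snd w)) = c *R sig A (fst w)"
proof -
 let ?w = "SOME w'. w' : pr w"
 have "w : pr w" using box_proj_eq[OF w] beq_refl[OF w] by simp
 hence "?w : pr w" by (rule someI)
 hence b: "beq ?w w" using box_proj_eq[OF w] beq_sym by simp
 note * = beqD[OF b]
 have "iso0 (pr w) (c *R sig B (snd w)) = (c * kap B (snd ?w) (snd w)) *R sig A (fst ?w)"
  using R.kap_eq[OF *(3,4,8)] R.sig_nz[OF *(3)] by (simp add: iso0_def Let_def)
 thus ?thesis using L.kap_eq[OF *(1,2,7)] *(9) by simp
qed

lemma CC_D: "w : pts CC ==> fst w : pts L.C" "w : pts CC ==> snd w : pts R.C"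
 by auto

lemma iso0_box: "box_iso A B iso0"
proof (rule box_isoI)
 fix z assume z: "z : pts P"
 obtain w where w: "w : pts CC" "z = pr w" by (rule P_ptsE[OF z])
 note w' = CC_D[OF w(1)]
 show "liso (fibre R.E (x2 z)) (fibre L.E (x1 z)) (iso0 z)"
  unfolding w(2) box_r_pr[OF w(1)] fst_conv snd_conv
  by (rule line_isoI[OF R.sig_nz[OF w'(2)] fibre_eq_span[OF R.Mm R.Eo R.qpts[OF w'(2)] R.sig_fibre[OF w'(2)] R.sig_nz[OF w'(2)]]
     L.sig_nz[OF w'(1)] fibre_eq_span[OF L.Mm L.Eo L.qpts[OF w'(1)] L.sig_fibre[OF w'(1)] L.sig_nz[OF w'(1)]], of 1])
    (simp_all add: iso0_pr[OF w(1)])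
 fix U e V e' assume e: "L.ff U e" "x1 z : U" and e': "R.ff V e'" "x2 z : V"
 have q: "L.q (fst w) : U" "R.q (snd w) : V" using e(2) e'(2) box_r_pr[OF w(1)] w(2) by auto
 obtain c where c: "c > 0" "near L.C (fst w) (%y. sig A y = c *R e (L.q y))" by (rule L.sig_local[OF w'(1) e(1) q(1)])
 obtain d where d: "d > 0" "near R.C (snd w) (%y. sig B y = d *R e' (R.q y))" by (rule R.sig_local[OF w'(2) e'(1) q(2)])
 have "w : pts L.C \<times> pts R.C" using w(1) by simp
 note fs = sa_fst_snd[OF L.Cm R.Cm this]
 have n: "near CC w (%w. sig A (fst w) = c *R e (L.q (fst w)) & sig B (snd w) = d *R e' (R.q (snd w)))"
  by (rule near_conj[OF near_preimage[OF CCm L.Cm fs(1) c(2)] near_preimage[OF CCm R.Cm fs(2) d(2)]])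
 have "near P z (%q. iso0 q (e' (x2 q)) = (c / d) *R e (x1 q))"
  unfolding w(2)
 proof (rule near_mono[OF near_pr[OF w(1) n]])
  fix q assume "EX w'. w' : pts CC & q = pr w' & sig A (fst w') = c *R e (L.q (fst w')) & sig B (snd w') = d *R e' (R.q (snd w'))"
  then obtain u where u: "u : pts CC" "q = pr u" "sig A (fst u) = c *R e (L.q (fst u))" "sig B (snd u) = d *R e' (R.q (snd u))" by blast
  have "e' (R.q (snd u)) = (1 / d) *R sig B (snd u)" using u(4) d(1) by simp
  thus "iso0 q (e' (x2 q)) = (c / d) *R e (x1 q)"
   using iso0_pr[OF u(1), of "1 / d"] u(3) box_r_pr[OF u(1)] unfolding u(2) by simp
 qed
 thus "EX c>0. near P z (%q. iso0 q (e' (x2 q)) = c *R e (x1 q))" using c(1) d(1) by (intro exI[of _ "c / d"]) simp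
qed

lemmas iso0_li = box_iso_line[OF iso0_box]

lemma box_iso_ratio:
 assumes Ph: "box_iso A B Ph" and Ps: "box_iso A B Ps"
 shows "EX k>0. ALL z:pts P. ALL xi:fibre R.E (x2 z). Ps z xi = k *R Ph z xi"
proof -
 define Q where "Q k z <-> (ALL xi:fibre R.E (x2 z). Ps z xi = k *R Ph z xi)" for k z
 have ex: "EX k>0. near P z (Q k)" if z: "z : pts P" for z
 proof -
  obtain U e where e: "x1 z : U" "L.ff U e" by (rule L.ffx[OF r1_pts[OF z]])
  obtain V e' where e': "x2 z : V" "R.ff V e'" by (rule R.ffx[OF r2_pts[OF z]])
  obtain c where c: "c > 0" "near P z (%q. Ph q (e' (x2 q)) = c *R e (x1 q))" using box_iso_const[OF Ph z e(2,1) e'(2,1)] by blast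
  obtain d where d: "d > 0" "near P z (%q. Ps q (e' (x2 q)) = d *R e (x1 q))" using box_iso_const[OF Ps z e(2,1) e'(2,1)] by blast
  have n: "near P z (%q. q : pts P & x2 q : V)"
   by (rule near_conj[OF near_in_pts[OF z]]) (use near_pull[OF Pm R.FB r2s z near_sframe[OF R.Mm R.Eo ffD(1)[OF e'(2)]]] e'(1) in simp)
  have "near P z (Q (d / c))"
  proof (rule near_mono3[OF c(2) d(2) n])
   fix q assume q: "Ph q (e' (x2 q)) = c *R e (x1 q)" "Ps q (e' (x2 q)) = d *R e (x1 q)" "q : pts P & x2 q : V"
   note s = sframeD(1,2)[OF ffD(1)[OF e'(2)] conjunct2[OF q(3)]]
   show "Q (d / c) q"
    unfolding Q_def
   proof
    fix xi assume "xi : fibre R.E (x2 q)"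
    then obtain a where a: "xi = a *R e' (x2 q)" using fibre_iff[OF R.Mm R.Eo r2_pts s] q(3) by blast
    show "Ps q xi = (d / c) *R Ph q xi"
     using q c(1) li_scaleR[OF box_iso_line[OF Ph] s(1)] li_scaleR[OF box_iso_line[OF Ps] s(1)] unfolding a by simp
   qed
  qed
  with c(1) d(1) show ?thesis by (intro exI[of _ "d / c"]) simp
 qed
 have uniq: "k = k'" if z: "z : pts P" and k: "Q k z" "Q k' z" for k k' z
 proof -
  obtain x where x: "x ~= 0" "fibre R.E (x2 z) = span {x}" using fibre_line[OF R.Mm R.Eo r2_pts[OF z]] by blast
  have xf: "x : fibre R.E (x2 z)" "0 : fibre R.E (x2 z)" using x(2) by (simp_all add: span_base span_zero)
  note li = box_iso_line[OF Ph z]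
  have "Ph z x ~= 0" using li_inj[OF li xf] li_scaleR[OF li xf(1), of 0] x(1) by auto
  thus ?thesis using k xf(1) by (auto simp: Q_def)
 qed
 have "EX k>0. ALL z:pts P. Q k z" by (rule connected_scale[OF P_connected P_ne]) (erule ex, erule (2) uniq)
 thus ?thesis unfolding Q_def .
qed

lemma box_iso_scaleR:
 assumes Ph: "box_iso A B Ph" and c: "c > 0"
 shows "box_iso A B (%z x. c *R Ph z x)"
proof (rule box_isoI)
 fix z assume z: "z : pts P"
 note li = box_iso_line[OF Ph z]
 obtain x where x: "x ~= 0" "fibre R.E (x2 z) = span {x}" using fibre_line[OF R.Mm R.Eo r2_pts[OF z]] by blast
 have xf: "x : fibre R.E (x2 z)" "0 : fibre R.E (x2 z)" using x(2) by (simp_all add: span_base span_zero)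
 have y: "Ph z x ~= 0" using li_inj[OF li xf] li_scaleR[OF li xf(1), of 0] x(1) by auto
 show "liso (fibre R.E (x2 z)) (fibre L.E (x1 z)) (%x. c *R Ph z x)"
  by (rule line_isoI[OF x y fibre_eq_span[OF L.Mm L.Eo r1_pts[OF z] li_mem[OF li xf(1)] y], of c])
    (use c li_scaleR[OF li xf(1)] in simp_all)
 fix U e V e' assume e: "L.ff U e" "x1 z : U" "R.ff V e'" "x2 z : V"
 obtain d where d: "d > 0" "near P z (%q. Ph q (e' (x2 q)) = d *R e (x1 q))" using box_iso_const[OF Ph z e] by blast
 show "EX k>0. near P z (%q. c *R Ph q (e' (x2 q)) = k *R e (x1 q))"
  by (rule exI[of _ "c * d"]) (use c d(1) near_mono[OF d(2)] in simp)
qed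

text \<open>Moving one factor inside a local section of \<open>r\<close> gives tangent vectors with
  one prescribed component and the other zero. Together they invert the pair \<open>T1\<close>,
  \<open>T2\<close> and split the tangent space.\<close>

lemma box_section_tmap:
 assumes z: "z : pts P" and s: "(V, s) : csec P MM r" "r z : V" "s (r z) = z"
 shows "T1 z (tmap L.M P (%x. s (x, x2 z)) (x1 z) a) = a" "T2 z (tmap L.M P (%x. s (x, x2 z)) (x1 z) a) = 0"
  "T1 z (tmap R.M P (%y. s (x1 z, y)) (x2 z) b) = 0" "T2 z (tmap R.M P (%y. s (x1 z, y)) (x2 z) b) = b"
  "smooth_at R.M P (x2 z) (%y. s (x1 z, y))"
proof -
 note p = r1_pts[OF z] r2_pts[OF z]
 have ss: "smooth_at MM P (x1 z, x2 z) s" using csec_smooth[OF Pm MMm r_covering s(1,2)] by simp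
 have sV: "opn MM V" by (rule csec_open[OF Pm MMm r_covering s(1)])
 have i1: "smooth_at L.M MM (x1 z) (%x. (x, x2 z))"
  by (rule sa_Pair[OF L.Mm R.Mm L.Mm sa_id[OF L.Mm p(1)] sa_const[OF L.Mm R.Mm p]])
 have i2: "smooth_at R.M MM (x2 z) (%y. (x1 z, y))"
  by (rule sa_Pair[OF L.Mm R.Mm R.Mm sa_const[OF R.Mm L.Mm p(2,1)] sa_id[OF R.Mm p(2)]])
 have j1: "smooth_at L.M P (x1 z) (%x. s (x, x2 z))" by (rule sa_compose[OF L.Mm MMm Pm i1 ss])
 show j2: "smooth_at R.M P (x2 z) (%y. s (x1 z, y))" by (rule sa_compose[OF R.Mm MMm Pm i2 ss])
 have n1: "near L.M (x1 z) (%x. r (s (x, x2 z)) = (x, x2 z))"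
  by (rule near_mono[OF sa_continuous[OF L.Mm MMm i1 sV]]) (use s(2) csec_right[OF Pm MMm r_covering s(1)] in simp_all)
 have n2: "near R.M (x2 z) (%y. r (s (x1 z, y)) = (x1 z, y))"
  by (rule near_mono[OF sa_continuous[OF R.Mm MMm i2 sV]]) (use s(2) csec_right[OF Pm MMm r_covering s(1)] in simp_all)
 have rs: "smooth_at P L.M (s (x1 z, x2 z)) r1" "smooth_at P R.M (s (x1 z, x2 z)) r2"
  using smD[OF r1s z] smD[OF r2s z] s(3) by simp_all
 have z': "s (x1 z, x2 z) = z" using s(3) by simp
 note c = tmap_compose[OF L.Mm Pm L.Mm j1 rs(1)] tmap_compose[OF L.Mm Pm R.Mm j1 rs(2)]
  tmap_compose[OF R.Mm Pm L.Mm j2 rs(1)] tmap_compose[OF R.Mm Pm R.Mm j2 rs(2)]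
 have "tmap L.M L.M (%x. r1 (s (x, x2 z))) (x1 z) = (%v. v)"
  using tmap_cong[OF L.Mm L.Mm sa_id[OF L.Mm p(1)], of "%x. r1 (s (x, x2 z))"] near_mono[OF n1] tmap_id[OF L.Mm p(1)] by simp
 thus "T1 z (tmap L.M P (%x. s (x, x2 z)) (x1 z) a) = a" using c(1) z' by metis
 have "tmap L.M R.M (%x. r2 (s (x, x2 z))) (x1 z) = (%v. 0)"
  using tmap_cong[OF L.Mm R.Mm sa_const[OF L.Mm R.Mm p], of "%x. r2 (s (x, x2 z))"] near_mono[OF n1] by simp
 thus "T2 z (tmap L.M P (%x. s (x, x2 z)) (x1 z) a) = 0" using c(2) z' by metis
 have "tmap R.M L.M (%y. r1 (s (x1 z, y))) (x2 z) = (%v. 0)"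
  using tmap_cong[OF R.Mm L.Mm sa_const[OF R.Mm L.Mm p(2,1)], of "%y. r1 (s (x1 z, y))"] near_mono[OF n2] by simp
 thus "T1 z (tmap R.M P (%y. s (x1 z, y)) (x2 z) b) = 0" using c(3) z' by metis
 have "tmap R.M R.M (%y. r2 (s (x1 z, y))) (x2 z) = (%v. v)"
  using tmap_cong[OF R.Mm R.Mm sa_id[OF R.Mm p(2)], of "%y. r2 (s (x1 z, y))"] near_mono[OF n2] tmap_id[OF R.Mm p(2)] by simp
 thus "T2 z (tmap R.M P (%y. s (x1 z, y)) (x2 z) b) = b" using c(4) z' by metis
qed

lemma T_linear: "z : pts P ==> linear (T1 z)" "z : pts P ==> linear (T2 z)"
 by (rule tmap_linear[OF Pm L.Mm smD[OF r1s]], assumption, rule tmap_linear[OF Pm R.Mm smD[OF r2s]])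

lemma T_bij:
 assumes z: "z : pts P"
 shows "EX v. T1 z v = a & T2 z v = b" "T1 z v = T1 z v' ==> T2 z v = T2 z v' ==> v = v'"
proof -
 obtain V s where s: "(V, s) : csec P MM r" "r z : V" "s (r z) = z" using csec_through[OF Pm MMm r_covering z] .
 note * = box_section_tmap[OF z s]
 have ex: "EX v. T1 z v = a & T2 z v = b" for a b
  by (rule exI[of _ "tmap L.M P (%x. s (x, x2 z)) (x1 z) a + tmap R.M P (%y. s (x1 z, y)) (x2 z) b"])
    (simp add: linear_add[OF T_linear(1)[OF z]] linear_add[OF T_linear(2)[OF z]] *)
 thus "EX v. T1 z v = a & T2 z v = b" .
 have lin: "linear (%v. (T1 z v, T2 z v))" using T_linear[OF z] by (simp add: linear_iff)
 have "surj (%v. (T1 z v, T2 z v))"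
  unfolding surj_def
 proof
  fix y :: "'e \<times> 'f"
  obtain v where "T1 z v = fst y" "T2 z v = snd y" using ex by blast
  thus "EX v. y = (T1 z v, T2 z v)" by (intro exI[of _ v]) simp
 qed
 hence "inj (%v. (T1 z v, T2 z v))" by (rule linear_surjective_imp_injective[OF lin _ refl])
 from injD[OF this, of v v'] show "T1 z v = T1 z v' ==> T2 z v = T2 z v' ==> v = v'" by simp
qed

lemma box_form:
 "z : pts P ==> lfrm (BS Ph) z [v, w] =
   L.om (x1 z) [T1 z v, T1 z w] - Ph z (R.om (x2 z) [T2 z v, T2 z w])"
 by (simp add: box_struct_def pull_form_def)

lemma box_struct_simps: "lbun (BS Ph) = F1" "lcon (BS Ph) = K1"
 by (simp_all add: box_struct_def)

lemma L_nondeg: "p : pts L.M ==> bij_betw (%v w. L.om p [v, w]) UNIV {A. linear A & range A <= fibre L.E p}"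
 and R_nondeg: "y : pts R.M ==> bij_betw (%v w. R.om y [v, w]) UNIV {A. linear A & range A <= fibre R.E y}"
 using L.lcs R.lcs unfolding lcs_def by blast+

lemmas L_form = lcs_closed_form[OF L.lcs] and R_form = lcs_closed_form[OF R.lcs]
lemmas L_bf = conjunct1[OF L_form[unfolded closed_form2_def]] and R_bf = conjunct1[OF R_form[unfolded closed_form2_def]]

lemmas L_fib = form2_fibre[OF L.FB L_bf] and R_fib = form2_fibre[OF R.FB R_bf]

text \<open>Closedness is inherited through pullback and difference. For nondegeneracy, vectors with
  one component zero separate the two summands, and a functional is represented by solving the
  equation in each factor separately.\<close>

lemma box_lcs:
 assumes Ph: "box_iso A B Ph"
 shows "lcs P (BS Ph)"
proof -
 have cf: "closed_form2 P F1 K1 (lfrm (BS Ph))"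
  unfolding box_struct_def lcs_structure.simps
  by (rule closed_form2_diff[OF FB1 FB2 Ph[unfolded box_iso_eq] closed_form2_pull[OF Pm L.FB r1s L_form] closed_form2_pull[OF Pm R.FB r2s R_form]])
 have nd: "bij_betw (%v w. lfrm (BS Ph) z [v, w]) UNIV {A. linear A & range A <= fibre F1 z}" if z: "z : pts P" for z
  unfolding bij_betw_def
 proof (intro conjI equalityI subsetI)
  note p = r1_pts[OF z] r2_pts[OF z]
  note li = box_iso_line[OF Ph z]
  have bf: "bundle_form P F1 2 (lfrm (BS Ph))" using cf by (simp add: closed_form2_def)
  note l0 = linear_0[OF form2_linear2[OF L.FB L_bf p(1)]] linear_0[OF form2_linear2[OF R.FB R_bf p(2)]]
  note Lf = L_fib[OF p(1)] and Rf = R_fib[OF p(2)]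
  have Ph0: "Ph z 0 = 0" using li_scaleR[OF li fibre_zero[OF R.Mm R.Eo p(2)], of 0] by simp
  show "inj (%v w. lfrm (BS Ph) z [v, w])"
  proof (rule injI)
   fix v v' assume eq: "(%w. lfrm (BS Ph) z [v, w]) = (%w. lfrm (BS Ph) z [v', w])"
   have "L.om (x1 z) [T1 z v, a] = L.om (x1 z) [T1 z v', a]" for a
   proof -
    obtain w where w: "T1 z w = a" "T2 z w = 0" using T_bij(1)[OF z] by blast
    show ?thesis using fun_cong[OF eq, of w] by (simp add: box_form[OF z] w l0 Ph0)
   qed
   hence 1: "T1 z v = T1 z v'" using L_nondeg[OF p(1)] by (auto simp: bij_betw_def inj_def)
   have "R.om (x2 z) [T2 z v, b] = R.om (x2 z) [T2 z v', b]" for b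
   proof -
    obtain w where w: "T1 z w = 0" "T2 z w = b" using T_bij(1)[OF z] by blast
    have "Ph z (R.om (x2 z) [T2 z v, b]) = Ph z (R.om (x2 z) [T2 z v', b])"
     using fun_cong[OF eq, of w] by (simp add: box_form[OF z] w l0)
    thus ?thesis by (rule li_inj[OF li Rf Rf])
   qed
   hence 2: "T2 z v = T2 z v'" using R_nondeg[OF p(2)] by (auto simp: bij_betw_def inj_def)
   show "v = v'" by (rule T_bij(2)[OF z 1 2])
  qed
  fix h :: "'e \<times> 'f => 'l"
  { assume "h : range (%v w. lfrm (BS Ph) z [v, w])"
   thus "h : {A. linear A & range A <= fibre F1 z}" using form2_linear2[OF FB1 bf z] form2_fibre[OF FB1 bf z] by auto }
  { assume "h : {A. linear A & range A <= fibre F1 z}"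
   hence h: "linear h" "!!v. h v : fibre L.E (x1 z)" by auto
   obtain V s where s: "(V, s) : csec P MM r" "r z : V" "s (r z) = z" using csec_through[OF Pm MMm r_covering z] .
   note st = box_section_tmap[OF z s]
   let ?j1 = "tmap L.M P (%x. s (x, x2 z)) (x1 z)" and ?j2 = "tmap R.M P (%y. s (x1 z, y)) (x2 z)"
   have zT: "w = ?j1 (T1 z w) + ?j2 (T2 z w)" for w
    by (rule T_bij(2)[OF z]) (simp_all add: linear_add[OF T_linear(1)[OF z]] linear_add[OF T_linear(2)[OF z]] st(1-4))
   have ja: "?j1 (a + a') = ?j1 a + ?j1 a'" "?j1 (k *R a) = k *R ?j1 a" for a a' k
    by (rule T_bij(2)[OF z]; simp add: linear_add[OF T_linear(1)[OF z]] linear_add[OF T_linear(2)[OF z]]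
      linear_scale[OF T_linear(1)[OF z]] linear_scale[OF T_linear(2)[OF z]] st(1-4))+
   have jb: "?j2 (a + a') = ?j2 a + ?j2 a'" "?j2 (k *R a) = k *R ?j2 a" for a a' k
    by (rule T_bij(2)[OF z]; simp add: linear_add[OF T_linear(1)[OF z]] linear_add[OF T_linear(2)[OF z]]
      linear_scale[OF T_linear(1)[OF z]] linear_scale[OF T_linear(2)[OF z]] st(1-4))+
   let ?i = "inv_into (fibre R.E (x2 z)) (Ph z)"
   have im: "?i x : fibre R.E (x2 z)" "Ph z (?i x) = x" if "x : fibre L.E (x1 z)" for x
    using li_inv_mem[OF li that] li_f_inv[OF li that] by auto
   note inv = li_inverse[OF R.Mm R.Eo p(2) li]
   have "(%a. h (?j1 a)) : {A. linear A & range A <= fibre L.E (x1 z)}"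
    by (auto intro!: linearI h(2) simp: ja linear_add[OF h(1)] linear_scale[OF h(1)])
   then obtain a where a: "(%x. L.om (x1 z) [a, x]) = (%x. h (?j1 x))"
    unfolding bij_betw_imp_surj_on[OF L_nondeg[OF p(1)], symmetric] by fastforce
   have neg: "- ?i (h (?j2 b)) : fibre R.E (x2 z)" for b
    using fibre_scaleR[OF R.Mm R.Eo p(2) im(1)[OF h(2)], of "-1"] by simp
   \<comment> \<open>The second summand enters with a minus sign and after applying
     \<open>Ph z\<close>; both are undone before the form of the second factor is inverted.\<close>
   have "(%b. - ?i (h (?j2 b))) : {A. linear A & range A <= fibre R.E (x2 z)}"
    by (auto intro!: linearI neg simp: jb linear_add[OF h(1)] linear_scale[OF h(1)] li_add[OF inv h(2) h(2)] li_scaleR[OF inv h(2)])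
   then obtain b where b: "(%x. R.om (x2 z) [b, x]) = (%x. - ?i (h (?j2 x)))"
    unfolding bij_betw_imp_surj_on[OF R_nondeg[OF p(2)], symmetric] by fastforce
   obtain v where v: "T1 z v = a" "T2 z v = b" using T_bij(1)[OF z] by blast
   have "lfrm (BS Ph) z [v, w] = h w" for w
   proof -
    have "Ph z (- ?i (h (?j2 (T2 z w)))) = - h (?j2 (T2 z w))"
     using li_scaleR[OF li im(1)[OF h(2)], of "-1"] im(2)[OF h(2)] by simp
    hence "lfrm (BS Ph) z [v, w] = h (?j1 (T1 z w)) + h (?j2 (T2 z w))"
     unfolding box_form[OF z] v fun_cong[OF a] fun_cong[OF b] by simp
    also have "... = h w" using zT[of w] linear_add[OF h(1)] by metis
    finally show ?thesis .
   qed
   thus "h : range (%v w. lfrm (BS Ph) z [v, w])" by (intro image_eqI[of _ _ v]) auto }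
 qed
 show ?thesis
  unfolding lcs_def length_3_conv box_struct_simps using FB1 cf nd by (simp add: flat_bundle_def closed_form2_def)
qed

end

text \<open>A model space has a basis vector, so injectivity excludes the zero form. This
  nonvanishing is what later determines the scaling constants.\<close>

lemma nondeg_nonzero:
 fixes a :: "'e::euclidean_space => 'e => 'l::real_vector"
 assumes "bij_betw (%v w. a v w) UNIV S" "!!w. a 0 w = 0"
 shows "EX v w. a v w ~= 0"
proof (rule ccontr)
 assume *: "~ (EX v w. a v w ~= 0)"
 obtain b :: 'e where "b : Basis" using nonempty_Basis by blast
 have "(%w. a b w) = (%w. a 0 w)" using * by auto
 hence "b = 0" using assms(1) by (auto simp: bij_betw_def inj_def)
 with `b : Basis` show False by simp
qed

section \<open>The torsor, the Lee class and the deck group\<close>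

context box
begin

lemma L_nonzero: "p : pts L.M ==> EX v w. L.om p [v, w] ~= 0"
 by (rule nondeg_nonzero[OF L_nondeg]) (use linear_0[OF form2_linear1[OF L.FB L_bf]] in simp_all)

lemma R_nonzero: "y : pts R.M ==> EX v w. R.om y [v, w] ~= 0"
 by (rule nondeg_nonzero[OF R_nondeg]) (use linear_0[OF form2_linear1[OF R.FB R_bf]] in simp_all)

lemma box_iso_nz:
 assumes "box_iso A B Ph" "z : pts P" "xi : fibre R.E (x2 z)" "xi ~= 0"
 shows "Ph z xi ~= 0"
 using li_inj[OF box_iso_line[OF assms(1,2)] assms(3) fibre_zero[OF R.Mm R.Eo r2_pts[OF assms(2)]]]
  li_scaleR[OF box_iso_line[OF assms(1,2)] assms(3), of 0] assms(4) by auto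

abbreviation "gom ph p v w == R.om (ph p) [tmap L.M R.M ph p v, tmap L.M R.M ph p w]"
abbreviation "Om0 c == BS (%z x. c *R iso0 z x)"

text \<open>Fibre maps may differ off the fibres without changing the structure, so structures
  correspond to fibre maps only up to this ambiguity.\<close>

lemma box_struct_cong:
 assumes "!!z xi. z : pts P ==> xi : fibre R.E (x2 z) ==> Ph z xi = Ps z xi"
 shows "BS Ph = BS Ps"
proof -
 have "Ph z (R.om (x2 z) (map (T2 z) vs)) = Ps z (R.om (x2 z) (map (T2 z) vs))" if z: "z : pts P" "length vs = 2" for z vs
 proof -
  obtain v w where "vs = [v, w]" using z(2) by (auto simp: numeral_2_eq_2 length_Suc_conv)
  thus ?thesis using assms[OF z(1) R_fib[OF r2_pts[OF z(1)]]] by simp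
 qed
 thus ?thesis by (auto simp: box_struct_def pull_form_def fun_eq_iff)
qed

lemma box_iso_scale_of:
 assumes Ph: "box_iso A B Ph"
 obtains k where "k > 0" "!!z xi. z : pts P ==> xi : fibre R.E (x2 z) ==> Ph z xi = k *R iso0 z xi" "BS Ph = Om0 k"
proof -
 obtain k where k: "k > 0" "ALL z:pts P. ALL xi:fibre R.E (x2 z). Ph z xi = k *R iso0 z xi" using box_iso_ratio[OF iso0_box Ph] by blast
 show ?thesis by (rule that[OF k(1)]) (use k(2) box_struct_cong[of Ph] in auto)
qed

text \<open>On vectors tangent to the second factor the first summand vanishes, and the second form
  is nonzero on a suitable pair.\<close>

lemma Om0_inj:
 assumes "Om0 c = Om0 d"
 shows "c = d"
proof -
 obtain z where z: "z : pts P" using P_ne by blast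
 obtain v w where vw: "R.om (x2 z) [v, w] ~= 0" using R_nonzero[OF r2_pts[OF z]] by blast
 obtain v' where v': "T1 z v' = 0" "T2 z v' = v" using T_bij(1)[OF z] by blast
 obtain w' where w': "T1 z w' = 0" "T2 z w' = w" using T_bij(1)[OF z] by blast
 have "lfrm (Om0 c) z [v', w'] = lfrm (Om0 d) z [v', w']" using assms by simp
 thus ?thesis unfolding box_form[OF z] v' w'
  using box_iso_nz[OF iso0_box z R_fib[OF r2_pts[OF z]] vw] by simp
qed

lemma Om0_Xi: "c > 0 ==> Om0 c : Xi A B"
 unfolding Xi_def using box_iso_scaleR[OF iso0_box] by blast

lemma Xi_cases:
 assumes "Om : Xi A B"
 obtains c where "c > 0" "Om = Om0 c"
 using assms unfolding Xi_def by (auto elim: box_iso_scale_of)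

text \<open>\<open>Xi_act\<close> selects some isomorphism that defines the structure. Any two
  candidates are multiples of \<open>iso0\<close>, with equal constants by \<open>Om0_inj\<close>,
  so they agree on the fibres and the action is well defined.\<close>

lemma Xi_act_eq:
 assumes Ph: "box_iso A B Ph"
 shows "Xi_act A B c (BS Ph) = BS (%z x. c *R Ph z x)"
proof -
 define Ps where "Ps = (SOME Ps. box_iso A B Ps & BS Ps = BS Ph)"
 have Ps: "box_iso A B Ps & BS Ps = BS Ph" unfolding Ps_def by (rule someI[of _ Ph]) (use Ph in simp)
 obtain k where k: "k > 0" "!!z xi. z : pts P ==> xi : fibre R.E (x2 z) ==> Ph z xi = k *R iso0 z xi" "BS Ph = Om0 k" by (rule box_iso_scale_of[OF Ph]) (rule that)
 obtain l where l: "l > 0" "!!z xi. z : pts P ==> xi : fibre R.E (x2 z) ==> Ps z xi = l *R iso0 z xi" "BS Ps = Om0 l" by (rule box_iso_scale_of[OF conjunct1[OF Ps]]) (rule that)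
 have "k = l" by (rule Om0_inj) (use k(3) l(3) Ps in simp)
 thus ?thesis
  unfolding Xi_act_def Ps_def[symmetric] Let_def by (intro box_struct_cong) (simp add: k(2) l(2))
qed

lemma Xi_act_Om0: "d > 0 ==> Xi_act A B c (Om0 d) = Om0 (c * d)"
 using Xi_act_eq[OF box_iso_scaleR[OF iso0_box]] by simp

lemma Xi_torsor: "torsor pos_real_group (Xi A B) (Xi_act A B)"
 unfolding torsor_def
proof (intro conjI ballI)
 let ?S = "Xi A B" and ?f = "%c. restrict (Xi_act A B c) (Xi A B)"
 have G: "group pos_real_group"
 proof (rule groupI)
  show "EX y:carrier pos_real_group. y \<otimes>\<^bsub>pos_real_group\<^esub> x = \<one>\<^bsub>pos_real_group\<^esub>" if "x : carrier pos_real_group" for x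
   using that by (intro bexI[of _ "inverse x"]) (auto simp: pos_real_group_def)
 qed (auto simp: pos_real_group_def)
 have act: "Xi_act A B c Om : ?S" if "c > 0" "Om : ?S" for c Om
  using that(2) by (rule Xi_cases) (use that(1) in "simp add: Xi_act_Om0 Om0_Xi")
 have mult: "Xi_act A B (c * d) Om = Xi_act A B c (Xi_act A B d Om)" if "c > 0" "d > 0" "Om : ?S" for c d Om
  using that(3) by (rule Xi_cases) (use that in "simp add: Xi_act_Om0 mult.assoc")
 have inv: "Xi_act A B (inverse c) (Xi_act A B c Om) = Om" "Xi_act A B c (Xi_act A B (inverse c) Om) = Om" if "c > 0" "Om : ?S" for c Om
  by (rule Xi_cases[OF that(2)], use that(1) in "simp add: Xi_act_Om0 mult.assoc[symmetric]")+
 have Bij: "?f c : Bij ?S" if c: "c > 0" for c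
 proof -
  have "bij_betw (?f c) ?S ?S"
   by (rule bij_betw_byWitness[of _ "Xi_act A B (inverse c)"]) (use act inv c in auto)
  thus ?thesis by (simp add: Bij_def)
 qed
 show "group_action pos_real_group ?S ?f"
  unfolding group_action_def group_hom_def group_hom_axioms_def
 proof (intro conjI G group_BijGroup homI)
  show "?f c : carrier (BijGroup ?S)" if "c : carrier pos_real_group" for c
   using Bij that by (simp add: BijGroup_def pos_real_group_def)
  show "?f (c \<otimes>\<^bsub>pos_real_group\<^esub> d) = ?f c \<otimes>\<^bsub>BijGroup ?S\<^esub> ?f d" if "c : carrier pos_real_group" "d : carrier pos_real_group" for c d
   using that Bij act mult by (auto simp: BijGroup_def pos_real_group_def compose_def fun_eq_iff)
 qed
 show "?S ~= {}" using Om0_Xi[of 1] by auto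
 fix x y assume "x : ?S" "y : ?S"
 then obtain c d where cd: "c > 0" "x = Om0 c" "d > 0" "y = Om0 d" by (metis Xi_cases)
 show "EX! g. g : carrier pos_real_group & Xi_act A B g x = y"
 proof (rule ex1I[of _ "d / c"])
  show "d / c : carrier pos_real_group & Xi_act A B (d / c) x = y" using cd by (simp add: pos_real_group_def Xi_act_Om0)
  fix g assume "g : carrier pos_real_group & Xi_act A B g x = y"
  hence "Om0 (g * c) = Om0 d" using cd by (simp add: Xi_act_Om0)
  from Om0_inj[OF this] show "g = d / c" using cd by (simp add: field_simps)
 qed
qed

lemma Xi_lcs: "Om : Xi A B ==> lcs P Om"
 unfolding Xi_def using box_lcs by blast

text \<open>The projections to both factors and the isomorphism between the pulled-back bundles all
  preserve holonomy, so the three classes have the same value on each loop.\<close>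

lemma Xi_lee:
 assumes "Om : Xi A B"
 shows "lee_class P Om = pull_class P r1 (lee_class L.M (cstr A))"
  "pull_class P r1 (lee_class L.M (cstr A)) = pull_class P r2 (lee_class R.M (cstr B))"
proof -
 obtain Ph where Ph: "box_iso A B Ph" "Om = BS Ph" using assms unfolding Xi_def by blast
 have 1: "holonomy L.M L.E L.D (%t. r1 (ga t)) = holonomy P F1 K1 ga" "loopin (mtop L.M) (%t. r1 (ga t))"
  "holonomy R.M R.E R.D (%t. r2 (ga t)) = holonomy P F1 K1 ga" "loopin (mtop R.M) (%t. r2 (ga t))"
  if "loopin (mtop P) ga" for ga
 proof -
  have ga: "pcont (mtop P) {0..1} ga" "ga 1 = ga 0" using that by (auto simp: loopin_iff)
  show "holonomy L.M L.E L.D (%t. r1 (ga t)) = holonomy P F1 K1 ga"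
   by (rule fm_holonomy[OF FB1 L.FB pull_morphism[OF Pm L.FB r1s] ga])
  have "holonomy R.M R.E R.D (%t. r2 (ga t)) = holonomy P F2 K2 ga"
   by (rule fm_holonomy[OF FB2 R.FB pull_morphism[OF Pm R.FB r2s] ga])
  also have "... = holonomy P F1 K1 ga"
   using fm_holonomy[OF FB2 FB1 Ph(1)[unfolded box_iso_eq] ga] by simp
  finally show "holonomy R.M R.E R.D (%t. r2 (ga t)) = holonomy P F1 K1 ga" .
  show "loopin (mtop L.M) (%t. r1 (ga t))"
   unfolding loopin_iff using path_cont_compose[OF ga(1) smooth_map_continuous[OF Pm L.Mm r1s]] ga(2) by simp
  show "loopin (mtop R.M) (%t. r2 (ga t))"
   unfolding loopin_iff using path_cont_compose[OF ga(1) smooth_map_continuous[OF Pm R.Mm r2s]] ga(2) by simp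
 qed
 show "lee_class P Om = pull_class P r1 (lee_class L.M (cstr A))"
  "pull_class P r1 (lee_class L.M (cstr A)) = pull_class P r2 (lee_class R.M (cstr B))"
  using 1 by (auto simp: fun_eq_iff lee_class_def pull_class_def Ph(2) box_struct_simps o_def)
qed

text \<open>Composing with a flat morphism of the second factor and with \<open>iso0\<close> at the
  moved point is again an isomorphism over the identity, so it can be compared with
  \<open>iso0\<close>. Used with the identity of the second factor for deck transformations, and for
  lifted automorphisms.\<close>

lemma box_iso_twist:
 assumes g: "smooth_map P P g" "!!z. z : pts P ==> r (g z) = (x1 z, ph (x2 z))"
  and Ps: "flat_morphism R.M R.E R.D R.M R.E R.D ph Ps"
 shows "box_iso A B (%z xi. iso0 (g z) (Ps (x2 z) xi))"
proof (rule box_isoI)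
 fix z assume z: "z : pts P"
 have gz: "g z : pts P" by (rule sa_pts_image[OF Pm smD[OF g(1) z]])
 note li = fm_liso[OF Ps r2_pts[OF z]] and li' = iso0_li[OF gz, unfolded g(2)[OF z] fst_conv snd_conv]
 show "liso (fibre R.E (x2 z)) (fibre L.E (x1 z)) (%xi. iso0 (g z) (Ps (x2 z) xi))"
  using bij_betw_trans[of "Ps (x2 z)" "fibre R.E (x2 z)" "fibre R.E (ph (x2 z))" "iso0 (g z)" "fibre L.E (x1 z)"]
   li li' li_mem[OF li] unfolding liso_def o_def by simp
 fix U e V e' assume e: "L.ff U e" "x1 z : U" and e': "R.ff V e'" "x2 z : V"
 obtain W f where f: "ph (x2 z) : W" "R.ff W f"
  by (rule R.ffx[ of "ph (x2 z)"]) (use r2_pts[OF gz] g(2)[OF z] in simp)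
 obtain c where c: "c > 0" "near R.M (x2 z) (%y. Ps y (e' y) = c *R f (ph y))"
  by (rule fm_const[OF R.FB R.FB Ps e' f(2,1)])
 obtain d where d: "d > 0" "near P (g z) (%q. iso0 q (f (x2 q)) = d *R e (x1 q))"
  using box_iso_const[OF iso0_box gz e(1) _ f(2)] e(2) f(1) g(2)[OF z] by auto
 have n1: "near P z (%q. Ps (x2 q) (e' (x2 q)) = c *R f (ph (x2 q)) & ph (x2 q) : W)"
 proof -
  have "near R.M (x2 z) (%y. ph y : W)"
   by (rule near_preimage[OF R.Mm R.Mm smD[OF fm_smooth[OF Ps] r2_pts[OF z]] near_sframe[OF R.Mm R.Eo ffD(1)[OF f(2)] f(1)]])
  from near_conj[OF c(2) this] show ?thesis using near_pull[OF Pm R.FB r2s z] by simp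
 qed
 have n2: "near P z (%q. iso0 (g q) (f (x2 (g q))) = d *R e (x1 (g q)))"
  by (rule near_preimage[OF Pm Pm smD[OF g(1) z] d(2)])
 have "near P z (%q. iso0 (g q) (Ps (x2 q) (e' (x2 q))) = (c * d) *R e (x1 q))"
 proof (rule near_mono3[OF n1 n2 near_in_pts[OF z]])
  fix q assume q: "Ps (x2 q) (e' (x2 q)) = c *R f (ph (x2 q)) & ph (x2 q) : W"
   "iso0 (g q) (f (x2 (g q))) = d *R e (x1 (g q))" "q : pts P"
  have gq: "g q : pts P" by (rule sa_pts_image[OF Pm smD[OF g(1) q(3)]])
  have "f (ph (x2 q)) : fibre R.E (x2 (g q))" using sframeD(1)[OF ffD(1)[OF f(2)] conjunct2[OF q(1)]] g(2)[OF q(3)] by simp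
  from li_scaleR[OF iso0_li[OF gq] this, of c]
  show "iso0 (g q) (Ps (x2 q) (e' (x2 q))) = (c * d) *R e (x1 q)" using q g(2)[OF q(3)] by simp
 qed
 thus "EX c>0. near P z (%q. iso0 (g q) (Ps (x2 q) (e' (x2 q))) = c *R e (x1 q))"
  using c(1) d(1) by (intro exI[of _ "c * d"]) simp
qed

text \<open>Since \<open>g\<close> preserves the first component, the fibres over \<open>z\<close>
  and \<open>g z\<close> are the same line and the identity is the bundle map. The first summands
  agree automatically, and \<open>eq\<close> compares the second ones.\<close>

lemma box_symplecto:
 assumes g: "diffeo P P g" "!!z. z : pts P ==> r (g z) = (x1 z, ph (x2 z))" and ph: "smooth_map R.M R.M ph"
  and Ph: "box_iso A B Ph"
  and eq: "!!z v w. z : pts P ==> Ph' (g z) (R.om (ph (x2 z)) [tmap R.M R.M ph (x2 z) v, tmap R.M R.M ph (x2 z) w]) = Ph z (R.om (x2 z) [v, w])"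
 shows "lsym (BS Ph) (BS Ph') g"
proof -
 note gs = diffeoD(1)[OF g(1)]
 have gz: "g z : pts P" if "z : pts P" for z by (rule sa_pts_image[OF Pm smD[OF gs that]])
 have m: "flat_morphism P F1 K1 P F1 K1 g (%z x. x)"
 proof (rule flat_morphismI[OF FB1 FB1 gs])
  show "liso (fibre F1 z) (fibre F1 (g z)) (%x. x)" if "z : pts P" for z
   using g(2)[OF that] by (simp add: liso_def bij_betw_def)
  fix z assume z: "z : pts P"
  obtain U e where e: "x1 z : U" "L.ff U e" by (rule L.ffx[OF r1_pts[OF z]])
  note pf = pull_flat_frame[OF Pm L.FB r1s e(2)]
  show "EX U e V e' c. flatf P F1 K1 U e & z : U & flatf P F1 K1 V e' & g z : V & c > 0 & near P z (%q. e q = c *R e' (g q))"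
   by (intro exI conjI, rule pf, use z e in simp, rule pf, use gz[OF z] g(2)[OF z] e in simp, rule zero_less_one)
     (rule near_mono[OF near_in_pts[OF z]], use g(2) in simp)
 qed
 have "bundle_pull_form P F1 P g (%z x. x) (lfrm (BS Ph')) z [v, w] = lfrm (BS Ph) z [v, w]" if z: "z : pts P" for z v w
 proof -
  have T1g: "T1 (g z) (tmap P P g z v) = T1 z v" for v
  proof -
   have "T1 (g z) (tmap P P g z v) = tmap P L.M (%q. r1 (g q)) z v"
    by (rule fun_cong[OF tmap_compose[OF Pm Pm L.Mm smD[OF gs z] smD[OF r1s gz[OF z]]], symmetric])
   also have "tmap P L.M (%q. r1 (g q)) z = T1 z"
    by (rule tmap_cong[OF Pm L.Mm smD[OF r1s z] near_mono[OF near_in_pts[OF z]]]) (simp add: g(2))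
   finally show ?thesis .
  qed
  have T2g: "T2 (g z) (tmap P P g z v) = tmap R.M R.M ph (x2 z) (T2 z v)" for v
  proof -
   have ph': "smooth_at R.M R.M (r2 z) ph" using smD[OF ph r2_pts[OF z]] by simp
   have "T2 (g z) (tmap P P g z v) = tmap P R.M (%q. r2 (g q)) z v"
    by (rule fun_cong[OF tmap_compose[OF Pm Pm R.Mm smD[OF gs z] smD[OF r2s gz[OF z]]], symmetric])
   also have "tmap P R.M (%q. r2 (g q)) z = tmap P R.M (%q. ph (r2 q)) z"
    by (rule tmap_cong[OF Pm R.Mm sa_compose[OF Pm R.Mm R.Mm smD[OF r2s z] ph'] near_mono[OF near_in_pts[OF z]]])
      (simp add: g(2))
   also have "tmap P R.M (%q. ph (r2 q)) z v = tmap R.M R.M ph (r2 z) (T2 z v)"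
    by (rule fun_cong[OF tmap_compose[OF Pm R.Mm R.Mm smD[OF r2s z] ph']])
   finally show ?thesis unfolding comp_apply .
  qed
  have bf: "bundle_form P F1 2 (lfrm (BS Ph))"
   using box_lcs[OF Ph] by (simp add: lcs_def box_struct_simps)
  have eq': "lfrm (BS Ph') (g z) [tmap P P g z v, tmap P P g z w] = lfrm (BS Ph) z [v, w]"
   unfolding box_form[OF gz[OF z]] box_form[OF z] T1g T2g using g(2)[OF z] eq[OF z] by simp
  have "inv_into (fibre F1 z) (%x. x) (lfrm (BS Ph) z [v, w]) = lfrm (BS Ph) z [v, w]"
   by (rule inv_into_f_eq[OF inj_on_id2 form2_fibre[OF FB1 bf z] refl])
  thus ?thesis using z eq' by (simp add: bundle_pull_form_def pull_form_def)
 qed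
 thus ?thesis
  unfolding lcs_symplecto_def lcs_map_def length_2_conv box_struct_simps using m g(1) by blast
qed

lemma id_morphism: "flat_morphism R.M R.E R.D R.M R.E R.D (%y. y) (%y x. x)"
proof (rule flat_morphismI[OF R.FB R.FB])
 show "smooth_map R.M R.M (%y. y)" using sa_id[OF R.Mm] by (simp add: smooth_map_def)
 show "liso (fibre R.E y) (fibre R.E y) (%x. x)" for y by (simp add: liso_def bij_betw_def)
 fix y assume y: "y : pts R.M"
 obtain V e where e: "y : V" "R.ff V e" by (rule R.ffx[OF y])
 show "EX U e V e' c. R.ff U e & y : U & R.ff V e' & y : V & c > 0 & near R.M y (%q. e q = c *R e' q)"
  by (intro exI conjI, rule e(2), rule e(1), rule e(2), rule e(1), rule zero_less_one) (rule near_all[OF y], simp)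
qed

text \<open>Deck transformations are given as homeomorphisms. As continuous lifts of the smooth map
  \<open>r\<close> through the covering they are smooth.\<close>

lemma cover_map_smooth:
 assumes g: "continuous_map (mtop P) (mtop P) g" "!!z. z : pts P ==> r (g z) = r z"
 shows "smooth_map P P g"
 unfolding smooth_map_def
proof
 fix z assume z: "z : pts P"
 show "smooth_at P P z g"
 proof (rule sa_into_cover[OF Pm MMm r_covering Pm])
  show "g z : pts P" using g(1) z by (auto simp: continuous_map_def)
  show "smooth_at P MM z (%w. r (g w))"
   by (rule sa_cong[OF Pm smD[OF r_smooth z] near_mono[OF near_in_pts[OF z]]]) (rule g(2))
  fix W assume W: "opn P W" "g z : W"
  have "opn P {x : pts P. g x : W}" using g(1) W(1) by (simp add: continuous_map_def)
  from near_open[OF this, of z] show "near P z (%w. g w : W)" using z W(2) by (auto elim: near_mono)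
 qed
qed

lemma box_deckD:
 assumes "g : carrier (deck_group (mtop P) r)"
 shows "diffeo P P g" "z : pts P ==> g z : pts P" "z : pts P ==> r (g z) = r z" "g : Bij (pts P)"
proof -
 have h: "homeomorphic_map (mtop P) (mtop P) g" and rg: "!!z. z : pts P ==> r (g z) = r z" and b: "g : Bij (pts P)"
  using assms by (auto simp: deck_group_def)
 show "g : Bij (pts P)" by (rule b)
 show "z : pts P ==> g z : pts P" using Bij_imp_funcset[OF b] by blast
 show "z : pts P ==> r (g z) = r z" by (rule rg)
 obtain h' where h': "homeomorphic_maps (mtop P) (mtop P) g h'" using h homeomorphic_map_maps by blast
 have c: "continuous_map (mtop P) (mtop P) g" "continuous_map (mtop P) (mtop P) h'" and gh: "!!z. z : pts P ==> h' (g z) = z" "!!z. z : pts P ==> g (h' z) = z"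
  using h' by (auto simp: homeomorphic_maps_def)
 have h'p: "h' z : pts P" if "z : pts P" for z using c(2) that by (auto simp: continuous_map_def)
 have bij: "bij_betw g (pts P) (pts P)" using b by (simp add: Bij_def)
 have rh: "r (h' z) = r z" if "z : pts P" for z using rg[OF h'p[OF that]] gh(2)[OF that] by simp
 have inv: "inv_into (pts P) g z = h' z" if "z : pts P" for z
  by (rule inv_into_f_eq) (use bij h'p[OF that] gh(2)[OF that] in "auto simp: bij_betw_def")
 have sm: "smooth_map P P h'" by (rule cover_map_smooth[OF c(2) rh])
 have "smooth_map P P (inv_into (pts P) g)"
  unfolding smooth_map_def
 proof
  fix z assume z: "z : pts P"
  show "smooth_at P P z (inv_into (pts P) g)"
   by (rule sa_cong[OF Pm smD[OF sm z] near_mono[OF near_in_pts[OF z]]]) (rule inv)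
 qed
 thus "diffeo P P g" using cover_map_smooth[OF c(1) rg] bij by (simp add: diffeo_def)
qed

definition dscale :: "(('c \<times> 'd) set => ('c \<times> 'd) set) => real" where
 "dscale g = (THE k. ALL z:pts P. ALL xi:fibre R.E (x2 z). iso0 (g z) xi = k *R iso0 z xi)"

lemma dscale_eqI:
 assumes "!!z xi. z : pts P ==> xi : fibre R.E (x2 z) ==> iso0 (g z) xi = k *R iso0 z xi"
 shows "dscale g = k"
 unfolding dscale_def
proof (rule the_equality)
 fix l assume l: "ALL z:pts P. ALL xi:fibre R.E (x2 z). iso0 (g z) xi = l *R iso0 z xi"
 obtain z where z: "z : pts P" using P_ne by blast
 obtain x where x: "x ~= 0" "fibre R.E (x2 z) = span {x}" using fibre_line[OF R.Mm R.Eo r2_pts[OF z]] by blast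
 have xf: "x : fibre R.E (x2 z)" using x(2) by (simp add: span_base)
 have "k *R iso0 z x = l *R iso0 z x" using assms[OF z xf] l z xf by auto
 thus "l = k" using box_iso_nz[OF iso0_box z xf x(1)] by simp
qed (use assms in blast)

lemma dscale:
 assumes g: "g : carrier (deck_group (mtop P) r)"
 shows "dscale g > 0" "z : pts P ==> xi : fibre R.E (x2 z) ==> iso0 (g z) xi = dscale g *R iso0 z xi"
proof -
 have "box_iso A B (%z xi. iso0 (g z) xi)"
  using box_iso_twist[OF diffeoD(1)[OF box_deckD(1)[OF g]] _ id_morphism] box_deckD(3)[OF g] by simp
 from box_iso_ratio[OF iso0_box this] obtain k where k: "k > 0" "ALL z:pts P. ALL xi:fibre R.E (x2 z). iso0 (g z) xi = k *R iso0 z xi" by blast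
 have "dscale g = k" by (rule dscale_eqI) (use k(2) in blast)
 with k show "dscale g > 0" "z : pts P ==> xi : fibre R.E (x2 z) ==> iso0 (g z) xi = dscale g *R iso0 z xi" by auto
qed

text \<open>Over one point of the product of the bases, equal fibre maps mean equal ratios of the
  parallel sections, that is, equivalent representatives. This makes the homomorphism on the deck
  group injective.\<close>

lemma iso0_inj:
 assumes z: "z : pts P" and z': "z' : pts P" and eq: "r z = r z'" "!!xi. xi : fibre R.E (x2 z) ==> iso0 z xi = iso0 z' xi"
 shows "z = z'"
proof -
 obtain w where w: "w : pts CC" "z = pr w" by (rule P_ptsE[OF z])
 obtain w' where w': "w' : pts CC" "z' = pr w'" by (rule P_ptsE[OF z'])
 note c = CC_D[OF w(1)] and c' = CC_D[OF w'(1)]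
 have q: "L.q (fst w) = L.q (fst w')" "R.q (snd w) = R.q (snd w')" using eq(1) box_r_pr[OF w(1)] box_r_pr[OF w'(1)] w(2) w'(2) by auto
 have "iso0 z' (sig B (snd w')) = iso0 z (sig B (snd w'))"
  by (rule eq(2)[symmetric]) (use R.sig_fibre[OF c'(2)] box_r_pr[OF w(1)] w(2) q(2) in simp)
 hence "sig A (fst w') = kap B (snd w) (snd w') *R sig A (fst w)"
  using iso0_pr[OF w'(1), of 1] iso0_pr[OF w(1), of "kap B (snd w) (snd w')"] R.kap_eq[OF c(2) c'(2) q(2)] w(2) w'(2) by simp
 hence "kap A (fst w) (fst w') = kap B (snd w) (snd w')" by (rule L.kap_unique[OF c(1)])
 hence "beq w w'" using w(1) w'(1) q by (simp add: beq_def)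
 thus ?thesis using pr_eq_iff[OF w(1) w'(1)] w(2) w'(2) by simp
qed

lemma deck_rho:
 "EX rho. rho : hom (deck_group (mtop P) r) add_real_group & inj_on rho (carrier (deck_group (mtop P) r)) &
   (ALL g:carrier (deck_group (mtop P) r). ALL Om:Xi A B. lsym Om (Xi_act A B (exp (rho g)) Om) g)"
proof (intro exI conjI ballI)
 \<comment> \<open>The target constant \<open>c'\<close> has to satisfy
   \<open>c' *R iso0 (g z) = c *R iso0 z\<close> on the fibre, so \<open>c\<close> is divided by
   \<open>dscale g\<close>.\<close>
 let ?G = "deck_group (mtop P) r" and ?rho = "%g. - ln (dscale g)"
 show "?rho : hom ?G add_real_group"
 proof (rule homI)
  fix g h assume g: "g : carrier ?G" and h: "h : carrier ?G"
  have e: "(g \<otimes>\<^bsub>?G\<^esub> h) z = g (h z)" if "z : pts P" for z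
   using box_deckD(4)[OF g] box_deckD(4)[OF h] that by (simp add: deck_group_def BijGroup_def compose_def)
  have "dscale (g \<otimes>\<^bsub>?G\<^esub> h) = dscale g * dscale h"
  proof (rule dscale_eqI)
   fix z xi assume z: "z : pts P" and xi: "xi : fibre R.E (x2 z)"
   show "iso0 ((g \<otimes>\<^bsub>?G\<^esub> h) z) xi = (dscale g * dscale h) *R iso0 z xi"
    using dscale(2)[OF g box_deckD(2)[OF h z], of xi] dscale(2)[OF h z xi] xi box_deckD(3)[OF h z] e[OF z] by simp
  qed
  thus "?rho (g \<otimes>\<^bsub>?G\<^esub> h) = ?rho g \<otimes>\<^bsub>add_real_group\<^esub> ?rho h"
   using dscale(1)[OF g] dscale(1)[OF h] by (simp add: add_real_group_def ln_mult)
 qed (simp add: add_real_group_def)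
 show "inj_on ?rho (carrier ?G)"
 proof (rule inj_onI)
  fix g h assume g: "g : carrier ?G" and h: "h : carrier ?G" and "?rho g = ?rho h"
  hence k: "dscale g = dscale h" using dscale(1)[OF g] dscale(1)[OF h] by simp
  show "g = h"
  proof (rule extensionalityI)
   show "g : extensional (pts P)" "h : extensional (pts P)" using box_deckD(4)[OF g] box_deckD(4)[OF h] by (auto simp: Bij_def)
   fix z assume z: "z : pts P"
   show "g z = h z"
    by (rule iso0_inj[OF box_deckD(2)[OF g z] box_deckD(2)[OF h z]])
      (use box_deckD(3)[OF g z] box_deckD(3)[OF h z] dscale(2)[OF g z] dscale(2)[OF h z] k in simp_all)
  qed
 qed
 fix g Om assume g: "g : carrier ?G" and "Om : Xi A B"
 then obtain c where c: "c > 0" "Om = Om0 c" by (auto elim: Xi_cases)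
 have "lsym (Om0 c) (Om0 (exp (?rho g) * c)) g"
 proof (rule box_symplecto[OF box_deckD(1)[OF g] _ fm_smooth[OF id_morphism] box_iso_scaleR[OF iso0_box c(1)]])
  fix z v w assume z: "z : pts P"
  show "r (g z) = (x1 z, x2 z)" using box_deckD(3)[OF g z] by simp
  show "(exp (?rho g) * c) *R iso0 (g z) (R.om (x2 z) [tmap R.M R.M (%y. y) (x2 z) v, tmap R.M R.M (%y. y) (x2 z) w]) =
    c *R iso0 z (R.om (x2 z) [v, w])"
   using dscale[OF g] z R_fib[OF r2_pts[OF z]] by (simp add: tmap_id[OF R.Mm r2_pts[OF z]] exp_minus)
 qed
 thus "lsym Om (Xi_act A B (exp (?rho g)) Om) g" using c by (simp add: Xi_act_Om0)
qed

section \<open>Graphs of maps and isotropy\<close>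

context
 fixes ph G
 assumes ph: "smooth_map L.M R.M ph" and G: "smooth_map L.M P G" and rG_all: "ALL p:pts L.M. r (G p) = (p, ph p)"
begin

private lemmas rG = bspec[OF rG_all]

lemma graph_pts: "p : pts L.M ==> G p : pts P"
 by (rule sa_pts_image[OF Pm smD[OF G]])

lemma graph_tmap:
 assumes p: "p : pts L.M"
 shows "T1 (G p) (tmap L.M P G p v) = v" "T2 (G p) (tmap L.M P G p v) = tmap L.M R.M ph p v"
proof -
 have "T1 (G p) (tmap L.M P G p v) = tmap L.M L.M (%q. r1 (G q)) p v"
  by (rule fun_cong[OF tmap_compose[OF L.Mm Pm L.Mm smD[OF G p] smD[OF r1s graph_pts[OF p]]], symmetric])
 also have "tmap L.M L.M (%q. r1 (G q)) p = tmap L.M L.M (%q. q) p"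
  by (rule tmap_cong[OF L.Mm L.Mm sa_id[OF L.Mm p] near_mono[OF near_in_pts[OF p]]]) (simp add: rG)
 finally show "T1 (G p) (tmap L.M P G p v) = v" unfolding tmap_id[OF L.Mm p] .
 have "T2 (G p) (tmap L.M P G p v) = tmap L.M R.M (%q. r2 (G q)) p v"
  by (rule fun_cong[OF tmap_compose[OF L.Mm Pm R.Mm smD[OF G p] smD[OF r2s graph_pts[OF p]]], symmetric])
 also have "tmap L.M R.M (%q. r2 (G q)) p = tmap L.M R.M ph p"
  by (rule tmap_cong[OF L.Mm R.Mm smD[OF ph p] near_mono[OF near_in_pts[OF p]]]) (simp add: rG)
 finally show "T2 (G p) (tmap L.M P G p v) = tmap L.M R.M ph p v" .
qed

text \<open>The projection \<open>r1\<close> is a left inverse of \<open>G\<close>, and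
  \<open>T1\<close> one of its differential, so a graph is always an embedding and only the equation
  of forms remains.\<close>

lemma graph_isotropic_iff:
 "iso_emb (BS Ph) G <->
   (ALL p:pts L.M. ALL v w. L.om p [v, w] = Ph (G p) (gom ph p v w))"
proof -
 have "section_map (mtop L.M) (mtop P) G"
  unfolding section_map_def retraction_maps_def
  using smooth_map_continuous[OF L.Mm Pm G] smooth_map_continuous[OF Pm L.Mm r1s] rG by (intro exI[of _ r1]) simp
 moreover have "inj (tmap L.M P G p)" if "p : pts L.M" for p
  by (rule inj_on_inverseI[of _ "T1 (G p)"]) (rule graph_tmap(1)[OF that])
 ultimately have "smooth_embedding L.M P G"
  unfolding smooth_embedding_def using G section_imp_embedding_map by blast
 moreover have "pull_form L.M P G (lfrm (BS Ph)) p [v, w] =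
   L.om p [v, w] - Ph (G p) (gom ph p v w)" if p: "p : pts L.M" for p v w
  using p by (simp add: pull_form_def box_form[OF graph_pts[OF p]] graph_tmap[OF p] rG[OF p])
 ultimately show ?thesis unfolding isotropic_embedding_def length_2_conv by simp
qed

lemma graph_unique:
 assumes "iso_emb (Om0 c) G" "iso_emb (Om0 d) G"
 shows "c = d"
proof -
 obtain p where p: "p : pts L.M" using L.ne by blast
 obtain v w where "L.om p [v, w] ~= 0" using L_nonzero[OF p] by blast
 moreover have "L.om p [v, w] = c *R iso0 (G p) (gom ph p v w)"
  "L.om p [v, w] = d *R iso0 (G p) (gom ph p v w)"
  using assms p unfolding graph_isotropic_iff by blast+
 ultimately show ?thesis by auto
qed

lemma graph_Xi_of:
 assumes "c > 0" "iso_emb (Om0 c) G"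
 shows "Xi_of A B G = Om0 c"
 unfolding Xi_of_def
proof (rule the_equality)
 fix Om assume Om: "Om : Xi A B & iso_emb Om G"
 then obtain d where d: "d > 0" "Om = Om0 d" by (auto elim: Xi_cases)
 have "c = d" by (rule graph_unique[OF assms(2)]) (use Om d(2) in blast)
 thus "Om = Om0 c" using d(2) by simp
qed (use assms Om0_Xi in simp)

text \<open>Following the bundle map of \<open>ph\<close> by \<open>iso0\<close> along the graph
  returns to the fibre of the first bundle over the same point. In flat frames this endomorphism is
  locally a positive constant, and \<open>L.M\<close> is connected.\<close>

lemma graph_morphism_scale:
 assumes Ps: "flat_morphism L.M L.E L.D R.M R.E R.D ph Ps"
 shows "EX c>0. ALL p:pts L.M. ALL xi:fibre L.E p. iso0 (G p) (Ps p xi) = c *R xi"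
proof -
 define Q where "Q c p <-> (ALL xi:fibre L.E p. iso0 (G p) (Ps p xi) = c *R xi)" for c p
 have ex: "EX c>0. near L.M p (Q c)" if p: "p : pts L.M" for p
 proof -
  obtain U e where e: "p : U" "L.ff U e" by (rule L.ffx[OF p])
  obtain V e' where e': "ph p : V" "R.ff V e'"
   by (rule R.ffx[ of "ph p"]) (use r2_pts[OF graph_pts[OF p]] rG[OF p] in simp)
  obtain c where c: "c > 0" "near L.M p (%q. Ps q (e q) = c *R e' (ph q))" by (rule fm_const[OF L.FB R.FB Ps e(2,1) e'(2,1)])
  obtain d where d: "d > 0" "near P (G p) (%q. iso0 q (e' (x2 q)) = d *R e (x1 q))"
   using box_iso_const[OF iso0_box graph_pts[OF p] e(2) _ e'(2)] e(1) e'(1) rG[OF p] by auto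
  have n: "near L.M p (%q. iso0 (G q) (e' (x2 (G q))) = d *R e (x1 (G q)))"
   by (rule near_preimage[OF L.Mm Pm smD[OF G p] d(2)])
  have n': "near L.M p (%q. q : U & ph q : V)"
   by (rule near_conj[OF near_sframe[OF L.Mm L.Eo ffD(1)[OF e(2)] e(1)]
      near_preimage[OF L.Mm R.Mm smD[OF ph p] near_sframe[OF R.Mm R.Eo ffD(1)[OF e'(2)] e'(1)]]])
  have "near L.M p (Q (c * d))"
  proof (rule near_mono3[OF c(2) n n'])
   fix q assume q: "Ps q (e q) = c *R e' (ph q)" "iso0 (G q) (e' (x2 (G q))) = d *R e (x1 (G q))" "q : U & ph q : V"
   note s = sframeD(1,2)[OF ffD(1)[OF e(2)] conjunct1[OF q(3)]] and qM = sframe_pts[OF ffD(1)[OF e(2)] conjunct1[OF q(3)]]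
   have s': "e' (ph q) : fibre R.E (x2 (G q))" using sframeD(1)[OF ffD(1)[OF e'(2)] conjunct2[OF q(3)]] rG[OF qM] by simp
   show "Q (c * d) q"
    unfolding Q_def
   proof
    fix xi assume "xi : fibre L.E q"
    then obtain a where a: "xi = a *R e q" using fibre_iff[OF L.Mm L.Eo qM s] by blast
    show "iso0 (G q) (Ps q xi) = (c * d) *R xi"
     using q li_scaleR[OF fm_liso[OF Ps qM] s(1)] li_scaleR[OF iso0_li[OF graph_pts[OF qM]] s'] rG[OF qM]
     unfolding a by (simp add: mult.commute mult.left_commute)
   qed
  qed
  with c(1) d(1) show ?thesis by (intro exI[of _ "c * d"]) simp
 qed
 have uniq: "c = d" if p: "p : pts L.M" and k: "Q c p" "Q d p" for c d p
 proof -
  obtain x where x: "x ~= 0" "fibre L.E p = span {x}" using fibre_line[OF L.Mm L.Eo p] by blast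
  have "x : fibre L.E p" using x(2) by (simp add: span_base)
  with k have "c *R x = d *R x" unfolding Q_def by metis
  thus ?thesis using x(1) by simp
 qed
 have "EX c>0. ALL p:pts L.M. Q c p" by (rule connected_scale[OF L.conn L.ne]) (erule ex, erule (2) uniq)
 thus ?thesis unfolding Q_def .
qed

text \<open>The structure is normalised so that the bundle map followed by the scaled
  \<open>iso0\<close> is the identity; hence the reciprocal of the constant just found. The last two
  conclusions are kept for the comparison with the lift of an isotopy.\<close>

lemma graph_lcs_map:
 assumes Ps: "flat_morphism L.M L.E L.D R.M R.E R.D ph Ps"
  and form: "ALL p:pts L.M. ALL v w. bundle_pull_form L.M L.E R.M ph Ps R.om p [v, w] = L.om p [v, w]"
 obtains c where "c > 0" "iso_emb (Om0 c) G" "!!p xi. p : pts L.M ==> xi : fibre L.E p ==> c *R iso0 (G p) (Ps p xi) = xi"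
  "!!p v w. p : pts L.M ==> Ps p (L.om p [v, w]) = gom ph p v w"
proof -
 obtain c where c: "c > 0" "ALL p:pts L.M. ALL xi:fibre L.E p. iso0 (G p) (Ps p xi) = c *R xi" using graph_morphism_scale[OF Ps] by blast
 have ps: "Ps p (L.om p [v, w]) = gom ph p v w" if p: "p : pts L.M" for p v w
 proof -
  have "gom ph p v w : fibre R.E (ph p)"
   using R_fib[OF r2_pts[OF graph_pts[OF p]]] rG[OF p] by simp
  from li_f_inv[OF fm_liso[OF Ps p] this] show ?thesis
   using form p by (simp add: bundle_pull_form_def pull_form_def)
 qed
 have s: "(1 / c) *R iso0 (G p) (Ps p xi) = xi" if "p : pts L.M" "xi : fibre L.E p" for p xi using c that by simp
 show ?thesis
 proof (rule that[of "1 / c", OF _ _ s ps])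
  show "iso_emb (Om0 (1 / c)) G"
   unfolding graph_isotropic_iff
  proof (intro ballI allI)
   fix p v w assume p: "p : pts L.M"
   show "L.om p [v, w] = (1 / c) *R iso0 (G p) (gom ph p v w)"
    using s[OF p L_fib[OF p]] ps[OF p] by simp
  qed
 qed (use c in simp_all)
qed

lemma graph_lcs_map_iff:
 "lcs_map L.M (cstr A) R.M (cstr B) ph <-> (EX Om:Xi A B. iso_emb Om G)"
proof
 assume "lcs_map L.M (cstr A) R.M (cstr B) ph"
 then obtain Ps where Ps: "flat_morphism L.M L.E L.D R.M R.E R.D ph Ps"
  "ALL p:pts L.M. ALL v w. bundle_pull_form L.M L.E R.M ph Ps R.om p [v, w] = L.om p [v, w]"
  unfolding lcs_map_def length_2_conv by blast
 obtain c where "c > 0" "iso_emb (Om0 c) G" by (rule graph_lcs_map[OF Ps])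
 with Om0_Xi show "EX Om:Xi A B. iso_emb Om G" by blast
next
 assume "EX Om:Xi A B. iso_emb Om G"
 then obtain Ph where Ph: "box_iso A B Ph" and iso: "iso_emb (BS Ph) G" unfolding Xi_def by blast
 \<comment> \<open>An isotropic graph produces the bundle map of \<open>ph\<close>: invert the
   isomorphism of the structure over the points of the graph.\<close>
 let ?Ps = "%p. inv_into (fibre R.E (ph p)) (Ph (G p))"
 have li: "liso (fibre R.E (ph p)) (fibre L.E p) (Ph (G p))" if "p : pts L.M" for p
  using box_iso_line[OF Ph graph_pts[OF that]] rG[OF that] by simp
 have php: "ph p : pts R.M" if "p : pts L.M" for p using r2_pts[OF graph_pts[OF that]] rG[OF that] by simp
 have li': "liso (fibre L.E p) (fibre R.E (ph p)) (?Ps p)" if p: "p : pts L.M" for p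
  by (rule li_inverse[OF R.Mm R.Eo php[OF p] li[OF p]])
 have m: "flat_morphism L.M L.E L.D R.M R.E R.D ph ?Ps"
 proof (rule flat_morphismI[OF L.FB R.FB ph li'])
  fix p assume p: "p : pts L.M"
  obtain U e where e: "p : U" "L.ff U e" by (rule L.ffx[OF p])
  obtain V e' where e': "ph p : V" "R.ff V e'" by (rule R.ffx[OF php[OF p]])
  obtain d where d: "d > 0" "near P (G p) (%q. Ph q (e' (x2 q)) = d *R e (x1 q))"
   using box_iso_const[OF Ph graph_pts[OF p] e(2) _ e'(2)] e(1) e'(1) rG[OF p] by auto
  have n: "near L.M p (%q. Ph (G q) (e' (x2 (G q))) = d *R e (x1 (G q)))"
   by (rule near_preimage[OF L.Mm Pm smD[OF G p] d(2)])
  have n': "near L.M p (%q. ph q : V)"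
   by (rule near_preimage[OF L.Mm R.Mm smD[OF ph p] near_sframe[OF R.Mm R.Eo ffD(1)[OF e'(2)] e'(1)]])
  have fin: "near L.M p (%q. ?Ps q (e q) = (1 / d) *R e' (ph q))"
  proof (rule near_mono3[OF n n' near_in_pts[OF p]])
   fix q assume q: "Ph (G q) (e' (x2 (G q))) = d *R e (x1 (G q))" "ph q : V" "q : pts L.M"
   note f = sframeD(1)[OF ffD(1)[OF e'(2)] q(2)]
   have "Ph (G q) ((1 / d) *R e' (ph q)) = e q" using li_scaleR[OF li[OF q(3)] f] q(1) rG[OF q(3)] d(1) by simp
   thus "?Ps q (e q) = (1 / d) *R e' (ph q)" using li_inv[OF li[OF q(3)] fibre_scaleR[OF R.Mm R.Eo php[OF q(3)] f]] by metis
  qed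
  have d': "0 < 1 / d" using d(1) by simp
  show "EX U e V e' c. L.ff U e & p : U & R.ff V e' & ph p : V & c > 0 & near L.M p (%q. ?Ps q (e q) = c *R e' (ph q))"
   by (intro exI conjI, rule e(2), rule e(1), rule e'(2), rule e'(1), rule d', rule fin)
 qed
 have "bundle_pull_form L.M L.E R.M ph ?Ps R.om p [v, w] = L.om p [v, w]" if p: "p : pts L.M" for p v w
 proof -
  let ?x = "gom ph p v w"
  have x: "?x : fibre R.E (ph p)" by (rule R_fib[OF php[OF p]])
  have eq: "L.om p [v, w] = Ph (G p) ?x" using iso p unfolding graph_isotropic_iff by blast
  have "?Ps p (L.om p [v, w]) = ?x" unfolding eq by (rule li_inv[OF li[OF p] x])
  with li_inv[OF li'[OF p] L_fib[OF p], of v w] show ?thesis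
   using p by (simp add: bundle_pull_form_def pull_form_def)
 qed
 with m show "lcs_map L.M (cstr A) R.M (cstr B) ph" unfolding lcs_map_def length_2_conv by blast
qed

lemma graph_ex1:
 assumes "lcs_map L.M (cstr A) R.M (cstr B) ph"
 shows "EX! Om. Om : Xi A B & iso_emb Om G"
proof (rule ex_ex1I)
 show "EX Om. Om : Xi A B & iso_emb Om G" using assms unfolding graph_lcs_map_iff by blast
 fix Om Om' assume "Om : Xi A B & iso_emb Om G" "Om' : Xi A B & iso_emb Om' G"
 thus "Om = Om'" by (metis Xi_cases graph_unique)
qed

end

end

section \<open>Isotopies\<close>

text \<open>Near time \<open>t\<close> the curve stays in the preferred chart at \<open>c t\<close>,
  where the chain rule applies within \<open>J\<close>. Applied with \<open>h\<close> a coordinate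
  map and with \<open>h\<close> a local section of \<open>r\<close>.\<close>

lemma curve_derivative:
 fixes M :: "('a, 'e::euclidean_space) manifold" and N :: "('b, 'f::euclidean_space) manifold" and c :: "real => 'a"
 assumes M: "mfd M" and N: "mfd N" and c: "pcont (mtop M) J c" "t : J" and h: "smooth_at M N (c t) h"
  and X: "((%ta. crd M (c t) (c ta)) has_vector_derivative X) (at t within J)"
 shows "((%ta. crd N (h (c t)) (h (c ta))) has_vector_derivative tmap M N h (c t) X) (at t within J)"
proof -
 have p: "c t : pts M" by (rule pcontD(1)[OF c])
 have lin: "linear (tmap M N h (c t))" by (rule tmap_linear[OF M N h])
 note d = sa_has_derivative[OF M N h]
 have "((%x. crd N (h (c t)) (h (cinv M (c t) x))) o (%ta. crd M (c t) (c ta)) has_derivative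
   tmap M N h (c t) o (%s. s *R X)) (at t within J)"
  by (rule diff_chain_within[OF X[unfolded has_vector_derivative_def] has_derivative_at_withinI[OF d]])
 hence 1: "((%ta. crd N (h (c t)) (h (cinv M (c t) (crd M (c t) (c ta))))) has_vector_derivative tmap M N h (c t) X) (at t within J)"
  by (simp add: has_vector_derivative_def o_def linear_scale[OF lin])
 obtain ep where ep: "ep > 0" "ALL t':J. abs (t' - t) < ep --> c t' : cdom M (c t)"
  using pcontD(2)[OF c openin_cdom[OF M p] mem_cdom[OF M p]] by blast
 show ?thesis
  by (rule has_vector_derivative_transform_within[OF 1 ep(1) c(2)])
    (use ep(2) crd_inv_crd[OF M p] in "simp add: dist_real_def")
qed

definition crd_vf :: "('a, 'e::euclidean_space) manifold => 'a => ('a => 'e) => 'e => 'e" where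
 "crd_vf M m X z = dmf M (crd M m) (cinv M m z) (X (cinv M m z))"

text \<open>Cartan's formula for a closed form: the right-hand side is the Lie derivative along
  \<open>X\<close> in coordinates. Closedness trades the derivatives of the coefficients along
  \<open>v\<close> and \<open>w\<close> for the one along \<open>X\<close>.\<close>

lemma ext_d_contraction:
 fixes M :: "('a, 'e::euclidean_space) manifold" and E :: "('a, 'l::real_vector) lbundle"
 assumes FB: "flat_bundle M E D" and c: "closed_form2 M E D al" and e: "flatf M E D U e" "m : U" and X: "smooth_vf_at M m X"
 shows "crd_vf M m X differentiable (at (crd M m m))"
  "ext_d M D (%q ws. al q (X q # ws)) m [v, w] = (let a = f2c M al e m; z = crd M m m in
    fd (%z. a z v w) z (X m) + a z (fd (crd_vf M m X) z v) w + a z v (fd (crd_vf M m X) z w)) *R e m"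
proof -
 note M = fbD(1)[OF FB] and E = fbD(2)[OF FB]
 have al: "bundle_form M E 2 al" using c by (simp add: closed_form2_def)
 have m: "m : pts M" by (rule sframe_pts[OF ffD(1)[OF e(1)] e(2)])
 let ?a = "f2c M al e m" and ?z = "crd M m m"
 have dX: "(crd_vf M m X has_derivative fd (crd_vf M m X) ?z) (at ?z)"
  
  by (rule fd_works[OF differentiableI]) (use has_derivative_real[OF M X[unfolded smooth_vf_at_def]] in "simp add: crd_vf_def[abs_def]")
 thus "crd_vf M m X differentiable (at ?z)" by (auto simp: differentiable_def)
 have X0: "crd_vf M m X ?z = X m" by (simp add: crd_vf_def crd_inv_crd_self[OF M m] tmap_crd_self[OF M m])
 obtain T where T: "open T" "?z : T" "!!z. z : T ==> EX q. q : cdom M m & q : U & z = crd M m q"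
  by (rule form2_dom[OF FB al e]) (rule that)
 have tl1: "linear (%v. ?a z v w)" and tl2: "linear (?a z v)" and tan: "?a z v w = - ?a z w v" if "z : T" for z v w
  using T(3)[OF that] form2_coef_linear[OF FB al e] by blast+
 have D: "D (%q. al q [X q, cvf M m w q]) m v = (fd (%z. ?a z (X m) w) ?z v + ?a ?z (fd (crd_vf M m X) ?z v) w) *R e m" for v w
 proof -
  let ?s = "%q. al q [X q, cvf M m w q]" and ?g = "%q. ?a (crd M m q) (dmf M (crd M m) q (X q)) w"
  have ss: "ssec M E m ?s" by (rule form2_smooth[OF FB al m X smooth_vf_at_coord[OF M m]])
  have g: "near M m (%q. ?s q = ?g q *R e q & ?g q = fcf (?s q) (e q))"
  proof (rule near_mono[OF near_form2[OF FB al e]])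
   fix q assume q: "q : cdom M m & q : U"
   have "?s q = ?g q *R e q"
    using form2_coef_eq[OF FB al e conjunct1[OF q] conjunct2[OF q], of "dmf M (crd M m) q (X q)" w] coord_vf_tmap_crd[OF M m conjunct1[OF q]] by simp
   thus "?s q = ?g q *R e q & ?g q = fcf (?s q) (e q)"
    using sframeD(2)[OF ffD(1)[OF e(1)] conjunct2[OF q]] by simp
  qed
  have "smf M m ?g"
   by (rule sa_cong[OF M sframe_coef_smooth(1)[OF M E ffD(1)[OF e(1)] e(2) ss] near_mono[OF g conjunct2]])
  hence "D ?s m v = fd (%x. ?g (cinv M m x)) ?z v *R e m"
   by (rule form2_conn[OF FB al e]) (rule near_mono[OF g conjunct1])
  also have "fd (%x. ?g (cinv M m x)) ?z = (%v. fd (%z. ?a z (X m) w) ?z v + ?a ?z (fd (crd_vf M m X) ?z v) w)"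
  proof (rule fd_eq)
   have "((%x. ?a x (crd_vf M m X x) w) has_derivative (%v. fd (%z. ?a z (crd_vf M m X ?z) w) ?z v + ?a ?z (fd (crd_vf M m X) ?z v) w)) (at ?z within UNIV)"
    by (rule has_derivative_linear_family[OF T(1,2) tl1 form2_coef_differentiable[OF FB al e] has_derivative_ident dX UNIV_I])
   thus "((%x. ?g (cinv M m x)) has_derivative (%v. fd (%z. ?a z (X m) w) ?z v + ?a ?z (fd (crd_vf M m X) ?z v) w)) (at ?z)"
    unfolding X0 by (rule hd_within[OF _ open_cimg[OF M m]]) (simp_all add: crd_vf_def mem_cdom[OF M m] crd_crd_inv[OF M m])
  qed
  finally show ?thesis .
 qed
 have "fd (%z. ?a z v w) ?z (X m) - fd (%z. ?a z (X m) w) ?z v + fd (%z. ?a z (X m) v) ?z w = 0"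
  using ext_d_2_coef[OF FB al e, of "X m" v w] c m sframeD(2)[OF ffD(1)[OF e(1)] e(2)] by (simp add: closed_form2_def Let_def)
 thus "ext_d M D (%q ws. al q (X q # ws)) m [v, w] = (let a = ?a; z = ?z in
    fd (%z. a z v w) z (X m) + a z (fd (crd_vf M m X) z v) w + a z v (fd (crd_vf M m X) z w)) *R e m"
  unfolding ext_d_1 D Let_def scaleR_left_diff_distrib[symmetric] tan[OF T(2), of v] by (intro arg_cong2[where f = scaleR]) simp_all
qed

text \<open>The local extension in time makes \<open>F\<close> smooth on an open set even if
  \<open>t\<close> is an end point of \<open>J\<close>, so two-sided derivatives and the symmetry of
  mixed derivatives are available.\<close>

lemma isotopy_coords:
 fixes M :: "('a, 'e::euclidean_space) manifold"
 assumes M: "mfd M" and ph: "smooth_isotopy J M ph" and t: "t : J" and p: "p : pts M"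
 obtains F d where "d > 0" "ball (crd M p p) d <= cimg M p" "smooth_on (ball t d \<times> ball (crd M p p) d) F"
  "!!ta x. ta : J ==> ta : ball t d ==> x : ball (crd M p p) d ==>
    ph ta (cinv M p x) : cdom M (ph t p) & F (ta, x) = crd M (ph t p) (ph ta (cinv M p x))"
proof -
 let ?RM = "prod_mfd eucl M :: (real \<times> 'a, real \<times> 'e) manifold" and ?m = "ph t p"
 note RM = prod_m[OF euclid_m M]
 have m: "?m : pts M" by (rule sa_pts_image[OF M smD[OF diffeoD(1)[OF isotopyD(1)[OF ph t]] p]])
 obtain f where f: "smooth_at ?RM M (t, p) f"
  "near ?RM (t, p) (%z. fst z : J & snd z : pts M --> f z = ph (fst z) (snd z))" "f (t, p) = ?m" by (rule isotopy_extension[OF ph t p])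
 have n: "near ?RM (t, p) (%z. f z : cdom M ?m)" by (rule sa_continuous[OF RM M f(1) openin_cdom[OF M m]]) (simp add: f(3) mem_cdom[OF M m])
 obtain d V where V: "d > 0" "opn M V" "p : V" "!!ta q. \<bar>ta - t\<bar> < d ==> q : V ==>
   (ta : J & q : pts M --> f (ta, q) = ph ta q) & f (ta, q) : cdom M ?m & smooth_at ?RM M (ta, q) f"
  by (rule near_prod_real[OF near_conj[OF f(2) near_conj[OF n sa_nearby[OF f(1)]]], unfolded fst_conv snd_conv]) (rule that)
 obtain rho where rho: "rho > 0" "ball (crd M p p) rho <= cimg M p" "ALL x:ball (crd M p p) rho. cinv M p x : V"
  by (rule near_cball[OF M p near_open[OF V(2,3)]])
 let ?d = "min d rho"
 show ?thesis
 proof (rule that[of ?d "%z. crd M ?m (f (fst z, cinv M p (snd z)))"])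
  show "smooth_on (ball t ?d \<times> ball (crd M p p) ?d) (%z. crd M ?m (f (fst z, cinv M p (snd z))))"
  proof (rule so_of_smooth_at[OF open_Times[OF open_ball open_ball]])
   fix z :: "real \<times> 'e" assume z: "z : ball t ?d \<times> ball (crd M p p) ?d"
   hence z': "abs (fst z - t) < d" "snd z : ball (crd M p p) rho" by (auto simp: dist_real_def)
   note * = V(4)[OF z'(1) bspec[OF rho(3) z'(2)]]
   note bl = sa_bounded_linear[OF euclid_m _ sa_id[OF euclid_m]]
   have s1: "smooth_at eucl ?RM z (%z. (fst z, cinv M p (snd z)))"
    by (rule sa_Pair[OF euclid_m M euclid_m bl[OF bounded_linear_fst]
       sa_compose[OF euclid_m euclid_m M bl[OF bounded_linear_snd] crd_inv_smooth[OF M p]]])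
      (use z'(2) rho(2) in auto)
   have s2: "smooth_at eucl M z (%z. f (fst z, cinv M p (snd z)))"
    by (rule sa_compose[OF euclid_m RM M s1]) (use * in simp)
   show "smf eucl z (%z. crd M ?m (f (fst z, cinv M p (snd z))))"
    by (rule sa_compose[OF euclid_m M euclid_m s2 crd_smooth[OF M m]]) (use * in simp)
  qed
  fix ta x assume ta: "ta : J" "ta : ball t ?d" and x: "x : ball (crd M p p) ?d"
  have x': "cinv M p x : V" "cinv M p x : pts M" using rho(3) x openin_subset[OF V(2)] by auto
  have "\<bar>ta - t\<bar> < d" using ta(2) by (simp add: dist_real_def abs_minus_commute)
  from V(4)[OF this x'(1)] ta(1) x'(2) have "f (ta, cinv M p x) = ph ta (cinv M p x)" "f (ta, cinv M p x) : cdom M ?m" by auto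
  thus "ph ta (cinv M p x) : cdom M ?m &
    crd M ?m (f (fst (ta, x), cinv M p (snd (ta, x)))) = crd M ?m (ph ta (cinv M p x))" by simp
 qed (use V(1) rho(1,2) in auto)
qed

lemma has_derivative_imp_vector:
 assumes "(f has_derivative L) (at t within S)"
 shows "(f has_vector_derivative L (1::real)) (at t within S)"
proof -
 have "L s = s *R L 1" for s using linear_scale[OF has_derivative_linear[OF assms], of s 1] by simp
 hence "L = (%s. s *R L 1)" by (rule ext)
 thus ?thesis using assms unfolding has_vector_derivative_def by simp
qed

lemma has_derivative_slices:
 fixes F :: "real \<times> 'e::euclidean_space => 'f::real_normed_vector"
 assumes "(F has_derivative F') (at (t, x))"
 shows "((%ta. F (ta, x)) has_derivative (%s. F' (s, 0))) (at t within S)" "((%x. F (t, x)) has_derivative (%v. F' (0, v))) (at x within R)"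
 using diff_chain_within[OF has_derivative_Pair[OF has_derivative_ident has_derivative_const] has_derivative_at_withinI[OF assms], of S]
  diff_chain_within[OF has_derivative_Pair[OF has_derivative_const has_derivative_ident] has_derivative_at_withinI[OF assms], of R]
 by (simp_all add: o_def)

text \<open>\<open>generated_by\<close> says nothing about smoothness of the field. Derivatives
  within \<open>J\<close> are unique at \<open>t\<close>, so the field is the time derivative of
  \<open>F\<close>, carried along by the inverse diffeomorphism, and smoothness follows.\<close>

lemma isotopy_velocity:
 fixes M :: "('a, 'e::euclidean_space) manifold"
 assumes M: "mfd M" and ph: "smooth_isotopy J M ph" and t: "t : J" "at t within J ~= bot" and p: "p : pts M"
  and gen: "generated_by J M ph X"
  and F: "d > 0" "ball (crd M p p) d <= cimg M p" "smooth_on (ball t d \<times> ball (crd M p p) d) F"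
  "!!ta x. ta : J ==> ta : ball t d ==> x : ball (crd M p p) d ==>
    ph ta (cinv M p x) : cdom M (ph t p) & F (ta, x) = crd M (ph t p) (ph ta (cinv M p x))"
 shows "x : ball (crd M p p) d ==> dmf M (crd M (ph t p)) (ph t (cinv M p x)) (X t (ph t (cinv M p x))) = fd F (t, x) (1, 0)"
  "smooth_vf_at M (ph t p) (X t)"
proof -
 let ?m = "ph t p"
 have td: "t : ball t d" using F(1) by simp
 note dif = diffeoD[OF isotopyD(1)[OF ph t(1)]]
 have m: "?m : pts M" by (rule sa_pts_image[OF M smD[OF dif(1) p]])
 have vel: "dmf M (crd M ?m) (ph t (cinv M p x)) (X t (ph t (cinv M p x))) = fd F (t, x) (1, 0)" if x: "x : ball (crd M p p) d" for x
 proof -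
  let ?q = "cinv M p x"
  have q: "?q : pts M" using crd_inv_cdom[OF M p] F(2) x cdom_subset[OF M p] by blast
  have 1: "((%ta. crd M ?m (ph ta ?q)) has_vector_derivative dmf M (crd M ?m) (ph t ?q) (X t (ph t ?q))) (at t within J)"
   using curve_derivative[OF M euclid_m isotopy_path[OF M ph q] t(1) crd_smooth[OF M m conjunct1[OF F(4)[OF t(1) td x]]], of "X t (ph t ?q)"] gen t(1) q
   by (simp add: generated_by_def)
  have "(F has_derivative fd F (t, x)) (at (t, x))" by (rule so_has_derivative[OF F(3)]) (use td x in simp)
  from has_derivative_imp_vector[OF has_derivative_slices(1)[OF this]]
  have "((%ta. F (ta, x)) has_vector_derivative fd F (t, x) (1, 0)) (at t within J)" .
  hence "((%ta. crd M ?m (ph ta ?q)) has_vector_derivative fd F (t, x) (1, 0)) (at t within J)"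
   by (rule has_vector_derivative_transform_within[OF _ F(1) t(1)]) (use F(4)[OF _ _ x] in "simp add: dist_commute")
  from vector_derivative_unique_within[OF t(2) 1 this] show ?thesis .
 qed
 thus "x : ball (crd M p p) d ==> dmf M (crd M ?m) (ph t (cinv M p x)) (X t (ph t (cinv M p x))) = fd F (t, x) (1, 0)" .
 let ?i = "inv_into (pts M) (ph t)"
 have i: "?i (ph t q) = q" if "q : pts M" for q using dif(2) that by (simp add: bij_betw_def)
 have i': "ph t (?i q) = q" if "q : pts M" for q using dif(2) that by (metis bij_betw_inv_into_right)
 have si: "smooth_at M M ?m ?i" by (rule smD[OF dif(3) m])
 have sm: "smf M ?m (%q. fd F (t, crd M p (?i q)) (1, 0))"
 proof (rule sa_real_compose[OF M sa_compose[OF M M euclid_m si crd_smooth[OF M p]] open_ball])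
  show "smooth_on (ball (crd M p p) d) (%x. fd F (t, x) (1, 0))"
   by (rule so_compose[OF open_ball so_Pair[OF open_ball so_const so_id[OF open_ball]] so_fd[OF F(3)]])
     (use td in auto)
 qed (use i[OF p] mem_cdom[OF M p] F(1) in simp_all)
 have "near M ?m (%q. q : pts M & ?i q : cdom M p & crd M p (?i q) : ball (crd M p p) d)"
  by (rule near_conj[OF near_in_pts[OF m] near_preimage[OF M M si]]) (use i[OF p] near_ball[OF M p F(1)] in simp)
 hence "near M ?m (%q. dmf M (crd M ?m) q (X t q) = fd F (t, crd M p (?i q)) (1, 0))"
 proof (rule near_mono)
  fix q assume q: "q : pts M & ?i q : cdom M p & crd M p (?i q) : ball (crd M p p) d"
  thus "dmf M (crd M ?m) q (X t q) = fd F (t, crd M p (?i q)) (1, 0)"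
   using vel[of "crd M p (?i q)"] crd_inv_crd[OF M p, of "?i q"] i'[of q] by simp
 qed
 thus "smooth_vf_at M ?m (X t)" unfolding smooth_vf_at_def by (rule sa_cong[OF M sm])
qed

section \<open>The diagonal, and forms transported along a lifted isotopy\<close>

locale selfbox = box A A for A :: "('a, 'e::euclidean_space, 'l::real_vector, 'c) covered_lcs"
begin

abbreviation "diag == diag_lift A"

lemma diag_eq:
 assumes x: "x : pts L.C"
 shows "diag (L.q x) = pr (x, x)"
proof -
 let ?x = "SOME y. y : pts L.C & L.q y = L.q x"
 have "?x : pts L.C & L.q ?x = L.q x" by (rule someI[of _ x]) (use x in simp)
 hence b: "beq (?x, ?x) (x, x)" using x by (simp add: beq_def)
 show ?thesis unfolding diag_lift_def Let_def by (rule iffD2[OF pr_eq_iff[OF beqD(5,6)[OF b]] b])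
qed

lemma diag_cases:
 assumes "p : pts L.M"
 obtains x where "x : pts L.C" "L.q x = p" "diag p = pr (x, x)"
proof -
 obtain x where x: "x : pts L.C" "L.q x = p" using assms covD(2)[OF L.cov] by (metis imageE)
 show ?thesis by (rule that[OF x]) (use diag_eq[OF x(1)] x(2) in simp)
qed

lemma r_diag: "p : pts L.M ==> r (diag p) = (p, p)"
 by (erule diag_cases) (simp add: box_r_pr)

text \<open>Both factors use the same parallel section, which \<open>iso0\<close> matches with
  itself over a point \<open>(x, x)\<close>.\<close>

lemma iso0_diag:
 assumes p: "p : pts L.M" and xi: "xi : fibre L.E p"
 shows "iso0 (diag p) xi = xi"
proof -
 obtain x where x: "x : pts L.C" "L.q x = p" "diag p = pr (x, x)" by (rule diag_cases[OF p])
 obtain c where "xi = c *R sig A x" using xi fibre_iff[OF L.Mm L.Eo p] L.sig_fibre[OF x(1)] L.sig_nz[OF x(1)] x(2) by blast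
 thus ?thesis using iso0_pr[of "(x, x)" c] x by simp
qed

lemma diag_smooth: "smooth_map L.M P diag"
 unfolding smooth_map_def
proof
 fix p assume p: "p : pts L.M"
 obtain x where x: "x : pts L.C" "L.q x = p" "diag p = pr (x, x)" by (rule diag_cases[OF p])
 obtain V s where s: "(V, s) : csec L.C L.M L.q" "L.q x : V" "s (L.q x) = x" using csec_through[OF L.Cm L.Mm L.cov x(1)] .
 have ss: "smooth_at L.M L.C p s" using csec_smooth[OF L.Cm L.Mm L.cov s(1,2)] x(2) by simp
 have "smooth_at L.M CC p (%q. (s q, s q))" by (rule sa_Pair[OF L.Cm L.Cm L.Mm ss ss])
 hence sm: "smooth_at L.M P p (%q. pr (s q, s q))"
  by (rule sa_compose[OF L.Mm CCm Pm]) (rule smD[OF pr_smooth], use s x in simp)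
 show "smooth_at L.M P p diag"
 proof (rule sa_cong[OF L.Mm sm nearbyI[OF csec_open[OF L.Cm L.Mm L.cov s(1)]]])
  show "diag q = pr (s q, s q)" if "q : V" for q
   using diag_eq[OF sa_pts_image[OF L.Cm csec_smooth[OF L.Cm L.Mm L.cov s(1) that]]] csec_right[OF L.Cm L.Mm L.cov s(1) that] by simp
 qed (use s(2) x(2) in simp)
qed

context
 fixes J ph ps
 assumes J: "is_interval J" "0 : J" and ph: "smooth_isotopy J L.M ph" and ps: "lifted_isotopy J A ph ps"
begin

abbreviation "GG t == ps t o diag"

lemma ps_iso: "smooth_isotopy J P ps" and r_ps: "t : J ==> z : pts P ==> r (ps t z) = (x1 z, ph t (x2 z))"
 using ps by (auto simp: lifted_isotopy_def map_prod_def split: prod.splits)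

lemma ph_map: "t : J ==> smooth_map L.M L.M (ph t)" and ps_map: "t : J ==> smooth_map P P (ps t)"
 by (rule diffeoD(1)[OF isotopyD(1)[OF ph]], assumption, rule diffeoD(1)[OF isotopyD(1)[OF ps_iso]])

lemma ph_pts: "t : J ==> p : pts L.M ==> ph t p : pts L.M"
 by (rule sa_pts_image[OF L.Mm smD[OF ph_map]])

lemma diag_pts: "p : pts L.M ==> diag p : pts P"
 by (rule sa_pts_image[OF Pm smD[OF diag_smooth]])

lemma GG: "t : J ==> smooth_map L.M P (GG t)" "t : J ==> p : pts L.M ==> r (GG t p) = (p, ph t p)"
 "t : J ==> p : pts L.M ==> GG t p : pts P"
proof -
 show sm: "smooth_map L.M P (GG t)" if "t : J" for t
  unfolding smooth_map_def o_def
  using sa_compose[OF L.Mm Pm Pm smD[OF diag_smooth] smD[OF ps_map[OF that] diag_pts]] by blast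
 show "t : J ==> p : pts L.M ==> r (GG t p) = (p, ph t p)" using r_ps diag_pts r_diag by simp
 show "t : J ==> p : pts L.M ==> GG t p : pts P" by (rule sa_pts_image[OF Pm smD[OF sm]])
qed

text \<open>The pullback of the form under \<open>ph t\<close>, brought back by \<open>iso0\<close>
  at the graph point to the fixed line over \<open>p\<close> and measured by \<open>xi\<close>: a
  real function of time.\<close>

definition trans_coef :: "'a => 'l => 'e => 'e => real => real" where
 "trans_coef p xi v w t = fcf (iso0 (GG t p) (gom (ph t) p v w)) xi"

text \<open>The time derivative is the transported contraction of Cartan's formula. It is stated
  through a smooth extension \<open>K\<close> on an open set, because \<open>J\<close> may end at
  \<open>t\<close> and because smoothness of \<open>K\<close> later shows that the expansion
  constants depend continuously on time.\<close>

lemma trans_coef_deriv: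
 assumes t: "t : J" "at t within J ~= bot" and gen: "generated_by J L.M ph X" and p: "p : pts L.M" and xi: "xi : fibre L.E p" "xi ~= 0"
 shows "EX S K. open S & t : S & smooth_on S K & (ALL ta:J Int S. trans_coef p xi v w ta = K ta) &
   (K has_vector_derivative fcf (iso0 (GG t p) (ext_d L.M L.D (%q ws. L.om q (X t q # ws)) (ph t p)
    [tmap L.M L.M (ph t) p v, tmap L.M L.M (ph t) p w])) xi) (at t)"
proof -
 let ?m = "ph t p" and ?x = "crd L.M p p" and ?z = "crd L.M (ph t p) (ph t p)"
 have m: "?m : pts L.M" by (rule ph_pts[OF t(1) p])
 obtain F d where F: "d > 0" "ball ?x d <= cimg L.M p" "smooth_on (ball t d \<times> ball ?x d) F"
  "!!ta x. ta : J ==> ta : ball t d ==> x : ball ?x d ==>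
    ph ta (cinv L.M p x) : cdom L.M ?m & F (ta, x) = crd L.M ?m (ph ta (cinv L.M p x))"
  by (rule isotopy_coords[OF L.Mm ph t(1) p]) (rule that)
 have vel: "dmf L.M (crd L.M ?m) (ph t (cinv L.M p x)) (X t (ph t (cinv L.M p x))) = fd F (t, x) (1, 0)" if "x : ball ?x d" for x
  by (rule isotopy_velocity(1)[OF L.Mm ph t p gen F]) (use that in simp_all)
 have vel2: "smooth_vf_at L.M ?m (X t)" by (rule isotopy_velocity(2)[OF L.Mm ph t p gen F])
 have x: "?x : ball ?x d" and td: "t : ball t d" using F(1) by auto
 have ip: "cinv L.M p ?x = p" by (rule crd_inv_crd_self[OF L.Mm p])
 have F0: "F (t, ?x) = ?z" using F(4)[OF t(1) td x] ip by simp
 obtain U e where e: "?m : U" "L.ff U e" by (rule L.ffx[OF m])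
 obtain U1 e1 where e1: "p : U1" "L.ff U1 e1" by (rule L.ffx[OF p])
 \<comment> \<open>While the lifted path stays near \<open>GG t p\<close>, the map
   \<open>iso0\<close> is one constant between flat frames. Time then enters only through the
   coefficients of the form and through \<open>F\<close>.\<close>
 obtain c where c: "near P (GG t p) (%q. iso0 q (e (x2 q)) = c *R e1 (x1 q))"
  using box_iso_const[OF iso0_box GG(3)[OF t(1) p] e1(2) _ e(2)] GG(2)[OF t(1) p] e(1) e1(1) by auto
 define k where "k = fcf (c *R e1 p) xi"
 have ck: "c *R e1 p = k *R xi"
  unfolding k_def by (rule fibre_coef[OF L.Mm L.Eo p xi fibre_scaleR[OF L.Mm L.Eo p sframeD(1)[OF ffD(1)[OF e1(2)] e1(1)]]])
 obtain W where W: "opn P W" "GG t p : W" "!!q. q : W ==> iso0 q (e (x2 q)) = c *R e1 (x1 q)" by (rule nearbyE[OF c]) (rule that)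
 obtain ep1 where ep1: "ep1 > 0" "ALL ta:J. \<bar>ta - t\<bar> < ep1 --> ps ta (diag p) : W"
  using pcontD(2)[OF isotopy_path[OF Pm ps_iso diag_pts[OF p]] t(1) W(1)] W(2) by auto
 obtain ep2 where ep2: "ep2 > 0" "ALL ta:J. \<bar>ta - t\<bar> < ep2 --> ph ta p : U"
  using pcontD(2)[OF isotopy_path[OF L.Mm ph p] t(1) sframeD(4)[OF ffD(1)[OF e(2)] e(1)] e(1)] by auto
 define S where "S = ball t (min d (min ep1 ep2))"
 let ?a = "f2c L.M L.om e ?m" and ?Y = "%v ta. fd F (ta, ?x) (0, v)"
 define K where "K ta = ?a (F (ta, ?x)) (?Y v ta) (?Y w ta) * k" for ta
 have dF: "(F has_derivative fd F (ta, x)) (at (ta, x))" if "ta : ball t d" "x : ball ?x d" for ta x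
  by (rule so_has_derivative[OF F(3)]) (use that in simp)
 have Y: "tmap L.M L.M (ph ta) p v = cvf L.M ?m (?Y v ta) (ph ta p)" if ta: "ta : J" "ta : ball t d" for ta v
 proof -
  have "((%x. crd L.M ?m (ph ta (cinv L.M p x))) has_derivative (%v. ?Y v ta)) (at ?x)"
   by (rule hd_within[OF has_derivative_slices(2)[OF dF[OF ta(2) x]] open_ball x]) (use F(4)[OF ta] in simp)
  from fd_eq[OF this] have "dmf L.M (%q. crd L.M ?m (ph ta q)) p v = ?Y v ta" by (simp add: tmap_real)
  with coord_vf_compose[OF L.Mm L.Mm smD[OF ph_map[OF ta(1)] p] m, of v] F(4)[OF ta x] ip show ?thesis by simp
 qed
 note bf = L_bf and e' = e(2,1)
 have K: "trans_coef p xi v w ta = K ta" if "ta : J Int S" for ta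
 proof -
  have ta: "ta : J" "ta : ball t d" "ps ta (diag p) : W" "ph ta p : U"
   using that ep1(2) ep2(2) by (auto simp: S_def dist_real_def abs_minus_commute)
  have dm: "ph ta p : cdom L.M ?m" "crd L.M ?m (ph ta p) = F (ta, ?x)" using F(4)[OF ta(1,2) x] ip by auto
  have fe: "e (ph ta p) : fibre L.E (x2 (GG ta p))" using GG(2)[OF ta(1) p] sframeD(1)[OF ffD(1)[OF e(2)] ta(4)] by simp
  have "iso0 (GG ta p) (e (ph ta p)) = k *R xi" using W(3)[OF ta(3)] GG(2)[OF ta(1) p] ck by simp
  hence "iso0 (GG ta p) (gom (ph ta) p v w) = K ta *R xi"
   unfolding Y[OF ta(1,2)] form2_coef_eq[OF L.FB bf e' dm(1) ta(4)] dm(2) K_def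
   using li_scaleR[OF iso0_li[OF GG(3)[OF ta(1) p]] fe] by simp
  thus ?thesis using xi(2) by (simp add: trans_coef_def)
 qed
 obtain T where T: "open T" "?z : T" "!!z. z : T ==> EX q. q : cdom L.M ?m & q : U & z = crd L.M ?m q"
  by (rule form2_dom[OF L.FB bf e']) (rule that)
 have tl1: "linear (%v. ?a z v w)" and tl2: "linear (?a z v)"
  and tex: "?a z v w = (SUM b:Basis. SUM b':Basis. (v \<bullet> b) * ((w \<bullet> b') * ?a z b b'))" if "z : T" for z v w
  using T(3)[OF that] form2_coef_linear[OF L.FB bf e'] form2_coef_expand[OF L.FB bf e'] by blast+
 have sF: "smooth_on (ball t d) (%ta. F (ta, ?x))" and sY: "smooth_on (ball t d) (?Y v)" for v
  using so_compose[OF open_ball so_Pair[OF open_ball so_id[OF open_ball] so_const]] F(3) so_fd[OF F(3)] x by blast+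
 note em = euclid_m
 have sFa: "smf eucl t (%ta. F (ta, ?x))" and sYa: "smf eucl t (%ta. ?Y v ta \<bullet> b)" for v b
  by (rule so_imp_smooth_at[OF open_ball sF td], rule sa_bounded_linear[OF em bounded_linear_inner_left so_imp_smooth_at[OF open_ball sY td]])
 have sa: "smf eucl ?z (%z. ?a z b b')" for b b'
 proof (rule sa_cong[OF em iffD1[OF sa_crd_inv_iff[OF L.Mm m mem_cdom[OF L.Mm m]] form2_coef_smooth[OF L.FB bf e']]])
  show "near eucl ?z (%z. ?a z b b' = ?a (crd L.M ?m (cinv L.M ?m z)) b b')"
   by (rule nearbyI[of _ "cimg L.M ?m"]) (simp_all add: open_cimg[OF L.Mm m] mem_cdom[OF L.Mm m] crd_crd_inv[OF L.Mm m])
 qed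
 have "smf eucl t (%ta. (SUM b:Basis. SUM b':Basis. (?Y v ta \<bullet> b) * ((?Y w ta \<bullet> b') * ?a (F (ta, ?x)) b b')) * k)"
  by (intro sa_sum[OF em] sa_mult[OF em] sYa sa_const[OF em em] sa_compose[OF em em em sFa]) (simp_all add: F0 sa)
 hence "smf eucl t K"
 proof (rule sa_cong[OF em])
  show "near eucl t (%ta. K ta = (SUM b:Basis. SUM b':Basis. (?Y v ta \<bullet> b) * ((?Y w ta \<bullet> b') * ?a (F (ta, ?x)) b b')) * k)"
   by (rule near_mono[OF sa_continuous[OF em em sFa, of T]]) (use T(1,2) F0 tex in "simp_all add: K_def")
 qed
 then obtain S' where S': "open S'" "t : S'" "smooth_on S' K" unfolding sa_euclid_iff by blast
 let ?XX = "crd_vf L.M ?m (X t)"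
 note vf = ext_d_contraction[OF L.FB L_form e' vel2]
 have Xt: "X t ?m = fd F (t, ?x) (1, 0)" using vel[OF x] ip tmap_crd_self[OF L.Mm m] by simp
 have v0: "tmap L.M L.M (ph t) p v = ?Y v t" for v using Y[OF t(1) td] coord_vf_self[OF L.Mm m] by simp
 \<comment> \<open>Symmetry of mixed derivatives: the time derivative of the image of
   \<open>v\<close> is the derivative of the generating field in the direction of that image. These
   are the extra terms of the Lie derivative.\<close>
 have dY: "fd (%y. fd F y (0, v)) (t, ?x) (1, 0) = fd ?XX ?z (?Y v t)" for v
 proof -
  have tx: "(t, ?x) : ball t d \<times> ball ?x d" using td x by simp
  have "((%x. ?XX (F (t, x))) has_derivative (%v. fd ?XX ?z (?Y v t))) (at ?x)"
   using diff_chain_at[OF has_derivative_slices(2)[OF dF[OF td x]], of ?XX "fd ?XX ?z"] fd_works[OF vf(1)] F0 by (simp add: o_def)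
  moreover have "?XX (F (t, x)) = fd F (t, x) (1, 0)" if "x : ball ?x d" for x
   using F(4)[OF t(1) td that] vel[OF that] crd_inv_crd[OF L.Mm m] by (simp add: crd_vf_def)
  ultimately have "((%x. fd F (t, x) (1, 0)) has_derivative (%v. fd ?XX ?z (?Y v t))) (at ?x)"
   by (rule hd_within[OF _ open_ball x])
  moreover have "((%x. fd F (t, x) (1, 0)) has_derivative (%v. fd (%y. fd F y (1, 0)) (t, ?x) (0, v))) (at ?x)"
   by (rule has_derivative_slices(2)[OF so_has_derivative[OF so_fd[OF F(3)] tx]])
  ultimately have "fd (%y. fd F y (1, 0)) (t, ?x) (0, v) = fd ?XX ?z (?Y v t)" by (metis has_derivative_unique)
  thus ?thesis using fd_fd_commute[OF open_Times[OF open_ball open_ball] F(3) tx] by simp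
 qed
 define R where "R = fd (%z. ?a z (?Y v t) (?Y w t)) ?z (X t ?m) + ?a ?z (fd ?XX ?z (?Y v t)) (?Y w t) + ?a ?z (?Y v t) (fd ?XX ?z (?Y w t))"
 have dK: "(K has_vector_derivative R * k) (at t)"
 proof -
  have tx: "(t, ?x) : ball t d \<times> ball ?x d" using td x by simp
  note d1 = has_derivative_slices(1)[OF dF[OF td x]] and d2 = has_derivative_slices(1)[OF so_has_derivative[OF so_fd[OF F(3)] tx]]
  have "((%ta. ?a (F (ta, ?x)) (?Y v ta) (?Y w ta)) has_derivative (%s. fd (%z. ?a z (?Y v t) (?Y w t)) (F (t, ?x)) (fd F (t, ?x) (s, 0)) +
    ?a (F (t, ?x)) (fd (%y. fd F y (0, v)) (t, ?x) (s, 0)) (?Y w t) + ?a (F (t, ?x)) (?Y v t) (fd (%y. fd F y (0, w)) (t, ?x) (s, 0)))) (at t within UNIV)"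
   by (rule has_derivative_bilinear_family[OF T(1) _ tl1 tl2 _ d1 d2 d2 UNIV_I]) (unfold F0, use T(2) form2_coef_differentiable[OF L.FB bf e'] in auto)
  from has_derivative_imp_vector[OF this] have "((%ta. ?a (F (ta, ?x)) (?Y v ta) (?Y w ta)) has_vector_derivative R) (at t)"
   unfolding F0 dY R_def Xt by simp
  thus ?thesis unfolding K_def[abs_def] by (rule has_vector_derivative_mult_left)
 qed
 have ed: "ext_d L.M L.D (%q ws. L.om q (X t q # ws)) ?m [?Y v t, ?Y w t] = R *R e ?m"
  unfolding vf(2) R_def Let_def ..
 have fe: "e ?m : fibre L.E (x2 (GG t p))" using GG(2)[OF t(1) p] sframeD(1)[OF ffD(1)[OF e(2)] e(1)] by simp
 have "iso0 (GG t p) (e ?m) = k *R xi" using W(3)[OF W(2)] GG(2)[OF t(1) p] ck by simp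
 hence "fcf (iso0 (GG t p) (ext_d L.M L.D (%q ws. L.om q (X t q # ws)) ?m [tmap L.M L.M (ph t) p v, tmap L.M L.M (ph t) p w])) xi = R * k"
  unfolding v0 ed li_scaleR[OF iso0_li[OF GG(3)[OF t(1) p]] fe] using xi(2) by simp
 thus ?thesis
  using dK K S' ep1(1) ep2(1) F(1) so_subset[OF S'(3)] by (intro exI[of _ "S Int S'"] exI[of _ K]) (auto simp: S_def)
qed

end

end

lemma interval_at_within:
 fixes J :: "real set"
 assumes "is_interval J" "a : J" "b : J" "a ~= b" "s : J"
 shows "at s within J ~= bot"
proof -
 have "J ~= {x}" for x using assms(2-4) by auto
 hence "s islimpt J" by (rule connected_imp_perfect[OF is_interval_connected[OF assms(1)] assms(5)])
 thus ?thesis by (simp add: trivial_limit_within)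
qed

text \<open>Nothing is assumed about regularity of \<open>mu\<close>. Near each time it equals
  \<open>K' / K\<close> for a smooth extension \<open>K\<close> of \<open>k\<close>, hence is
  continuous, and the fundamental theorem applies to \<open>ln k\<close>.\<close>

lemma log_derivative_integral:
 fixes k mu :: "real => real"
 assumes J: "is_interval J" "0 : J" "t : J" and nt: "!!s. s : J ==> at s within J ~= bot" and pos: "!!s. s : J ==> k s > 0"
  and loc: "!!s. s : J ==> EX S K. open S & s : S & smooth_on S K & (ALL ta:J Int S. k ta = K ta) & (K has_vector_derivative mu s * k s) (at s)"
 shows "(LBINT ta=0..t. mu ta) = ln (k t) - ln (k 0)"
proof -
 have dk: "(k has_vector_derivative D) (at s within J)"
  if s: "s : J" "open S" "s : S" "ALL ta:J Int S. k ta = K ta" "(K has_vector_derivative D) (at s)" for s S K D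
 proof -
  obtain d where d: "d > 0" "ball s d <= S" using s(2,3) open_contains_ball by blast
  show ?thesis
  proof (rule has_vector_derivative_transform_within[OF has_vector_derivative_at_within[OF s(5)] d(1) s(1)])
   fix x assume x: "x : J" "dist x s < d"
   hence "x : S" using d(2) by (auto simp: dist_commute)
   with s(4) x(1) show "K x = k x" by simp
  qed
 qed
 have dk': "(k has_vector_derivative mu s * k s) (at s within J)" if s: "s : J" for s
  using loc[OF s] dk[OF s] by blast
 have "continuous_on J mu"
  unfolding continuous_on_eq_continuous_within
 proof
  fix s assume s: "s : J"
  obtain S K where K: "open S" "s : S" "smooth_on S K" "ALL ta:J Int S. k ta = K ta" using loc[OF s] by blast
  have eq: "fd K ta 1 / K ta = mu ta" if ta: "ta : J" "ta : S" for ta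
  proof -
   have "(K has_vector_derivative fd K ta 1) (at ta)" by (rule has_derivative_imp_vector[OF so_has_derivative[OF K(3) ta(2)]])
   from vector_derivative_unique_within[OF nt[OF ta(1)] dk[OF ta(1) K(1) ta(2) K(4) this] dk'[OF ta(1)]]
   show ?thesis using pos[OF ta(1)] K(4) ta by (auto simp: field_simps)
  qed
  have cK: "continuous (at s) K" "continuous (at s) (%ta. fd K ta 1)"
   using so_continuous[OF K(3)] so_continuous[OF so_fd[OF K(3)]] K(1,2) continuous_on_eq_continuous_at by blast+
  have "K s ~= 0" using pos[OF s] K(2,4) s by auto
  hence cont: "continuous (at s within J) (%ta. fd K ta 1 / K ta)"
   by (rule continuous_at_imp_continuous_within[OF isCont_divide[OF cK(2,1)]])
  obtain d where d: "d > 0" "ball s d <= S" using K(1,2) open_contains_ball by blast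
  show "continuous (at s within J) mu"
  proof (rule continuous_transform_within[OF cont d(1) s])
   show "fd K x 1 / K x = mu x" if "x : J" "dist x s < d" for x
    using eq[OF that(1)] d(2) that(2) by (auto simp: dist_commute)
  qed
 qed
 moreover have sub: "{min 0 t..max 0 t} <= J"
 proof
  fix s assume "s : {min 0 t..max 0 t}"
  moreover have "min 0 t : J" "max 0 t : J" using J(2,3) by (simp_all add: min_def max_def)
  ultimately show "s : J" using mem_is_interval_1_I[OF J(1)] by (meson atLeastAtMost_iff)
 qed
 ultimately have c: "continuous_on {min 0 t..max 0 t} mu" using continuous_on_subset by blast
 have "((%ta. ln (k ta)) has_vector_derivative mu s) (at s within {min 0 t..max 0 t})" if "min 0 t <= s" "s <= max 0 t" for s
 proof -
  have s: "s : J" using sub that by auto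
  have "(k has_field_derivative mu s * k s) (at s within {min 0 t..max 0 t})"
   using has_vector_derivative_within_subset[OF dk'[OF s] sub] by (simp add: has_real_derivative_iff_has_vector_derivative)
  hence "((%ta. ln (k ta)) has_field_derivative mu s) (at s within {min 0 t..max 0 t})"
   by (rule DERIV_cong[OF DERIV_chain2[where g = k and x = s, OF DERIV_ln[OF pos[OF s]]]]) (use pos[OF s] in simp)
  thus ?thesis by (simp add: has_real_derivative_iff_has_vector_derivative)
 qed
 from interval_integral_FTC_finite[OF c this] show ?thesis by (simp add: zero_ereal_def)
qed

lemma prod_isotopy:
 assumes M: "mfd M" and ph: "smooth_isotopy J M ph"
 shows "smooth_isotopy J (prod_mfd M M) (%t. map_prod id (ph t))"
proof -
 let ?MM = "prod_mfd M M" and ?R = "eucl :: (real, real) manifold"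
 note MM = prod_m[OF M M] and em = euclid_m
 note RMM = prod_m[OF em MM] and RM = prod_m[OF em M]
 have sm: "smooth_map ?MM ?MM (%z. (fst z, f (snd z)))" if f: "smooth_map M M f" for f
  unfolding smooth_map_def
 proof
  fix z assume "z : pts ?MM"
  hence z: "z : pts M \<times> pts M" "snd z : pts M" by auto
  show "smooth_at ?MM ?MM z (%z. (fst z, f (snd z)))"
   by (rule sa_Pair[OF M M MM sa_fst_snd(1)[OF M M z(1)] sa_compose[OF MM M M sa_fst_snd(2)[OF M M z(1)] smD[OF f z(2)]]])
 qed
 have "diffeo ?MM ?MM (map_prod id (ph t))" if t: "t : J" for t
 proof -
  note d = diffeoD[OF isotopyD(1)[OF ph t]]
  let ?g = "map_prod id (ph t)" and ?i = "inv_into (pts M) (ph t)"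
  have bij: "bij_betw ?g (pts ?MM) (pts ?MM)"
   using bij_betw_map_prod[OF bij_betw_id d(2)] by simp
  have "inv_into (pts ?MM) ?g z = (fst z, ?i (snd z))" if z: "z : pts ?MM" for z
  proof (rule inv_into_f_eq)
   show "inj_on ?g (pts ?MM)" using bij by (simp add: bij_betw_def)
   show "(fst z, ?i (snd z)) : pts ?MM" using z bij_betwE[OF bij_betw_inv_into[OF d(2)]] by auto
   show "?g (fst z, ?i (snd z)) = z" using z bij_betw_inv_into_right[OF d(2)] by auto
  qed
  hence "smooth_map ?MM ?MM (inv_into (pts ?MM) ?g)"
   unfolding smooth_map_def
   using sa_cong[OF MM smD[OF sm[OF d(3)]] near_mono[OF near_in_pts]] by blast
  thus ?thesis using sm[OF d(1)] bij by (simp add: diffeo_def map_prod_def case_prod_beta')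
 qed
 moreover have "smooth_map_on (prod_mfd ?R ?MM) (J \<times> pts ?MM) ?MM (%(t, p). map_prod id (ph t) p)"
  unfolding smooth_map_on_def
 proof
  fix z assume z: "z : J \<times> pts ?MM"
  hence z': "z : pts ?R \<times> pts ?MM" "snd z : pts M \<times> pts M" "fst z : J" "snd (snd z) : pts M" by auto
  obtain f where f: "smooth_at (prod_mfd ?R M) M (fst z, snd (snd z)) f"
   "near (prod_mfd ?R M) (fst z, snd (snd z)) (%z. fst z : J & snd z : pts M --> f z = ph (fst z) (snd z))" by (rule isotopy_extension[OF ph z'(3,4)])
  note s = sa_fst_snd[OF em MM z'(1)]
  note s2 = sa_compose[OF RMM MM M s(2) sa_fst_snd(1)[OF M M z'(2)]] sa_compose[OF RMM MM M s(2) sa_fst_snd(2)[OF M M z'(2)]]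
  have h: "smooth_at (prod_mfd ?R ?MM) (prod_mfd ?R M) z (%z. (fst z, snd (snd z)))" by (rule sa_Pair[OF em M RMM s(1) s2(2)])
  show "EX F. smooth_at (prod_mfd ?R ?MM) ?MM z F & near (prod_mfd ?R ?MM) z (%q. q : J \<times> pts ?MM --> F q = (case q of (t, p) => map_prod id (ph t) p))"
  proof (intro exI conjI)
   show "smooth_at (prod_mfd ?R ?MM) ?MM z (%z. (fst (snd z), f (fst z, snd (snd z))))"
    by (rule sa_Pair[OF M M RMM s2(1) sa_compose[OF RMM RM M h f(1)]])
   show "near (prod_mfd ?R ?MM) z (%q. q : J \<times> pts ?MM --> (fst (snd q), f (fst q, snd (snd q))) = (case q of (t, p) => map_prod id (ph t) p))"
    by (rule near_mono[OF near_preimage[OF RMM RM h f(2)]]) auto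
  qed
 qed
 ultimately show ?thesis using isotopyD(2)[OF ph] by (auto simp: smooth_isotopy_def)
qed

section \<open>Lifted isotopies: the expansion formula and the Hamiltonian case\<close>

context selfbox
begin

lemma lift_exists:
 assumes "is_interval J" "0 : J" "smooth_isotopy J L.M ph"
 shows "EX ps. lifted_isotopy J A ph ps"
 using isotopy_lift[OF Pm MMm r_covering assms(1,2) prod_isotopy[OF L.Mm assms(3)]] by (simp add: lifted_isotopy_def)

lemma r_diag_all: "ALL p:pts L.M. r (diag p) = (p, p)"
 using r_diag by blast

text \<open>By \<open>iso0_diag\<close> the isomorphism is the identity over the diagonal, so the
  constant 1 makes the two summands cancel. This fixes the reference structure of the
  torsor.\<close>

lemma diag_isotropic: "iso_emb (Om0 1) diag" and Xi_of_diag: "Xi_of A A diag = Om0 1"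
proof -
 have i: "smooth_map L.M L.M (%p. p)" using sa_id[OF L.Mm] by (simp add: smooth_map_def)
 show "iso_emb (Om0 1) diag"
  unfolding graph_isotropic_iff[OF i diag_smooth r_diag_all] by (simp add: tmap_id[OF L.Mm] iso0_diag L_fib)
 thus "Xi_of A A diag = Om0 1" by (rule graph_Xi_of[OF i diag_smooth r_diag_all zero_less_one])
qed

lemma hamiltonian_section:
 assumes H: "smooth_sec_family J L.M L.E H" and t: "t : J" and p: "p : pts L.M"
 shows "ssec L.M L.E p (H t)"
proof -
 let ?RM = "prod_mfd eucl L.M :: (real \<times> 'a, real \<times> 'e) manifold"
 note em = euclid_m and RM = prod_m[OF euclid_m L.Mm]
 obtain U e where e: "(U, e) : frames L.E" "p : U" using frame_exists[OF L.Mm L.Eo p] by blast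
 obtain g where g: "smooth_map_on ?RM (J \<times> U) eucl g" "ALL t:J. ALL q:U. H t q = g (t, q) *R e q"
  using H e(1) unfolding smooth_sec_family_def by blast
 obtain F where F: "smf ?RM (t, p) F" "near ?RM (t, p) (%z. z : J \<times> U --> F z = g z)"
  using g(1) t e(2) unfolding smooth_map_on_def by blast
 have i: "smooth_at L.M ?RM p (%q. (t, q))"
  by (rule sa_Pair[OF em L.Mm L.Mm sa_const[OF L.Mm em p] sa_id[OF L.Mm p]]) simp
 show ?thesis
 proof (rule smooth_secI[OF e sa_compose[OF L.Mm RM em i F(1)]])
  show "near L.M p (%q. q : U & H t q = F (t, q) *R e q)"
   by (rule near_mono2[OF near_preimage[OF L.Mm RM i F(2)] near_open[OF frameD(1)[OF L.Mm L.Eo e(1)] e(2)]]) (use g(2) t in simp)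
 qed
qed

text \<open>The contraction is \<open>- \<nabla>H\<close>, and its differential is minus the
  curvature applied to \<open>H\<close>, which vanishes because the connection is flat.\<close>

lemma hamiltonian_contraction_closed:
 assumes H: "smooth_sec_family J L.M L.E H" and X: "hamiltonian_vf L.M (cstr A) (H t) Y" and t: "t : J" and m: "m : pts L.M"
 shows "ext_d L.M L.D (%q ws. L.om q (Y q # ws)) m [v, w] = 0"
proof -
 have bc: "bundle_connection L.M L.E L.D" and fl: "ext_d L.M L.D (%q vs. L.D (H t) q (hd vs)) m [v, w] = 0"
  using L.FB hamiltonian_section[OF H t m] m unfolding flat_bundle_def flat_connection_def by blast+
 have "L.D (%q. L.om q [Y q, cvf L.M m w q]) m v = - L.D (%q. L.D (H t) q (cvf L.M m w q)) m v" for v w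
 proof -
  let ?s = "%q. L.D (H t) q (cvf L.M m w q)"
  have s: "ssec L.M L.E m ?s" by (rule connectionD(5)[OF bc m hamiltonian_section[OF H t m] smooth_vf_at_coord[OF L.Mm m]])
  have c: "smf L.M m (%q. - 1 :: real)" by (rule sa_const[OF L.Mm euclid_m m]) simp
  have n: "near L.M m (%q. L.om q [Y q, cvf L.M m w q] = (- 1) *R ?s q)"
   by (rule near_mono[OF near_in_pts[OF m]]) (use X in "simp add: hamiltonian_vf_def")
  show ?thesis
   unfolding connectionD(4)[OF bc m ss_scaleR[OF L.Mm L.Eo s c] n] using connectionD(3)[OF bc m s c, of v] by simp
 qed
 thus ?thesis using fl by (simp add: ext_d_1)
qed

context
 fixes J ph ps
 assumes J: "is_interval J" "0 : J" and ph: "smooth_isotopy J L.M ph" and ps: "lifted_isotopy J A ph ps"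
begin

private lemmas ctx = J ph ps
private abbreviation "G == %t. ps t o diag"
private lemma G_all: "t : J ==> ALL p:pts L.M. r (G t p) = (p, ph t p)"
 using GG(2)[OF ctx] by blast

private lemmas G = GG[OF ctx] and phm = ph_map[OF ctx] and rps = r_ps[OF ctx]

text \<open>Two constants occur: \<open>c\<close> makes the graph isotropic, and \<open>k\<close>
  compares \<open>iso0\<close> with its twist by \<open>ps t\<close>. Evaluating both at a diagonal
  point, where \<open>iso0\<close> is the identity, gives \<open>c * k = 1\<close>; with this the
  second summands match on all of the product.\<close>

lemma automorphism_lift:
 assumes t: "t : J" and a: "lcs_automorphism L.M (cstr A) (ph t)"
 obtains c where "c > 0" "Xi_of A A (G t) = Om0 c" "lsym (Om0 1) (Om0 c) (ps t)"
  "iso_emb (Om0 c) (G t)"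
proof -
 obtain Ps where Ps: "flat_morphism L.M L.E L.D L.M L.E L.D (ph t) Ps"
  and form: "ALL p:pts L.M. ALL v w. bundle_pull_form L.M L.E L.M (ph t) Ps L.om p [v, w] = L.om p [v, w]"
  using a unfolding lcs_symplecto_def lcs_map_def length_2_conv by blast
 obtain c where c: "c > 0" "iso_emb (Om0 c) (G t)"
  "!!p xi. p : pts L.M ==> xi : fibre L.E p ==> c *R iso0 (G t p) (Ps p xi) = xi"
  "!!p v w. p : pts L.M ==> Ps p (L.om p [v, w]) = gom (ph t) p v w"
  by (rule graph_lcs_map[OF phm[OF t] G(1)[OF t] G_all[OF t] Ps form]) (rule that)
 have "box_iso A A (%z xi. iso0 (ps t z) (Ps (x2 z) xi))" by (rule box_iso_twist[OF ps_map[OF ctx t] rps[OF t] Ps])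
 from box_iso_ratio[OF iso0_box this] obtain k
  where k: "ALL z:pts P. ALL xi:fibre L.E (x2 z). iso0 (ps t z) (Ps (x2 z) xi) = k *R iso0 z xi" by blast
 obtain p where p: "p : pts L.M" using L.ne by blast
 obtain x where x: "x ~= 0" "fibre L.E p = span {x}" using fibre_line[OF L.Mm L.Eo p] by blast
 have xf: "x : fibre L.E p" using x(2) by (simp add: span_base)
 have "iso0 (G t p) (Ps p x) = k *R x" using k diag_pts[OF ctx p] r_diag[OF p] iso0_diag[OF p xf] xf by force
 hence "(c * k) *R x = 1 *R x" using c(3)[OF p xf] by simp
 hence ck: "c * k = 1" using x(1) by (simp only: scaleR_cancel_right) simp
 show ?thesis
 proof (rule that[OF c(1) _ _ c(2)])
  show "Xi_of A A (G t) = Om0 c" by (rule graph_Xi_of[OF phm[OF t] G(1)[OF t] G_all[OF t] c(1,2)])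
  show "lsym (Om0 1) (Om0 c) (ps t)"
  proof (rule box_symplecto[OF isotopyD(1)[OF ps_iso[OF ctx] t] rps[OF t] phm[OF t] box_iso_scaleR[OF iso0_box zero_less_one]])
   fix z v w assume z: "z : pts P"
   note y = r2_pts[OF z]
   show "c *R iso0 (ps t z) (L.om (ph t (x2 z)) [tmap L.M L.M (ph t) (x2 z) v, tmap L.M L.M (ph t) (x2 z) w]) =
     1 *R iso0 z (L.om (x2 z) [v, w])"
    using k z L_fib[OF y] ck unfolding c(4)[OF y, symmetric] by simp
  qed
 qed
qed

lemma automorphism_symp:
 assumes "t : J" "lcs_automorphism L.M (cstr A) (ph t)"
 shows "lsym (Xi_of A A diag) (Xi_of A A (G t)) (ps t)"
 by (rule automorphism_lift[OF assms]) (simp add: Xi_of_diag)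

lemma trans_coef_0:
 assumes p: "p : pts L.M"
 shows "trans_coef ph ps p xi v w 0 = fcf (L.om p [v, w]) xi"
proof -
 have "tmap L.M L.M (ph 0) p = (%v. v)"
  using tmap_cong[OF L.Mm L.Mm sa_id[OF L.Mm p] near_mono[OF near_in_pts[OF p]], of "ph 0"] isotopyD(2)[OF ph] tmap_id[OF L.Mm p] by simp
 thus ?thesis
  using isotopyD(2)[OF ph p] isotopyD(2)[OF ps_iso[OF ctx] diag_pts[OF ctx p]] iso0_diag[OF p L_fib[OF p]]
  by (simp add: trans_coef_def[OF ctx])
qed

lemma Xi_of_expansion:
 assumes a: "ALL t:J. lcs_automorphism L.M (cstr A) (ph t)" and gen: "generated_by J L.M ph X"
  and X: "ALL t:J. lcs_vf L.M (cstr A) (X t) (mu t)" and t: "t : J"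
 shows "Xi_of A A (G t) = Xi_act A A (exp (- (LBINT ta=0..t. mu ta))) (Xi_of A A diag)"
proof -
 obtain p where p: "p : pts L.M" using L.ne by blast
 obtain v w where vw: "L.om p [v, w] ~= 0" using L_nonzero[OF p] by blast
 let ?xi = "L.om p [v, w]"
 have xi: "?xi : fibre L.E p" by (rule L_fib[OF p])
 let ?k = "trans_coef ph ps p ?xi v w"
 let ?b = "%ta. iso0 (G ta p) (gom (ph ta) p v w)"
 have k: "EX c>0. Xi_of A A (G ta) = Om0 c & ?k ta = 1 / c" if ta: "ta : J" for ta
 proof -
  obtain c where c: "c > 0" "Xi_of A A (G ta) = Om0 c" "iso_emb (Om0 c) (G ta)"
   using automorphism_lift[OF ta] a ta by metis
  have "?xi = c *R ?b ta" using c(3) p unfolding graph_isotropic_iff[OF phm[OF ta] G(1)[OF ta] G_all[OF ta]] by blast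
  hence "?b ta = (1 / c) *R ?xi" using c(1) by simp
  hence "?k ta = 1 / c" unfolding trans_coef_def[OF ctx] using vw by simp
  with c show ?thesis by blast
 qed
 have k0: "?k 0 = 1" using trans_coef_0[OF p] frame_coef_scaleR[OF vw, of 1] by simp
 have "(LBINT ta=0..t. mu ta) = ln (?k t)"
 \<comment> \<open>\<open>J\<close> may be the single point 0, where derivatives within
   \<open>J\<close> carry no information. Any other \<open>t\<close> makes every point of
   \<open>J\<close> a limit point of it.\<close>
 proof (cases "t = 0")
  case True
  thus ?thesis using k0 by (simp add: zero_ereal_def)
 next
  case False
  have nt: "at s within J ~= bot" if "s : J" for s by (rule interval_at_within[OF J t not_sym[OF False] that])
  have "(LBINT ta=0..t. mu ta) = ln (?k t) - ln (?k 0)"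
  proof (rule log_derivative_integral[OF J t nt])
   show "?k s > 0" if "s : J" for s using k[OF that] by auto
   fix s assume s: "s : J"
   let ?u = "[tmap L.M L.M (ph s) p v, tmap L.M L.M (ph s) p w]"
   note m = ph_pts[OF ctx s p]
   have "ext_d L.M L.D (%q ws. L.om q (X s q # ws)) (ph s p) ?u = mu s *R L.om (ph s p) ?u"
    using X s m unfolding lcs_vf_def length_2_conv by blast
   moreover have "L.om (ph s p) ?u : fibre L.E (x2 (G s p))" using L_fib[OF m] G(2)[OF s p] by simp
   moreover have "?b s = ?k s *R ?xi"
    unfolding trans_coef_def[OF ctx]
    by (rule fibre_coef[OF L.Mm L.Eo p xi vw]) (use li_mem[OF iso0_li[OF G(3)[OF s p]] calculation(2)] G(2)[OF s p] in simp)
   ultimately have "fcf (iso0 (G s p) (ext_d L.M L.D (%q ws. L.om q (X s q # ws)) (ph s p) ?u)) ?xi = mu s * ?k s"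
    using li_scaleR[OF iso0_li[OF G(3)[OF s p]]] vw by simp
   with trans_coef_deriv[OF ctx s nt[OF s] gen p xi vw, of v w]
   show "EX S K. open S & s : S & smooth_on S K & (ALL ta:J Int S. ?k ta = K ta) & (K has_vector_derivative mu s * ?k s) (at s)" by simp
  qed
  thus ?thesis by (simp add: k0)
 qed
 moreover obtain c where c: "c > 0" "Xi_of A A (G t) = Om0 c" "?k t = 1 / c" using k[OF t] by blast
 ultimately have "exp (- (LBINT ta=0..t. mu ta)) = c" by (simp add: ln_div)
 thus ?thesis using c(2) by (simp add: Xi_of_diag Xi_act_Om0[of 1, simplified])
qed

context
 fixes H X
 assumes H: "smooth_sec_family J L.M L.E H" and X: "ALL t:J. hamiltonian_vf L.M (cstr A) (H t) (X t)" and gen: "generated_by J L.M ph X"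
begin

private lemmas em = euclid_m

text \<open>The maps \<open>ph t\<close> are not known to be automorphisms here, so there is no
  common factor to follow. Instead the coefficient is shown to be constant in time for each point
  and each pair of vectors separately.\<close>

lemma hamiltonian_trans_coef:
 assumes t: "t : J" and p: "p : pts L.M" and xi: "xi : fibre L.E p" "xi ~= 0"
 shows "trans_coef ph ps p xi v w t = fcf (L.om p [v, w]) xi"
proof (cases "t = 0")
 case True
 thus ?thesis using trans_coef_0[OF p] by simp
next
 case False
 let ?k = "trans_coef ph ps p xi v w"
 have d0: "(?k has_vector_derivative 0) (at s within J)" if s: "s : J" for s
 proof -
  have m: "ph s p : pts L.M" by (rule ph_pts[OF ctx s p])
  have li: "liso (fibre L.E (x2 (G s p))) (fibre L.E (x1 (G s p))) (iso0 (G s p))" by (rule iso0_li[OF G(3)[OF s p]])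
  have "iso0 (G s p) 0 = 0" using li_scaleR[OF li fibre_zero[OF L.Mm L.Eo r2_pts[OF G(3)[OF s p]]], of 0] by simp
  hence z: "fcf (iso0 (G s p) (ext_d L.M L.D (%q ws. L.om q (X s q # ws)) (ph s p) [tmap L.M L.M (ph s) p v, tmap L.M L.M (ph s) p w])) xi = 0"
   using hamiltonian_contraction_closed[OF H bspec[OF X s] s m] frame_coef_scaleR[OF xi(2), of 0] by simp
  obtain S K where K: "open S" "s : S" "ALL ta:J Int S. ?k ta = K ta" "(K has_vector_derivative 0) (at s)"
   using trans_coef_deriv[OF ctx s interval_at_within[OF J t not_sym[OF False] s] gen p xi, of v w] unfolding z by blast
  obtain d where d: "d > 0" "ball s d <= S" using K(1,2) open_contains_ball by blast
  show ?thesis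
  proof (rule has_vector_derivative_transform_within[OF has_vector_derivative_at_within[OF K(4)] d(1) s])
   show "K x = ?k x" if "x : J" "dist x s < d" for x using K(3) that d(2) by (auto simp: dist_commute)
  qed
 qed
 obtain c where "!!s. s : J ==> ?k s = c"
  by (rule has_vector_derivative_zero_constant[OF is_interval_convex[OF J(1)] d0]) (assumption, rule that)
 hence "?k t = ?k 0" using t J(2) by simp
 thus ?thesis by (simp add: trans_coef_0[OF p])
qed

lemma hamiltonian_Xi_of:
 assumes t: "t : J"
 shows "Xi_of A A (G t) = Xi_of A A diag"
proof -
 have G_all: "ALL p:pts L.M. r (G t p) = (p, ph t p)" using G(2)[OF t] by blast
 have "iso_emb (Om0 1) (G t)"
  unfolding graph_isotropic_iff[OF phm[OF t] G(1)[OF t] G_all]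
 proof (intro ballI allI)
  fix p v w assume p: "p : pts L.M"
  obtain xi where x: "xi ~= 0" "fibre L.E p = span {xi}" using fibre_line[OF L.Mm L.Eo p] by blast
  have xi: "xi : fibre L.E p" using x(2) by (simp add: span_base)
  let ?b = "iso0 (G t p) (gom (ph t) p v w)"
  have "?b : fibre L.E p"
   using li_mem[OF iso0_li[OF G(3)[OF t p]]] G(2)[OF t p] L_fib[OF ph_pts[OF ctx t p]] by simp
  from fibre_coef[OF L.Mm L.Eo p xi x(1) this] fibre_coef[OF L.Mm L.Eo p xi x(1) L_fib[OF p, of v w]]
  show "L.om p [v, w] = 1 *R ?b"
   using hamiltonian_trans_coef[OF t p xi x(1), of v w] unfolding trans_coef_def[OF ctx] by simp
 qed
 from graph_Xi_of[OF phm[OF t] G(1)[OF t] G_all zero_less_one this] show ?thesis unfolding Xi_of_diag .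
qed

text \<open>The lift moves the second factor alone, so its generator has components 0 and
  \<open>X t\<close>. Contraction with it sees the second summand only.\<close>

lemma hamiltonian_lift: "hamiltonian_isotopy J P (Xi_of A A diag) ps"
proof -
 \<comment> \<open>The sign is that of the second summand in the form of the product.\<close>
 define H' where "H' t z = - iso0 z (H t (x2 z))" for t z
 define X' where "X' t z = (SOME u. T1 z u = 0 & T2 z u = X t (x2 z))" for t z
 have X': "T1 z (X' t z) = 0" "T2 z (X' t z) = X t (x2 z)" if "z : pts P" for t z
  using someI_ex[OF T_bij(1)[OF that, of 0 "X t (x2 z)"]] by (auto simp: X'_def)
 note li = iso0_li
 have iso0_scale: "iso0 z (c *R x) = c *R iso0 z x" if "z : pts P" "x : fibre L.E (x2 z)" for z x c
  by (rule li_scaleR[OF li[OF that(1)] that(2)])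
 have "hamiltonian_vf P (Om0 1) (H' t) (X' t)" if t: "t : J" for t
  unfolding hamiltonian_vf_def
 proof (intro ballI allI)
  fix z v assume z: "z : pts P"
  note y = r2_pts[OF z]
  obtain V e where e: "x2 z : V" "L.ff V e" by (rule L.ffx[OF y])
  obtain U e1 where e1: "x1 z : U" "L.ff U e1" by (rule L.ffx[OF r1_pts[OF z]])
  obtain c where c: "near P z (%q. iso0 q (e (x2 q)) = c *R e1 (x1 q))" using box_iso_const[OF iso0_box z e1(2,1) e(2,1)] by blast
  obtain h where h: "smf L.M (x2 z) h" "near L.M (x2 z) (%q. H t q = h q *R e q)"
   by (rule sframe_rep[OF L.Mm L.Eo ffD(1)[OF e(2)] e(1) hamiltonian_section[OF H t y]])
  have h2: "smf L.M (r2 z) h" using h(1) by simp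
  have hs: "smf P z (%q. h (r2 q))" by (rule sa_compose[OF Pm L.Mm em smD[OF r2s z] h2])
  have n1: "near P z (%q. H t (x2 q) = h (x2 q) *R e (x2 q) & x2 q : V)"
   using near_pull[OF Pm L.FB r2s z, of "%q. H t q = h q *R e q & q : V"] near_conj[OF h(2) near_sframe[OF L.Mm L.Eo ffD(1)[OF e(2)] e(1)]] by simp
  have n: "near P z (%q. H' t q = ((- c) * h (r2 q)) *R e1 (r1 q))"
  proof (rule near_mono3[OF n1 c near_in_pts[OF z]])
   fix q assume q: "H t (x2 q) = h (x2 q) *R e (x2 q) & x2 q : V" "iso0 q (e (x2 q)) = c *R e1 (x1 q)" "q : pts P"
   thus "H' t q = ((- c) * h (r2 q)) *R e1 (r1 q)"
    using iso0_scale[OF q(3) sframeD(1)[OF ffD(1)[OF e(2)] conjunct2[OF q(1)]]] by (simp add: H'_def)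
  qed
  have sm: "smf P z (%q. (- c) * h (r2 q))" by (rule sa_mult[OF Pm sa_const[OF Pm em z] hs]) simp
  have "K1 (H' t) z v = dmf P (%q. (- c) * h (r2 q)) z v *R e1 (r1 z)"
   by (rule fun_cong[OF pull_conn_eq[OF Pm L.FB r1s e1(2) z _ sm n]]) (use e1(1) in simp)
  also have "dmf P (%q. (- c) * h (r2 q)) z v = (- c) * dmf P (%q. h (r2 q)) z v" by (rule tmap_cmult[OF Pm hs])
  also have "dmf P (%q. h (r2 q)) z v = dmf L.M h (r2 z) (T2 z v)"
   by (rule fun_cong[OF tmap_compose[OF Pm L.Mm em smD[OF r2s z] h2]])
  finally have K: "K1 (H' t) z v = ((- c) * dmf L.M h (r2 z) (T2 z v)) *R e1 (r1 z)" .
  note fe = sframeD(1)[OF ffD(1)[OF e(2)] e(1)]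
  have dH: "L.D (H t) (x2 z) u = dmf L.M h (x2 z) u *R e (x2 z)" for u
   by (rule fun_cong[OF flatf_conn[OF L.FB e(2,1) h]])
  have omX: "L.om (x2 z) [X t (x2 z), T2 z v] = - dmf L.M h (x2 z) (T2 z v) *R e (x2 z)"
   using X t y dH by (simp add: hamiltonian_vf_def)
  show "lfrm (Om0 1) z [X' t z, v] = - lcon (Om0 1) (H' t) z v"
   unfolding box_form[OF z] X'[OF z] box_struct_simps K omX iso0_scale[OF z fe] near_self[OF c]
   using linear_0[OF form2_linear1[OF L.FB L_bf r1_pts[OF z]]] by simp
 qed
 moreover have "generated_by J P ps X'"
  unfolding generated_by_def
 proof (intro ballI)
  fix t z assume t: "t : J" and z: "z : pts P"
  let ?w = "ps t z" and ?y = "x2 z"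
  have w: "?w : pts P" by (rule sa_pts_image[OF Pm smD[OF ps_map[OF ctx t] z]])
  obtain V s where s: "(V, s) : csec P MM r" "r ?w : V" "s (r ?w) = ?w" using csec_through[OF Pm MMm r_covering w] .
  note st = box_section_tmap[OF w s]
  have rw: "r (ps ta z) = (x1 ?w, ph ta ?y)" if "ta : J" for ta using rps[OF that z] rps[OF t z] by simp
  let ?h = "%y. s (x1 ?w, y)"
  have e: "x2 ?w = ph t ?y" using rw[OF t] by (metis snd_conv)
  have hs: "smooth_at L.M P (ph t ?y) ?h" using st(5) unfolding e .
  have hw: "?h (ph t ?y) = ?w" by (subst rw[OF t, symmetric]) (rule s(3))
  \<comment> \<open>Near \<open>?w\<close> the lifted curve is the curve in the second factor
    followed by the local section \<open>?h\<close>; the differential of \<open>?h\<close> has first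
    component zero, so it sends \<open>X t\<close> to the lifted field.\<close>
  have vX: "tmap L.M P ?h (ph t ?y) (X t (ph t ?y)) = X' t ?w"
   by (rule T_bij(2)[OF w]) (simp_all add: st(3,4)[unfolded e] X'[OF w, unfolded e])
  have "((%ta. crd L.M (ph t ?y) (ph ta ?y)) has_vector_derivative X t (ph t ?y)) (at t within J)"
   using gen t r2_pts[OF z] by (simp add: generated_by_def)
  from curve_derivative[OF L.Mm Pm isotopy_path[OF L.Mm ph r2_pts[OF z]] t hs this]
  have 1: "((%ta. crd P ?w (?h (ph ta ?y))) has_vector_derivative X' t ?w) (at t within J)" unfolding hw vX .
  obtain W where W: "opn P W" "?w : W" "!!u. u : W ==> r u : V & s (r u) = u"
   by (rule nearbyE[OF csec_near[OF Pm MMm r_covering s(1) w s(2,3)]]) (rule that)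
  obtain d where d: "d > 0" "ALL ta:J. \<bar>ta - t\<bar> < d --> ps ta z : W"
   using pcontD(2)[OF isotopy_path[OF Pm ps_iso[OF ctx] z] t W(1,2)] by blast
  show "((%ta. crd P ?w (ps ta z)) has_vector_derivative X' t ?w) (at t within J)"
  proof (rule has_vector_derivative_transform_within[OF 1 d(1) t])
   show "crd P ?w (?h (ph x ?y)) = crd P ?w (ps x z)" if "x : J" "dist x t < d" for x
    using W(3)[of "ps x z"] d(2) that rw[OF that(1)] by (simp add: dist_real_def)
  qed
 qed
 moreover have "smooth_sec_family J P F1 H'"
  unfolding smooth_sec_family_def
 proof clarify
  fix U' e' assume "(U', e') : frames F1"
  then obtain U e where e: "(U, e) : frames L.E" "U' = pts P Int r1 -` U" "e' = e o r1" by auto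
  let ?R = "eucl :: (real, real) manifold"
  note RP = prod_m[OF em Pm] and RM = prod_m[OF em L.Mm]
  \<comment> \<open>One coefficient function is required on all of \<open>J\<close> times
    \<open>U'\<close>, whereas frames of the second bundle exist only locally. The coefficient is
    read off pointwise, and \<open>rep\<close> identifies it near each point with a smooth
    expression in such a frame.\<close>
  let ?g = "%z. fcf (H' (fst z) (snd z)) (e (x1 (snd z)))"
  have rep: "EX f. smf (prod_mfd ?R P) z f & near (prod_mfd ?R P) z (%q. q : J \<times> U' --> f q = ?g q & H' (fst q) (snd q) = ?g q *R e' (snd q))"
   if z: "z : J \<times> U'" for z
  proof -
   have z': "fst z : J" "snd z : pts P" "x1 (snd z) : U" "z : pts ?R \<times> pts P" using z e(2) by auto
   note s = sa_fst_snd[OF em Pm z'(4)]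
   obtain V f where f: "(V, f) : frames L.E" "x2 (snd z) : V" using frame_exists[OF L.Mm L.Eo r2_pts[OF z'(2)]] by blast
   have ff: "(pts P Int r2 -` V, f o r2) : frames F2" "(U', e') : frames F1" using f(1) e by auto
   obtain ga where ga: "ALL q:pts P. q : pts P Int r2 -` V & id q : U' --> smf P q ga & (ga q :: real) > 0 & iso0 q ((f o r2) q) = ga q *R e' (id q)"
    using fm_frames[OF iso0_box[unfolded box_iso_eq] ff] by blast
   obtain g where g: "smooth_map_on (prod_mfd ?R L.M) (J \<times> V) eucl g" "ALL t:J. ALL q:V. H t q = g (t, q) *R f q"
    using H f(1) unfolding smooth_sec_family_def by blast
   obtain F where F: "smf (prod_mfd ?R L.M) (fst z, r2 (snd z)) F" "near (prod_mfd ?R L.M) (fst z, r2 (snd z)) (%q. q : J \<times> V --> F q = g q)"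
    using g(1) z'(1) f(2) unfolding smooth_map_on_def by auto
   have s2: "smooth_at (prod_mfd ?R P) L.M z (%q. r2 (snd q))" by (rule sa_compose[OF RP Pm L.Mm s(2) smD[OF r2s z'(2)]])
   have h: "smooth_at (prod_mfd ?R P) (prod_mfd ?R L.M) z (%q. (fst q, r2 (snd q)))" by (rule sa_Pair[OF em L.Mm RP s(1) s2])
   have sga: "smf P (snd z) ga" using ga z'(2,3) f(2) e(2) by simp
   have sf: "smf (prod_mfd ?R P) z (%q. (- 1) * (F (fst q, r2 (snd q)) * ga (snd q)))"
    by (rule sa_mult[OF RP sa_const[OF RP em] sa_mult[OF RP sa_compose[OF RP RM em h F(1)] sa_compose[OF RP Pm em s(2) sga]]])
      (use z' in simp_all)
   have nV: "near (prod_mfd ?R P) z (%q. r2 (snd q) : V)"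
    by (rule sa_continuous[OF RP L.Mm s2 frameD(1)[OF L.Mm L.Eo f(1)]]) (use f(2) in simp)
   show ?thesis
   proof (rule exI, rule conjI[OF sf near_mono2[OF near_preimage[OF RP RM h F(2)] nV]], rule impI)
    fix q assume q: "(fst q, r2 (snd q)) : J \<times> V --> F (fst q, r2 (snd q)) = g (fst q, r2 (snd q))" "r2 (snd q) : V" "q : J \<times> U'"
    have q': "fst q : J" "snd q : U'" "snd q : pts P" "x1 (snd q) : U" "x2 (snd q) : V" using q(2,3) e(2) by auto
    have "iso0 (snd q) (H (fst q) (x2 (snd q))) = g (fst q, x2 (snd q)) *R iso0 (snd q) (f (x2 (snd q)))"
     using g(2) q'(1,5) iso0_scale[OF q'(3) frameD(2)[OF L.Mm L.Eo f(1) q'(5)]] by simp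
    moreover have "iso0 (snd q) (f (x2 (snd q))) = ga (snd q) *R e (x1 (snd q))" using ga q' e(3) by simp
    ultimately have Hq: "H' (fst q) (snd q) = ((- 1) * (F (fst q, r2 (snd q)) * ga (snd q))) *R e (x1 (snd q))"
     using q(1) q' by (simp add: H'_def)
    have "?g q = (- 1) * (F (fst q, r2 (snd q)) * ga (snd q))"
     unfolding Hq by (rule frame_coef_scaleR[OF frameD(3)[OF L.Mm L.Eo e(1) q'(4)]])
    with Hq show "(- 1) * (F (fst q, r2 (snd q)) * ga (snd q)) = ?g q & H' (fst q) (snd q) = ?g q *R e' (snd q)"
     unfolding e(3) comp_apply by metis
   qed
  qed
  show "EX g. smooth_map_on (prod_mfd eucl P) (J \<times> U') eucl g & (ALL t:J. ALL p:U'. H' t p = g (t, p) *R e' p)"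
  proof (intro exI[of _ ?g] conjI ballI)
   show "smooth_map_on (prod_mfd eucl P) (J \<times> U') eucl ?g"
    unfolding smooth_map_on_def
   proof
    fix z assume z: "z : J \<times> U'"
    obtain f where f: "smf (prod_mfd ?R P) z f"
     "near (prod_mfd ?R P) z (%q. q : J \<times> U' --> f q = ?g q & H' (fst q) (snd q) = ?g q *R e' (snd q))" using rep[OF z] by blast
    show "EX f. smf (prod_mfd ?R P) z f & near (prod_mfd ?R P) z (%q. q : J \<times> U' --> f q = ?g q)"
     by (intro exI conjI, rule f(1), rule near_mono[OF f(2)]) blast
   qed
   fix t p assume "t : J" "p : U'"
   hence tp: "(t, p) : J \<times> U'" by simp
   thus "H' t p = ?g (t, p) *R e' p" using rep[OF tp] near_self by fastforce
  qed
 qed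
 ultimately show ?thesis
  unfolding hamiltonian_isotopy_def Xi_of_diag box_struct_simps using ps_iso[OF ctx] by blast
qed

end

end

lemma hamiltonian_lifts:
 assumes "is_interval J" "0 : J" "hamiltonian_isotopy J L.M (cstr A) ph"
 shows "EX ps. lifted_isotopy J A ph ps"
  "lifted_isotopy J A ph ps ==> t : J ==> Xi_of A A (ps t o diag) = Xi_of A A diag"
  "lifted_isotopy J A ph ps ==> hamiltonian_isotopy J P (Xi_of A A diag) ps"
proof -
 obtain H X where HX: "smooth_isotopy J L.M ph" "smooth_sec_family J L.M L.E H"
  "ALL t:J. hamiltonian_vf L.M (cstr A) (H t) (X t)" "generated_by J L.M ph X"
  using assms(3) unfolding hamiltonian_isotopy_def by blast
 note * = assms(1,2) HX(1) _ HX(2-4)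
 show "EX ps. lifted_isotopy J A ph ps" by (rule lift_exists[OF assms(1,2) HX(1)])
 show "lifted_isotopy J A ph ps ==> t : J ==> Xi_of A A (ps t o diag) = Xi_of A A diag" by (rule hamiltonian_Xi_of[OF *])
 show "lifted_isotopy J A ph ps ==> hamiltonian_isotopy J P (Xi_of A A diag) ps" by (rule hamiltonian_lift[OF *])
qed

end

theorem theorem1p6:
  fixes A :: "('a, 'e::euclidean_space, 'l::real_vector, 'c) covered_lcs"
    and B :: "('b, 'f::euclidean_space, 'm::real_vector, 'd) covered_lcs"
  assumes "connected_covered_lcs A" and "connected_covered_lcs B"
  shows
    "((\<forall>\<Omega>\<in>Xi A B. lcs (boxplus A B) \<Omega>) \<and>
      (\<forall>c>0. \<forall>\<Phi>. box_iso A B \<Phi> \<longrightarrow>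
         Xi_act A B c (box_struct A B \<Phi>) = box_struct A B (\<lambda>z x. c *\<^sub>R \<Phi> z x)) \<and>
      torsor pos_real_group (Xi A B) (Xi_act A B)) \<and>
     (\<exists>\<rho>. \<rho> \<in> hom (deck_group (mtop (boxplus A B)) (box_r A B)) add_real_group \<and>
          inj_on \<rho> (carrier (deck_group (mtop (boxplus A B)) (box_r A B))) \<and>
          (\<forall>g\<in>carrier (deck_group (mtop (boxplus A B)) (box_r A B)). \<forall>\<Omega>\<in>Xi A B.
             lcs_symplecto (boxplus A B) \<Omega> (boxplus A B) (Xi_act A B (exp (\<rho> g)) \<Omega>) g)) \<and>
     (\<forall>\<Omega>\<in>Xi A B.
        lee_class (boxplus A B) \<Omega> = pull_class (boxplus A B) (box_r1 A B) (lee_class (cmfd A) (cstr A)) \<and>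
        pull_class (boxplus A B) (box_r1 A B) (lee_class (cmfd A) (cstr A)) =
          pull_class (boxplus A B) (box_r2 A B) (lee_class (cmfd B) (cstr B))) \<and>
     (\<forall>\<phi> G. smooth_map (cmfd A) (cmfd B) \<phi> \<and> smooth_map (cmfd A) (boxplus A B) G \<and>
            (\<forall>p\<in>pts (cmfd A). box_r A B (G p) = (p, \<phi> p)) \<longrightarrow>
        (lcs_map (cmfd A) (cstr A) (cmfd B) (cstr B) \<phi> \<longleftrightarrow>
           (\<exists>\<Omega>\<in>Xi A B. isotropic_embedding (cmfd A) (boxplus A B) \<Omega> G)) \<and>
        (lcs_map (cmfd A) (cstr A) (cmfd B) (cstr B) \<phi> \<longrightarrow>
           (\<exists>!\<Omega>. \<Omega> \<in> Xi A B \<and> isotropic_embedding (cmfd A) (boxplus A B) \<Omega> G))) \<and>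
     (\<forall>J \<phi>. is_interval J \<and> 0 \<in> J \<and> smooth_isotopy J (cmfd A) \<phi> \<and>
            (\<forall>t\<in>J. lcs_automorphism (cmfd A) (cstr A) (\<phi> t)) \<longrightarrow>
        (\<exists>\<psi>. lifted_isotopy J A \<phi> \<psi>) \<and>
        (\<forall>\<psi>. lifted_isotopy J A \<phi> \<psi> \<longrightarrow>
           (\<forall>t\<in>J. lcs_symplecto (boxplus A A) (Xi_of A A (diag_lift A))
                     (boxplus A A) (Xi_of A A (\<psi> t \<circ> diag_lift A)) (\<psi> t)) \<and>
           (\<forall>X \<mu>. generated_by J (cmfd A) \<phi> X \<and>
                  (\<forall>t\<in>J. lcs_vf (cmfd A) (cstr A) (X t) (\<mu> t)) \<longrightarrow>
              (\<forall>t\<in>J. Xi_of A A (\<psi> t \<circ> diag_lift A) =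
                 Xi_act A A (exp (- (LBINT \<tau>=0..t. \<mu> \<tau>))) (Xi_of A A (diag_lift A)))))) \<and>
     (\<forall>J \<phi>. is_interval J \<and> 0 \<in> J \<and> hamiltonian_isotopy J (cmfd A) (cstr A) \<phi> \<longrightarrow>
        (\<exists>\<psi>. lifted_isotopy J A \<phi> \<psi>) \<and>
        (\<forall>\<psi>. lifted_isotopy J A \<phi> \<psi> \<longrightarrow>
           (\<forall>t\<in>J. Xi_of A A (\<psi> t \<circ> diag_lift A) = Xi_of A A (diag_lift A)) \<and>
           hamiltonian_isotopy J (boxplus A A) (Xi_of A A (diag_lift A)) \<psi>))"
proof -
 interpret box A B by (simp add: box_def ccl_def assms)
 interpret S: selfbox A by (simp add: selfbox_def box_def ccl_def assms)
 show ?thesis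
  apply (intro conjI deck_rho Xi_torsor)
  subgoal using Xi_lcs by blast
  subgoal using Xi_act_eq by blast
  subgoal using Xi_lee by blast
  subgoal using graph_lcs_map_iff graph_ex1 by blast
  subgoal
   apply (intro allI impI conjI ballI; elim conjE)
   subgoal by (rule S.lift_exists)
   subgoal by (rule S.automorphism_symp) auto
   subgoal by (rule S.Xi_of_expansion) auto
   done
  subgoal
   apply (intro allI impI conjI ballI; elim conjE)
   subgoal by (rule S.hamiltonian_lifts)
   subgoal by (rule S.hamiltonian_lifts)
   subgoal by (rule S.hamiltonian_lifts)
   done
  done
qed

end
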